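(* Let $k$ be a noetherian commutative $\mathbb{Q}$-algebra, let $W\in k[x]$, $V\in k[y]=k[y_1,\dots,y_m]$ and $U\in k[z]$ be potentials, let $X$ be a finite rank matrix factorisation of $V-W$ over $k[x,y]$ and $Y$ a finite rank matrix factorisation of $U-V$ over $k[y,z]$. Then the finite rank matrix factorisation $Y\mid X=Y\otimes_{k[y]}J_V\otimes_{k[y]}X$ of $U-W$ over $k[x,z]$, together with the odd closed $k[x,z]$-linear operators $$\gamma_i=\mathrm{At}_i,\qquad \gamma_i^\dagger=-\partial_{y_i}(d_X)-\tfrac12\sum_q\partial_{y_q}\partial_{y_i}(V)\,\mathrm{At}_q\qquad(1\le i\le m),$$ defines a representation of the Clifford algebra $C_m$ in the homotopy category of matrix factorisations; that is, up to $k[x,z]$-linear homotopy, $$[\gamma_i,\gamma_j]\simeq0,\qquad[\gamma_i^\dagger,\gamma_j^\dagger]\simeq0,\qquad[\gamma_i,\gamma_j^\dagger]\simeq\delta_{ij}\qquad(1\le i,j\le m).$$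
   Context: Commutators are graded, $[a,b]=ab-(-1)^{|a||b|}ba$; operators on tensor products act with Koszul signs, $(f\otimes g)(a\otimes b)=(-1)^{|g||a|}f(a)\otimes g(b)$. A potential $W\in k[x_1,\dots,x_n]$ is a polynomial such that $\partial_{x_1}W,\dots,\partial_{x_n}W$ is quasi-regular, $J_W=k[x]/(\partial_{x_1}W,\dots,\partial_{x_n}W)$ is a finitely generated free $k$-module, and the Koszul complex of the partial derivatives is exact except in degree zero. A matrix factorisation of $W\in R$ is a free $\mathbb{Z}_2$-graded $R$-module with an odd $R$-linear $d$ with $d^2=W$; finite rank means finitely generated. Two closed linear operators $f,g$ of the same parity are homotopic, $f\simeq g$, if $f-g=[d,h]$ for some linear $h$ of opposite parity. $C_m$ is the $\mathbb{Z}_2$-graded $k$-algebra generated by odd $\gamma_i,\gamma_i^\dagger$ ($1\le i\le m$) with $[\gamma_i,\gamma_j]=0=[\gamma_i^\dagger,\gamma_j^\dagger]$, $[\gamma_i,\gamma_j^\dagger]=\delta_{ij}$. $Y\mid X$ has differential induced by $d_{Y\otimes X}=d_Y\otimes1+1\otimes d_X$. Fix homogeneous bases of $Y$ and $X$. $\partial_{y_i}(d_X)$ is the entrywise derivative of the matrix of $d_X$, acting as $1\otimes\partial_{y_i}(d_X)$. Atiyah classes: $t_i=\partial_{y_i}V$; $\widehat{k[y]}$ is the $(t_1,\dots,t_m)$-adic completion of $k[y]$; $Y\widehat\otimes X=Y\otimes_{k[y]}\widehat{k[y]}\otimes_{k[y]}X$. Fix a $k$-linear section $\sigma:J_V\to\widehat{k[y]}$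 of the quotient map. Every $h\in\widehat{k[y]}$ is uniquely a series $\sum_u\sigma(r_u)t^u$ with $r_u\in J_V$; put $\partial_{t_i}h=\sum_u u_i\sigma(r_u)t^{u-\epsilon_i}$, with $\epsilon_i$ the $i$th unit vector (the components of a flat $k$-linear connection on $\widehat{k[y]}$ over $k[t]$, so $[\partial_{t_i},t_j]=\delta_{ij}$). Extend $\partial_{t_i}$ to a $k[x,z]$-linear operator on $Y\widehat\otimes X$ by $e_a\otimes h\otimes f_b\mapsto e_a\otimes\partial_{t_i}(h)\otimes f_b$ for the chosen basis elements $e_a$ of $Y$, $f_b$ of $X$. The commutator $[d_{Y\otimes X},\partial_{t_i}]$ is $k[t]$-linear, and $\mathrm{At}_i$ is the odd $k[x,z]$-linear operator it induces on $Y\mid X\cong(Y\widehat\otimes X)\otimes_{k[t]}k[t]/(t)$. *)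

theory Defs
  imports
    "HOL-Algebra.Algebraic_Closure_Type"
    "HOL-Algebra.Ring_Divisibility"
    "HOL-Algebra.Ideal_Product"
    "HOL-Algebra.QuotRing"
    "HOL-Algebra.Module"
    "HOL-Algebra.Generated_Groups"
    "HOL-Algebra.Free_Abelian_Groups"
    "HOL-Library.Poly_Mapping"
    "HOL-Library.Z2"
begin

section \<open>Polynomial rings\<close>

text \<open>
  All polynomial rings are subrings of one polynomial ring in three countable families of
  variables: \<open>k[S]\<close>, for a set \<open>S\<close> of variables, consists of the polynomials all of whose
  monomials only involve variables from \<open>S\<close>.  In particular \<open>mpoly_ring {}\<close> is the copy of
  \<open>k\<close> given by the constant polynomials, so that every scalar ring occurring below is a
  \<open>mpoly_ring S\<close>, and restriction of scalars is just a change of the scalar ring.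
\<close>

datatype pvar = Xv nat | Yv nat | Zv nat

type_synonym 'k pol = "(pvar \<Rightarrow>\<^sub>0 nat) \<Rightarrow>\<^sub>0 'k"

definition mpoly_ring :: "pvar set \<Rightarrow> ('k::comm_ring_1) pol ring" where
  "mpoly_ring S =
    \<lparr>carrier = {p. \<forall>u\<in>Poly_Mapping.keys p. Poly_Mapping.keys u \<subseteq> S}, monoid.mult = (*), one = 1, ring.zero = 0, add = (+)\<rparr>"

abbreviation xvars :: "nat \<Rightarrow> pvar set" where "xvars n \<equiv> Xv ` {..<n}"
abbreviation yvars :: "nat \<Rightarrow> pvar set" where "yvars m \<equiv> Yv ` {..<m}"
abbreviation zvars :: "nat \<Rightarrow> pvar set" where "zvars l \<equiv> Zv ` {..<l}"

definition cpoly :: "'k::comm_ring_1 \<Rightarrow> 'k pol" where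
  "cpoly c = Poly_Mapping.single 0 c"

definition pd :: "pvar \<Rightarrow> ('k::comm_ring_1) pol \<Rightarrow> 'k pol" where
  "pd v p = (\<Sum>u\<in>Poly_Mapping.keys p. Poly_Mapping.single (u - Poly_Mapping.single v 1)
                          (of_nat (Poly_Mapping.lookup u v) * Poly_Mapping.lookup p u))"

definition mon_restrict :: "pvar set \<Rightarrow> (pvar \<Rightarrow>\<^sub>0 nat) \<Rightarrow> (pvar \<Rightarrow>\<^sub>0 nat)" where
  "mon_restrict S u = (\<Sum>v\<in>Poly_Mapping.keys u \<inter> S. Poly_Mapping.single v (Poly_Mapping.lookup u v))"


section \<open>Linear maps and bases\<close>

definition is_linear ::
  "('a, 'r) ring_scheme \<Rightarrow> ('a, 'b, 'p) module_scheme \<Rightarrow> ('a, 'c, 'q) module_scheme \<Rightarrow> ('b \<Rightarrow> 'c) \<Rightarrow> bool"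
where
  "is_linear R M N f \<longleftrightarrow> f \<in> hom (add_monoid M) (add_monoid N) \<and>
     (\<forall>a\<in>carrier R. \<forall>v\<in>carrier M. f (a \<odot>\<^bsub>M\<^esub> v) = a \<odot>\<^bsub>N\<^esub> f v)"

definition finite_basis ::
  "('a, 'r) ring_scheme \<Rightarrow> ('a, 'b, 'p) module_scheme \<Rightarrow> 'i set \<Rightarrow> ('i \<Rightarrow> 'b) \<Rightarrow> bool"
where
  "finite_basis R M B e \<longleftrightarrow> finite B \<and> e \<in> B \<rightarrow> carrier M \<and>
     (\<forall>v\<in>carrier M. \<exists>!c. c \<in> B \<rightarrow>\<^sub>E carrier R \<and> v = (\<Oplus>\<^bsub>M\<^esub>b\<in>B. c b \<odot>\<^bsub>M\<^esub> e b))"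

definition coords ::
  "('a, 'r) ring_scheme \<Rightarrow> ('a, 'b, 'p) module_scheme \<Rightarrow> 'i set \<Rightarrow> ('i \<Rightarrow> 'b) \<Rightarrow> 'b \<Rightarrow> 'i \<Rightarrow> 'a"
where
  "coords R M B e v =
     (THE c. c \<in> B \<rightarrow>\<^sub>E carrier R \<and> v = (\<Oplus>\<^bsub>M\<^esub>b\<in>B. c b \<odot>\<^bsub>M\<^esub> e b))"


section \<open>Quotients and completions\<close>

definition quot_alg :: "('a, 'r) ring_scheme \<Rightarrow> 'a set \<Rightarrow> ('a, 'a set) module" where
  "quot_alg R I = ring.extend (R Quot I)
     (module.fields (\<lambda>a C. (I +>\<^bsub>R\<^esub> a) \<otimes>\<^bsub>R Quot I\<^esub> C))"

primrec ideal_pow :: "('a, 'r) ring_scheme \<Rightarrow> 'a set \<Rightarrow> nat \<Rightarrow> 'a set" where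
  "ideal_pow R I 0 = carrier R"
| "ideal_pow R I (Suc N) = ideal_prod R (ideal_pow R I N) I"

text \<open>
  The \<open>I\<close>-adic completion, as the inverse limit of the rings \<open>R / I^N\<close>.  A coset of
  \<open>I^(N+1)\<close> maps to a given coset of \<open>I^N\<close> iff it is contained in it.
\<close>

definition completion :: "('a, 'r) ring_scheme \<Rightarrow> 'a set \<Rightarrow> ('a, nat \<Rightarrow> 'a set) module" where
  "completion R I =
    \<lparr>carrier = {h. (\<forall>N. h N \<in> carrier (R Quot ideal_pow R I N)) \<and> (\<forall>N. h (Suc N) \<subseteq> h N)},
     monoid.mult = (\<lambda>g h N. g N \<otimes>\<^bsub>R Quot ideal_pow R I N\<^esub> h N),
     one = (\<lambda>N. \<one>\<^bsub>R Quot ideal_pow R I N\<^esub>),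
     ring.zero = (\<lambda>N. \<zero>\<^bsub>R Quot ideal_pow R I N\<^esub>),
     add = (\<lambda>g h N. g N \<oplus>\<^bsub>R Quot ideal_pow R I N\<^esub> h N),
     module.smult = (\<lambda>a h N. (ideal_pow R I N +>\<^bsub>R\<^esub> a) \<otimes>\<^bsub>R Quot ideal_pow R I N\<^esub> h N)\<rparr>"

text \<open>
  Convergence of a family in the adic topology, that is, in the inverse limit of the
  discrete rings \<open>R / I^N\<close>.
\<close>

definition adic_sums ::
  "('a, 'r) ring_scheme \<Rightarrow> 'a set \<Rightarrow> 'i set \<Rightarrow> ('i \<Rightarrow> nat \<Rightarrow> 'a set) \<Rightarrow> (nat \<Rightarrow> 'a set) \<Rightarrow> bool"
where
  "adic_sums R I A g h \<longleftrightarrow> h \<in> carrier (completion R I) \<and>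
     (\<forall>N. \<exists>F\<^sub>0. finite F\<^sub>0 \<and> F\<^sub>0 \<subseteq> A \<and>
        (\<forall>F. finite F \<and> F\<^sub>0 \<subseteq> F \<and> F \<subseteq> A \<longrightarrow> (\<Oplus>\<^bsub>completion R I\<^esub>u\<in>F. g u) N = h N))"


section \<open>Potentials\<close>

definition multi_indices :: "nat \<Rightarrow> (nat \<Rightarrow>\<^sub>0 nat) set" where
  "multi_indices n = {u. Poly_Mapping.keys u \<subseteq> {..<n}}"

text \<open>
  \<open>f\<^sub>0, \<dots>, f\<^sub>n\<^sub>-\<^sub>1\<close>, generating the ideal \<open>I\<close>, is quasi-regular if a form of degree \<open>d\<close> over \<open>R\<close>
  whose value at \<open>f\<close> lies in \<open>I^(d+1)\<close> has all its coefficients in \<open>I\<close>; equivalently,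
  \<open>(R/I)[T\<^sub>0, \<dots>, T\<^sub>n\<^sub>-\<^sub>1]\<close> maps isomorphically onto the graded ring of \<open>I\<close>.
\<close>

definition quasi_regular :: "('a, 'r) ring_scheme \<Rightarrow> nat \<Rightarrow> (nat \<Rightarrow> 'a) \<Rightarrow> bool" where
  "quasi_regular R n f \<longleftrightarrow>
     (let I = Idl\<^bsub>R\<^esub> (f ` {..<n}) in
      \<forall>d c. let D = {u \<in> multi_indices n. (\<Sum>i<n. Poly_Mapping.lookup u i) = d} in
        c \<in> D \<rightarrow> carrier R \<and>
        (\<Oplus>\<^bsub>R\<^esub>u\<in>D. c u \<otimes>\<^bsub>R\<^esub> (\<Otimes>\<^bsub>R\<^esub>i\<in>{..<n}. f i [^]\<^bsub>R\<^esub> Poly_Mapping.lookup u i)) \<in> ideal_pow R I (Suc d)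
        \<longrightarrow> (\<forall>u\<in>D. c u \<in> I))"

text \<open>
  A chain of degree \<open>p\<close> of the Koszul complex is given by its coefficients at the basis
  elements of the exterior power, which are indexed by the subsets of size \<open>p\<close>.
  \<open>koszul_diff R n f p\<close> is the differential (contraction with \<open>f\<close>) from degree \<open>p + 1\<close> to \<open>p\<close>.
\<close>

definition koszul_chains :: "('a, 'r) ring_scheme \<Rightarrow> nat \<Rightarrow> nat \<Rightarrow> (nat set \<Rightarrow> 'a) set" where
  "koszul_chains R n p = {J. J \<subseteq> {..<n} \<and> card J = p} \<rightarrow>\<^sub>E carrier R"

definition koszul_diff ::
  "('a, 'r) ring_scheme \<Rightarrow> nat \<Rightarrow> (nat \<Rightarrow> 'a) \<Rightarrow> nat \<Rightarrow> (nat set \<Rightarrow> 'a) \<Rightarrow> nat set \<Rightarrow> 'a"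
where
  "koszul_diff R n f p \<omega> = (\<lambda>J\<in>{J. J \<subseteq> {..<n} \<and> card J = p}.
     \<Oplus>\<^bsub>R\<^esub>i\<in>{..<n} - J. if even (card {j\<in>J. j < i}) then f i \<otimes>\<^bsub>R\<^esub> \<omega> (insert i J)
                       else \<ominus>\<^bsub>R\<^esub> (f i \<otimes>\<^bsub>R\<^esub> \<omega> (insert i J)))"

definition koszul_acyclic :: "('a, 'r) ring_scheme \<Rightarrow> nat \<Rightarrow> (nat \<Rightarrow> 'a) \<Rightarrow> bool" where
  "koszul_acyclic R n f \<longleftrightarrow>
     (\<forall>p. \<forall>\<omega>\<in>koszul_chains R n (Suc p).
        (\<forall>J. J \<subseteq> {..<n} \<and> card J = p \<longrightarrow> koszul_diff R n f p \<omega> J = \<zero>\<^bsub>R\<^esub>) \<longrightarrow>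
        (\<exists>\<eta>\<in>koszul_chains R n (Suc (Suc p)). koszul_diff R n f (Suc p) \<eta> = \<omega>))"

text \<open>
  Below, \<open>v\<close> is one of \<open>Xv\<close>, \<open>Yv\<close>, \<open>Zv\<close> and \<open>n\<close> is the number of variables of that kind.
\<close>

definition jac_ideal :: "(nat \<Rightarrow> pvar) \<Rightarrow> nat \<Rightarrow> ('k::comm_ring_1) pol \<Rightarrow> 'k pol set" where
  "jac_ideal v n W = Idl\<^bsub>mpoly_ring (v ` {..<n})\<^esub> ((\<lambda>i. pd (v i) W) ` {..<n})"

definition jac_ring ::
  "(nat \<Rightarrow> pvar) \<Rightarrow> nat \<Rightarrow> ('k::comm_ring_1) pol \<Rightarrow> ('k pol, 'k pol set) module" where
  "jac_ring v n W = quot_alg (mpoly_ring (v ` {..<n})) (jac_ideal v n W)"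

definition potential :: "(nat \<Rightarrow> pvar) \<Rightarrow> nat \<Rightarrow> ('k::comm_ring_1) pol \<Rightarrow> bool" where
  "potential v n W \<longleftrightarrow>
     (let R = mpoly_ring (v ` {..<n}); f = (\<lambda>i. pd (v i) W) in
      W \<in> carrier R \<and> quasi_regular R n f \<and>
      (\<exists>B. finite_basis (mpoly_ring {} :: 'k pol ring) (jac_ring v n W) B (\<lambda>b. b)) \<and>
      koszul_acyclic R n f)"


section \<open>Matrix factorisations\<close>

text \<open>
  Parities are elements of \<open>bit\<close>, the integers mod 2; \<open>homog M p\<close> is the submodule of
  homogeneous elements of parity \<open>p\<close>.  The fields \<open>mult\<close> and \<open>one\<close> that the library's module
  records inherit from ring records are irrelevant.
\<close>

record ('a, 'b) mf = "('a, 'b) module" +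
  homog :: "bit \<Rightarrow> 'b set"
  dmap :: "'b \<Rightarrow> 'b"

definition graded_module :: "('a, 'r) ring_scheme \<Rightarrow> ('a, 'b, 'p) mf_scheme \<Rightarrow> bool" where
  "graded_module R M \<longleftrightarrow> module R M \<and> (\<forall>p. submodule (homog M p) R M) \<and>
     (\<forall>v\<in>carrier M. \<exists>!w. fst w \<in> homog M 0 \<and> snd w \<in> homog M 1 \<and> v = fst w \<oplus>\<^bsub>M\<^esub> snd w)"

definition homogeneous_basis ::
  "('a, 'r) ring_scheme \<Rightarrow> ('a, 'b, 'p) mf_scheme \<Rightarrow> 'i set \<Rightarrow> ('i \<Rightarrow> 'b) \<Rightarrow> bool" where
  "homogeneous_basis R M B e \<longleftrightarrow> finite_basis R M B e \<and> (\<forall>b\<in>B. \<exists>p. e b \<in> homog M p)"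

definition has_parity :: "('a, 'b, 'p) mf_scheme \<Rightarrow> bit \<Rightarrow> ('b \<Rightarrow> 'b) \<Rightarrow> bool" where
  "has_parity M p f \<longleftrightarrow> (\<forall>q. f ` homog M q \<subseteq> homog M (p + q))"

definition finite_rank_mf ::
  "('a, 'r) ring_scheme \<Rightarrow> 'a \<Rightarrow> ('a, 'b, 'p) mf_scheme \<Rightarrow> bool" where
  "finite_rank_mf R W M \<longleftrightarrow> W \<in> carrier R \<and> graded_module R M \<and>
     (\<exists>B. homogeneous_basis R M B (\<lambda>b. b)) \<and>
     is_linear R M M (dmap M) \<and> has_parity M 1 (dmap M) \<and>
     (\<forall>v\<in>carrier M. dmap M (dmap M v) = W \<odot>\<^bsub>M\<^esub> v)"

text \<open>The graded commutator of an operator \<open>f\<close> of parity \<open>p\<close> and an operator \<open>g\<close> of parity \<open>q\<close>.\<close>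

definition gcomm ::
  "('a, 'b, 'p) mf_scheme \<Rightarrow> bit \<Rightarrow> bit \<Rightarrow> ('b \<Rightarrow> 'b) \<Rightarrow> ('b \<Rightarrow> 'b) \<Rightarrow> 'b \<Rightarrow> 'b" where
  "gcomm M p q f g v =
     (if p * q = 0 then f (g v) \<ominus>\<^bsub>M\<^esub> g (f v) else f (g v) \<oplus>\<^bsub>M\<^esub> g (f v))"

definition closed_operator ::
  "('a, 'r) ring_scheme \<Rightarrow> ('a, 'b, 'p) mf_scheme \<Rightarrow> bit \<Rightarrow> ('b \<Rightarrow> 'b) \<Rightarrow> bool" where
  "closed_operator R M p f \<longleftrightarrow> is_linear R M M f \<and> has_parity M p f \<and>
     (\<forall>v\<in>carrier M. gcomm M 1 p (dmap M) f v = \<zero>\<^bsub>M\<^esub>)"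

definition homotopic ::
  "('a, 'r) ring_scheme \<Rightarrow> ('a, 'b, 'p) mf_scheme \<Rightarrow> bit \<Rightarrow> ('b \<Rightarrow> 'b) \<Rightarrow> ('b \<Rightarrow> 'b) \<Rightarrow> bool" where
  "homotopic R M p f g \<longleftrightarrow> closed_operator R M p f \<and> closed_operator R M p g \<and>
     (\<exists>h. is_linear R M M h \<and> has_parity M (p + 1) h \<and>
        (\<forall>v\<in>carrier M. f v \<ominus>\<^bsub>M\<^esub> g v = gcomm M 1 (p + 1) (dmap M) h v))"

text \<open>\<open>parity_inv M\<close> is multiplication by the Koszul sign \<open>(-1)^|v|\<close>, extended additively.\<close>

definition parity_inv :: "('a, 'b, 'p) mf_scheme \<Rightarrow> 'b \<Rightarrow> 'b" where
  "parity_inv M v = (THE w. \<exists>a\<in>homog M 0. \<exists>b\<in>homog M 1. v = a \<oplus>\<^bsub>M\<^esub> b \<and> w = a \<ominus>\<^bsub>M\<^esub> b)"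


section \<open>Tensor products\<close>

text \<open>
  For modules \<open>YY\<close>, \<open>S\<close>, \<open>XX\<close> over \<open>A\<close> (which may be modules over larger rings as well),
  \<open>tensor_group A YY S XX\<close> is the abelian group underlying the tensor product of \<open>YY\<close>, \<open>S\<close>, \<open>XX\<close> over \<open>A\<close>:
  the free abelian group on all triples modulo additivity in each argument and balancedness.
  The library writes free abelian groups and their quotients multiplicatively.
\<close>

definition tensor_rels ::
  "('a, 'r) ring_scheme \<Rightarrow> ('a, 'y, 'p) module_scheme \<Rightarrow> ('a, 's, 'q) module_scheme \<Rightarrow>
   ('a, 'x, 't) module_scheme \<Rightarrow> (('y \<times> 's \<times> 'x) \<Rightarrow>\<^sub>0 int) set"
where
  "tensor_rels A YY S XX =
     {frag_of (y \<oplus>\<^bsub>YY\<^esub> y', s, x) - frag_of (y, s, x) - frag_of (y', s, x) | y y' s x.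
        y \<in> carrier YY \<and> y' \<in> carrier YY \<and> s \<in> carrier S \<and> x \<in> carrier XX} \<union>
     {frag_of (y, s \<oplus>\<^bsub>S\<^esub> s', x) - frag_of (y, s, x) - frag_of (y, s', x) | y s s' x.
        y \<in> carrier YY \<and> s \<in> carrier S \<and> s' \<in> carrier S \<and> x \<in> carrier XX} \<union>
     {frag_of (y, s, x \<oplus>\<^bsub>XX\<^esub> x') - frag_of (y, s, x) - frag_of (y, s, x') | y s x x'.
        y \<in> carrier YY \<and> s \<in> carrier S \<and> x \<in> carrier XX \<and> x' \<in> carrier XX} \<union>
     {frag_of (a \<odot>\<^bsub>YY\<^esub> y, s, x) - frag_of (y, a \<odot>\<^bsub>S\<^esub> s, x) | a y s x.
        a \<in> carrier A \<and> y \<in> carrier YY \<and> s \<in> carrier S \<and> x \<in> carrier XX} \<union>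
     {frag_of (y, a \<odot>\<^bsub>S\<^esub> s, x) - frag_of (y, s, a \<odot>\<^bsub>XX\<^esub> x) | a y s x.
        a \<in> carrier A \<and> y \<in> carrier YY \<and> s \<in> carrier S \<and> x \<in> carrier XX}"

definition tensor_group ::
  "('a, 'r) ring_scheme \<Rightarrow> ('a, 'y, 'p) module_scheme \<Rightarrow> ('a, 's, 'q) module_scheme \<Rightarrow>
   ('a, 'x, 't) module_scheme \<Rightarrow> (('y \<times> 's \<times> 'x) \<Rightarrow>\<^sub>0 int) set monoid"
where
  "tensor_group A YY S XX =
     (let F = free_Abelian_group (carrier YY \<times> carrier S \<times> carrier XX)
      in F Mod (generate F (tensor_rels A YY S XX)))"

definition pure_tensor ::
  "('a, 'r) ring_scheme \<Rightarrow> ('a, 'y, 'p) module_scheme \<Rightarrow> ('a, 's, 'q) module_scheme \<Rightarrow>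
   ('a, 'x, 't) module_scheme \<Rightarrow> 'y \<Rightarrow> 's \<Rightarrow> 'x \<Rightarrow> (('y \<times> 's \<times> 'x) \<Rightarrow>\<^sub>0 int) set"
where
  "pure_tensor A YY S XX y s x =
     (let F = free_Abelian_group (carrier YY \<times> carrier S \<times> carrier XX)
      in generate F (tensor_rels A YY S XX) #>\<^bsub>F\<^esub> frag_of (y, s, x))"

text \<open>The homomorphism on the tensor product with prescribed values on pure tensors.\<close>

definition tensor_lift ::
  "('a, 'r) ring_scheme \<Rightarrow> ('a, 'y, 'p) module_scheme \<Rightarrow> ('a, 's, 'q) module_scheme \<Rightarrow>
   ('a, 'x, 't) module_scheme \<Rightarrow> ('h, 'i) monoid_scheme \<Rightarrow> ('y \<Rightarrow> 's \<Rightarrow> 'x \<Rightarrow> 'h) \<Rightarrow>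
   (('y \<times> 's \<times> 'x) \<Rightarrow>\<^sub>0 int) set \<Rightarrow> 'h"
where
  "tensor_lift A YY S XX H \<phi> =
     (THE f. f \<in> extensional (carrier (tensor_group A YY S XX)) \<and>
        f \<in> hom (tensor_group A YY S XX) H \<and>
        (\<forall>y\<in>carrier YY. \<forall>s\<in>carrier S. \<forall>x\<in>carrier XX. f (pure_tensor A YY S XX y s x) = \<phi> y s x))"

text \<open>
  The tensor product \<open>YY \<otimes> S \<otimes> XX\<close> over \<open>A = k[y]\<close>, where \<open>YY\<close> is a matrix factorisation over
  \<open>k[y,z]\<close>, \<open>XX\<close> one over \<open>k[x,y]\<close> and \<open>S\<close> a \<open>k[y]\<close>-algebra (of parity 0).  A monomial in the
  variables \<open>x, y, z\<close> acts on pure tensors through its \<open>z\<close>-part on \<open>YY\<close>, its \<open>y\<close>-part on \<open>S\<close> and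
  its \<open>x\<close>-part on \<open>XX\<close>.  The differential is \<open>d \<otimes> 1 + 1 \<otimes> d\<close>, with Koszul sign.
\<close>

definition tensor_mf ::
  "nat \<Rightarrow> (('k::comm_ring_1) pol, 'y) mf \<Rightarrow> ('k pol, 's) module \<Rightarrow> ('k pol, 'x) mf \<Rightarrow>
   ('k pol, (('y \<times> 's \<times> 'x) \<Rightarrow>\<^sub>0 int) set) mf"
where
  "tensor_mf m YY S XX =
     (let A = mpoly_ring (yvars m); T = tensor_group A YY S XX; \<tau> = pure_tensor A YY S XX;
          lft = tensor_lift A YY S XX T
      in \<lparr>carrier = carrier T, monoid.mult = undefined, one = undefined,
          ring.zero = \<one>\<^bsub>T\<^esub>, add = monoid.mult T,
          module.smult = (\<lambda>p v. finprod T
             (\<lambda>u. lft (\<lambda>y s x. \<tau> (Poly_Mapping.single (mon_restrict (range Zv) u) 1 \<odot>\<^bsub>YY\<^esub> y)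
                                 (Poly_Mapping.single (mon_restrict (range Yv) u) 1 \<odot>\<^bsub>S\<^esub> s)
                                 (Poly_Mapping.single (mon_restrict (range Xv) u) (Poly_Mapping.lookup p u) \<odot>\<^bsub>XX\<^esub> x)) v)
             (Poly_Mapping.keys p)),
          homog = (\<lambda>p. generate T {\<tau> y s x | y s x q r.
             y \<in> homog YY q \<and> s \<in> carrier S \<and> x \<in> homog XX r \<and> q + r = p}),
          dmap = lft (\<lambda>y s x. \<tau> (dmap YY y) s x \<otimes>\<^bsub>T\<^esub> \<tau> (parity_inv YY y) s (dmap XX x))\<rparr>)"


section \<open>The operators\<close>

text \<open>\<open>J\<^sub>V\<close> and the completion of \<open>k[y]\<close> along \<open>t\<^sub>i = \<partial>V/\<partial>y\<^sub>i\<close>, both as algebras over \<open>k[y]\<close>.\<close>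

abbreviation JV :: "nat \<Rightarrow> ('k::comm_ring_1) pol \<Rightarrow> ('k pol, 'k pol set) module" where
  "JV m V \<equiv> jac_ring Yv m V"

definition ky_hat :: "nat \<Rightarrow> ('k::comm_ring_1) pol \<Rightarrow> ('k pol, nat \<Rightarrow> 'k pol set) module" where
  "ky_hat m V = completion (mpoly_ring (yvars m)) (jac_ideal Yv m V)"

text \<open>The quotient map from the completion to \<open>J\<^sub>V = k[y]/I\<close> is evaluation at level 1, as \<open>I^1 = I\<close>.\<close>

definition linear_section ::
  "nat \<Rightarrow> ('k::comm_ring_1) pol \<Rightarrow> ('k pol set \<Rightarrow> nat \<Rightarrow> 'k pol set) \<Rightarrow> bool" where
  "linear_section m V \<sigma> \<longleftrightarrow> is_linear (mpoly_ring {} :: 'k pol ring) (JV m V) (ky_hat m V) \<sigma> \<and>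
     (\<forall>r\<in>carrier (JV m V). \<sigma> r 1 = r)"

definition t_pow :: "nat \<Rightarrow> ('k::comm_ring_1) pol \<Rightarrow> (nat \<Rightarrow>\<^sub>0 nat) \<Rightarrow> 'k pol" where
  "t_pow m V u = (\<Prod>i<m. pd (Yv i) V ^ Poly_Mapping.lookup u i)"

definition t_expansion ::
  "nat \<Rightarrow> ('k::comm_ring_1) pol \<Rightarrow> ('k pol set \<Rightarrow> nat \<Rightarrow> 'k pol set) \<Rightarrow>
   (nat \<Rightarrow> 'k pol set) \<Rightarrow> ((nat \<Rightarrow>\<^sub>0 nat) \<Rightarrow> 'k pol set) \<Rightarrow> bool"
where
  "t_expansion m V \<sigma> h r \<longleftrightarrow> r \<in> multi_indices m \<rightarrow> carrier (JV m V) \<and>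
     adic_sums (mpoly_ring (yvars m)) (jac_ideal Yv m V) (multi_indices m)
       (\<lambda>u. t_pow m V u \<odot>\<^bsub>ky_hat m V\<^esub> \<sigma> (r u)) h"

definition partial_t ::
  "nat \<Rightarrow> ('k::comm_ring_1) pol \<Rightarrow> ('k pol set \<Rightarrow> nat \<Rightarrow> 'k pol set) \<Rightarrow> nat \<Rightarrow>
   (nat \<Rightarrow> 'k pol set) \<Rightarrow> (nat \<Rightarrow> 'k pol set)"
where
  "partial_t m V \<sigma> i h =
     (THE g. \<exists>r. t_expansion m V \<sigma> h r \<and>
        adic_sums (mpoly_ring (yvars m)) (jac_ideal Yv m V) (multi_indices m)
          (\<lambda>u. (of_nat (Poly_Mapping.lookup u i) * t_pow m V (u - Poly_Mapping.single i 1))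
                 \<odot>\<^bsub>ky_hat m V\<^esub> \<sigma> (r u)) g)"

text \<open>\<open>Y | X\<close> and its completed version.\<close>

definition mf_cut ::
  "nat \<Rightarrow> ('k::comm_ring_1) pol \<Rightarrow> ('k pol, 'y) mf \<Rightarrow> ('k pol, 'x) mf \<Rightarrow>
   ('k pol, (('y \<times> 'k pol set \<times> 'x) \<Rightarrow>\<^sub>0 int) set) mf" where
  "mf_cut m V YY XX = tensor_mf m YY (JV m V) XX"

definition mf_cut_hat ::
  "nat \<Rightarrow> ('k::comm_ring_1) pol \<Rightarrow> ('k pol, 'y) mf \<Rightarrow> ('k pol, 'x) mf \<Rightarrow>
   ('k pol, (('y \<times> (nat \<Rightarrow> 'k pol set) \<times> 'x) \<Rightarrow>\<^sub>0 int) set) mf" where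
  "mf_cut_hat m V YY XX = tensor_mf m YY (ky_hat m V) XX"

text \<open>
  Reduction modulo \<open>t\<close>, induced by the quotient map from the completion to \<open>J\<^sub>V\<close>; this is the
  map that identifies \<open>Y | X\<close> with the base change of the completed tensor product from \<open>k[t]\<close> to
  \<open>k[t]/(t)\<close>.
\<close>

definition mod_t ::
  "nat \<Rightarrow> ('k::comm_ring_1) pol \<Rightarrow> ('k pol, 'y) mf \<Rightarrow> ('k pol, 'x) mf \<Rightarrow>
   (('y \<times> (nat \<Rightarrow> 'k pol set) \<times> 'x) \<Rightarrow>\<^sub>0 int) set \<Rightarrow> (('y \<times> 'k pol set \<times> 'x) \<Rightarrow>\<^sub>0 int) set"
where
  "mod_t m V YY XX =
     (let A = mpoly_ring (yvars m) in
      tensor_lift A YY (ky_hat m V) XX (tensor_group A YY (JV m V) XX)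
        (\<lambda>y h x. pure_tensor A YY (JV m V) XX y (h 1) x))"

text \<open>The \<open>k[x,z]\<close>-linear extension of \<open>partial_t\<close>, for chosen bases \<open>e\<close> of \<open>YY\<close> and \<open>f\<close> of \<open>XX\<close>.\<close>

definition nabla ::
  "nat \<Rightarrow> nat \<Rightarrow> nat \<Rightarrow> ('k::comm_ring_1) pol \<Rightarrow> ('k pol set \<Rightarrow> nat \<Rightarrow> 'k pol set) \<Rightarrow>
   ('k pol, 'y) mf \<Rightarrow> 'a set \<Rightarrow> ('a \<Rightarrow> 'y) \<Rightarrow> ('k pol, 'x) mf \<Rightarrow> 'b set \<Rightarrow> ('b \<Rightarrow> 'x) \<Rightarrow> nat \<Rightarrow>
   (('y \<times> (nat \<Rightarrow> 'k pol set) \<times> 'x) \<Rightarrow>\<^sub>0 int) set \<Rightarrow> (('y \<times> (nat \<Rightarrow> 'k pol set) \<times> 'x) \<Rightarrow>\<^sub>0 int) set"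
where
  "nabla n m l V \<sigma> YY A e XX B f i =
     (let M = mf_cut_hat m V YY XX;
          \<tau> = pure_tensor (mpoly_ring (yvars m)) YY (ky_hat m V) XX
      in THE D. D \<in> extensional (carrier M) \<and>
           is_linear (mpoly_ring (xvars n \<union> zvars l) :: 'k pol ring) M M D \<and>
           (\<forall>a\<in>A. \<forall>h\<in>carrier (ky_hat m V). \<forall>b\<in>B.
              D (\<tau> (e a) h (f b)) = \<tau> (e a) (partial_t m V \<sigma> i h) (f b)))"

definition atiyah ::
  "nat \<Rightarrow> nat \<Rightarrow> nat \<Rightarrow> ('k::comm_ring_1) pol \<Rightarrow> ('k pol set \<Rightarrow> nat \<Rightarrow> 'k pol set) \<Rightarrow>
   ('k pol, 'y) mf \<Rightarrow> 'a set \<Rightarrow> ('a \<Rightarrow> 'y) \<Rightarrow> ('k pol, 'x) mf \<Rightarrow> 'b set \<Rightarrow> ('b \<Rightarrow> 'x) \<Rightarrow> nat \<Rightarrow>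
   (('y \<times> 'k pol set \<times> 'x) \<Rightarrow>\<^sub>0 int) set \<Rightarrow> (('y \<times> 'k pol set \<times> 'x) \<Rightarrow>\<^sub>0 int) set"
where
  "atiyah n m l V \<sigma> YY A e XX B f i =
     (let M = mf_cut_hat m V YY XX
      in THE g. g \<in> extensional (carrier (mf_cut m V YY XX)) \<and>
           (\<forall>v\<in>carrier M. g (mod_t m V YY XX v) =
              mod_t m V YY XX (gcomm M 1 0 (dmap M) (nabla n m l V \<sigma> YY A e XX B f i) v)))"

text \<open>The operator whose matrix in the basis \<open>f\<close> is the entrywise derivative of the matrix of \<open>D\<close>.\<close>

definition entrywise_pd ::
  "pvar \<Rightarrow> ('k::comm_ring_1) pol ring \<Rightarrow> ('k pol, 'x) mf \<Rightarrow> 'b set \<Rightarrow> ('b \<Rightarrow> 'x) \<Rightarrow>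
   ('x \<Rightarrow> 'x) \<Rightarrow> 'x \<Rightarrow> 'x"
where
  "entrywise_pd v R XX B f D x =
     (\<Oplus>\<^bsub>XX\<^esub>b'\<in>B. (\<Sum>b\<in>B. pd v (coords R XX B f (D (f b)) b') * coords R XX B f x b) \<odot>\<^bsub>XX\<^esub> f b')"

text \<open>The operator \<open>1 \<otimes> \<partial>d/\<partial>y\<^sub>i\<close> on \<open>Y | X\<close>, for the differential \<open>d\<close> of \<open>XX\<close>, with Koszul sign.\<close>

definition partial_dX ::
  "nat \<Rightarrow> nat \<Rightarrow> ('k::comm_ring_1) pol \<Rightarrow> ('k pol, 'y) mf \<Rightarrow>
   ('k pol, 'x) mf \<Rightarrow> 'b set \<Rightarrow> ('b \<Rightarrow> 'x) \<Rightarrow> nat \<Rightarrow>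
   (('y \<times> 'k pol set \<times> 'x) \<Rightarrow>\<^sub>0 int) set \<Rightarrow> (('y \<times> 'k pol set \<times> 'x) \<Rightarrow>\<^sub>0 int) set"
where
  "partial_dX n m V YY XX B f i =
     (let A = mpoly_ring (yvars m)
      in tensor_lift A YY (JV m V) XX (tensor_group A YY (JV m V) XX)
           (\<lambda>y s x. pure_tensor A YY (JV m V) XX (parity_inv YY y) s
              (entrywise_pd (Yv i) (mpoly_ring (xvars n \<union> yvars m)) XX B f (dmap XX) x)))"

text \<open>\<open>\<phi>\<close> is the structure map of \<open>k\<close> as an algebra over the rationals.\<close>

definition gamma_dag ::
  "(rat \<Rightarrow> 'k) \<Rightarrow> nat \<Rightarrow> nat \<Rightarrow> nat \<Rightarrow> ('k::comm_ring_1) pol \<Rightarrow>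
   ('k pol set \<Rightarrow> nat \<Rightarrow> 'k pol set) \<Rightarrow>
   ('k pol, 'y) mf \<Rightarrow> 'a set \<Rightarrow> ('a \<Rightarrow> 'y) \<Rightarrow> ('k pol, 'x) mf \<Rightarrow> 'b set \<Rightarrow> ('b \<Rightarrow> 'x) \<Rightarrow> nat \<Rightarrow>
   (('y \<times> 'k pol set \<times> 'x) \<Rightarrow>\<^sub>0 int) set \<Rightarrow> (('y \<times> 'k pol set \<times> 'x) \<Rightarrow>\<^sub>0 int) set"
where
  "gamma_dag \<phi> n m l V \<sigma> YY A e XX B f i v =
     (let M = mf_cut m V YY XX in
      \<ominus>\<^bsub>M\<^esub> partial_dX n m V YY XX B f i v \<ominus>\<^bsub>M\<^esub>
        cpoly (\<phi> (1 / 2)) \<odot>\<^bsub>M\<^esub>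
          (\<Oplus>\<^bsub>M\<^esub>q\<in>{..<m}. pd (Yv q) (pd (Yv i) V) \<odot>\<^bsub>M\<^esub> atiyah n m l V \<sigma> YY A e XX B f q v))"

end

theory Submission
  imports Defs
begin

text \<open>
  Write \<open>\<nabla>\<^sub>i\<close> for the extension of \<open>\<partial>/\<partial>t\<^sub>i\<close> to the completed tensor product.  Quasi-regularity of the partial
  derivatives of \<open>V\<close> makes the expansion in powers of \<open>t\<close> exist and be unique, so that \<open>[\<nabla>\<^sub>i, t\<^sub>j] = \<delta>\<^sub>i\<^sub>j\<close>.
  If an operator \<open>Q\<close> is linear over \<open>k[x,z]\<close> and \<open>k[t]\<close>, then so is \<open>[\<nabla>\<^sub>i, Q]\<close>, and the
  graded Jacobi identity for \<open>d\<close>, \<open>\<nabla>\<^sub>i\<close> and \<open>Q\<close> turns it into a homotopy on the reduction modulo \<open>t\<close>.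
  With \<open>Q = At\<^sub>j\<close> this gives \<open>[At\<^sub>i, At\<^sub>j] \<simeq> 0\<close>; with \<open>Q\<close> multiplication by an element of \<open>k[y]\<close> it shows that
  \<open>At\<^sub>i\<close> is \<open>k[y]\<close>-linear up to homotopy; with \<open>Q = \<lambda>\<^sub>j = \<partial>\<^sub>j d\<^sub>X\<close>, where \<open>[d, \<lambda>\<^sub>j] = t\<^sub>j\<close>, it gives
  \<open>[At\<^sub>i, \<lambda>\<^sub>j] \<simeq> - \<delta>\<^sub>i\<^sub>j\<close>.  Differentiating \<open>d\<^sub>X\<^sup>2 = V - W\<close> twice shows \<open>[\<lambda>\<^sub>i, \<lambda>\<^sub>j] \<simeq> \<partial>\<^sub>i \<partial>\<^sub>j V\<close>, with homotopy
  \<open>- \<partial>\<^sub>i \<partial>\<^sub>j d\<^sub>X\<close>; the Hessian term in \<open>\<gamma>\<^sub>i\<^sup>\<dagger>\<close> is what cancels this.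
\<close>

section \<open>Polynomials\<close>

text \<open>The connection is only k[x,z]-linear, so it does not pass to a tensor product over k[y]
  by functoriality. This obstacle shapes the proof: homogeneous bases of the outer factors and
  monomials in x and z give coordinates in the middle factor, where the connection acts, its
  commutation rules are checked, and the kernel of reduction modulo t is seen to consist of
  multiples of the t_j. Everything up to the coordinates is done for an arbitrary middle factor,
  because it is needed for the completion and for the Jacobi ring.

  The factor 1/2 is forced: with H the Hessian, each of the two mixed anticommutators of -\<lambda>
  with -(1/2) H At contributes -(1/2) H_ij, against H_ij from [\<lambda>_i, \<lambda>_j]. Pulling
  the entries of H out of these anticommutators costs a further homotopy, which is why the
  k[y]-linearity of At up to homotopy is tracked. Division by 2 also serves the grading: it makes
  the homogeneous parts of a tensor product the eigenspaces of an involution.\<close>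

lemma mem_mpoly_ring: "p \<in> carrier (mpoly_ring S) \<longleftrightarrow> (\<forall>u\<in>Poly_Mapping.keys p. Poly_Mapping.keys u \<subseteq> S)"
  by (simp add: mpoly_ring_def)

lemma mpoly_ring_simps [simp]:
  "monoid.mult (mpoly_ring S) = (*)" "one (mpoly_ring S) = 1"
  "ring.zero (mpoly_ring S) = 0" "ring.add (mpoly_ring S) = (+)"
  by (simp_all add: mpoly_ring_def)

lemma mpoly_mono: "S \<subseteq> S' \<Longrightarrow> p \<in> carrier (mpoly_ring S) \<Longrightarrow> p \<in> carrier (mpoly_ring S')"
  by (auto simp: mem_mpoly_ring)

lemma mpoly_single [intro]: "Poly_Mapping.keys u \<subseteq> S \<Longrightarrow> Poly_Mapping.single u c \<in> carrier (mpoly_ring S)"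
  by (auto simp: mem_mpoly_ring)

lemma mpoly_0 [simp, intro]: "0 \<in> carrier (mpoly_ring S)"
  by (auto simp: mem_mpoly_ring)

lemma mpoly_1 [simp, intro]: "1 \<in> carrier (mpoly_ring S)"
  by (auto simp: mem_mpoly_ring)

lemma mpoly_add [simp, intro]:
  "p \<in> carrier (mpoly_ring S) \<Longrightarrow> q \<in> carrier (mpoly_ring S) \<Longrightarrow> p + q \<in> carrier (mpoly_ring S)"
  using keys_add[of p q] by (fastforce simp: mem_mpoly_ring)

lemma mpoly_uminus [simp, intro]:
  "p \<in> carrier (mpoly_ring S) \<Longrightarrow> - p \<in> carrier (mpoly_ring S)"
  by (auto simp: mem_mpoly_ring in_keys_iff)

lemma mpoly_diff [simp, intro]:
  "p \<in> carrier (mpoly_ring S) \<Longrightarrow> q \<in> carrier (mpoly_ring S) \<Longrightarrow> p - q \<in> carrier (mpoly_ring S)"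
  using mpoly_add[OF _ mpoly_uminus, of p S q] by simp

lemma mpoly_mult [simp, intro]:
  assumes "p \<in> carrier (mpoly_ring S)" "q \<in> carrier (mpoly_ring S)"
  shows "p * q \<in> carrier (mpoly_ring S)"
  unfolding mem_mpoly_ring
proof
  fix u assume "u \<in> Poly_Mapping.keys (p * q)"
  then obtain a b where "u = a + b" "a \<in> Poly_Mapping.keys p" "b \<in> Poly_Mapping.keys q"
    using keys_mult[of p q] by auto
  then show "Poly_Mapping.keys u \<subseteq> S"
    using keys_add[of a b] assms by (fastforce simp: mem_mpoly_ring)
qed

lemma mpoly_sum [simp, intro]:
  "(\<And>i. i \<in> F \<Longrightarrow> f i \<in> carrier (mpoly_ring S)) \<Longrightarrow> sum f F \<in> carrier (mpoly_ring S)"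
  by (induction F rule: infinite_finite_induct) auto

lemma mpoly_prod [simp, intro]:
  "(\<And>i. i \<in> F \<Longrightarrow> f i \<in> carrier (mpoly_ring S)) \<Longrightarrow> prod f F \<in> carrier (mpoly_ring S)"
  by (induction F rule: infinite_finite_induct) auto

lemma mpoly_power [simp, intro]:
  "p \<in> carrier (mpoly_ring S) \<Longrightarrow> p ^ N \<in> carrier (mpoly_ring S)"
  by (induction N) auto

lemma mpoly_of_nat [simp, intro]: "of_nat N \<in> carrier (mpoly_ring S)"
  by (induction N) auto

lemma cring_mpoly [simp, intro]: "cring (mpoly_ring S :: ('k::comm_ring_1) pol ring)"
proof (rule cringI)
  show "abelian_group (mpoly_ring S :: 'k pol ring)"
    by (rule abelian_groupI) (auto simp: algebra_simps intro!: bexI[of _ "- _"])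
  show "comm_monoid (mpoly_ring S :: 'k pol ring)"
    by unfold_locales (auto simp: algebra_simps)
qed (auto simp: algebra_simps)

lemma ring_mpoly [simp, intro]: "ring (mpoly_ring S :: ('k::comm_ring_1) pol ring)"
  by (rule cring.axioms) simp

lemma uminus_mpoly [simp]:
  fixes p :: "('k::comm_ring_1) pol"
  assumes "p \<in> carrier (mpoly_ring S)" shows "\<ominus>\<^bsub>mpoly_ring S\<^esub> p = - p"
proof -
  interpret ring "mpoly_ring S :: 'k pol ring" by simp
  show ?thesis using assms minus_equality[of "-p" p] by simp
qed

lemma minus_mpoly [simp]:
  fixes p :: "('k::comm_ring_1) pol"
  assumes "q \<in> carrier (mpoly_ring S)" shows "p \<ominus>\<^bsub>mpoly_ring S\<^esub> q = p - q"
  using assms by (simp add: a_minus_def)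

lemma finsum_mpoly:
  fixes f :: "'i \<Rightarrow> ('k::comm_ring_1) pol"
  assumes "f \<in> F \<rightarrow> carrier (mpoly_ring S)" shows "finsum (mpoly_ring S) f F = sum f F"
proof -
  interpret cring "mpoly_ring S :: 'k pol ring" by simp
  show ?thesis using assms
    by (induction F rule: infinite_finite_induct) auto
qed

lemma finprod_mpoly:
  fixes f :: "'i \<Rightarrow> ('k::comm_ring_1) pol"
  assumes "f \<in> F \<rightarrow> carrier (mpoly_ring S)" shows "finprod (mpoly_ring S) f F = prod f F"
proof -
  interpret cring "mpoly_ring S :: 'k pol ring" by simp
  show ?thesis using assms
    by (induction F rule: infinite_finite_induct) auto
qed

lemma pow_mpoly [simp]:
  fixes p :: "('k::comm_ring_1) pol"
  shows "p [^]\<^bsub>mpoly_ring S\<^esub> (N::nat) = p ^ N"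
proof -
  interpret cring "mpoly_ring S :: 'k pol ring" by simp
  show ?thesis by (induction N) (auto simp: mult.commute)
qed

lemma poly_sum_monomials:
  fixes p :: "'a \<Rightarrow>\<^sub>0 'b::comm_monoid_add"
  shows "p = (\<Sum>u\<in>Poly_Mapping.keys p. Poly_Mapping.single u (Poly_Mapping.lookup p u))"
proof (rule poly_mapping_eqI)
  fix k
  show "Poly_Mapping.lookup p k = Poly_Mapping.lookup (\<Sum>u\<in>Poly_Mapping.keys p. Poly_Mapping.single u (Poly_Mapping.lookup p u)) k"
    by (simp add: lookup_sum lookup_single when_def sum.delta in_keys_iff)
qed

text \<open>Most constructions below are additive in the polynomial, so this reduces them to
  monomials. The addition step records that both summands lie in the subring, where the module laws
  are available.\<close>

lemma mpoly_induct [consumes 1, case_names zero single add]: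
  assumes "p \<in> carrier (mpoly_ring S)" and "P 0"
    and "\<And>u c. Poly_Mapping.keys u \<subseteq> S \<Longrightarrow> P (Poly_Mapping.single u c)"
    and "\<And>p q. p \<in> carrier (mpoly_ring S) \<Longrightarrow> q \<in> carrier (mpoly_ring S) \<Longrightarrow> P p \<Longrightarrow> P q \<Longrightarrow> P (p + q)"
  shows "P (p::('k::comm_ring_1) pol)"
proof -
  have "P (\<Sum>u\<in>F. Poly_Mapping.single u (Poly_Mapping.lookup p u))"
    if "F \<subseteq> Poly_Mapping.keys p" for F
    using finite_subset[OF that finite_keys] that
  proof (induction F)
    case empty then show ?case using assms by simp
  next
    case (insert u F)
    then have "Poly_Mapping.keys v \<subseteq> S" if "v \<in> insert u F" for v
      using assms(1) that by (auto simp: mem_mpoly_ring)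
    then show ?case using insert
      by (auto intro!: assms mpoly_sum mpoly_single)
  qed
  from this[of "Poly_Mapping.keys p"] show ?thesis
    using poly_sum_monomials[of p] by simp
qed

lemma mpoly_UNIV [simp]: "p \<in> carrier (mpoly_ring UNIV)"
  by (simp add: mem_mpoly_ring)

lemmas pol_induct [case_names zero single add] = mpoly_induct[OF mpoly_UNIV]

lemma cpoly_mem [simp, intro]: "cpoly c \<in> carrier (mpoly_ring S)"
  unfolding cpoly_def by (rule mpoly_single) simp

lemma cpoly_simps: "cpoly 0 = 0" "cpoly 1 = 1" "cpoly (a + b) = cpoly a + cpoly b"
  "cpoly (a * b) = cpoly a * cpoly b" "cpoly (- a) = - cpoly a"
  by (simp_all add: cpoly_def single_add mult_single single_uminus)

subsection \<open>Partial derivatives\<close>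

lemma pd_superset:
  assumes "finite F" "Poly_Mapping.keys p \<subseteq> F"
  shows "pd v p = (\<Sum>u\<in>F. Poly_Mapping.single (u - Poly_Mapping.single v 1)
                          (of_nat (Poly_Mapping.lookup u v) * Poly_Mapping.lookup p u))"
  unfolding pd_def using assms
  by (intro sum.mono_neutral_left) (auto simp: in_keys_iff)

lemma pd_0 [simp]: "pd v 0 = 0"
  by (simp add: pd_def)

lemma pd_add [simp]: "pd v (p + q) = pd v p + pd v q"
proof -
  let ?F = "Poly_Mapping.keys p \<union> Poly_Mapping.keys q"
  have "Poly_Mapping.keys (p + q) \<subseteq> ?F" by (rule keys_add)
  then show ?thesis
    by (simp add: pd_superset[of ?F] lookup_add distrib_left single_add sum.distrib)
qed

lemma pd_uminus [simp]: "pd v (- p) = - pd v p"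
  using pd_add[of v p "- p"] by (simp add: eq_neg_iff_add_eq_0 add.commute)

lemma pd_diff [simp]: "pd v (p - q) = pd v p - pd v q"
  using pd_add[of v p "- q"] by simp

lemma pd_single:
  "pd v (Poly_Mapping.single u c) =
     Poly_Mapping.single (u - Poly_Mapping.single v 1) (of_nat (Poly_Mapping.lookup u v) * c)"
  by (cases "c = 0") (auto simp: pd_def)

lemma pd_cpoly [simp]: "pd v (cpoly c) = 0"
  by (simp add: cpoly_def pd_single)

lemma pd_1 [simp]: "pd v 1 = 0"
  using pd_cpoly[of v 1] by (simp add: cpoly_simps)

text \<open>Subtraction of exponents is truncated, so lowering the exponent of \<open>v\<close>
  commutes with adding \<open>w\<close> only if \<open>v\<close> occurs in \<open>u\<close>. In the
  product rule the other case is harmless, because the coefficient of the derivative is then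
  zero.\<close>

lemma minus_single_add:
  fixes u w :: "pvar \<Rightarrow>\<^sub>0 nat"
  assumes "Poly_Mapping.lookup u v \<noteq> 0"
  shows "u - Poly_Mapping.single v 1 + w = u + w - Poly_Mapping.single v 1"
  using assms by (intro poly_mapping_eqI) (auto simp: lookup_add lookup_minus lookup_single when_def)

lemma pd_mult: "pd v (p * q) = pd v p * q + p * pd v q"
proof (induction p rule: pol_induct)
  case (single u c)
  show ?case
  proof (induction q rule: pol_induct)
    case (single w d)
    have 1: "Poly_Mapping.single (u - Poly_Mapping.single v 1 + w) (of_nat (Poly_Mapping.lookup u v) * c * d)
        = Poly_Mapping.single (u + w - Poly_Mapping.single v 1) (of_nat (Poly_Mapping.lookup u v) * c * d)"
      using minus_single_add[of u v w] by (cases "Poly_Mapping.lookup u v = 0") simp_all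
    have 2: "Poly_Mapping.single (u + (w - Poly_Mapping.single v 1)) (of_nat (Poly_Mapping.lookup w v) * c * d)
        = Poly_Mapping.single (u + w - Poly_Mapping.single v 1) (of_nat (Poly_Mapping.lookup w v) * c * d)"
      using minus_single_add[of w v u] by (cases "Poly_Mapping.lookup w v = 0") (simp_all add: add.commute)
    have "pd v (Poly_Mapping.single u c) * Poly_Mapping.single w d + Poly_Mapping.single u c * pd v (Poly_Mapping.single w d)
        = Poly_Mapping.single (u - Poly_Mapping.single v 1 + w) (of_nat (Poly_Mapping.lookup u v) * c * d)
          + Poly_Mapping.single (u + (w - Poly_Mapping.single v 1)) (of_nat (Poly_Mapping.lookup w v) * c * d)"
      unfolding pd_single mult_single by (simp only: mult.left_commute mult.assoc mult.commute)
    also have "\<dots> = pd v (Poly_Mapping.single u c * Poly_Mapping.single w d)"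
      unfolding 1 2 pd_single mult_single lookup_add by (simp add: distrib_right mult.assoc flip: single_add)
    finally show ?case by simp
  qed (auto simp: algebra_simps)
qed (auto simp: algebra_simps)

lemma pd_mem [simp, intro]: "p \<in> carrier (mpoly_ring S) \<Longrightarrow> pd v p \<in> carrier (mpoly_ring S)"
proof (induction p rule: mpoly_induct)
  case (single u c)
  have "Poly_Mapping.keys (u - Poly_Mapping.single v 1) \<subseteq> Poly_Mapping.keys u"
    by (auto simp: in_keys_iff lookup_minus)
  with single show ?case by (auto simp: pd_single intro!: mpoly_single)
qed auto

lemma pd_const: "p \<in> carrier (mpoly_ring S) \<Longrightarrow> v \<notin> S \<Longrightarrow> pd v p = 0"
proof (induction p rule: mpoly_induct)
  case (single u c)
  then have "Poly_Mapping.lookup u v = 0" by (auto simp: in_keys_iff)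
  then show ?case by (simp add: pd_single)
qed auto

lemma pd_commute: "pd v (pd w p) = pd w (pd v p)"
proof (induction p rule: pol_induct)
  case (single u c)
  have *: "u - Poly_Mapping.single w 1 - Poly_Mapping.single v 1 = u - Poly_Mapping.single v 1 - Poly_Mapping.single w 1"
    by (intro poly_mapping_eqI) (auto simp: lookup_minus)
  show ?case
    by (cases "v = w") (auto simp: pd_single lookup_minus lookup_single *[simplified] mult_ac)
qed auto

subsection \<open>Restriction of monomials\<close>

lemma lookup_mon_restrict [simp]:
  "Poly_Mapping.lookup (mon_restrict S u) v = (if v \<in> S then Poly_Mapping.lookup u v else 0)"
  by (auto simp: mon_restrict_def lookup_sum lookup_single when_def sum.delta in_keys_iff)

lemma keys_mon_restrict [simp]: "Poly_Mapping.keys (mon_restrict S u) = Poly_Mapping.keys u \<inter> S"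
  by (auto simp: in_keys_iff split: if_splits)

lemma mon_restrict_add [simp]: "mon_restrict S (u + v) = mon_restrict S u + mon_restrict S v"
  by (intro poly_mapping_eqI) (simp add: lookup_add)

lemma mon_restrict_id: "Poly_Mapping.keys u \<subseteq> S \<Longrightarrow> mon_restrict S u = u"
  by (intro poly_mapping_eqI) (auto simp: in_keys_iff)

lemma mon_restrict_0: "Poly_Mapping.keys u \<inter> S = {} \<Longrightarrow> mon_restrict S u = 0"
  by (intro poly_mapping_eqI) (auto simp: in_keys_iff)

lemma mon_restrict_xyz:
  "mon_restrict (range Zv) u + mon_restrict (range Yv) u + mon_restrict (range Xv) u = u"
proof (rule poly_mapping_eqI)
  fix v show "Poly_Mapping.lookup (mon_restrict (range Zv) u + mon_restrict (range Yv) u + mon_restrict (range Xv) u) v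
    = Poly_Mapping.lookup u v"
    by (cases v) (auto simp: lookup_add)
qed

section \<open>Modules\<close>

lemma module_mpoly_mono:
  fixes M :: "(('k::comm_ring_1) pol, 'b, 'c) module_scheme"
  assumes "module (mpoly_ring S) M" "S' \<subseteq> S"
  shows "module (mpoly_ring S') M"
proof -
  interpret module "mpoly_ring S :: 'k pol ring" M by fact
  show ?thesis
  proof (rule moduleI)
    fix a b :: "'k pol" and x assume "a \<in> carrier (mpoly_ring S')" "b \<in> carrier (mpoly_ring S')" and x: "x \<in> carrier M"
    note ab = this(1,2)[THEN mpoly_mono[OF assms(2)]]
    show "(a \<oplus>\<^bsub>mpoly_ring S'\<^esub> b) \<odot>\<^bsub>M\<^esub> x = a \<odot>\<^bsub>M\<^esub> x \<oplus>\<^bsub>M\<^esub> b \<odot>\<^bsub>M\<^esub> x"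
      "(a \<otimes>\<^bsub>mpoly_ring S'\<^esub> b) \<odot>\<^bsub>M\<^esub> x = a \<odot>\<^bsub>M\<^esub> (b \<odot>\<^bsub>M\<^esub> x)"
      using smult_l_distr[OF ab x] smult_assoc1[OF ab x] by simp_all
  next
    fix x assume "x \<in> carrier M"
    then show "\<one>\<^bsub>mpoly_ring S'\<^esub> \<odot>\<^bsub>M\<^esub> x = x" using smult_one[of x] by simp
  qed (auto intro: M.abelian_group_axioms smult_closed mpoly_mono[OF assms(2)] smult_r_distr)
qed

section \<open>Tensor products of three modules\<close>

text \<open>The conditions dual to \<open>tensor_rels\<close>. Both balancing laws move a scalar to
  the middle factor, the common normal form for a scalar that may sit in any of the three
  places.\<close>

definition balanced ::
  "('a, 'r) ring_scheme \<Rightarrow> ('a, 'y, 'p) module_scheme \<Rightarrow> ('a, 's, 'q) module_scheme \<Rightarrow>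
   ('a, 'x, 't) module_scheme \<Rightarrow> ('h, 'i) monoid_scheme \<Rightarrow> ('y \<Rightarrow> 's \<Rightarrow> 'x \<Rightarrow> 'h) \<Rightarrow> bool" where
  "balanced A YY S XX H \<psi> \<longleftrightarrow>
    (\<forall>y\<in>carrier YY. \<forall>s\<in>carrier S. \<forall>x\<in>carrier XX. \<psi> y s x \<in> carrier H) \<and>
    (\<forall>y\<in>carrier YY. \<forall>y'\<in>carrier YY. \<forall>s\<in>carrier S. \<forall>x\<in>carrier XX.
       \<psi> (y \<oplus>\<^bsub>YY\<^esub> y') s x = \<psi> y s x \<otimes>\<^bsub>H\<^esub> \<psi> y' s x) \<and>
    (\<forall>y\<in>carrier YY. \<forall>s\<in>carrier S. \<forall>s'\<in>carrier S. \<forall>x\<in>carrier XX.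
       \<psi> y (s \<oplus>\<^bsub>S\<^esub> s') x = \<psi> y s x \<otimes>\<^bsub>H\<^esub> \<psi> y s' x) \<and>
    (\<forall>y\<in>carrier YY. \<forall>s\<in>carrier S. \<forall>x\<in>carrier XX. \<forall>x'\<in>carrier XX.
       \<psi> y s (x \<oplus>\<^bsub>XX\<^esub> x') = \<psi> y s x \<otimes>\<^bsub>H\<^esub> \<psi> y s x') \<and>
    (\<forall>a\<in>carrier A. \<forall>y\<in>carrier YY. \<forall>s\<in>carrier S. \<forall>x\<in>carrier XX.
       \<psi> (a \<odot>\<^bsub>YY\<^esub> y) s x = \<psi> y (a \<odot>\<^bsub>S\<^esub> s) x \<and> \<psi> y s (a \<odot>\<^bsub>XX\<^esub> x) = \<psi> y (a \<odot>\<^bsub>S\<^esub> s) x)"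

lemma balancedI:
  assumes "\<And>y s x. y \<in> carrier YY \<Longrightarrow> s \<in> carrier S \<Longrightarrow> x \<in> carrier XX \<Longrightarrow> \<psi> y s x \<in> carrier H"
    and "\<And>y y' s x. y \<in> carrier YY \<Longrightarrow> y' \<in> carrier YY \<Longrightarrow> s \<in> carrier S \<Longrightarrow> x \<in> carrier XX \<Longrightarrow>
       \<psi> (y \<oplus>\<^bsub>YY\<^esub> y') s x = \<psi> y s x \<otimes>\<^bsub>H\<^esub> \<psi> y' s x"
    and "\<And>y s s' x. y \<in> carrier YY \<Longrightarrow> s \<in> carrier S \<Longrightarrow> s' \<in> carrier S \<Longrightarrow> x \<in> carrier XX \<Longrightarrow>
       \<psi> y (s \<oplus>\<^bsub>S\<^esub> s') x = \<psi> y s x \<otimes>\<^bsub>H\<^esub> \<psi> y s' x"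
    and "\<And>y s x x'. y \<in> carrier YY \<Longrightarrow> s \<in> carrier S \<Longrightarrow> x \<in> carrier XX \<Longrightarrow> x' \<in> carrier XX \<Longrightarrow>
       \<psi> y s (x \<oplus>\<^bsub>XX\<^esub> x') = \<psi> y s x \<otimes>\<^bsub>H\<^esub> \<psi> y s x'"
    and "\<And>a y s x. a \<in> carrier A \<Longrightarrow> y \<in> carrier YY \<Longrightarrow> s \<in> carrier S \<Longrightarrow> x \<in> carrier XX \<Longrightarrow>
       \<psi> (a \<odot>\<^bsub>YY\<^esub> y) s x = \<psi> y (a \<odot>\<^bsub>S\<^esub> s) x"
    and "\<And>a y s x. a \<in> carrier A \<Longrightarrow> y \<in> carrier YY \<Longrightarrow> s \<in> carrier S \<Longrightarrow> x \<in> carrier XX \<Longrightarrow>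
       \<psi> y s (a \<odot>\<^bsub>XX\<^esub> x) = \<psi> y (a \<odot>\<^bsub>S\<^esub> s) x"
  shows "balanced A YY S XX H \<psi>"
  unfolding balanced_def by (intro conjI ballI; rule assms; assumption)

locale tensor3 =
  fixes A :: "('a, 'r) ring_scheme" and YY :: "('a, 'y, 'p) module_scheme"
    and S :: "('a, 's, 'q) module_scheme" and XX :: "('a, 'x, 't) module_scheme"
  assumes YY_mod: "module A YY" and S_mod: "module A S" and XX_mod: "module A XX"
begin

abbreviation "Fr \<equiv> free_Abelian_group (carrier YY \<times> carrier S \<times> carrier XX)"
abbreviation "Nr \<equiv> generate Fr (tensor_rels A YY S XX)"
abbreviation "T \<equiv> tensor_group A YY S XX"
abbreviation "\<tau> \<equiv> pure_tensor A YY S XX"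

lemma T_eq: "T = Fr Mod Nr" by (simp add: tensor_group_def Let_def)
lemma \<tau>_eq: "\<tau> y s x = Nr #>\<^bsub>Fr\<^esub> frag_of (y, s, x)" by (simp add: pure_tensor_def Let_def)

sublocale Y: module A YY by (rule YY_mod)
sublocale S: module A S by (rule S_mod)
sublocale X: module A XX by (rule XX_mod)

lemma keys_frag_diff3:
  assumes "a \<in> C" "b \<in> C" "c \<in> C"
  shows "Poly_Mapping.keys (frag_of a - frag_of b - frag_of c) \<subseteq> C"
  using assms keys_diff[of "frag_of a - frag_of b" "frag_of c"] keys_diff[of "frag_of a" "frag_of b"]
  by (auto simp: keys_frag_of)

lemma keys_frag_diff2:
  assumes "a \<in> C" "b \<in> C"
  shows "Poly_Mapping.keys (frag_of a - frag_of b) \<subseteq> C"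
  using assms keys_diff[of "frag_of a" "frag_of b"]
  by (auto simp: keys_frag_of)

lemma rels_carrier: "tensor_rels A YY S XX \<subseteq> carrier Fr"
  unfolding tensor_rels_def
  by (intro Un_least subsetI; elim CollectE exE conjE; hypsubst;
      simp only: carrier_free_Abelian_group_iff; (rule keys_frag_diff3 | rule keys_frag_diff2); simp)

lemma N_subgroup: "subgroup Nr Fr"
  by (rule group.generate_is_subgroup) (auto simp: rels_carrier)

lemma N_normal: "Nr \<lhd> Fr"
  by (rule comm_group.subgroup_imp_normal[OF abelian_free_Abelian_group N_subgroup])

lemma T_comm_group: "comm_group T"
  unfolding T_eq by (rule comm_group.abelian_FactGroup[OF abelian_free_Abelian_group N_subgroup])

sublocale T: comm_group T by (rule T_comm_group)

lemma proj_add: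
  assumes "u \<in> carrier Fr" "v \<in> carrier Fr"
  shows "Nr #>\<^bsub>Fr\<^esub> (u + v) = (Nr #>\<^bsub>Fr\<^esub> u) \<otimes>\<^bsub>T\<^esub> (Nr #>\<^bsub>Fr\<^esub> v)"
  using normal.rcos_sum[OF N_normal assms] by (simp add: T_eq)

lemma proj_closed: "u \<in> carrier Fr \<Longrightarrow> Nr #>\<^bsub>Fr\<^esub> u \<in> carrier T"
  by (auto simp: T_eq carrier_FactGroup)

lemma proj_rel:
  assumes "u \<in> tensor_rels A YY S XX" shows "Nr #>\<^bsub>Fr\<^esub> u = \<one>\<^bsub>T\<^esub>"
proof -
  have "Nr #>\<^bsub>Fr\<^esub> u = Nr"
    using assms rels_carrier
    by (intro group.coset_join2[OF group_free_Abelian_group _ N_subgroup] generate.incl) blast+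
  then show ?thesis by (simp add: T_eq)
qed

lemma proj_inv:
  assumes "v \<in> carrier Fr" shows "Nr #>\<^bsub>Fr\<^esub> (- v) = inv\<^bsub>T\<^esub> (Nr #>\<^bsub>Fr\<^esub> v)"
  using proj_add[of "- v" v] assms proj_closed[of v] proj_closed[of "-v"]
    group.coset_mult_one[OF group_free_Abelian_group, of Nr] subgroup.subset[OF N_subgroup]
  by (intro T.inv_equality[symmetric]) (auto simp: T_eq)

lemma proj_diff:
  assumes "u \<in> carrier Fr" "v \<in> carrier Fr"
  shows "Nr #>\<^bsub>Fr\<^esub> (u - v) = (Nr #>\<^bsub>Fr\<^esub> u) \<otimes>\<^bsub>T\<^esub> inv\<^bsub>T\<^esub> (Nr #>\<^bsub>Fr\<^esub> v)"
  using proj_add[of u "- v"] proj_inv[of v] assms by auto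

lemma \<tau>_closed [simp, intro]:
  "y \<in> carrier YY \<Longrightarrow> s \<in> carrier S \<Longrightarrow> x \<in> carrier XX \<Longrightarrow> \<tau> y s x \<in> carrier T"
  unfolding \<tau>_eq by (rule proj_closed) (simp add: keys_frag_of)

lemma \<tau>_rel3:
  assumes "frag_of (y,s,x) - frag_of (y',s',x') - frag_of (y'',s'',x'') \<in> tensor_rels A YY S XX"
    and "(y,s,x) \<in> carrier YY \<times> carrier S \<times> carrier XX" "(y',s',x') \<in> carrier YY \<times> carrier S \<times> carrier XX"
    "(y'',s'',x'') \<in> carrier YY \<times> carrier S \<times> carrier XX"
  shows "\<tau> y s x = \<tau> y' s' x' \<otimes>\<^bsub>T\<^esub> \<tau> y'' s'' x''"
proof -
  have 1: "frag_of (y,s,x) - frag_of (y',s',x') \<in> carrier Fr" 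
    using keys_frag_diff2[OF assms(2,3)] by simp
  have "(\<tau> y s x \<otimes>\<^bsub>T\<^esub> inv\<^bsub>T\<^esub> \<tau> y' s' x') \<otimes>\<^bsub>T\<^esub> inv\<^bsub>T\<^esub> \<tau> y'' s'' x'' = \<one>\<^bsub>T\<^esub>"
    using proj_rel[OF assms(1)] proj_diff[OF 1, of "frag_of (y'',s'',x'')"]
      proj_diff[of "frag_of (y,s,x)" "frag_of (y',s',x')"] assms(2-4)
    by (simp add: \<tau>_eq keys_frag_of)
  then show ?thesis using assms(2-4)
    by (metis SigmaE2 T.inv_closed T.inv_solve_right T.l_one T.m_closed T.m_comm T.one_closed \<tau>_closed)
qed

lemma \<tau>_rel2:
  assumes "frag_of (y,s,x) - frag_of (y',s',x') \<in> tensor_rels A YY S XX"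
    and "(y,s,x) \<in> carrier YY \<times> carrier S \<times> carrier XX" "(y',s',x') \<in> carrier YY \<times> carrier S \<times> carrier XX"
  shows "\<tau> y s x = \<tau> y' s' x'"
proof -
  have "\<tau> y s x \<otimes>\<^bsub>T\<^esub> inv\<^bsub>T\<^esub> \<tau> y' s' x' = \<one>\<^bsub>T\<^esub>"
    using proj_rel[OF assms(1)] 
      proj_diff[of "frag_of (y,s,x)" "frag_of (y',s',x')"] assms(2-)
    by (simp add: \<tau>_eq keys_frag_of)
  then show ?thesis using assms(2-)
    by (metis SigmaE2 T.inv_solve_right T.l_one T.one_closed \<tau>_closed)
qed

lemma \<tau>_add1: "y \<in> carrier YY \<Longrightarrow> y' \<in> carrier YY \<Longrightarrow> s \<in> carrier S \<Longrightarrow> x \<in> carrier XX \<Longrightarrow>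
    \<tau> (y \<oplus>\<^bsub>YY\<^esub> y') s x = \<tau> y s x \<otimes>\<^bsub>T\<^esub> \<tau> y' s x"
  by (rule \<tau>_rel3) (auto simp: tensor_rels_def)
lemma \<tau>_add2: "y \<in> carrier YY \<Longrightarrow> s \<in> carrier S \<Longrightarrow> s' \<in> carrier S \<Longrightarrow> x \<in> carrier XX \<Longrightarrow>
    \<tau> y (s \<oplus>\<^bsub>S\<^esub> s') x = \<tau> y s x \<otimes>\<^bsub>T\<^esub> \<tau> y s' x"
  by (rule \<tau>_rel3) (auto simp: tensor_rels_def)
lemma \<tau>_add3: "y \<in> carrier YY \<Longrightarrow> s \<in> carrier S \<Longrightarrow> x \<in> carrier XX \<Longrightarrow> x' \<in> carrier XX \<Longrightarrow>
    \<tau> y s (x \<oplus>\<^bsub>XX\<^esub> x') = \<tau> y s x \<otimes>\<^bsub>T\<^esub> \<tau> y s x'"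
  by (rule \<tau>_rel3) (auto simp: tensor_rels_def)
lemma \<tau>_smult1: "a \<in> carrier A \<Longrightarrow> y \<in> carrier YY \<Longrightarrow> s \<in> carrier S \<Longrightarrow> x \<in> carrier XX \<Longrightarrow>
    \<tau> (a \<odot>\<^bsub>YY\<^esub> y) s x = \<tau> y (a \<odot>\<^bsub>S\<^esub> s) x"
  by (rule \<tau>_rel2) (auto simp: tensor_rels_def)
lemma \<tau>_smult3: "a \<in> carrier A \<Longrightarrow> y \<in> carrier YY \<Longrightarrow> s \<in> carrier S \<Longrightarrow> x \<in> carrier XX \<Longrightarrow>
    \<tau> y s (a \<odot>\<^bsub>XX\<^esub> x) = \<tau> y (a \<odot>\<^bsub>S\<^esub> s) x"
  by (rule \<tau>_rel2[symmetric]) (auto simp: tensor_rels_def)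

text \<open>Inverses need no case of their own: the inverse of a pure tensor is again pure, with the
  first factor negated.\<close>

lemma T_induct [consumes 1, case_names one pure mult]:
  assumes v: "v \<in> carrier T" and one: "P \<one>\<^bsub>T\<^esub>"
    and pure: "\<And>y s x. y \<in> carrier YY \<Longrightarrow> s \<in> carrier S \<Longrightarrow> x \<in> carrier XX \<Longrightarrow> P (\<tau> y s x)"
    and mult: "\<And>a b. a \<in> carrier T \<Longrightarrow> b \<in> carrier T \<Longrightarrow> P a \<Longrightarrow> P b \<Longrightarrow> P (a \<otimes>\<^bsub>T\<^esub> b)"
  shows "P v"
proof -
  have inv_\<tau>: "inv\<^bsub>T\<^esub> \<tau> y s x = \<tau> (\<ominus>\<^bsub>YY\<^esub> y) s x"
    if "y \<in> carrier YY" "s \<in> carrier S" "x \<in> carrier XX" for y s x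
  proof -
    have "\<tau> \<zero>\<^bsub>YY\<^esub> s x = \<tau> \<zero>\<^bsub>YY\<^esub> s x \<otimes>\<^bsub>T\<^esub> \<tau> \<zero>\<^bsub>YY\<^esub> s x"
      using \<tau>_add1[of "\<zero>\<^bsub>YY\<^esub>" "\<zero>\<^bsub>YY\<^esub>" s x] that by simp
    then have "\<tau> \<zero>\<^bsub>YY\<^esub> s x = \<one>\<^bsub>T\<^esub>" using that by (metis T.r_cancel_one' Y.zero_closed \<tau>_closed)
    then show ?thesis using that \<tau>_add1[of "\<ominus>\<^bsub>YY\<^esub> y" y s x]
      by (intro T.inv_equality) (auto simp: Y.l_neg)
  qed
  obtain u where u: "u \<in> carrier Fr" "v = Nr #>\<^bsub>Fr\<^esub> u"
    using v by (auto simp: T_eq carrier_FactGroup)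
  \<comment> \<open>The free abelian group is generated under differences, so the claim is carried
    together with the claim for the inverse.\<close>
  have "P (Nr #>\<^bsub>Fr\<^esub> u) \<and> P (inv\<^bsub>T\<^esub> (Nr #>\<^bsub>Fr\<^esub> u))"
    using u(1)[unfolded carrier_free_Abelian_group_iff]
  proof (induction u rule: free_Abelian_group_induct[consumes 1, case_names zero diff of])
    case zero
    have "Nr #>\<^bsub>Fr\<^esub> 0 = \<one>\<^bsub>T\<^esub>"
      using group.coset_mult_one[OF group_free_Abelian_group, of Nr] subgroup.subset[OF N_subgroup]
      by (simp add: T_eq)
    then show ?case using one by simp
  next
    case (diff x y)
    then show ?case
      using proj_diff[of x y] proj_closed[of x] proj_closed[of y]
      by (auto simp: T.inv_mult_group intro!: mult)
  next
    case (of a)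
    then show ?case
      by (cases a) (auto simp: inv_\<tau> simp flip: \<tau>_eq intro!: pure)
  qed
  then show ?thesis using u by simp
qed

lemma hom_eqI:
  assumes "f \<in> hom T H" "g \<in> hom T H" "group H"
    and "\<And>y s x. y \<in> carrier YY \<Longrightarrow> s \<in> carrier S \<Longrightarrow> x \<in> carrier XX \<Longrightarrow> f (\<tau> y s x) = g (\<tau> y s x)"
    and "v \<in> carrier T"
  shows "f v = g v"
  using assms(5)
proof (induction v rule: T_induct)
  case one
  then show ?case using hom_one[OF assms(1)] hom_one[OF assms(2)] assms(3) by simp
qed (use assms in \<open>auto simp: hom_mult\<close>)

text \<open>A balanced map extends freely to formal sums. Every relation then lies in the kernel, so
  the extension factors through the quotient.\<close>

lemma lift_exists:
  assumes "comm_group H" and b: "balanced A YY S XX H \<psi>"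
  shows "\<exists>f. f \<in> hom T H \<and> (\<forall>y\<in>carrier YY. \<forall>s\<in>carrier S. \<forall>x\<in>carrier XX. f (\<tau> y s x) = \<psi> y s x)"
proof -
  interpret H: comm_group H by fact
  obtain h where h: "h \<in> hom Fr H"
    and hf: "\<And>p. p \<in> carrier YY \<times> carrier S \<times> carrier XX \<Longrightarrow> h (frag_of p) = (case p of (y,s,x) \<Rightarrow> \<psi> y s x)"
    using H.free_Abelian_group_universal[of "\<lambda>(y,s,x). \<psi> y s x" "carrier YY \<times> carrier S \<times> carrier XX"] b
    by (auto simp: balanced_def image_subset_iff)
  interpret h: group_hom Fr H h
    by (simp add: group_hom_def group_hom_axioms_def h H.is_group)
  have hd: "h (u - v) = h u \<otimes>\<^bsub>H\<^esub> inv\<^bsub>H\<^esub> h v" if "u \<in> carrier Fr" "v \<in> carrier Fr" for u v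
    using h.hom_mult[of u "-v"] h.hom_inv[of v] that by simp
  have ker3: "frag_of (y,s,x) - frag_of (y',s',x') - frag_of (y'',s'',x'') \<in> kernel Fr H h"
    if "(y,s,x) \<in> carrier YY \<times> carrier S \<times> carrier XX" "(y',s',x') \<in> carrier YY \<times> carrier S \<times> carrier XX"
    "(y'',s'',x'') \<in> carrier YY \<times> carrier S \<times> carrier XX" "\<psi> y s x = \<psi> y' s' x' \<otimes>\<^bsub>H\<^esub> \<psi> y'' s'' x''"
    for y s x y' s' x' y'' s'' x''
  proof -
    have c: "frag_of (y,s,x) - frag_of (y',s',x') \<in> carrier Fr"
      "frag_of (y,s,x) - frag_of (y',s',x') - frag_of (y'',s'',x'') \<in> carrier Fr"
      using keys_frag_diff2[OF that(1,2)] keys_frag_diff3[OF that(1-3)] by simp_all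
    have "\<psi> y' s' x' \<in> carrier H" "\<psi> y'' s'' x'' \<in> carrier H" using that b by (auto simp: balanced_def)
    then show ?thesis using c that hd[OF c(1)] hd[of "frag_of (y,s,x)" "frag_of (y',s',x')"]
      by (auto simp: kernel_def hf keys_frag_of H.m_comm[of "\<psi> y' s' x'"] H.m_assoc)
  qed
  have ker2: "frag_of (y,s,x) - frag_of (y',s',x') \<in> kernel Fr H h"
    if "(y,s,x) \<in> carrier YY \<times> carrier S \<times> carrier XX" "(y',s',x') \<in> carrier YY \<times> carrier S \<times> carrier XX"
     "\<psi> y s x = \<psi> y' s' x'"
    for y s x y' s' x'
  proof -
    have c: "frag_of (y,s,x) - frag_of (y',s',x') \<in> carrier Fr"
      using keys_frag_diff2[OF that(1,2)] by simp
    have "\<psi> y' s' x' \<in> carrier H" using that b by (auto simp: balanced_def)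
    then show ?thesis using c that hd[of "frag_of (y,s,x)" "frag_of (y',s',x')"]
      by (auto simp: kernel_def hf keys_frag_of)
  qed
  have "tensor_rels A YY S XX \<subseteq> kernel Fr H h"
    unfolding tensor_rels_def using b
    by (auto simp: balanced_def simp del: carrier_free_Abelian_group_iff intro!: ker3 ker2)
  then have "Nr \<subseteq> kernel Fr H h"
    by (rule group.generate_subgroup_incl[OF group_free_Abelian_group _ h.subgroup_kernel])
  then obtain g where "g \<in> hom (Fr Mod Nr) H" "\<And>x. x \<in> carrier Fr \<Longrightarrow> g(Nr #>\<^bsub>Fr\<^esub> x) = h x"
    using h.FactGroup_universal_kernel[OF N_normal] by blast
  then show ?thesis
    by (intro exI[of _ g]) (simp add: T_eq \<tau>_eq hf keys_frag_of)
qed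

lemma lift:
  assumes "comm_group H" and b: "balanced A YY S XX H \<psi>"
  shows "tensor_lift A YY S XX H \<psi> \<in> hom T H"
    and "tensor_lift A YY S XX H \<psi> \<in> extensional (carrier T)"
    and "\<And>y s x. y \<in> carrier YY \<Longrightarrow> s \<in> carrier S \<Longrightarrow> x \<in> carrier XX \<Longrightarrow>
      tensor_lift A YY S XX H \<psi> (\<tau> y s x) = \<psi> y s x"
proof -
  interpret H: comm_group H by fact
  let ?P = "\<lambda>f. f \<in> extensional (carrier T) \<and> f \<in> hom T H \<and>
    (\<forall>y\<in>carrier YY. \<forall>s\<in>carrier S. \<forall>x\<in>carrier XX. f (\<tau> y s x) = \<psi> y s x)"
  obtain f where f: "f \<in> hom T H" "\<forall>y\<in>carrier YY. \<forall>s\<in>carrier S. \<forall>x\<in>carrier XX. f (\<tau> y s x) = \<psi> y s x"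
    using lift_exists[OF assms] by blast
  \<comment> \<open>Off the carrier a homomorphism is arbitrary; restricting it singles out one
    function, as the definite description requires.\<close>
  have "?P (restrict f (carrier T))"
    using f by (auto simp: hom_def Pi_iff)
  moreover have "g = restrict f (carrier T)" if "?P g" for g
  proof (rule extensionalityI[where A = "carrier T"])
    fix v assume "v \<in> carrier T"
    then show "g v = restrict f (carrier T) v"
      using hom_eqI[of g H f v] f that by auto
  qed (use that in auto)
  ultimately have "?P (THE f. ?P f)" by (rule theI)
  then show "tensor_lift A YY S XX H \<psi> \<in> hom T H"
    and "tensor_lift A YY S XX H \<psi> \<in> extensional (carrier T)"
    and "\<And>y s x. y \<in> carrier YY \<Longrightarrow> s \<in> carrier S \<Longrightarrow> x \<in> carrier XX \<Longrightarrow>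
      tensor_lift A YY S XX H \<psi> (\<tau> y s x) = \<psi> y s x"
    unfolding tensor_lift_def by auto
qed

end

section \<open>Additive and linear maps\<close>

abbreviation addhom :: "('b, 'p) ring_scheme \<Rightarrow> ('c, 'q) ring_scheme \<Rightarrow> ('b \<Rightarrow> 'c) set" where
  "addhom M N \<equiv> hom (add_monoid M) (add_monoid N)"

lemma addhomI:
  assumes "\<And>v. v \<in> carrier M \<Longrightarrow> f v \<in> carrier N"
    and "\<And>v w. v \<in> carrier M \<Longrightarrow> w \<in> carrier M \<Longrightarrow> f (v \<oplus>\<^bsub>M\<^esub> w) = f v \<oplus>\<^bsub>N\<^esub> f w"
  shows "f \<in> addhom M N"
  using assms by (auto simp: hom_def)

lemma addhom_closed: "f \<in> addhom M N \<Longrightarrow> v \<in> carrier M \<Longrightarrow> f v \<in> carrier N"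
  by (auto simp: hom_def)

lemma addhom_add: "f \<in> addhom M N \<Longrightarrow> v \<in> carrier M \<Longrightarrow> w \<in> carrier M \<Longrightarrow> f (v \<oplus>\<^bsub>M\<^esub> w) = f v \<oplus>\<^bsub>N\<^esub> f w"
  by (auto simp: hom_def)

lemma addhom_zero:
  assumes "f \<in> addhom M N" "abelian_group M" "abelian_group N"
  shows "f \<zero>\<^bsub>M\<^esub> = \<zero>\<^bsub>N\<^esub>"
  using hom_one[OF assms(1)] assms(2,3)[THEN abelian_group.a_group] by simp

lemma addhom_neg:
  assumes "f \<in> addhom M N" "abelian_group M" "abelian_group N" "v \<in> carrier M"
  shows "f (\<ominus>\<^bsub>M\<^esub> v) = \<ominus>\<^bsub>N\<^esub> f v"
proof -
  interpret M: abelian_group M by fact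
  interpret N: abelian_group N by fact
  have "f (\<ominus>\<^bsub>M\<^esub> v) \<oplus>\<^bsub>N\<^esub> f v = \<zero>\<^bsub>N\<^esub>"
    using addhom_add[OF assms(1), of "\<ominus>\<^bsub>M\<^esub> v" v] assms addhom_zero[OF assms(1-3)] by (simp add: M.l_neg)
  then show ?thesis using assms addhom_closed[OF assms(1)] by (intro N.minus_equality[symmetric]) auto
qed

lemma addhom_minus:
  assumes "f \<in> addhom M N" "abelian_group M" "abelian_group N" "v \<in> carrier M" "w \<in> carrier M"
  shows "f (v \<ominus>\<^bsub>M\<^esub> w) = f v \<ominus>\<^bsub>N\<^esub> f w"
  using assms by (simp add: a_minus_def addhom_add addhom_neg abelian_group.a_inv_closed)

lemma addhom_finsum:
  assumes "f \<in> addhom M N" "abelian_group M" "abelian_group N" "g \<in> I \<rightarrow> carrier M"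
  shows "f (finsum M g I) = (\<Oplus>\<^bsub>N\<^esub>i\<in>I. f (g i))"
proof -
  interpret M: abelian_group M by fact
  interpret N: abelian_group N by fact
  show ?thesis using assms(4)
  proof (induction I rule: infinite_finite_induct)
    case (insert i I)
    then show ?case using addhom_closed[OF assms(1)]
      by (simp add: addhom_add[OF assms(1)] Pi_iff)
  qed (auto simp: addhom_zero[OF assms(1-3)])
qed

lemma addhom_comp: "f \<in> addhom M N \<Longrightarrow> g \<in> addhom N P \<Longrightarrow> (\<lambda>v. g (f v)) \<in> addhom M P"
  by (auto simp: hom_def Pi_iff)

lemma addhom_plus:
  assumes "f \<in> addhom M N" "g \<in> addhom M N" "abelian_group N"
  shows "(\<lambda>v. f v \<oplus>\<^bsub>N\<^esub> g v) \<in> addhom M N"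
proof -
  interpret N: abelian_group N by fact
  show ?thesis using addhom_closed[OF assms(1)] addhom_closed[OF assms(2)]
    by (intro addhomI) (auto simp: addhom_add[OF assms(1)] addhom_add[OF assms(2)] N.a_ac)
qed

lemma addhom_uminus:
  assumes "f \<in> addhom M N" "abelian_group N"
  shows "(\<lambda>v. \<ominus>\<^bsub>N\<^esub> f v) \<in> addhom M N"
proof -
  interpret N: abelian_group N by fact
  show ?thesis using addhom_closed[OF assms(1)]
    by (intro addhomI) (auto simp: addhom_add[OF assms(1)] N.minus_add)
qed

lemma addhom_diff:
  assumes "f \<in> addhom M N" "g \<in> addhom M N" "abelian_group N"
  shows "(\<lambda>v. f v \<ominus>\<^bsub>N\<^esub> g v) \<in> addhom M N"
  unfolding a_minus_def using assms by (intro addhom_plus addhom_uminus)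

lemma addhom_finsum_map:
  assumes "\<And>i. i \<in> I \<Longrightarrow> f i \<in> addhom M N" "abelian_group N"
  shows "(\<lambda>v. \<Oplus>\<^bsub>N\<^esub>i\<in>I. f i v) \<in> addhom M N"
proof -
  interpret N: abelian_group N by fact
  have c: "\<And>v. v \<in> carrier M \<Longrightarrow> (\<lambda>i. f i v) \<in> I \<rightarrow> carrier N" using addhom_closed[OF assms(1)] by auto
  show ?thesis
  proof (rule addhomI)
    fix v w assume vw: "v \<in> carrier M" "w \<in> carrier M"
    show "(\<Oplus>\<^bsub>N\<^esub>i\<in>I. f i (v \<oplus>\<^bsub>M\<^esub> w)) = (\<Oplus>\<^bsub>N\<^esub>i\<in>I. f i v) \<oplus>\<^bsub>N\<^esub> (\<Oplus>\<^bsub>N\<^esub>i\<in>I. f i w)"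
      unfolding N.finsum_addf[OF c[OF vw(1)] c[OF vw(2)], symmetric]
      using vw c[OF vw(1)] c[OF vw(2)] by (intro N.finsum_cong') (auto simp: addhom_add[OF assms(1)])
  qed (use c in auto)
qed

lemma addhom_const_zero:
  assumes "abelian_group N" shows "(\<lambda>v. \<zero>\<^bsub>N\<^esub>) \<in> addhom M N"
proof -
  interpret N: abelian_group N by fact
  show ?thesis by (intro addhomI) auto
qed

lemma addhom_if:
  assumes "f \<in> addhom M N" "abelian_group N" shows "(\<lambda>v. if P then f v else \<zero>\<^bsub>N\<^esub>) \<in> addhom M N"
  using assms addhom_const_zero[OF assms(2)] by (cases P) auto

lemma is_linearI:
  assumes "f \<in> addhom M N"
    and "\<And>a v. a \<in> carrier R \<Longrightarrow> v \<in> carrier M \<Longrightarrow> f (a \<odot>\<^bsub>M\<^esub> v) = a \<odot>\<^bsub>N\<^esub> f v"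
  shows "is_linear R M N f"
  using assms by (auto simp: is_linear_def)

lemma is_linear_addhom: "is_linear R M N f \<Longrightarrow> f \<in> addhom M N"
  by (auto simp: is_linear_def)

lemma is_linear_smult:
  "is_linear R M N f \<Longrightarrow> a \<in> carrier R \<Longrightarrow> v \<in> carrier M \<Longrightarrow> f (a \<odot>\<^bsub>M\<^esub> v) = a \<odot>\<^bsub>N\<^esub> f v"
  by (auto simp: is_linear_def)

lemmas is_linear_closed = is_linear_addhom[THEN addhom_closed]

lemma is_linear_mono: "is_linear R M N f \<Longrightarrow> carrier R' \<subseteq> carrier R \<Longrightarrow> is_linear R' M N f"
  by (auto simp: is_linear_def)

lemma is_linear_mpoly_mono: "is_linear (mpoly_ring S) M N f \<Longrightarrow> S' \<subseteq> S \<Longrightarrow> is_linear (mpoly_ring S') M N f"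
  by (erule is_linear_mono) (auto intro: mpoly_mono)

lemma is_linear_comp: "is_linear R M N f \<Longrightarrow> is_linear R N P g \<Longrightarrow> is_linear R M P (\<lambda>v. g (f v))"
  by (auto simp: is_linear_def hom_def Pi_iff)

lemma is_linear_id: "is_linear R M M (\<lambda>v. v)"
  by (auto simp: is_linear_def hom_def)

lemma is_linear_plus:
  assumes "is_linear R M N f" "is_linear R M N g" "module R N"
  shows "is_linear R M N (\<lambda>v. f v \<oplus>\<^bsub>N\<^esub> g v)"
proof -
  interpret N: module R N by fact
  show ?thesis using assms is_linear_closed[OF assms(1)] is_linear_closed[OF assms(2)]
    by (intro is_linearI addhom_plus)
       (auto simp: is_linear_smult[OF assms(1)] is_linear_smult[OF assms(2)] N.smult_r_distr
         intro: is_linear_addhom N.M.abelian_group_axioms)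
qed

lemma is_linear_uminus:
  assumes "is_linear R M N f" "module R N"
  shows "is_linear R M N (\<lambda>v. \<ominus>\<^bsub>N\<^esub> f v)"
proof -
  interpret N: module R N by fact
  show ?thesis using assms is_linear_closed[OF assms(1)]
    by (intro is_linearI addhom_uminus)
       (auto simp: is_linear_smult[OF assms(1)] N.smult_r_minus
         intro: is_linear_addhom N.M.abelian_group_axioms)
qed

lemma is_linear_diff:
  assumes "is_linear R M N f" "is_linear R M N g" "module R N"
  shows "is_linear R M N (\<lambda>v. f v \<ominus>\<^bsub>N\<^esub> g v)"
  unfolding a_minus_def using assms by (intro is_linear_plus is_linear_uminus)

lemma is_linear_zero:
  assumes "module R N" shows "is_linear R M N (\<lambda>v. \<zero>\<^bsub>N\<^esub>)"
proof -
  interpret N: module R N by fact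
  show ?thesis by (auto intro!: is_linearI addhom_const_zero N.M.abelian_group_axioms)
qed

lemma is_linear_smult_map:
  assumes "module R M" "cring R" "a \<in> carrier R" shows "is_linear R M M (\<lambda>v. a \<odot>\<^bsub>M\<^esub> v)"
proof -
  interpret M: module R M by fact
  show ?thesis using assms(3)
    by (auto intro!: is_linearI addhomI simp: M.smult_r_distr M.R.m_comm simp flip: M.smult_assoc1)
qed

section \<open>Sums over the monomials of a polynomial\<close>

definition polysum ::
  "('b, 'c) ring_scheme \<Rightarrow> ((pvar \<Rightarrow>\<^sub>0 nat) \<Rightarrow> 'k \<Rightarrow> 'b) \<Rightarrow> ('k::comm_ring_1) pol \<Rightarrow> 'b" where
  "polysum M G p = (\<Oplus>\<^bsub>M\<^esub>u\<in>Poly_Mapping.keys p. G u (Poly_Mapping.lookup p u))"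

text \<open>Additivity in the coefficient, for each fixed monomial, suffices to make the sum
  additive in the polynomial: it forces \<open>G u 0\<close> to vanish, so two supports can be
  enlarged to a common one even when coefficients cancel.\<close>

definition polysummable ::
  "('b, 'c) ring_scheme \<Rightarrow> pvar set \<Rightarrow> ((pvar \<Rightarrow>\<^sub>0 nat) \<Rightarrow> ('k::comm_ring_1) \<Rightarrow> 'b) \<Rightarrow> bool" where
  "polysummable M V G \<longleftrightarrow> abelian_group M \<and> (\<forall>u c c'. Poly_Mapping.keys u \<subseteq> V \<longrightarrow>
     G u c \<in> carrier M \<and> G u (c + c') = G u c \<oplus>\<^bsub>M\<^esub> G u c')"

lemma polysummableI:
  assumes "abelian_group M" "\<And>u c. Poly_Mapping.keys u \<subseteq> V \<Longrightarrow> G u c \<in> carrier M"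
   "\<And>u c c'. Poly_Mapping.keys u \<subseteq> V \<Longrightarrow> G u (c + c') = G u c \<oplus>\<^bsub>M\<^esub> G u c'"
  shows "polysummable M V G"
  using assms by (auto simp: polysummable_def)

context
  fixes M :: "('b, 'c) ring_scheme" and V and G :: "(pvar \<Rightarrow>\<^sub>0 nat) \<Rightarrow> 'k::comm_ring_1 \<Rightarrow> 'b"
  assumes G: "polysummable M V G"
begin

interpretation M: abelian_group M using G by (simp add: polysummable_def)

lemma polysummable_zero: assumes "Poly_Mapping.keys u \<subseteq> V" shows "G u 0 = \<zero>\<^bsub>M\<^esub>"
proof -
  have "G u 0 \<oplus>\<^bsub>M\<^esub> G u 0 = G u 0" "G u 0 \<in> carrier M"
    using G assms unfolding polysummable_def by (metis add_0, blast)
  then show ?thesis using M.add.r_cancel_one by blast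
qed

lemma polysum_superset:
  assumes "p \<in> carrier (mpoly_ring V)" "finite F" "Poly_Mapping.keys p \<subseteq> F" "\<And>u. u \<in> F \<Longrightarrow> Poly_Mapping.keys u \<subseteq> V"
  shows "polysum M G p = (\<Oplus>\<^bsub>M\<^esub>u\<in>F. G u (Poly_Mapping.lookup p u))"
  unfolding polysum_def using assms G
  by (intro M.add.finprod_mono_neutral_cong_left)
     (auto simp: in_keys_iff polysummable_zero polysummable_def)

lemma polysum_closed [intro]: "p \<in> carrier (mpoly_ring V) \<Longrightarrow> polysum M G p \<in> carrier M"
  unfolding polysum_def using G
  by (intro M.finsum_closed) (auto simp: mem_mpoly_ring polysummable_def)

lemma polysum_add:
  assumes "p \<in> carrier (mpoly_ring V)" "q \<in> carrier (mpoly_ring V)"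
  shows "polysum M G (p + q) = polysum M G p \<oplus>\<^bsub>M\<^esub> polysum M G q"
proof -
  let ?F = "Poly_Mapping.keys p \<union> Poly_Mapping.keys q"
  have "Poly_Mapping.keys (p + q) \<subseteq> ?F" by (rule keys_add)
  moreover have *: "Poly_Mapping.keys u \<subseteq> V" if "u \<in> ?F" for u using assms that by (auto simp: mem_mpoly_ring)
  moreover have "(\<Oplus>\<^bsub>M\<^esub>u\<in>?F. G u (Poly_Mapping.lookup (p + q) u)) =
    (\<Oplus>\<^bsub>M\<^esub>u\<in>?F. G u (Poly_Mapping.lookup p u) \<oplus>\<^bsub>M\<^esub> G u (Poly_Mapping.lookup q u))"
    using * G by (intro M.finsum_cong') (auto simp: polysummable_def lookup_add)
  ultimately show ?thesis
    using assms G
    by (subst (1 2 3) polysum_superset[of _ ?F])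
       (auto simp: polysummable_def intro!: M.finsum_addf)
qed

lemma polysum_single:
  assumes "Poly_Mapping.keys u \<subseteq> V"
  shows "polysum M G (Poly_Mapping.single u c) = G u c"
  using polysum_superset[of "Poly_Mapping.single u c" "{u}"] assms G
  by (auto simp: polysummable_def mpoly_single)

lemma polysum_0: "polysum M G 0 = \<zero>\<^bsub>M\<^esub>"
  by (simp add: polysum_def)

end

lemma polysum_addhom:
  assumes "\<And>u c. Poly_Mapping.keys u \<subseteq> V \<Longrightarrow> (\<lambda>v. G v u c) \<in> addhom M N" "abelian_group N" "p \<in> carrier (mpoly_ring V)"
  shows "(\<lambda>v. polysum N (G v) p) \<in> addhom M N"
  unfolding polysum_def using assms(3)
  by (intro addhom_finsum_map assms(1,2)) (auto simp: mem_mpoly_ring)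

lemma add_idem_zero:
  assumes "abelian_group G" "v \<in> carrier G" "v = v \<oplus>\<^bsub>G\<^esub> v" shows "v = \<zero>\<^bsub>G\<^esub>"
proof -
  interpret abelian_group G by fact
  show ?thesis using add.l_cancel_one'[OF assms(2,2)] assms(3) by simp
qed

lemma balanced_maps:
  assumes "tensor3 A YY S XX" "tensor3 A YY S' XX"
    and f: "is_linear A YY YY f" and g: "is_linear A S S' g" and h: "is_linear A XX XX h"
  shows "balanced A YY S XX (tensor_group A YY S' XX) (\<lambda>y s x. pure_tensor A YY S' XX (f y) (g s) (h x))"
proof -
  interpret T': tensor3 A YY S' XX by fact
  note cl = is_linear_closed[OF f] is_linear_closed[OF g] is_linear_closed[OF h]
  note ad = is_linear_addhom[OF f, THEN addhom_add] is_linear_addhom[OF g, THEN addhom_add] is_linear_addhom[OF h, THEN addhom_add]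
  note sm = is_linear_smult[OF f] is_linear_smult[OF g] is_linear_smult[OF h]
  show ?thesis
    by (rule balancedI) (simp_all add: cl ad sm T'.\<tau>_add1 T'.\<tau>_add2 T'.\<tau>_add3 T'.\<tau>_smult1 T'.\<tau>_smult3)
qed

text \<open>The middle factor \<open>S\<close> is a parameter because every construction is used
  twice, for the Jacobi ring and for the completion.\<close>

locale cut_mod =
  fixes n m l :: nat
    and YY :: "(('k::comm_ring_1) pol, 'y) mf" and XX :: "('k pol, 'x) mf" and S :: "('k pol, 's) module"
  assumes YYm: "module (mpoly_ring (yvars m \<union> zvars l)) YY"
    and XXm: "module (mpoly_ring (xvars n \<union> yvars m)) XX"
    and Sm: "module (mpoly_ring (yvars m)) S"
begin

abbreviation "Ry \<equiv> mpoly_ring (yvars m) :: 'k pol ring"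
abbreviation "Ryz \<equiv> mpoly_ring (yvars m \<union> zvars l) :: 'k pol ring"
abbreviation "Rxy \<equiv> mpoly_ring (xvars n \<union> yvars m) :: 'k pol ring"
abbreviation "Vxyz \<equiv> xvars n \<union> yvars m \<union> zvars l"
abbreviation "R \<equiv> mpoly_ring Vxyz :: 'k pol ring"
abbreviation "M \<equiv> tensor_mf m YY S XX"

lemma Y_mod': "module Ry YY" by (rule module_mpoly_mono[OF YYm]) auto
lemma X_mod': "module Ry XX" by (rule module_mpoly_mono[OF XXm]) auto

sublocale tensor3 Ry YY S XX
  by (intro tensor3.intro Y_mod' Sm X_mod')

sublocale YZ: module Ryz YY by (rule YYm)
sublocale XY: module Rxy XX by (rule XXm)

lemma Ry_Ryz: "p \<in> carrier Ry \<Longrightarrow> p \<in> carrier Ryz" by (erule mpoly_mono[rotated]) auto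
lemma Ry_Rxy: "p \<in> carrier Ry \<Longrightarrow> p \<in> carrier Rxy" by (erule mpoly_mono[rotated]) auto
lemma Ryz_R: "p \<in> carrier Ryz \<Longrightarrow> p \<in> carrier R" by (erule mpoly_mono[rotated]) auto
lemma Rxy_R: "p \<in> carrier Rxy \<Longrightarrow> p \<in> carrier R" by (erule mpoly_mono[rotated]) auto
lemma Ry_R: "p \<in> carrier Ry \<Longrightarrow> p \<in> carrier R" by (erule mpoly_mono[rotated]) auto

lemma M_carrier: "carrier M = carrier T" and M_zero: "\<zero>\<^bsub>M\<^esub> = \<one>\<^bsub>T\<^esub>" and M_add: "(\<oplus>\<^bsub>M\<^esub>) = (\<otimes>\<^bsub>T\<^esub>)"
  by (simp_all add: tensor_mf_def Let_def)

lemma homT: "hom T H = hom (add_monoid M) H" "hom H T = hom H (add_monoid M)"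
  by (simp_all add: hom_def M_carrier M_add)

lemma finprodT: "finprod T g I = finsum M g I"
  by (simp add: finsum_def finprod_def M_carrier M_zero M_add)

lemma M_ab: "abelian_group M"
proof -
  have "comm_group (add_monoid M)"
    by (rule comm_groupI) (simp_all add: M_carrier M_zero M_add T.m_assoc T.l_inv_ex, rule T.m_comm)
  then show ?thesis
    by (simp add: abelian_group_def abelian_monoid_def abelian_group_axioms_def comm_group_def)
qed

sublocale M: abelian_group M by (rule M_ab)

lemma \<tau>M [simp, intro]: "y \<in> carrier YY \<Longrightarrow> s \<in> carrier S \<Longrightarrow> x \<in> carrier XX \<Longrightarrow> \<tau> y s x \<in> carrier M"
  by (simp add: M_carrier)

lemmas \<tau>_addY = \<tau>_add1[folded M_add]
lemmas \<tau>_addS = \<tau>_add2[folded M_add]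
lemmas \<tau>_addX = \<tau>_add3[folded M_add]

lemmas M_induct [consumes 1, case_names zero pure add] = T_induct[folded M_carrier M_zero M_add]

lemma M_addhom_eqI:
  assumes "f \<in> addhom M N" "g \<in> addhom M N" "abelian_group N"
    and "\<And>y s x. y \<in> carrier YY \<Longrightarrow> s \<in> carrier S \<Longrightarrow> x \<in> carrier XX \<Longrightarrow> f (\<tau> y s x) = g (\<tau> y s x)"
    and "v \<in> carrier M"
  shows "f v = g v"
  using hom_eqI[of f "add_monoid N" g v] assms abelian_group.a_group[OF assms(3)] by (simp add: homT M_carrier)

lemma M_lift:
  assumes "abelian_group N" "balanced Ry YY S XX (add_monoid N) \<psi>"
  shows "tensor_lift Ry YY S XX (add_monoid N) \<psi> \<in> addhom M N"
    and "tensor_lift Ry YY S XX (add_monoid N) \<psi> \<in> extensional (carrier M)"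
    and "\<And>y s x. y \<in> carrier YY \<Longrightarrow> s \<in> carrier S \<Longrightarrow> x \<in> carrier XX \<Longrightarrow>
      tensor_lift Ry YY S XX (add_monoid N) \<psi> (\<tau> y s x) = \<psi> y s x"
  using lift[of "add_monoid N" \<psi>] assms abelian_group.a_comm_group[OF assms(1)] by (simp_all add: homT M_carrier)

lemmas M_liftT = lift[OF T_comm_group, unfolded homT, folded M_carrier]

lemma balanced_T:
  assumes "is_linear Ry YY YY f" "is_linear Ry S S g" "is_linear Ry XX XX h"
  shows "balanced Ry YY S XX T (\<lambda>y s x. \<tau> (f y) (g s) (h x))"
  by (rule balanced_maps) (use assms tensor3_axioms in auto)

subsection \<open>The module structure\<close>

definition monop :: "(pvar \<Rightarrow>\<^sub>0 nat) \<Rightarrow> 'k \<Rightarrow> (('y \<times> 's \<times> 'x) \<Rightarrow>\<^sub>0 int) set \<Rightarrow> (('y \<times> 's \<times> 'x) \<Rightarrow>\<^sub>0 int) set" where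
  "monop u c = tensor_lift Ry YY S XX T (\<lambda>y s x. \<tau> (Poly_Mapping.single (mon_restrict (range Zv) u) 1 \<odot>\<^bsub>YY\<^esub> y)
                                 (Poly_Mapping.single (mon_restrict (range Yv) u) 1 \<odot>\<^bsub>S\<^esub> s)
                                 (Poly_Mapping.single (mon_restrict (range Xv) u) c \<odot>\<^bsub>XX\<^esub> x))"

lemma smult_eq: "p \<odot>\<^bsub>M\<^esub> v = polysum M (\<lambda>u c. monop u c v) p"
proof -
  have "p \<odot>\<^bsub>M\<^esub> v = finprod T (\<lambda>u. monop u (Poly_Mapping.lookup p u) v) (Poly_Mapping.keys p)"
    by (simp add: tensor_mf_def Let_def monop_def)
  then show ?thesis by (simp only: finprodT polysum_def)
qed

lemma mon_parts:
  assumes "Poly_Mapping.keys u \<subseteq> Vxyz"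
  shows "Poly_Mapping.single (mon_restrict (range Zv) u) c \<in> carrier Ryz"
    "Poly_Mapping.single (mon_restrict (range Yv) u) c \<in> carrier Ry"
    "Poly_Mapping.single (mon_restrict (range Xv) u) c \<in> carrier Rxy"
  using assms by (auto intro!: mpoly_single)

lemma smult_lin:
  "p \<in> carrier Ryz \<Longrightarrow> is_linear Ry YY YY (\<lambda>y. p \<odot>\<^bsub>YY\<^esub> y)"
  "p \<in> carrier Ry \<Longrightarrow> is_linear Ry S S (\<lambda>s. p \<odot>\<^bsub>S\<^esub> s)"
  "p \<in> carrier Rxy \<Longrightarrow> is_linear Ry XX XX (\<lambda>x. p \<odot>\<^bsub>XX\<^esub> x)"
  using is_linear_mpoly_mono[OF is_linear_smult_map[OF YYm cring_mpoly], of p "yvars m"]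
    is_linear_smult_map[OF Sm cring_mpoly, of p]
    is_linear_mpoly_mono[OF is_linear_smult_map[OF XXm cring_mpoly], of p "yvars m"] by auto

lemma monop:
  assumes "Poly_Mapping.keys u \<subseteq> Vxyz"
  shows "monop u c \<in> addhom M M"
    and "\<And>y s x. y \<in> carrier YY \<Longrightarrow> s \<in> carrier S \<Longrightarrow> x \<in> carrier XX \<Longrightarrow>
      monop u c (\<tau> y s x) = \<tau> (Poly_Mapping.single (mon_restrict (range Zv) u) 1 \<odot>\<^bsub>YY\<^esub> y)
                                 (Poly_Mapping.single (mon_restrict (range Yv) u) 1 \<odot>\<^bsub>S\<^esub> s)
                                 (Poly_Mapping.single (mon_restrict (range Xv) u) c \<odot>\<^bsub>XX\<^esub> x)"
proof -
  have b: "balanced Ry YY S XX T (\<lambda>y s x. \<tau> (Poly_Mapping.single (mon_restrict (range Zv) u) 1 \<odot>\<^bsub>YY\<^esub> y)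
                                 (Poly_Mapping.single (mon_restrict (range Yv) u) 1 \<odot>\<^bsub>S\<^esub> s)
                                 (Poly_Mapping.single (mon_restrict (range Xv) u) c \<odot>\<^bsub>XX\<^esub> x))"
    using mon_parts[OF assms] by (intro balanced_T smult_lin)
  show "monop u c \<in> addhom M M" unfolding monop_def using M_liftT(1)[OF b] by simp
  show "\<And>y s x. y \<in> carrier YY \<Longrightarrow> s \<in> carrier S \<Longrightarrow> x \<in> carrier XX \<Longrightarrow>
      monop u c (\<tau> y s x) = \<tau> (Poly_Mapping.single (mon_restrict (range Zv) u) 1 \<odot>\<^bsub>YY\<^esub> y)
                                 (Poly_Mapping.single (mon_restrict (range Yv) u) 1 \<odot>\<^bsub>S\<^esub> s)
                                 (Poly_Mapping.single (mon_restrict (range Xv) u) c \<odot>\<^bsub>XX\<^esub> x)"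
    unfolding monop_def by (rule M_liftT(3)[OF b])
qed

lemma monop_add:
  assumes "Poly_Mapping.keys u \<subseteq> Vxyz" "v \<in> carrier M"
  shows "monop u (c + c') v = monop u c v \<oplus>\<^bsub>M\<^esub> monop u c' v"
proof (rule M_addhom_eqI[OF _ _ M_ab _ assms(2)])
  show "(\<lambda>v. monop u c v \<oplus>\<^bsub>M\<^esub> monop u c' v) \<in> addhom M M"
    by (intro addhom_plus monop assms M_ab)
  fix y s x assume "y \<in> carrier YY" "s \<in> carrier S" "x \<in> carrier XX"
  with mon_parts[OF assms(1)] show "monop u (c + c') (\<tau> y s x) = monop u c (\<tau> y s x) \<oplus>\<^bsub>M\<^esub> monop u c' (\<tau> y s x)"
    using XY.smult_l_distr[of "Poly_Mapping.single (mon_restrict (range Xv) u) c" "Poly_Mapping.single (mon_restrict (range Xv) u) c'" x]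
    by (simp add: monop(2)[OF assms(1)] single_add \<tau>_addX)
qed (intro monop assms)

lemma summable_monop: "v \<in> carrier M \<Longrightarrow> polysummable M Vxyz (\<lambda>u c. monop u c v)"
  by (intro polysummableI M_ab monop_add) (auto intro: addhom_closed monop(1))

lemma smult_single: "Poly_Mapping.keys u \<subseteq> Vxyz \<Longrightarrow> v \<in> carrier M \<Longrightarrow> Poly_Mapping.single u c \<odot>\<^bsub>M\<^esub> v = monop u c v"
  unfolding smult_eq by (rule polysum_single[OF summable_monop])

lemma smult_addhom: "p \<in> carrier R \<Longrightarrow> (\<lambda>v. p \<odot>\<^bsub>M\<^esub> v) \<in> addhom M M"
  unfolding smult_eq by (rule polysum_addhom[OF _ M_ab]) (auto intro: monop(1))

lemma smult_add: "p \<in> carrier R \<Longrightarrow> q \<in> carrier R \<Longrightarrow> v \<in> carrier M \<Longrightarrow> (p + q) \<odot>\<^bsub>M\<^esub> v = p \<odot>\<^bsub>M\<^esub> v \<oplus>\<^bsub>M\<^esub> q \<odot>\<^bsub>M\<^esub> v"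
  unfolding smult_eq by (rule polysum_add[OF summable_monop])

lemma smult_0: "v \<in> carrier M \<Longrightarrow> 0 \<odot>\<^bsub>M\<^esub> v = \<zero>\<^bsub>M\<^esub>"
  unfolding smult_eq by (rule polysum_0[OF summable_monop])

lemma monop_monop:
  assumes u: "Poly_Mapping.keys u \<subseteq> Vxyz" and u': "Poly_Mapping.keys u' \<subseteq> Vxyz" and "v \<in> carrier M"
  shows "monop (u + u') (c * c') v = monop u c (monop u' c' v)"
proof (rule M_addhom_eqI[OF _ _ M_ab _ assms(3)])
  have uu: "Poly_Mapping.keys (u + u') \<subseteq> Vxyz" using keys_add[of u u'] u u' by blast
  show "monop (u + u') (c * c') \<in> addhom M M" by (intro monop uu)
  show "(\<lambda>v. monop u c (monop u' c' v)) \<in> addhom M M" by (intro addhom_comp[OF monop(1) monop(1)] u u')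
  fix y s x assume yx: "y \<in> carrier YY" "s \<in> carrier S" "x \<in> carrier XX"
  note mu = mon_parts[OF u] and mu' = mon_parts[OF u']
  have *: "Poly_Mapping.single (mon_restrict (range Zv) (u + u')) 1 \<odot>\<^bsub>YY\<^esub> y
      = Poly_Mapping.single (mon_restrict (range Zv) u) 1 \<odot>\<^bsub>YY\<^esub> (Poly_Mapping.single (mon_restrict (range Zv) u') 1 \<odot>\<^bsub>YY\<^esub> y)"
    "Poly_Mapping.single (mon_restrict (range Yv) (u + u')) 1 \<odot>\<^bsub>S\<^esub> s
      = Poly_Mapping.single (mon_restrict (range Yv) u) 1 \<odot>\<^bsub>S\<^esub> (Poly_Mapping.single (mon_restrict (range Yv) u') 1 \<odot>\<^bsub>S\<^esub> s)"
    "Poly_Mapping.single (mon_restrict (range Xv) (u + u')) (c * c') \<odot>\<^bsub>XX\<^esub> x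
      = Poly_Mapping.single (mon_restrict (range Xv) u) c \<odot>\<^bsub>XX\<^esub> (Poly_Mapping.single (mon_restrict (range Xv) u') c' \<odot>\<^bsub>XX\<^esub> x)"
    using YZ.smult_assoc1[OF mu(1) mu'(1) yx(1), of 1 1] S.smult_assoc1[OF mu(2) mu'(2) yx(2), of 1 1]
      XY.smult_assoc1[OF mu(3) mu'(3) yx(3), of c c'] by (simp_all add: mult_single)
  have "monop (u + u') (c * c') (\<tau> y s x) = \<tau> (Poly_Mapping.single (mon_restrict (range Zv) (u + u')) 1 \<odot>\<^bsub>YY\<^esub> y)
     (Poly_Mapping.single (mon_restrict (range Yv) (u + u')) 1 \<odot>\<^bsub>S\<^esub> s)
     (Poly_Mapping.single (mon_restrict (range Xv) (u + u')) (c * c') \<odot>\<^bsub>XX\<^esub> x)"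
    by (rule monop(2)[OF uu yx])
  also have "\<dots> = monop u c (monop u' c' (\<tau> y s x))"
    unfolding * monop(2)[OF u' yx]
    by (rule monop(2)[OF u YZ.smult_closed[OF mu'(1) yx(1)] S.smult_closed[OF mu'(2) yx(2)]
          XY.smult_closed[OF mu'(3) yx(3)], symmetric])
  finally show "monop (u + u') (c * c') (\<tau> y s x) = monop u c (monop u' c' (\<tau> y s x))" .
qed

lemma smult_closed: "p \<in> carrier R \<Longrightarrow> v \<in> carrier M \<Longrightarrow> p \<odot>\<^bsub>M\<^esub> v \<in> carrier M"
  by (rule addhom_closed[OF smult_addhom])

lemma smult_assoc:
  assumes "p \<in> carrier R" "q \<in> carrier R" "v \<in> carrier M"
  shows "(p * q) \<odot>\<^bsub>M\<^esub> v = p \<odot>\<^bsub>M\<^esub> (q \<odot>\<^bsub>M\<^esub> v)"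
  using assms(1)
proof (induction p rule: mpoly_induct)
  case zero
  then show ?case using assms by (simp add: smult_0 smult_closed)
next
  case (add p p')
  then show ?case using assms by (simp add: smult_add smult_closed distrib_right)
next
  case (single u c)
  have c: "Poly_Mapping.single u c \<in> carrier R" using single by auto
  show ?case using assms(2)
  proof (induction q rule: mpoly_induct)
    case zero
    then show ?case using assms addhom_zero[OF smult_addhom[OF c]] M_ab by (simp add: smult_0)
  next
    case (add p p')
    then show ?case using assms c by (simp add: smult_add smult_closed distrib_left addhom_add[OF smult_addhom])
  next
    case (single u' c')
    have uu: "Poly_Mapping.keys (u + u') \<subseteq> Vxyz" using keys_add[of u u'] single \<open>Poly_Mapping.keys u \<subseteq> Vxyz\<close> by blast
    then show ?case using single \<open>Poly_Mapping.keys u \<subseteq> Vxyz\<close> assms(3)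
      by (simp add: mult_single smult_single monop_monop addhom_closed[OF monop(1)])
  qed
qed

lemma smult_1:
  assumes "v \<in> carrier M" shows "1 \<odot>\<^bsub>M\<^esub> v = v"
proof -
  have "monop 0 1 v = v"
  proof (rule M_addhom_eqI[OF _ _ M_ab _ assms])
    have 0: "mon_restrict V 0 = 0" for V by (intro poly_mapping_eqI) simp
    fix y s x assume "y \<in> carrier YY" "s \<in> carrier S" "x \<in> carrier XX"
    then show "monop 0 1 (\<tau> y s x) = \<tau> y s x"
      using YZ.smult_one[of y] XY.smult_one[of x] S.smult_one[of s] by (simp add: monop(2) 0)
  qed (auto intro: monop addhomI)
  then show ?thesis using smult_single[of 0 v 1] assms by simp
qed

lemma M_module: "module R M"
proof (rule moduleI)
  fix p v w assume "p \<in> carrier R" "v \<in> carrier M" "w \<in> carrier M"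
  then show "p \<odot>\<^bsub>M\<^esub> (v \<oplus>\<^bsub>M\<^esub> w) = p \<odot>\<^bsub>M\<^esub> v \<oplus>\<^bsub>M\<^esub> p \<odot>\<^bsub>M\<^esub> w"
    by (rule addhom_add[OF smult_addhom])
qed (simp_all only: mpoly_ring_simps smult_closed smult_add smult_assoc smult_1 M_ab cring_mpoly)

sublocale MR: module R M by (rule M_module)

text \<open>The action was defined by splitting each monomial over the three factors. Without
  x-variables, the y-part and the coefficient can be moved back to the left factor by balancedness,
  which recovers the action given there.\<close>

lemma smult_pure_YZ:
  assumes "p \<in> carrier Ryz" and y: "y \<in> carrier YY" and s: "s \<in> carrier S" and x: "x \<in> carrier XX"
  shows "p \<odot>\<^bsub>M\<^esub> \<tau> y s x = \<tau> (p \<odot>\<^bsub>YY\<^esub> y) s x"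
  using assms(1)
proof (induction p rule: mpoly_induct)
  case zero
  have "\<tau> \<zero>\<^bsub>YY\<^esub> s x = \<zero>\<^bsub>M\<^esub>" using \<tau>_addY[of "\<zero>\<^bsub>YY\<^esub>" "\<zero>\<^bsub>YY\<^esub>" s x] s x
    by (intro add_idem_zero[OF M_ab]) simp_all
  then show ?case using YZ.smult_l_null[of y] assms by (simp add: smult_0)
next
  case (add p q)
  then show ?case using YZ.smult_l_distr[of p q y] assms by (simp add: smult_add Ryz_R \<tau>_addY)
next
  case (single u c)
  let ?z = "Poly_Mapping.single (mon_restrict (range Zv) u) (1::'k)" and ?y = "Poly_Mapping.single (mon_restrict (range Yv) u) (1::'k)"
  have u: "Poly_Mapping.keys u \<subseteq> Vxyz" using single by auto
  note mp = mon_parts[OF u]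
  have "Poly_Mapping.keys u \<inter> range Xv = {}" using single by auto
  then have 0: "mon_restrict (range Xv) u = 0" by (rule mon_restrict_0)
  have ueq: "Poly_Mapping.single u c = cpoly c * ?y * ?z"
    using mon_restrict_xyz[of u] 0 by (simp add: cpoly_def mult_single add.commute)
  have "Poly_Mapping.single u c \<odot>\<^bsub>M\<^esub> \<tau> y s x = \<tau> (?z \<odot>\<^bsub>YY\<^esub> y) (?y \<odot>\<^bsub>S\<^esub> s) (cpoly c \<odot>\<^bsub>XX\<^esub> x)"
    using assms u by (simp add: smult_single monop(2) 0 cpoly_def)
  also have "\<dots> = \<tau> ((cpoly c * ?y) \<odot>\<^bsub>YY\<^esub> (?z \<odot>\<^bsub>YY\<^esub> y)) s x"
    using assms mp by (simp add: \<tau>_smult3 \<tau>_smult1 S.smult_assoc1[simplified])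
  also have "\<dots> = \<tau> (Poly_Mapping.single u c \<odot>\<^bsub>YY\<^esub> y) s x"
    unfolding ueq using assms mp by (simp add: YZ.smult_assoc1[simplified] Ry_Ryz)
  finally show ?case .
qed

lemma smult_pure_S:
  assumes "p \<in> carrier Ry" and y: "y \<in> carrier YY" and s: "s \<in> carrier S" and x: "x \<in> carrier XX"
  shows "p \<odot>\<^bsub>M\<^esub> \<tau> y s x = \<tau> y (p \<odot>\<^bsub>S\<^esub> s) x"
  using assms by (simp add: smult_pure_YZ Ry_Ryz \<tau>_smult1)

lemma smult_pure_XY:
  assumes "p \<in> carrier Rxy" and y: "y \<in> carrier YY" and s: "s \<in> carrier S" and x: "x \<in> carrier XX"
  shows "p \<odot>\<^bsub>M\<^esub> \<tau> y s x = \<tau> y s (p \<odot>\<^bsub>XX\<^esub> x)"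
  using assms(1)
proof (induction p rule: mpoly_induct)
  case zero
  have "\<tau> y s \<zero>\<^bsub>XX\<^esub> = \<zero>\<^bsub>M\<^esub>" using \<tau>_addX[of y s "\<zero>\<^bsub>XX\<^esub>" "\<zero>\<^bsub>XX\<^esub>"] y s
    by (intro add_idem_zero[OF M_ab]) simp_all
  then show ?case using XY.smult_l_null[of x] assms by (simp add: smult_0)
next
  case (add p q)
  then show ?case using XY.smult_l_distr[of p q x] assms by (simp add: smult_add Rxy_R \<tau>_addX)
next
  case (single u c)
  let ?x = "Poly_Mapping.single (mon_restrict (range Xv) u) c" and ?y = "Poly_Mapping.single (mon_restrict (range Yv) u) (1::'k)"
  have u: "Poly_Mapping.keys u \<subseteq> Vxyz" using single by auto
  note mp = mon_parts[OF u]
  have "Poly_Mapping.keys u \<inter> range Zv = {}" using single by auto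
  then have 0: "mon_restrict (range Zv) u = 0" by (rule mon_restrict_0)
  have ueq: "Poly_Mapping.single u c = ?y * ?x"
    using mon_restrict_xyz[of u] 0 by (simp add: mult_single add.commute)
  have "Poly_Mapping.single u c \<odot>\<^bsub>M\<^esub> \<tau> y s x = \<tau> y (?y \<odot>\<^bsub>S\<^esub> s) (?x \<odot>\<^bsub>XX\<^esub> x)"
    using assms u YZ.smult_one[of y] by (simp add: smult_single monop(2) 0)
  also have "\<dots> = \<tau> y s (?y \<odot>\<^bsub>XX\<^esub> (?x \<odot>\<^bsub>XX\<^esub> x))"
    using assms mp by (simp add: \<tau>_smult3)
  also have "\<dots> = \<tau> y s (Poly_Mapping.single u c \<odot>\<^bsub>XX\<^esub> x)"
    unfolding ueq using assms mp by (simp add: XY.smult_assoc1[simplified] Ry_Rxy)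
  finally show ?case .
qed

text \<open>The rings k[y,z] and k[x,y] generate k[x,y,z]. On pure tensors they act through one
  outer factor each, so linearity over the whole ring can be checked on these two kinds of
  scalars.\<close>

lemma R_induct [consumes 1, case_names yz xy mult add]:
  assumes "p \<in> carrier R" "\<And>p. p \<in> carrier Ryz \<Longrightarrow> P p" "\<And>p. p \<in> carrier Rxy \<Longrightarrow> P p"
    and "\<And>p q. p \<in> carrier R \<Longrightarrow> q \<in> carrier R \<Longrightarrow> P p \<Longrightarrow> P q \<Longrightarrow> P (p * q)"
    and "\<And>p q. p \<in> carrier R \<Longrightarrow> q \<in> carrier R \<Longrightarrow> P p \<Longrightarrow> P q \<Longrightarrow> P (p + q)"
  shows "P p"
  using assms(1)
proof (induction p rule: mpoly_induct)
  case (single u c)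
  let ?z = "Poly_Mapping.single (mon_restrict (range Zv) u) (1::'k)" and ?y = "Poly_Mapping.single (mon_restrict (range Yv) u) (1::'k)"
    and ?x = "Poly_Mapping.single (mon_restrict (range Xv) u) c"
  note mp = mon_parts[OF single]
  have ueq: "Poly_Mapping.single u c = ?z * (?y * ?x)"
    using mon_restrict_xyz[of u] by (simp add: mult_single add.assoc)
  show ?case unfolding ueq using mp[of 1] mp[of c]
    by (intro assms(4) assms(2) assms(3)) (auto intro: Ryz_R Rxy_R Ry_Rxy)
qed (use assms in auto)

lemma M_linearI:
  assumes N: "module R N" and f: "f \<in> addhom M N"
    and yz: "\<And>p y s x. p \<in> carrier Ryz \<Longrightarrow> y \<in> carrier YY \<Longrightarrow> s \<in> carrier S \<Longrightarrow> x \<in> carrier XX \<Longrightarrow>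
       f (\<tau> (p \<odot>\<^bsub>YY\<^esub> y) s x) = p \<odot>\<^bsub>N\<^esub> f (\<tau> y s x)"
    and xy: "\<And>p y s x. p \<in> carrier Rxy \<Longrightarrow> y \<in> carrier YY \<Longrightarrow> s \<in> carrier S \<Longrightarrow> x \<in> carrier XX \<Longrightarrow>
       f (\<tau> y s (p \<odot>\<^bsub>XX\<^esub> x)) = p \<odot>\<^bsub>N\<^esub> f (\<tau> y s x)"
  shows "is_linear R M N f"
proof (rule is_linearI[OF f])
  interpret N: module R N by fact
  fix p v assume "p \<in> carrier R" "v \<in> carrier M"
  have sm: "(\<lambda>v. p \<odot>\<^bsub>N\<^esub> f v) \<in> addhom M N" if "p \<in> carrier R" for p
    by (rule addhom_comp[OF f is_linear_addhom[OF is_linear_smult_map]]) (use that N in auto)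
  have sm': "(\<lambda>v. f (p \<odot>\<^bsub>M\<^esub> v)) \<in> addhom M N" if "p \<in> carrier R" for p
    by (rule addhom_comp[OF smult_addhom f]) (use that in auto)
  have "\<forall>v\<in>carrier M. f (p \<odot>\<^bsub>M\<^esub> v) = p \<odot>\<^bsub>N\<^esub> f v"
    using \<open>p \<in> carrier R\<close>
  proof (induction p rule: R_induct)
    case (yz p)
    show ?case
    proof
      fix v assume "v \<in> carrier M"
      then show "f (p \<odot>\<^bsub>M\<^esub> v) = p \<odot>\<^bsub>N\<^esub> f v"
      proof (rule M_addhom_eqI[OF sm'[OF Ryz_R[OF yz]] sm[OF Ryz_R[OF yz]] N.M.abelian_group_axioms, rotated])
        fix y s x assume yx: "y \<in> carrier YY" "s \<in> carrier S" "x \<in> carrier XX"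
        show "f (p \<odot>\<^bsub>M\<^esub> \<tau> y s x) = p \<odot>\<^bsub>N\<^esub> f (\<tau> y s x)"
          unfolding smult_pure_YZ[OF yz yx] by (rule assms(3)[OF yz yx])
      qed
    qed
  next
    case (xy p)
    show ?case
    proof
      fix v assume "v \<in> carrier M"
      then show "f (p \<odot>\<^bsub>M\<^esub> v) = p \<odot>\<^bsub>N\<^esub> f v"
      proof (rule M_addhom_eqI[OF sm'[OF Rxy_R[OF xy]] sm[OF Rxy_R[OF xy]] N.M.abelian_group_axioms, rotated])
        fix y s x assume yx: "y \<in> carrier YY" "s \<in> carrier S" "x \<in> carrier XX"
        show "f (p \<odot>\<^bsub>M\<^esub> \<tau> y s x) = p \<odot>\<^bsub>N\<^esub> f (\<tau> y s x)"
          unfolding smult_pure_XY[OF xy yx] by (rule assms(4)[OF xy yx])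
      qed
    qed
  next
    case (mult p q)
    then show ?case using addhom_closed[OF f]
      by (simp add: smult_assoc N.smult_assoc1[simplified] smult_closed)
  next
    case (add p q)
    then show ?case using addhom_closed[OF f]
      by (simp add: smult_add N.smult_l_distr[simplified] smult_closed addhom_add[OF f])
  qed
  with \<open>v \<in> carrier M\<close> show "f (p \<odot>\<^bsub>M\<^esub> v) = p \<odot>\<^bsub>N\<^esub> f v" by blast
qed

subsection \<open>Operators induced by linear maps of the outer factors\<close>

text \<open>There is no Koszul sign in this map. Operators that are odd on the right factor receive
  theirs by taking the parity involution of the left factor for \<open>f\<close>.\<close>

definition tmap :: "('y \<Rightarrow> 'y) \<Rightarrow> ('x \<Rightarrow> 'x) \<Rightarrow> (('y \<times> 's \<times> 'x) \<Rightarrow>\<^sub>0 int) set \<Rightarrow> (('y \<times> 's \<times> 'x) \<Rightarrow>\<^sub>0 int) set" where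
  "tmap f h = tensor_lift Ry YY S XX T (\<lambda>y s x. \<tau> (f y) s (h x))"

context
  fixes f h
  assumes f: "is_linear Ryz YY YY f" and h: "is_linear Rxy XX XX h"
begin

lemma tmap_balanced: "balanced Ry YY S XX T (\<lambda>y s x. \<tau> (f y) s (h x))"
  by (intro balanced_T is_linear_id is_linear_mpoly_mono[OF f] is_linear_mpoly_mono[OF h]) auto

lemma tmap_pure: "y \<in> carrier YY \<Longrightarrow> s \<in> carrier S \<Longrightarrow> x \<in> carrier XX \<Longrightarrow> tmap f h (\<tau> y s x) = \<tau> (f y) s (h x)"
  unfolding tmap_def by (rule M_liftT(3)[OF tmap_balanced])

lemma tmap_linear: "is_linear R M M (tmap f h)"
proof (rule M_linearI[OF M_module])
  show "tmap f h \<in> addhom M M" unfolding tmap_def using M_liftT(1)[OF tmap_balanced] by simp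
next
  fix p y s x assume "p \<in> carrier Ryz" "y \<in> carrier YY" "s \<in> carrier S" "x \<in> carrier XX"
  then show "tmap f h (\<tau> (p \<odot>\<^bsub>YY\<^esub> y) s x) = p \<odot>\<^bsub>M\<^esub> tmap f h (\<tau> y s x)"
    using is_linear_closed[OF f] is_linear_closed[OF h]
    by (simp add: tmap_pure is_linear_smult[OF f] smult_pure_YZ)
next
  fix p y s x assume "p \<in> carrier Rxy" "y \<in> carrier YY" "s \<in> carrier S" "x \<in> carrier XX"
  then show "tmap f h (\<tau> y s (p \<odot>\<^bsub>XX\<^esub> x)) = p \<odot>\<^bsub>M\<^esub> tmap f h (\<tau> y s x)"
    using is_linear_closed[OF f] is_linear_closed[OF h]
    by (simp add: tmap_pure is_linear_smult[OF h] smult_pure_XY)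
qed

end

end

section \<open>Gradings\<close>

definition psgn :: "('a, 'b, 'p) mf_scheme \<Rightarrow> bit \<Rightarrow> 'b \<Rightarrow> 'b" where
  "psgn M p v = (if p = 0 then v else \<ominus>\<^bsub>M\<^esub> v)"

lemma bit_cases: "(p::bit) = 0 \<or> p = 1"
  by (cases p) auto

lemma psgn_psgn: "abelian_group M \<Longrightarrow> v \<in> carrier M \<Longrightarrow> psgn M p (psgn M q v) = psgn M (p + q) v"
  using bit_cases[of p] bit_cases[of q]
  by (auto simp: psgn_def abelian_group.minus_minus)

lemma addhom_psgn: "f \<in> addhom M M \<Longrightarrow> abelian_group M \<Longrightarrow> v \<in> carrier M \<Longrightarrow> f (psgn M p v) = psgn M p (f v)"
  by (simp add: psgn_def addhom_neg)

lemma psgn_add: "abelian_group M \<Longrightarrow> v \<in> carrier M \<Longrightarrow> w \<in> carrier M \<Longrightarrow> psgn M p (v \<oplus>\<^bsub>M\<^esub> w) = psgn M p v \<oplus>\<^bsub>M\<^esub> psgn M p w"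
  by (simp add: psgn_def abelian_group.minus_add)

lemma is_linear_psgn: "module R M \<Longrightarrow> is_linear R M M (psgn M p)"
  unfolding psgn_def using is_linear_uminus[OF is_linear_id] is_linear_id[of R M] by (cases "p = 0") auto

context
  fixes R :: "('a, 'r) ring_scheme" and M :: "('a, 'b, 'p) mf_scheme"
  assumes gm: "graded_module R M"
begin

lemma gm_module: "module R M"
  using gm by (simp add: graded_module_def)

interpretation M: module R M by (rule gm_module)

lemma gm_sub: "submodule (homog M p) R M"
  using gm by (simp add: graded_module_def)

lemma gm_closed: "v \<in> homog M p \<Longrightarrow> v \<in> carrier M"
  using M.submoduleE(1)[OF gm_sub] by (rule subsetD)

lemma gm_decomp:
  assumes "v \<in> carrier M" obtains a b where "a \<in> homog M 0" "b \<in> homog M 1" "v = a \<oplus>\<^bsub>M\<^esub> b"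
proof -
  have "\<exists>!w. fst w \<in> homog M 0 \<and> snd w \<in> homog M 1 \<and> v = fst w \<oplus>\<^bsub>M\<^esub> snd w"
    using gm assms by (simp add: graded_module_def)
  then show ?thesis using that by (elim ex1E conjE) 
qed

lemma gm_unique:
  assumes "a \<in> homog M 0" "b \<in> homog M 1" "a' \<in> homog M 0" "b' \<in> homog M 1" "a \<oplus>\<^bsub>M\<^esub> b = a' \<oplus>\<^bsub>M\<^esub> b'"
  shows "a = a' \<and> b = b'"
proof -
  have "a \<oplus>\<^bsub>M\<^esub> b \<in> carrier M" using assms gm_closed by simp
  then have "\<exists>!w. fst w \<in> homog M 0 \<and> snd w \<in> homog M 1 \<and> a \<oplus>\<^bsub>M\<^esub> b = fst w \<oplus>\<^bsub>M\<^esub> snd w"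
    using gm by (simp add: graded_module_def)
  then have "(a, b) = (a', b')" using assms by (elim ex1E) (metis fst_conv snd_conv)
  then show ?thesis by simp
qed

lemma parity_inv_eq:
  assumes "a \<in> homog M 0" "b \<in> homog M 1" shows "parity_inv M (a \<oplus>\<^bsub>M\<^esub> b) = a \<ominus>\<^bsub>M\<^esub> b"
  unfolding parity_inv_def
proof (rule the_equality)
  show "\<exists>a'\<in>homog M 0. \<exists>b'\<in>homog M 1. a \<oplus>\<^bsub>M\<^esub> b = a' \<oplus>\<^bsub>M\<^esub> b' \<and> a \<ominus>\<^bsub>M\<^esub> b = a' \<ominus>\<^bsub>M\<^esub> b'"
    using assms by blast
next
  fix w assume "\<exists>a'\<in>homog M 0. \<exists>b'\<in>homog M 1. a \<oplus>\<^bsub>M\<^esub> b = a' \<oplus>\<^bsub>M\<^esub> b' \<and> w = a' \<ominus>\<^bsub>M\<^esub> b'"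
  then obtain a' b' where "a' \<in> homog M 0" "b' \<in> homog M 1" "a \<oplus>\<^bsub>M\<^esub> b = a' \<oplus>\<^bsub>M\<^esub> b'" "w = a' \<ominus>\<^bsub>M\<^esub> b'" by blast
  then show "w = a \<ominus>\<^bsub>M\<^esub> b" using gm_unique[OF assms] by simp
qed

lemma gm_zero: "\<zero>\<^bsub>M\<^esub> \<in> homog M p"
proof -
  interpret S: submodule "homog M p" R M by (rule gm_sub)
  show ?thesis using S.one_closed by simp
qed

lemma parity_inv_homog:
  assumes "v \<in> homog M p" shows "parity_inv M v = psgn M p v"
  using bit_cases[of p]
proof
  assume "p = 0"
  then show ?thesis using parity_inv_eq[of v "\<zero>\<^bsub>M\<^esub>"] assms gm_zero gm_closed[OF assms] by (simp add: psgn_def a_minus_def)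
next
  assume "p = 1"
  then show ?thesis using parity_inv_eq[of "\<zero>\<^bsub>M\<^esub>" v] assms gm_zero gm_closed[OF assms] by (simp add: psgn_def a_minus_def)
qed

lemma parity_inv_linear: "is_linear R M M (parity_inv M)"
proof (intro is_linearI addhomI)
  fix v assume v: "v \<in> carrier M"
  obtain a b where ab: "a \<in> homog M 0" "b \<in> homog M 1" "v = a \<oplus>\<^bsub>M\<^esub> b" using gm_decomp[OF v] .
  then show "parity_inv M v \<in> carrier M" using gm_closed by (simp add: parity_inv_eq)
  {
    fix w assume w: "w \<in> carrier M"
    obtain c d where cd: "c \<in> homog M 0" "d \<in> homog M 1" "w = c \<oplus>\<^bsub>M\<^esub> d" using gm_decomp[OF w] .
    have cl: "a \<in> carrier M" "b \<in> carrier M" "c \<in> carrier M" "d \<in> carrier M" using ab cd gm_closed by simp_all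
    have "v \<oplus>\<^bsub>M\<^esub> w = (a \<oplus>\<^bsub>M\<^esub> c) \<oplus>\<^bsub>M\<^esub> (b \<oplus>\<^bsub>M\<^esub> d)" using cl ab cd by (simp add: M.M.a_ac)
    moreover have "a \<oplus>\<^bsub>M\<^esub> c \<in> homog M 0" "b \<oplus>\<^bsub>M\<^esub> d \<in> homog M 1"
      using M.submoduleE(5)[OF gm_sub] ab cd by simp_all
    ultimately have "parity_inv M (v \<oplus>\<^bsub>M\<^esub> w) = (a \<oplus>\<^bsub>M\<^esub> c) \<ominus>\<^bsub>M\<^esub> (b \<oplus>\<^bsub>M\<^esub> d)"
      by (simp only: parity_inv_eq)
    then show "parity_inv M (v \<oplus>\<^bsub>M\<^esub> w) = parity_inv M v \<oplus>\<^bsub>M\<^esub> parity_inv M w"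
      using ab cd cl by (simp add: parity_inv_eq a_minus_def M.minus_add M.M.a_ac)
  }
  {
    fix r assume r: "r \<in> carrier R"
    have cl: "a \<in> carrier M" "b \<in> carrier M" using ab gm_closed by simp_all
    have "r \<odot>\<^bsub>M\<^esub> v = r \<odot>\<^bsub>M\<^esub> a \<oplus>\<^bsub>M\<^esub> r \<odot>\<^bsub>M\<^esub> b" using cl ab r by (simp add: M.smult_r_distr)
    moreover have "r \<odot>\<^bsub>M\<^esub> a \<in> homog M 0" "r \<odot>\<^bsub>M\<^esub> b \<in> homog M 1"
      using M.submoduleE(4)[OF gm_sub] ab r by simp_all
    ultimately show "parity_inv M (r \<odot>\<^bsub>M\<^esub> v) = r \<odot>\<^bsub>M\<^esub> parity_inv M v"
      using ab cl r by (simp add: parity_inv_eq a_minus_def M.smult_r_distr M.smult_r_minus)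
  }
qed

lemma parity_inv_closed: "v \<in> carrier M \<Longrightarrow> parity_inv M v \<in> carrier M"
  by (rule is_linear_closed[OF parity_inv_linear])

lemma parity_inv_add: "v \<in> carrier M \<Longrightarrow> w \<in> carrier M \<Longrightarrow> parity_inv M (v \<oplus>\<^bsub>M\<^esub> w) = parity_inv M v \<oplus>\<^bsub>M\<^esub> parity_inv M w"
  by (rule addhom_add[OF is_linear_addhom[OF parity_inv_linear]])

lemma gm_induct [consumes 1, case_names homog add]:
  assumes "v \<in> carrier M" "\<And>p v. v \<in> homog M p \<Longrightarrow> P v"
    "\<And>v w. v \<in> carrier M \<Longrightarrow> w \<in> carrier M \<Longrightarrow> P v \<Longrightarrow> P w \<Longrightarrow> P (v \<oplus>\<^bsub>M\<^esub> w)"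
  shows "P v"
proof -
  obtain a b where "a \<in> homog M 0" "b \<in> homog M 1" "v = a \<oplus>\<^bsub>M\<^esub> b" using gm_decomp[OF assms(1)] .
  then show ?thesis using assms(2,3) gm_closed by simp
qed

text \<open>Parity expressed as a commutation rule. Unlike \<open>has_parity\<close> this is an
  identity between additive maps, so on a tensor product such a rule can be checked on pure
  tensors.\<close>

lemma parity_inv_parity:
  assumes f: "f \<in> addhom M M" and p: "has_parity M p f" and v: "v \<in> carrier M"
  shows "parity_inv M (f v) = psgn M p (f (parity_inv M v))"
  using v
proof (induction v rule: gm_induct)
  case (homog q v)
  then have "f v \<in> homog M (p + q)" using p unfolding has_parity_def by blast
  then show ?case using homog gm_closed[OF homog] addhom_closed[OF f]
    by (simp add: parity_inv_homog addhom_psgn[OF f] psgn_psgn M.M.abelian_group_axioms)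
next
  case (add v w)
  then show ?case
    by (simp add: addhom_add[OF f] parity_inv_add parity_inv_closed addhom_closed[OF f] psgn_add M.M.abelian_group_axioms)
qed

lemma parity_inv_parity_inv: "v \<in> carrier M \<Longrightarrow> parity_inv M (parity_inv M v) = v"
proof (induction v rule: gm_induct)
  case (homog q v)
  have "q + q = 0" using bit_cases[of q] by auto
  then show ?case using homog gm_closed[OF homog]
    by (simp add: parity_inv_homog addhom_psgn[OF is_linear_addhom[OF parity_inv_linear]] psgn_psgn M.M.abelian_group_axioms)
       (simp add: psgn_def)
next
  case (add v w)
  then show ?case by (simp add: parity_inv_add parity_inv_closed)
qed

end

section \<open>Coordinates\<close>

context
  fixes V :: "pvar set" and M :: "(('k::comm_ring_1) pol, 'b, 'p) module_scheme" and B :: "'i set" and e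
  assumes md: "module (mpoly_ring V) M" and fb: "finite_basis (mpoly_ring V) M B e"
begin

interpretation M: module "mpoly_ring V" M by (rule md)

lemma fb_finite: "finite B" using fb by (simp add: finite_basis_def)
lemma fb_closed: "b \<in> B \<Longrightarrow> e b \<in> carrier M" using fb by (auto simp: finite_basis_def)

lemma coords_ex1:
  assumes "v \<in> carrier M"
  shows "\<exists>!c. c \<in> B \<rightarrow>\<^sub>E carrier (mpoly_ring V) \<and> v = (\<Oplus>\<^bsub>M\<^esub>b\<in>B. c b \<odot>\<^bsub>M\<^esub> e b)"
  using fb assms by (simp add: finite_basis_def)

lemma coords_closed: "v \<in> carrier M \<Longrightarrow> b \<in> B \<Longrightarrow> coords (mpoly_ring V) M B e v b \<in> carrier (mpoly_ring V)"
  using theI'[OF coords_ex1, of v] unfolding coords_def[symmetric] by auto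

lemma coords_expand: "v \<in> carrier M \<Longrightarrow> v = (\<Oplus>\<^bsub>M\<^esub>b\<in>B. coords (mpoly_ring V) M B e v b \<odot>\<^bsub>M\<^esub> e b)"
  using theI'[OF coords_ex1, of v] unfolding coords_def[symmetric] by auto

lemma coords_unique:
  assumes c: "\<And>b. b \<in> B \<Longrightarrow> c b \<in> carrier (mpoly_ring V)" and v: "v = (\<Oplus>\<^bsub>M\<^esub>b\<in>B. c b \<odot>\<^bsub>M\<^esub> e b)" and b: "b \<in> B"
  shows "coords (mpoly_ring V) M B e v b = c b"
proof -
  have cl: "(\<lambda>b. c b \<odot>\<^bsub>M\<^esub> e b) \<in> B \<rightarrow> carrier M" using c fb_closed by auto
  have vM: "v \<in> carrier M" unfolding v by (rule M.finsum_closed[OF cl])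
  have "v = (\<Oplus>\<^bsub>M\<^esub>b\<in>B. restrict c B b \<odot>\<^bsub>M\<^esub> e b)"
    unfolding v by (rule M.finsum_cong') (use cl in auto)
  then have "coords (mpoly_ring V) M B e v = restrict c B"
    unfolding coords_def using c by (intro the1_equality[OF coords_ex1[OF vM]]) auto
  then show ?thesis using b by simp
qed

lemma coords_add:
  assumes "v \<in> carrier M" "w \<in> carrier M" "b \<in> B"
  shows "coords (mpoly_ring V) M B e (v \<oplus>\<^bsub>M\<^esub> w) b = coords (mpoly_ring V) M B e v b + coords (mpoly_ring V) M B e w b"
proof (rule coords_unique[OF _ _ assms(3)])
  have cl: "\<And>v. v \<in> carrier M \<Longrightarrow> (\<lambda>b. coords (mpoly_ring V) M B e v b \<odot>\<^bsub>M\<^esub> e b) \<in> B \<rightarrow> carrier M"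
    using coords_closed fb_closed by auto
  have "v \<oplus>\<^bsub>M\<^esub> w = (\<Oplus>\<^bsub>M\<^esub>b\<in>B. coords (mpoly_ring V) M B e v b \<odot>\<^bsub>M\<^esub> e b) \<oplus>\<^bsub>M\<^esub> (\<Oplus>\<^bsub>M\<^esub>b\<in>B. coords (mpoly_ring V) M B e w b \<odot>\<^bsub>M\<^esub> e b)"
    using coords_expand[OF assms(1)] coords_expand[OF assms(2)] by simp
  also have "\<dots> = (\<Oplus>\<^bsub>M\<^esub>b\<in>B. coords (mpoly_ring V) M B e v b \<odot>\<^bsub>M\<^esub> e b \<oplus>\<^bsub>M\<^esub> coords (mpoly_ring V) M B e w b \<odot>\<^bsub>M\<^esub> e b)"
    by (rule M.finsum_addf[OF cl[OF assms(1)] cl[OF assms(2)], symmetric])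
  also have "\<dots> = (\<Oplus>\<^bsub>M\<^esub>b\<in>B. (coords (mpoly_ring V) M B e v b + coords (mpoly_ring V) M B e w b) \<odot>\<^bsub>M\<^esub> e b)"
    using assms M.smult_l_distr[OF coords_closed coords_closed fb_closed]
    by (intro M.finsum_cong') (auto simp: coords_closed fb_closed)
  finally show "v \<oplus>\<^bsub>M\<^esub> w = \<dots>" .
qed (use assms coords_closed in auto)

lemma coords_smult:
  assumes "r \<in> carrier (mpoly_ring V)" "v \<in> carrier M" "b \<in> B"
  shows "coords (mpoly_ring V) M B e (r \<odot>\<^bsub>M\<^esub> v) b = r * coords (mpoly_ring V) M B e v b"
proof (rule coords_unique[OF _ _ assms(3)])
  have cl: "(\<lambda>b. coords (mpoly_ring V) M B e v b \<odot>\<^bsub>M\<^esub> e b) \<in> B \<rightarrow> carrier M"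
    using coords_closed[OF assms(2)] fb_closed by auto
  have "r \<odot>\<^bsub>M\<^esub> v = r \<odot>\<^bsub>M\<^esub> (\<Oplus>\<^bsub>M\<^esub>b\<in>B. coords (mpoly_ring V) M B e v b \<odot>\<^bsub>M\<^esub> e b)"
    using coords_expand[OF assms(2)] by simp
  also have "\<dots> = (\<Oplus>\<^bsub>M\<^esub>b\<in>B. r \<odot>\<^bsub>M\<^esub> (coords (mpoly_ring V) M B e v b \<odot>\<^bsub>M\<^esub> e b))"
    by (rule M.finsum_smult_ldistr[OF fb_finite assms(1) cl])
  also have "\<dots> = (\<Oplus>\<^bsub>M\<^esub>b\<in>B. (r * coords (mpoly_ring V) M B e v b) \<odot>\<^bsub>M\<^esub> e b)"
    using assms M.smult_assoc1[OF assms(1) coords_closed fb_closed]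
    by (intro M.finsum_cong') (auto simp: coords_closed fb_closed)
  finally show "r \<odot>\<^bsub>M\<^esub> v = \<dots>" .
qed (use assms coords_closed in auto)

lemma finsum_delta:
  assumes "v \<in> carrier M" "b \<in> C" "finite C"
  shows "(\<Oplus>\<^bsub>M\<^esub>b'\<in>C. if b' = b then v else \<zero>\<^bsub>M\<^esub>) = v"
  using M.finsum_singleton[of b C "\<lambda>_. v"] assms by (simp add: eq_commute[of _ b])

lemma coords_basis:
  assumes "b \<in> B" "b' \<in> B"
  shows "coords (mpoly_ring V) M B e (e b) b' = (if b' = b then 1 else 0)"
proof (rule coords_unique[OF _ _ assms(2)])
  have "(\<Oplus>\<^bsub>M\<^esub>b'\<in>B. (if b' = b then 1 else 0) \<odot>\<^bsub>M\<^esub> e b') = (\<Oplus>\<^bsub>M\<^esub>b'\<in>B. if b' = b then e b else \<zero>\<^bsub>M\<^esub>)"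
    using M.smult_one M.smult_l_null assms fb_closed by (intro M.finsum_cong') auto
  also have "\<dots> = e b" by (rule finsum_delta[OF fb_closed[OF assms(1)] assms(1) fb_finite])
  finally show "e b = (\<Oplus>\<^bsub>M\<^esub>b'\<in>B. (if b' = b then 1 else 0) \<odot>\<^bsub>M\<^esub> e b')" by simp
qed auto

lemma basis_addhom_eqI:
  assumes "f \<in> addhom M N" "g \<in> addhom M N" "abelian_group N"
   and "\<And>r b. r \<in> carrier (mpoly_ring V) \<Longrightarrow> b \<in> B \<Longrightarrow> f (r \<odot>\<^bsub>M\<^esub> e b) = g (r \<odot>\<^bsub>M\<^esub> e b)" "v \<in> carrier M"
  shows "f v = g v"
proof -
  interpret N: abelian_group N by fact
  have cl: "(\<lambda>b. coords (mpoly_ring V) M B e v b \<odot>\<^bsub>M\<^esub> e b) \<in> B \<rightarrow> carrier M"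
    using coords_closed[OF assms(5)] fb_closed by auto
  have "f v = (\<Oplus>\<^bsub>N\<^esub>b\<in>B. f (coords (mpoly_ring V) M B e v b \<odot>\<^bsub>M\<^esub> e b))"
    by (subst coords_expand[OF assms(5)], subst addhom_finsum[OF assms(1) M.M.abelian_group_axioms assms(3) cl]) simp
  also have "\<dots> = (\<Oplus>\<^bsub>N\<^esub>b\<in>B. g (coords (mpoly_ring V) M B e v b \<odot>\<^bsub>M\<^esub> e b))"
    using coords_closed[OF assms(5)] assms(4) addhom_closed[OF assms(2) funcset_mem[OF cl]]
    by (intro N.finsum_cong') auto
  also have "\<dots> = g v"
    by (subst (2) coords_expand[OF assms(5)], subst addhom_finsum[OF assms(2) M.M.abelian_group_axioms assms(3) cl]) simp
  finally show ?thesis .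
qed

end

context tensor3
begin

text \<open>Identifies a \<open>tensor_lift\<close> with a homomorphism already at hand, so that
  balancedness of the prescribed values need not be checked separately.\<close>

lemma lift_of_hom:
  assumes "h \<in> hom T H" "group H"
    "\<And>y s x. y \<in> carrier YY \<Longrightarrow> s \<in> carrier S \<Longrightarrow> x \<in> carrier XX \<Longrightarrow> \<psi> y s x = h (\<tau> y s x)"
  shows "tensor_lift A YY S XX H \<psi> = restrict h (carrier T)"
  unfolding tensor_lift_def
proof (rule the_equality)
  show "restrict h (carrier T) \<in> extensional (carrier T) \<and> restrict h (carrier T) \<in> hom T H \<and>
    (\<forall>y\<in>carrier YY. \<forall>s\<in>carrier S. \<forall>x\<in>carrier XX. restrict h (carrier T) (\<tau> y s x) = \<psi> y s x)"
    using assms by (auto simp: hom_def Pi_iff)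
next
  fix g assume g: "g \<in> extensional (carrier T) \<and> g \<in> hom T H \<and>
    (\<forall>y\<in>carrier YY. \<forall>s\<in>carrier S. \<forall>x\<in>carrier XX. g (\<tau> y s x) = \<psi> y s x)"
  show "g = restrict h (carrier T)"
  proof (rule extensionalityI[where A = "carrier T"])
    fix v assume "v \<in> carrier T"
    then show "g v = restrict h (carrier T) v"
      using hom_eqI[of g H h v] g assms by auto
  qed (use g in auto)
qed

end

section \<open>The grading and the differential of the tensor product\<close>

locale cut = cut_mod n m l YY XX S
  for n m l and YY :: "(('k::comm_ring_1) pol, 'y) mf" and XX :: "('k pol, 'x) mf" and S :: "('k pol, 's) module" +
  fixes U V W :: "'k pol" and hf :: 'k
  assumes gY: "graded_module (mpoly_ring (yvars m \<union> zvars l)) YY"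
    and gX: "graded_module (mpoly_ring (xvars n \<union> yvars m)) XX"
    and hf: "hf + hf = 1"
    and U: "U \<in> carrier (mpoly_ring (zvars l))" and V: "V \<in> carrier (mpoly_ring (yvars m))"
    and W: "W \<in> carrier (mpoly_ring (xvars n))"
    and dY: "is_linear (mpoly_ring (yvars m \<union> zvars l)) YY YY (dmap YY)" and dYp: "has_parity YY 1 (dmap YY)"
    and dX: "is_linear (mpoly_ring (xvars n \<union> yvars m)) XX XX (dmap XX)" and dXp: "has_parity XX 1 (dmap XX)"
    and dYdY: "\<And>y. y \<in> carrier YY \<Longrightarrow> dmap YY (dmap YY y) = (U - V) \<odot>\<^bsub>YY\<^esub> y"
    and dXdX: "\<And>x. x \<in> carrier XX \<Longrightarrow> dmap XX (dmap XX x) = (V - W) \<odot>\<^bsub>XX\<^esub> x"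
begin

abbreviation "PY \<equiv> parity_inv YY"
abbreviation "PX \<equiv> parity_inv XX"
abbreviation "eps \<equiv> tmap PY PX"
abbreviation "d \<equiv> dmap M"

lemmas PYl = parity_inv_linear[OF gY] and PXl = parity_inv_linear[OF gX]
lemmas PYc = parity_inv_closed[OF gY] and PXc = parity_inv_closed[OF gX]
lemmas PYPY = parity_inv_parity_inv[OF gY]
lemmas dYc = is_linear_closed[OF dY] and dXc = is_linear_closed[OF dX]

lemma PYdY: "y \<in> carrier YY \<Longrightarrow> PY (dmap YY y) = \<ominus>\<^bsub>YY\<^esub> dmap YY (PY y)"
  using parity_inv_parity[OF gY is_linear_addhom[OF dY] dYp] by (simp add: psgn_def)
lemma PXdX: "x \<in> carrier XX \<Longrightarrow> PX (dmap XX x) = \<ominus>\<^bsub>XX\<^esub> dmap XX (PX x)"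
  using parity_inv_parity[OF gX is_linear_addhom[OF dX] dXp] by (simp add: psgn_def)

lemma \<tau>_homY: "s \<in> carrier S \<Longrightarrow> x \<in> carrier XX \<Longrightarrow> (\<lambda>y. \<tau> y s x) \<in> addhom YY M"
  by (rule addhomI) (simp_all add: \<tau>_addY)
lemma \<tau>_homS: "y \<in> carrier YY \<Longrightarrow> x \<in> carrier XX \<Longrightarrow> (\<lambda>s. \<tau> y s x) \<in> addhom S M"
  by (rule addhomI) (simp_all add: \<tau>_addS)
lemma \<tau>_homX: "y \<in> carrier YY \<Longrightarrow> s \<in> carrier S \<Longrightarrow> (\<lambda>x. \<tau> y s x) \<in> addhom XX M"
  by (rule addhomI) (simp_all add: \<tau>_addX)

lemma Y_ab: "abelian_group YY" and S_ab: "abelian_group S" and X_ab: "abelian_group XX"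
  by (rule Y.abelian_group_axioms S.abelian_group_axioms X.abelian_group_axioms)+

lemma \<tau>_negY: "y \<in> carrier YY \<Longrightarrow> s \<in> carrier S \<Longrightarrow> x \<in> carrier XX \<Longrightarrow> \<tau> (\<ominus>\<^bsub>YY\<^esub> y) s x = \<ominus>\<^bsub>M\<^esub> \<tau> y s x"
  by (rule addhom_neg[OF \<tau>_homY Y_ab M_ab])
lemma \<tau>_negX: "y \<in> carrier YY \<Longrightarrow> s \<in> carrier S \<Longrightarrow> x \<in> carrier XX \<Longrightarrow> \<tau> y s (\<ominus>\<^bsub>XX\<^esub> x) = \<ominus>\<^bsub>M\<^esub> \<tau> y s x"
  by (rule addhom_neg[OF \<tau>_homX X_ab M_ab])
lemma \<tau>_zeroS: "y \<in> carrier YY \<Longrightarrow> x \<in> carrier XX \<Longrightarrow> \<tau> y \<zero>\<^bsub>S\<^esub> x = \<zero>\<^bsub>M\<^esub>"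
  by (rule addhom_zero[OF \<tau>_homS S_ab M_ab])

lemma \<tau>_psgn:
  assumes "y \<in> carrier YY" "s \<in> carrier S" "x \<in> carrier XX"
  shows "\<tau> (psgn YY p y) s (psgn XX q x) = psgn M (p + q) (\<tau> y s x)"
  using bit_cases[of p] bit_cases[of q] assms
  by (elim disjE) (simp_all add: psgn_def \<tau>_negY \<tau>_negX M.minus_minus)

lemma eps_linear: "is_linear R M M eps" by (rule tmap_linear[OF PYl PXl])
lemmas eps_hom = is_linear_addhom[OF eps_linear] and eps_closed = is_linear_closed[OF eps_linear]

lemma eps_pure: "y \<in> carrier YY \<Longrightarrow> s \<in> carrier S \<Longrightarrow> x \<in> carrier XX \<Longrightarrow> eps (\<tau> y s x) = \<tau> (PY y) s (PX x)"
  by (rule tmap_pure[OF PYl PXl])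

lemma invT: "inv\<^bsub>T\<^esub> v = \<ominus>\<^bsub>M\<^esub> v"
  by (simp add: a_inv_def m_inv_def M_carrier M_zero M_add)

lemma M_neg_zero: "\<ominus>\<^bsub>M\<^esub> \<zero>\<^bsub>M\<^esub> = \<zero>\<^bsub>M\<^esub>"
  by (rule M.minus_equality) auto

lemma homog_M: "homog M p = generate T {\<tau> y s x | y s x q r.
             y \<in> homog YY q \<and> s \<in> carrier S \<and> x \<in> homog XX r \<and> q + r = p}"
  by (simp add: tensor_mf_def Let_def)

lemma homog_zero: "\<zero>\<^bsub>M\<^esub> \<in> homog M p"
  unfolding homog_M M_zero by (rule generate.one)

lemma homog_add: "v \<in> homog M p \<Longrightarrow> w \<in> homog M p \<Longrightarrow> v \<oplus>\<^bsub>M\<^esub> w \<in> homog M p"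
  unfolding homog_M M_add by (rule generate.eng)

lemma homog_pure: "y \<in> homog YY q \<Longrightarrow> s \<in> carrier S \<Longrightarrow> x \<in> homog XX r \<Longrightarrow> \<tau> y s x \<in> homog M (q + r)"
  unfolding homog_M by (rule generate.incl) blast

text \<open>It is enough to look at the generators, pure tensors of homogeneous elements, on which
  the signs of the two outer factors multiply.\<close>

lemma homog_eps:
  assumes "v \<in> homog M p" shows "v \<in> carrier M \<and> eps v = psgn M p v"
  using assms unfolding homog_M
proof (induction v rule: generate.induct)
  case one
  show ?case unfolding M_zero[symmetric]
    by (simp add: addhom_zero[OF eps_hom M_ab M_ab] psgn_def M_neg_zero)
next
  case (incl h)
  then obtain y s x q r where h: "h = \<tau> y s x" "y \<in> homog YY q" "s \<in> carrier S" "x \<in> homog XX r" "q + r = p" by blast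
  then have "y \<in> carrier YY" "x \<in> carrier XX" using gm_closed[OF gY] gm_closed[OF gX] by simp_all
  then show ?case using h by (simp add: eps_pure parity_inv_homog[OF gY] parity_inv_homog[OF gX] \<tau>_psgn)
next
  case (inv h)
  then obtain y s x q r where h: "h = \<tau> y s x" "y \<in> homog YY q" "s \<in> carrier S" "x \<in> homog XX r" "q + r = p" by blast
  then have c: "y \<in> carrier YY" "x \<in> carrier XX" using gm_closed[OF gY] gm_closed[OF gX] by simp_all
  have "eps h = psgn M p h"
    using h c by (simp add: eps_pure parity_inv_homog[OF gY] parity_inv_homog[OF gX] \<tau>_psgn)
  moreover have "h \<in> carrier M" using h c by simp
  ultimately show ?case unfolding invT by (simp add: addhom_neg[OF eps_hom M_ab M_ab] psgn_def)
next
  case (eng v w)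
  then show ?case unfolding M_add[symmetric] by (simp add: addhom_add[OF eps_hom] psgn_add M_ab)
qed

text \<open>The form in which division by 2 enters the grading: an element equal to its own negative
  is zero, so the two eigenspaces of \<open>eps\<close> meet trivially.\<close>

lemma half_zero:
  assumes "v \<in> carrier M" "v \<oplus>\<^bsub>M\<^esub> v = \<zero>\<^bsub>M\<^esub>" shows "v = \<zero>\<^bsub>M\<^esub>"
proof -
  have "v = (cpoly hf + cpoly hf) \<odot>\<^bsub>M\<^esub> v" using hf assms smult_1 by (simp add: cpoly_simps(2) flip: cpoly_simps(3))
  also have "\<dots> = cpoly hf \<odot>\<^bsub>M\<^esub> (v \<oplus>\<^bsub>M\<^esub> v)"
    unfolding smult_add[OF cpoly_mem cpoly_mem assms(1)] addhom_add[OF smult_addhom[OF cpoly_mem] assms(1,1)] ..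
  also have "\<dots> = \<zero>\<^bsub>M\<^esub>" unfolding assms(2) by (rule addhom_zero[OF smult_addhom M_ab M_ab]) simp
  finally show ?thesis .
qed

text \<open>For a pure tensor, the four products of homogeneous components are sorted by total
  parity.\<close>

lemma M_decomp: "v \<in> carrier M \<Longrightarrow> \<exists>a\<in>homog M 0. \<exists>b\<in>homog M 1. v = a \<oplus>\<^bsub>M\<^esub> b"
proof (induction v rule: M_induct)
  case zero
  show ?case by (intro bexI[OF _ homog_zero]) simp
next
  case (pure y s x)
  obtain y0 y1 where y: "y0 \<in> homog YY 0" "y1 \<in> homog YY 1" "y = y0 \<oplus>\<^bsub>YY\<^esub> y1" using gm_decomp[OF gY pure(1)] .
  obtain x0 x1 where x: "x0 \<in> homog XX 0" "x1 \<in> homog XX 1" "x = x0 \<oplus>\<^bsub>XX\<^esub> x1" using gm_decomp[OF gX pure(3)] .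
  note c = y(1,2)[THEN gm_closed[OF gY]] x(1,2)[THEN gm_closed[OF gX]]
  have 0: "\<tau> y0 s x0 \<oplus>\<^bsub>M\<^esub> \<tau> y1 s x1 \<in> homog M 0"
    using homog_pure[OF y(1) pure(2) x(1)] homog_pure[OF y(2) pure(2) x(2)] by (intro homog_add) simp_all
  have 1: "\<tau> y0 s x1 \<oplus>\<^bsub>M\<^esub> \<tau> y1 s x0 \<in> homog M 1"
    using homog_pure[OF y(1) pure(2) x(2)] homog_pure[OF y(2) pure(2) x(1)] by (intro homog_add) simp_all
  have "\<tau> y s x = (\<tau> y0 s x0 \<oplus>\<^bsub>M\<^esub> \<tau> y1 s x1) \<oplus>\<^bsub>M\<^esub> (\<tau> y0 s x1 \<oplus>\<^bsub>M\<^esub> \<tau> y1 s x0)"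
    unfolding y(3) x(3) using c pure by (simp add: \<tau>_addY \<tau>_addX M.a_ac)
  then show ?case using 0 1 by blast
next
  case (add v w)
  obtain a b where v: "a \<in> homog M 0" "b \<in> homog M 1" "v = a \<oplus>\<^bsub>M\<^esub> b" using add by blast
  obtain a' b' where w: "a' \<in> homog M 0" "b' \<in> homog M 1" "w = a' \<oplus>\<^bsub>M\<^esub> b'" using add by blast
  have "v \<oplus>\<^bsub>M\<^esub> w = (a \<oplus>\<^bsub>M\<^esub> a') \<oplus>\<^bsub>M\<^esub> (b \<oplus>\<^bsub>M\<^esub> b')"
    unfolding v(3) w(3) using v(1,2) w(1,2) homog_eps by (simp add: M.a_ac)
  then show ?case using homog_add[OF v(1) w(1)] homog_add[OF v(2) w(2)] by blast
qed

text \<open>The homogeneous parts are defined by generators, where membership is hard to decide. As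
  eigenspaces of the parity involution they are given by an equation.\<close>

lemma homog_iff: "v \<in> homog M p \<longleftrightarrow> v \<in> carrier M \<and> eps v = psgn M p v"
proof
  assume v: "v \<in> carrier M \<and> eps v = psgn M p v"
  obtain a b where ab: "a \<in> homog M 0" "b \<in> homog M 1" "v = a \<oplus>\<^bsub>M\<^esub> b" using M_decomp v by blast
  have a: "a \<in> carrier M" "eps a = a" and b: "b \<in> carrier M" "eps b = \<ominus>\<^bsub>M\<^esub> b"
    using homog_eps[OF ab(1)] homog_eps[OF ab(2)] by (simp_all add: psgn_def)
  \<comment> \<open>With v = a + b split by parity, \<open>eps v\<close> is a - b. Comparing it with
    the sign times a + b shows that the component of the wrong parity is its own negative.\<close>
  have eq: "a \<oplus>\<^bsub>M\<^esub> \<ominus>\<^bsub>M\<^esub> b = psgn M p (a \<oplus>\<^bsub>M\<^esub> b)" using v a b ab(3) by (simp add: addhom_add[OF eps_hom])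
  show "v \<in> homog M p" using bit_cases[of p]
  proof
    assume "p = 0"
    then have "b = \<ominus>\<^bsub>M\<^esub> b" using eq a b by (simp add: psgn_def)
    then have "b \<oplus>\<^bsub>M\<^esub> b = \<zero>\<^bsub>M\<^esub>" using b(1) M.r_neg by metis
    then have "b = \<zero>\<^bsub>M\<^esub>" by (rule half_zero[OF b(1)])
    then show ?thesis using ab a \<open>p = 0\<close> by simp
  next
    assume "p = 1"
    then have "a = \<ominus>\<^bsub>M\<^esub> a" using eq a b by (simp add: psgn_def M.minus_add)
    then have "a \<oplus>\<^bsub>M\<^esub> a = \<zero>\<^bsub>M\<^esub>" using a(1) M.r_neg by metis
    then have "a = \<zero>\<^bsub>M\<^esub>" by (rule half_zero[OF a(1)])
    then show ?thesis using ab b \<open>p = 1\<close> by simp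
  qed
qed (rule homog_eps)

lemma has_parityI:
  assumes f: "f \<in> addhom M M" and "\<And>v. v \<in> carrier M \<Longrightarrow> eps (f v) = psgn M p (f (eps v))"
  shows "has_parity M p f"
  unfolding has_parity_def
proof (intro allI image_subsetI)
  fix q v assume "v \<in> homog M q"
  then have v: "v \<in> carrier M" "eps v = psgn M q v" by (simp_all add: homog_iff)
  then show "f v \<in> homog M (p + q)" using assms(2)[OF v(1)] addhom_closed[OF f v(1)]
    by (simp add: homog_iff addhom_psgn[OF f M_ab] psgn_psgn[OF M_ab])
qed

lemma M_graded:
  assumes "Z \<subseteq> Vxyz" shows "graded_module (mpoly_ring Z) M"
proof -
  interpret Z: module "mpoly_ring Z" M by (rule module_mpoly_mono[OF M_module assms])
  have sub: "submodule (homog M p) (mpoly_ring Z) M" for p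
  proof (rule Z.submoduleI)
    show "homog M p \<subseteq> carrier M" using homog_iff by blast
    show "\<zero>\<^bsub>M\<^esub> \<in> homog M p" by (rule homog_zero)
    show "a \<oplus>\<^bsub>M\<^esub> b \<in> homog M p" if "a \<in> homog M p" "b \<in> homog M p" for a b by (rule homog_add[OF that])
    show "\<ominus>\<^bsub>M\<^esub> a \<in> homog M p" if "a \<in> homog M p" for a
      using that unfolding homog_iff by (simp add: addhom_neg[OF eps_hom M_ab M_ab] psgn_def)
    show "r \<odot>\<^bsub>M\<^esub> a \<in> homog M p" if "r \<in> carrier (mpoly_ring Z)" "a \<in> homog M p" for r a
      using that mpoly_mono[OF assms that(1)] unfolding homog_iff
      by (simp add: is_linear_smult[OF eps_linear] is_linear_smult[OF is_linear_psgn[OF M_module]] smult_closed)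
  qed
  show ?thesis unfolding graded_module_def
  proof (intro conjI allI ballI sub)
    show "module (mpoly_ring Z) M" by (rule Z.module_axioms)
    fix v assume "v \<in> carrier M"
    then obtain a b where ab: "a \<in> homog M 0" "b \<in> homog M 1" "v = a \<oplus>\<^bsub>M\<^esub> b" using M_decomp by blast
    show "\<exists>!w. fst w \<in> homog M 0 \<and> snd w \<in> homog M 1 \<and> v = fst w \<oplus>\<^bsub>M\<^esub> snd w"
    proof (rule ex1I[of _ "(a, b)"])
      show "fst (a, b) \<in> homog M 0 \<and> snd (a, b) \<in> homog M 1 \<and> v = fst (a, b) \<oplus>\<^bsub>M\<^esub> snd (a, b)" using ab by simp
      fix w assume w: "fst w \<in> homog M 0 \<and> snd w \<in> homog M 1 \<and> v = fst w \<oplus>\<^bsub>M\<^esub> snd w"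
      define a' b' where "a' = fst w" and "b' = snd w"
      have w': "a' \<in> homog M 0" "b' \<in> homog M 1" "v = a' \<oplus>\<^bsub>M\<^esub> b'" using w by (simp_all add: a'_def b'_def)
      have c: "a \<in> carrier M" "b \<in> carrier M" "a' \<in> carrier M" "b' \<in> carrier M" using ab w' homog_iff by blast+
      \<comment> \<open>The difference of the two even parts is the opposite of the difference of
        the odd parts, so it is both even and odd and hence its own negative.\<close>
      let ?c = "a \<oplus>\<^bsub>M\<^esub> \<ominus>\<^bsub>M\<^esub> a'"
      have "?c = b' \<oplus>\<^bsub>M\<^esub> \<ominus>\<^bsub>M\<^esub> b"
      proof -
        have "?c \<oplus>\<^bsub>M\<^esub> (a' \<oplus>\<^bsub>M\<^esub> b) = a \<oplus>\<^bsub>M\<^esub> b" using c by (simp add: M.a_assoc M.r_neg1)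
        also have "\<dots> = b' \<oplus>\<^bsub>M\<^esub> a'" using ab w' c by (simp add: M.a_comm)
        also have "\<dots> = (b' \<oplus>\<^bsub>M\<^esub> \<ominus>\<^bsub>M\<^esub> b) \<oplus>\<^bsub>M\<^esub> (b \<oplus>\<^bsub>M\<^esub> a')" using c by (simp add: M.a_assoc M.r_neg1)
        also have "b \<oplus>\<^bsub>M\<^esub> a' = a' \<oplus>\<^bsub>M\<^esub> b" using c by (simp add: M.a_comm)
        finally have "?c \<oplus>\<^bsub>M\<^esub> (a' \<oplus>\<^bsub>M\<^esub> b) = (b' \<oplus>\<^bsub>M\<^esub> \<ominus>\<^bsub>M\<^esub> b) \<oplus>\<^bsub>M\<^esub> (a' \<oplus>\<^bsub>M\<^esub> b)" .
        then show ?thesis using c by simp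
      qed
      moreover have "?c \<in> homog M 0" using ab(1) w'(1) Z.submoduleE(3,5)[OF sub] by simp
      moreover have "b' \<oplus>\<^bsub>M\<^esub> \<ominus>\<^bsub>M\<^esub> b \<in> homog M 1" using ab(2) w'(2) Z.submoduleE(3,5)[OF sub] by simp
      ultimately have "eps ?c = ?c" "eps ?c = \<ominus>\<^bsub>M\<^esub> ?c" unfolding homog_iff psgn_def by simp_all
      then have "?c = \<ominus>\<^bsub>M\<^esub> ?c" by simp
      moreover have cc: "?c \<in> carrier M" using c by simp
      ultimately have "?c \<oplus>\<^bsub>M\<^esub> ?c = \<zero>\<^bsub>M\<^esub>" using M.r_neg by metis
      then have 0: "?c = \<zero>\<^bsub>M\<^esub>" by (rule half_zero[OF cc])
      then have "a = a'" using c by (metis M.minus_equality M.minus_minus M.a_inv_closed)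
      moreover have "b = b'" using c ab(3) w'(3) \<open>a = a'\<close> by simp
      ultimately show "w = (a, b)" by (simp add: a'_def b'_def)
    qed
  qed
qed

subsection \<open>The differential\<close>

lemma id_Y: "is_linear Ryz YY YY (\<lambda>y. y)" and id_X: "is_linear Rxy XX XX (\<lambda>x. x)"
  by (rule is_linear_id)+

lemma d_eq: "v \<in> carrier M \<Longrightarrow> d v = tmap (dmap YY) (\<lambda>x. x) v \<oplus>\<^bsub>M\<^esub> tmap PY (dmap XX) v"
proof -
  assume v: "v \<in> carrier M"
  let ?h = "\<lambda>v. tmap (dmap YY) (\<lambda>x. x) v \<oplus>\<^bsub>M\<^esub> tmap PY (dmap XX) v"
  have h: "?h \<in> hom T T" unfolding homT
    by (intro addhom_plus is_linear_addhom[OF tmap_linear] dY PYl dX id_X M_ab)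
  have "d = tensor_lift Ry YY S XX T (\<lambda>y s x. \<tau> (dmap YY y) s x \<otimes>\<^bsub>T\<^esub> \<tau> (PY y) s (dmap XX x))"
    by (simp add: tensor_mf_def Let_def)
  also have "\<dots> = restrict ?h (carrier T)"
    by (rule lift_of_hom[OF h T.is_group])
       (simp add: tmap_pure[OF dY id_X] tmap_pure[OF PYl dX] M_add)
  finally show ?thesis using v by (simp add: M_carrier)
qed

lemma d_linear: "is_linear R M M d"
proof -
  have l: "is_linear R M M (\<lambda>v. tmap (dmap YY) (\<lambda>x. x) v \<oplus>\<^bsub>M\<^esub> tmap PY (dmap XX) v)"
    by (intro is_linear_plus tmap_linear dY PYl dX id_X M_module)
  show ?thesis
  proof (intro is_linearI addhomI)
    fix v assume v: "v \<in> carrier M"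
    show "d v \<in> carrier M" unfolding d_eq[OF v] by (rule is_linear_closed[OF l v])
    show "d (v \<oplus>\<^bsub>M\<^esub> w) = d v \<oplus>\<^bsub>M\<^esub> d w" if w: "w \<in> carrier M" for w
      unfolding d_eq[OF v] d_eq[OF w] d_eq[OF M.a_closed[OF v w]]
      by (rule addhom_add[OF is_linear_addhom[OF l] v w])
    show "d (r \<odot>\<^bsub>M\<^esub> v) = r \<odot>\<^bsub>M\<^esub> d v" if r: "r \<in> carrier R" for r
      unfolding d_eq[OF v] d_eq[OF smult_closed[OF r v]]
      by (rule is_linear_smult[OF l r v])
  qed
qed

lemmas d_hom = is_linear_addhom[OF d_linear] and d_closed = is_linear_closed[OF d_linear]

lemma d_pure:
  assumes "y \<in> carrier YY" "s \<in> carrier S" "x \<in> carrier XX"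
  shows "d (\<tau> y s x) = \<tau> (dmap YY y) s x \<oplus>\<^bsub>M\<^esub> \<tau> (PY y) s (dmap XX x)"
  using assms by (simp add: d_eq tmap_pure[OF dY id_X] tmap_pure[OF PYl dX])

lemma d_eps:
  assumes v: "v \<in> carrier M" shows "eps (d v) = psgn M 1 (d (eps v))"
proof (rule M_addhom_eqI[OF _ _ M_ab _ v])
    show "(\<lambda>v. eps (d v)) \<in> addhom M M" by (rule addhom_comp[OF d_hom eps_hom])
    show "(\<lambda>v. psgn M 1 (d (eps v))) \<in> addhom M M" unfolding psgn_def
      using addhom_uminus[OF addhom_comp[OF eps_hom d_hom] M_ab] by simp
    fix y s x assume c: "y \<in> carrier YY" "s \<in> carrier S" "x \<in> carrier XX"
    show "eps (d (\<tau> y s x)) = psgn M 1 (d (eps (\<tau> y s x)))"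
      using c by (simp add: d_pure eps_pure addhom_add[OF eps_hom] PYc PXc dYc dXc psgn_def M.minus_add
           PYdY PXdX PYPY \<tau>_negY \<tau>_negX)
qed

lemma d_parity: "has_parity M 1 d"
  by (rule has_parityI[OF d_hom d_eps])

lemma UVW: "U \<in> carrier Ryz" "V \<in> carrier Ryz" "V \<in> carrier Rxy" "W \<in> carrier Rxy" "V \<in> carrier Ry"
  using mpoly_mono[OF _ U] mpoly_mono[OF _ V] mpoly_mono[OF _ W] by auto

text \<open>The mixed terms cancel because the parity involution anticommutes with
  \<open>dmap YY\<close>. The squares leave U - V acting through the left factor and V - W through
  the right one, and V acts in the same way through either.\<close>

lemma d_d: 
  assumes v: "v \<in> carrier M" shows "d (d v) = (U - W) \<odot>\<^bsub>M\<^esub> v"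
proof (rule M_addhom_eqI[OF _ _ M_ab _ v])
  show "(\<lambda>v. d (d v)) \<in> addhom M M" by (rule addhom_comp[OF d_hom d_hom])
  show "(\<lambda>v. (U - W) \<odot>\<^bsub>M\<^esub> v) \<in> addhom M M" by (rule smult_addhom) (intro mpoly_diff Ryz_R Rxy_R UVW)
  fix y s x assume c: "y \<in> carrier YY" "s \<in> carrier S" "x \<in> carrier XX"
  have "d (d (\<tau> y s x)) = \<tau> ((U - V) \<odot>\<^bsub>YY\<^esub> y) s x \<oplus>\<^bsub>M\<^esub> \<tau> y s ((V - W) \<odot>\<^bsub>XX\<^esub> x)"
    using c by (simp add: d_pure addhom_add[OF d_hom] PYc PXc dYc dXc PYdY \<tau>_negY PYPY dYdY dXdX UVW M.a_ac M.r_neg M.r_neg1 M.r_neg2)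
  also have "\<dots> = ((U - V) + (V - W)) \<odot>\<^bsub>M\<^esub> \<tau> y s x"
    using smult_pure_YZ[of "U - V" y s x] smult_pure_XY[of "V - W" y s x] c UVW
      smult_add[of "U - V" "V - W" "\<tau> y s x"]
    by (simp add: Ryz_R Rxy_R)
  finally show "d (d (\<tau> y s x)) = (U - W) \<odot>\<^bsub>M\<^esub> \<tau> y s x" by simp
qed

subsection \<open>Odd operators on the right factor\<close>

definition oddX :: "('x \<Rightarrow> 'x) \<Rightarrow> bool" where
  "oddX h \<longleftrightarrow> is_linear Rxy XX XX h \<and> (\<forall>x\<in>carrier XX. PX (h x) = \<ominus>\<^bsub>XX\<^esub> h (PX x))"

abbreviation "lam \<equiv> tmap PY"

context fixes h assumes h: "oddX h" begin

lemma hl: "is_linear Rxy XX XX h" using h by (simp add: oddX_def)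
lemmas hc = is_linear_closed[OF hl]
lemmas lam_linear = tmap_linear[OF PYl hl]
lemmas lam_hom = is_linear_addhom[OF lam_linear] and lam_closed = is_linear_closed[OF lam_linear]
lemmas lam_pure = tmap_pure[OF PYl hl]

lemma lam_eps:
  assumes v: "v \<in> carrier M" shows "eps (lam h v) = psgn M 1 (lam h (eps v))"
proof (rule M_addhom_eqI[OF _ _ M_ab _ v])
    show "(\<lambda>v. eps (lam h v)) \<in> addhom M M" by (rule addhom_comp[OF lam_hom eps_hom])
    show "(\<lambda>v. psgn M 1 (lam h (eps v))) \<in> addhom M M" unfolding psgn_def
      using addhom_uminus[OF addhom_comp[OF eps_hom lam_hom] M_ab] by simp
    fix y s x assume c: "y \<in> carrier YY" "s \<in> carrier S" "x \<in> carrier XX"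
    have "PX (h x) = \<ominus>\<^bsub>XX\<^esub> h (PX x)" using h c by (simp add: oddX_def)
    then show "eps (lam h (\<tau> y s x)) = psgn M 1 (lam h (eps (\<tau> y s x)))"
      using c by (simp add: lam_pure eps_pure PYc PXc hc psgn_def \<tau>_negX)
qed

text \<open>The Koszul sign removes the left differential from the anticommutator, so the relation
  between \<open>h\<close> and the differential of \<open>XX\<close> passes unchanged to the tensor
  product.\<close>

lemma d_lam:
  assumes p: "p \<in> carrier Rxy" and hp: "\<And>x. x \<in> carrier XX \<Longrightarrow> dmap XX (h x) \<oplus>\<^bsub>XX\<^esub> h (dmap XX x) = p \<odot>\<^bsub>XX\<^esub> x"
    and v: "v \<in> carrier M"
  shows "d (lam h v) \<oplus>\<^bsub>M\<^esub> lam h (d v) = p \<odot>\<^bsub>M\<^esub> v"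
proof (rule M_addhom_eqI[OF _ _ M_ab _ v])
  show "(\<lambda>v. d (lam h v) \<oplus>\<^bsub>M\<^esub> lam h (d v)) \<in> addhom M M" by (intro addhom_plus M_ab addhom_comp[OF d_hom lam_hom] addhom_comp[OF lam_hom d_hom])
  show "(\<lambda>v. p \<odot>\<^bsub>M\<^esub> v) \<in> addhom M M" by (intro smult_addhom Rxy_R p)
  fix y s x assume c: "y \<in> carrier YY" "s \<in> carrier S" "x \<in> carrier XX"
  have "d (lam h (\<tau> y s x)) \<oplus>\<^bsub>M\<^esub> lam h (d (\<tau> y s x)) = \<tau> y s (dmap XX (h x)) \<oplus>\<^bsub>M\<^esub> \<tau> y s (h (dmap XX x))"
    using c by (simp add: d_pure lam_pure addhom_add[OF lam_hom] PYc PXc dYc dXc hc PYdY \<tau>_negY PYPY M.a_ac M.r_neg M.r_neg1 M.r_neg2)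
  also have "\<dots> = \<tau> y s (p \<odot>\<^bsub>XX\<^esub> x)" using c hp[OF c(3)] \<tau>_addX[of y s "dmap XX (h x)" "h (dmap XX x)"] by (simp add: hc dXc)
  finally show "d (lam h (\<tau> y s x)) \<oplus>\<^bsub>M\<^esub> lam h (d (\<tau> y s x)) = p \<odot>\<^bsub>M\<^esub> \<tau> y s x"
    using c p by (simp add: smult_pure_XY)
qed

end

text \<open>The same cancellation for a second-order relation. Here \<open>h\<close> and
  \<open>h'\<close> will be first derivatives of the differential of \<open>XX\<close> and
  \<open>g\<close> a second derivative, which then becomes a homotopy.\<close>

lemma lam_lam:
  assumes h: "oddX h" "oddX h'" "oddX g" and p: "p \<in> carrier Rxy"
    and hp: "\<And>x. x \<in> carrier XX \<Longrightarrow> (dmap XX (g x) \<oplus>\<^bsub>XX\<^esub> g (dmap XX x)) \<oplus>\<^bsub>XX\<^esub> (h (h' x) \<oplus>\<^bsub>XX\<^esub> h' (h x)) = p \<odot>\<^bsub>XX\<^esub> x"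
    and v: "v \<in> carrier M"
  shows "(d (lam g v) \<oplus>\<^bsub>M\<^esub> lam g (d v)) \<oplus>\<^bsub>M\<^esub> (lam h (lam h' v) \<oplus>\<^bsub>M\<^esub> lam h' (lam h v)) = p \<odot>\<^bsub>M\<^esub> v"
proof (rule M_addhom_eqI[OF _ _ M_ab _ v])
  show "(\<lambda>v. (d (lam g v) \<oplus>\<^bsub>M\<^esub> lam g (d v)) \<oplus>\<^bsub>M\<^esub> (lam h (lam h' v) \<oplus>\<^bsub>M\<^esub> lam h' (lam h v))) \<in> addhom M M"
    by (intro addhom_plus M_ab addhom_comp[OF d_hom lam_hom] addhom_comp[OF lam_hom d_hom] addhom_comp[OF lam_hom lam_hom] h)
  show "(\<lambda>v. p \<odot>\<^bsub>M\<^esub> v) \<in> addhom M M" by (intro smult_addhom Rxy_R p)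
  fix y s x assume c: "y \<in> carrier YY" "s \<in> carrier S" "x \<in> carrier XX"
  note hc = hc[OF h(1)] hc[OF h(2)] hc[OF h(3)]
  have "(d (lam g (\<tau> y s x)) \<oplus>\<^bsub>M\<^esub> lam g (d (\<tau> y s x))) \<oplus>\<^bsub>M\<^esub> (lam h (lam h' (\<tau> y s x)) \<oplus>\<^bsub>M\<^esub> lam h' (lam h (\<tau> y s x)))
     = (\<tau> y s (dmap XX (g x)) \<oplus>\<^bsub>M\<^esub> \<tau> y s (g (dmap XX x))) \<oplus>\<^bsub>M\<^esub> (\<tau> y s (h (h' x)) \<oplus>\<^bsub>M\<^esub> \<tau> y s (h' (h x)))"
    using c by (simp add: d_pure lam_pure h addhom_add[OF lam_hom] PYc PXc dYc dXc hc PYdY \<tau>_negY PYPY M.a_ac M.r_neg M.r_neg1 M.r_neg2)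
  also have "\<dots> = \<tau> y s (p \<odot>\<^bsub>XX\<^esub> x)" unfolding hp[OF c(3), symmetric] using c by (simp add: \<tau>_addX hc dXc)
  finally show "(d (lam g (\<tau> y s x)) \<oplus>\<^bsub>M\<^esub> lam g (d (\<tau> y s x))) \<oplus>\<^bsub>M\<^esub> (lam h (lam h' (\<tau> y s x)) \<oplus>\<^bsub>M\<^esub> lam h' (lam h (\<tau> y s x))) = p \<odot>\<^bsub>M\<^esub> \<tau> y s x"
    using c p by (simp add: smult_pure_XY)
qed

end

text \<open>A matrix factorisation of finite rank asks for a basis that is a set of vectors, while
  the one constructed below is an indexed family. The family is injective because coordinates of
  basis vectors are 0 or 1, and these differ.\<close>

lemma finite_basis_image:
  fixes M :: "(('k::comm_ring_1) pol, 'b, 'p) module_scheme"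
  assumes md: "module (mpoly_ring V) M" and fb: "finite_basis (mpoly_ring V) M I g"
  shows "finite_basis (mpoly_ring V) M (g ` I) (\<lambda>b. b)"
proof -
  interpret M: module "mpoly_ring V" M by (rule md)
  have inj: "inj_on g I"
  proof (rule inj_onI, rule ccontr)
    fix i i' assume i: "i \<in> I" "i' \<in> I" "g i = g i'" "i \<noteq> i'"
    then show False using coords_basis[OF md fb i(1) i(1)] coords_basis[OF md fb i(2) i(1)] by simp
  qed
  have cl: "\<And>i. i \<in> I \<Longrightarrow> g i \<in> carrier M" by (rule fb_closed[OF md fb])
  have eq: "(\<Oplus>\<^bsub>M\<^esub>b\<in>g ` I. c b \<odot>\<^bsub>M\<^esub> b) = (\<Oplus>\<^bsub>M\<^esub>i\<in>I. c (g i) \<odot>\<^bsub>M\<^esub> g i)" if "c \<in> g ` I \<rightarrow> carrier (mpoly_ring V)" for c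
    using M.finsum_reindex[of "\<lambda>b. c b \<odot>\<^bsub>M\<^esub> b" g I] that inj cl by (auto simp: Pi_iff)
  show ?thesis unfolding finite_basis_def
  proof (intro conjI ballI)
    show "finite (g ` I)" using fb_finite[OF md fb] by simp
    show "(\<lambda>b. b) \<in> g ` I \<rightarrow> carrier M" using cl by auto
    fix v assume v: "v \<in> carrier M"
    let ?c = "\<lambda>b\<in>g ` I. coords (mpoly_ring V) M I g v (inv_into I g b)"
    have c: "?c \<in> g ` I \<rightarrow>\<^sub>E carrier (mpoly_ring V)"
      using coords_closed[OF md fb v] inj by auto
    show "\<exists>!c. c \<in> g ` I \<rightarrow>\<^sub>E carrier (mpoly_ring V) \<and> v = (\<Oplus>\<^bsub>M\<^esub>b\<in>g ` I. c b \<odot>\<^bsub>M\<^esub> b)"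
    proof (rule ex1I[of _ ?c], intro conjI c)
      have "v = (\<Oplus>\<^bsub>M\<^esub>i\<in>I. coords (mpoly_ring V) M I g v i \<odot>\<^bsub>M\<^esub> g i)" by (rule coords_expand[OF md fb v])
      also have "\<dots> = (\<Oplus>\<^bsub>M\<^esub>i\<in>I. ?c (g i) \<odot>\<^bsub>M\<^esub> g i)"
        using inj coords_closed[OF md fb v] cl by (intro M.finsum_cong') auto
      also have "\<dots> = (\<Oplus>\<^bsub>M\<^esub>b\<in>g ` I. ?c b \<odot>\<^bsub>M\<^esub> b)"
        by (rule eq[symmetric]) (use c in \<open>simp only: PiE_def Int_iff\<close>)
      finally show "v = (\<Oplus>\<^bsub>M\<^esub>b\<in>g ` I. ?c b \<odot>\<^bsub>M\<^esub> b)" .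
    next
      fix c assume c': "c \<in> g ` I \<rightarrow>\<^sub>E carrier (mpoly_ring V) \<and> v = (\<Oplus>\<^bsub>M\<^esub>b\<in>g ` I. c b \<odot>\<^bsub>M\<^esub> b)"
      then have "v = (\<Oplus>\<^bsub>M\<^esub>i\<in>I. c (g i) \<odot>\<^bsub>M\<^esub> g i)" using eq[of c] by auto
      then have "coords (mpoly_ring V) M I g v i = c (g i)" if "i \<in> I" for i
        using c' that by (intro coords_unique[OF md fb]) auto
      then show "c = ?c" using c' c inj by (intro PiE_ext[of _ "g ` I" "\<lambda>_. carrier (mpoly_ring V)"]) auto
    qed
  qed
qed

section \<open>Coordinates with respect to homogeneous bases and monomials in x and z\<close>

locale cut_basis = cut n m l YY XX S U V W hf
  for n m l and YY :: "(('k::comm_ring_1) pol, 'y) mf" and XX :: "('k pol, 'x) mf" and S :: "('k pol, 's) module" and U V W hf +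
  fixes A :: "'a set" and e and B :: "'b set" and f
  assumes eb: "homogeneous_basis (mpoly_ring (yvars m \<union> zvars l)) YY A e"
    and fb: "homogeneous_basis (mpoly_ring (xvars n \<union> yvars m)) XX B f"
begin

lemma eB: "finite_basis Ryz YY A e" and fB: "finite_basis Rxy XX B f"
  using eb fb by (simp_all add: homogeneous_basis_def)

lemmas ec = fb_closed[OF YYm eB] and fc = fb_closed[OF XXm fB]
lemmas Afin = fb_finite[OF YYm eB] and Bfin = fb_finite[OF XXm fB]

abbreviation "Vxz \<equiv> xvars n \<union> zvars l"
abbreviation "Rxz \<equiv> mpoly_ring Vxz :: 'k pol ring"
abbreviation "cY \<equiv> coords Ryz YY A e"
abbreviation "cX \<equiv> coords Rxy XX B f"
abbreviation "mr \<equiv> mon_restrict (range Xv \<union> range Zv)"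
abbreviation "my \<equiv> mon_restrict (range Yv)"

lemma Rxz_R: "p \<in> carrier Rxz \<Longrightarrow> p \<in> carrier R" by (erule mpoly_mono[rotated]) auto

lemma mr_my: "mr u + my u = u"
proof (rule poly_mapping_eqI)
  fix v show "Poly_Mapping.lookup (mr u + my u) v = Poly_Mapping.lookup u v"
    by (cases v) (auto simp: lookup_add)
qed

lemma keys_mr: "Poly_Mapping.keys u \<subseteq> Vxyz \<Longrightarrow> Poly_Mapping.keys (mr u) \<subseteq> Vxz" by auto
lemma keys_my: "Poly_Mapping.keys u \<subseteq> Vxyz \<Longrightarrow> Poly_Mapping.keys (my u) \<subseteq> yvars m" by auto
lemma mr_xz: "Poly_Mapping.keys u \<subseteq> Vxz \<Longrightarrow> mr u = u" by (rule mon_restrict_id) auto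
lemma my_xz: "Poly_Mapping.keys u \<subseteq> Vxz \<Longrightarrow> my u = 0" by (rule mon_restrict_0) auto
lemma mr_y: "Poly_Mapping.keys u \<subseteq> yvars m \<Longrightarrow> mr u = 0" by (rule mon_restrict_0) auto
lemma my_y: "Poly_Mapping.keys u \<subseteq> yvars m \<Longrightarrow> my u = u" by (rule mon_restrict_id) auto

lemma smult_\<tau>: "r \<in> carrier R \<Longrightarrow> y \<in> carrier YY \<Longrightarrow> s \<in> carrier S \<Longrightarrow> x \<in> carrier XX \<Longrightarrow> r \<odot>\<^bsub>M\<^esub> \<tau> y s x \<in> carrier M"
  by (intro smult_closed \<tau>M)

text \<open>The y-part of every coefficient is absorbed by the middle factor, so only monomials in x
  and z remain in front. An operator that is merely k[x,z]-linear is therefore determined by its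
  values on basis tensors.\<close>

lemma basis_induct [consumes 1, case_names zero basis add]:
  assumes v: "v \<in> carrier M" and zero: "P \<zero>\<^bsub>M\<^esub>"
    and basis: "\<And>w a s b. Poly_Mapping.keys w \<subseteq> Vxz \<Longrightarrow> a \<in> A \<Longrightarrow> s \<in> carrier S \<Longrightarrow> b \<in> B \<Longrightarrow>
      P (Poly_Mapping.single w 1 \<odot>\<^bsub>M\<^esub> \<tau> (e a) s (f b))"
    and add: "\<And>v w. v \<in> carrier M \<Longrightarrow> w \<in> carrier M \<Longrightarrow> P v \<Longrightarrow> P w \<Longrightarrow> P (v \<oplus>\<^bsub>M\<^esub> w)"
  shows "P v"
  using v
proof (induction v rule: M_induct)
  case (pure y s x)
  have sum: "P (\<Oplus>\<^bsub>M\<^esub>i\<in>I. g i)" if "finite I" "\<And>i. i \<in> I \<Longrightarrow> g i \<in> carrier M \<and> P (g i)" for I :: "'i set" and g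
    using that
  proof (induction I rule: finite_induct)
    case (insert i I)
    have "(\<Oplus>\<^bsub>M\<^esub>i\<in>insert i I. g i) = g i \<oplus>\<^bsub>M\<^esub> (\<Oplus>\<^bsub>M\<^esub>i\<in>I. g i)" using insert by (intro M.finsum_insert) auto
    moreover have "(\<Oplus>\<^bsub>M\<^esub>i\<in>I. g i) \<in> carrier M" using insert by (intro M.finsum_closed) auto
    ultimately show ?case using insert by (simp add: add)
  qed (simp add: zero)
  have 1: "P (p \<odot>\<^bsub>M\<^esub> \<tau> (e a) s (f b))" if "p \<in> carrier R" and a: "a \<in> A" and b: "b \<in> B" for p a b
    using that(1)
  proof (induction p rule: mpoly_induct)
    case zero
    show ?case using smult_0[OF \<tau>M[OF ec[OF a] pure(2) fc[OF b]]] assms(2) by simp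
  next
    case (add p q)
    then show ?case
      using smult_add[OF add(1,2) \<tau>M[OF ec[OF a] pure(2) fc[OF b]]]
      by (simp add: assms(4) smult_\<tau> ec fc a b pure(2))
  next
    case (single u c)
    have my: "Poly_Mapping.single (my u) c \<in> carrier Ry" and mr: "Poly_Mapping.single (mr u) 1 \<in> carrier R"
      using keys_my[OF single] keys_mr[OF single] by (auto intro!: mpoly_single)
    have "Poly_Mapping.single u c = Poly_Mapping.single (mr u) 1 * Poly_Mapping.single (my u) c"
      by (simp add: mult_single mr_my)
    then have "Poly_Mapping.single u c \<odot>\<^bsub>M\<^esub> \<tau> (e a) s (f b) = Poly_Mapping.single (mr u) 1 \<odot>\<^bsub>M\<^esub> \<tau> (e a) (Poly_Mapping.single (my u) c \<odot>\<^bsub>S\<^esub> s) (f b)"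
      using my mr a b pure by (simp add: smult_assoc Ry_R ec fc smult_pure_S)
    then show ?case using basis[OF keys_mr[OF single] a S.smult_closed[OF my pure(2)] b] by simp
  qed
  have 2: "\<tau> (cY y a \<odot>\<^bsub>YY\<^esub> e a) s (cX x b \<odot>\<^bsub>XX\<^esub> f b) = (cY y a * cX x b) \<odot>\<^bsub>M\<^esub> \<tau> (e a) s (f b)"
    if "a \<in> A" "b \<in> B" for a b
    using coords_closed[OF YYm eB pure(1) that(1)] coords_closed[OF XXm fB pure(3) that(2)] that pure
    by (simp add: smult_assoc Ryz_R Rxy_R smult_pure_YZ smult_pure_XY ec fc)
  have cp: "cY y a * cX x b \<in> carrier R" if "a \<in> A" "b \<in> B" for a b
    using coords_closed[OF YYm eB pure(1) that(1)] coords_closed[OF XXm fB pure(3) that(2)]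
    by (intro mpoly_mult Ryz_R Rxy_R)
  have yc: "(\<lambda>a. cY y a \<odot>\<^bsub>YY\<^esub> e a) \<in> A \<rightarrow> carrier YY" using coords_closed[OF YYm eB pure(1)] ec by auto
  have xc: "(\<lambda>b. cX x b \<odot>\<^bsub>XX\<^esub> f b) \<in> B \<rightarrow> carrier XX" using coords_closed[OF XXm fB pure(3)] fc by auto
  have "\<tau> y s x = (\<Oplus>\<^bsub>M\<^esub>a\<in>A. \<tau> (cY y a \<odot>\<^bsub>YY\<^esub> e a) s x)"
    by (subst coords_expand[OF YYm eB pure(1)], rule addhom_finsum[OF \<tau>_homY[OF pure(2,3)] Y_ab M_ab yc])
  also have "\<dots> = (\<Oplus>\<^bsub>M\<^esub>a\<in>A. \<Oplus>\<^bsub>M\<^esub>b\<in>B. (cY y a * cX x b) \<odot>\<^bsub>M\<^esub> \<tau> (e a) s (f b))"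
  proof (rule M.finsum_cong')
    fix a assume a: "a \<in> A"
    note ya = funcset_mem[OF yc a]
    have "\<tau> (cY y a \<odot>\<^bsub>YY\<^esub> e a) s x = (\<Oplus>\<^bsub>M\<^esub>b\<in>B. \<tau> (cY y a \<odot>\<^bsub>YY\<^esub> e a) s (cX x b \<odot>\<^bsub>XX\<^esub> f b))"
      by (subst coords_expand[OF XXm fB pure(3)], rule addhom_finsum[OF \<tau>_homX[OF ya pure(2)] X_ab M_ab xc])
    also have "\<dots> = (\<Oplus>\<^bsub>M\<^esub>b\<in>B. (cY y a * cX x b) \<odot>\<^bsub>M\<^esub> \<tau> (e a) s (f b))"
      using 2[OF a] smult_\<tau>[OF cp[OF a] ec[OF a] pure(2) fc] by (intro M.finsum_cong') auto
    finally show "\<tau> (cY y a \<odot>\<^bsub>YY\<^esub> e a) s x = (\<Oplus>\<^bsub>M\<^esub>b\<in>B. (cY y a * cX x b) \<odot>\<^bsub>M\<^esub> \<tau> (e a) s (f b))" .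
  qed (use smult_\<tau>[OF cp ec pure(2) fc] in \<open>auto intro!: M.finsum_closed\<close>)
  also have "P \<dots>"
    using smult_\<tau>[OF cp ec pure(2) fc] 1[OF cp]
    by (intro sum Afin Bfin conjI M.finsum_closed) auto
  finally show ?case .
qed (use zero add in auto)

subsection \<open>Maps defined through coordinates\<close>

text \<open>The coordinate of a tensor at \<open>(e a, f b)\<close> lies in the tensor product of \<open>S\<close> and \<open>k[x,y,z]\<close> over
  \<open>k[y]\<close>.  \<open>coordG\<close> lists the conditions under which a map out of it may be prescribed on the elements
  \<open>s \<otimes> c u\<close> for monomials \<open>u\<close>; \<open>coordL\<close> is the resulting map on \<open>M\<close>.\<close>

definition coordG :: "('c, 'd) ring_scheme \<Rightarrow> ('s \<Rightarrow> (pvar \<Rightarrow>\<^sub>0 nat) \<Rightarrow> 'k \<Rightarrow> 'c) \<Rightarrow> bool" where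
  "coordG N G \<longleftrightarrow> abelian_group N \<and> (\<forall>s\<in>carrier S. polysummable N Vxyz (G s)) \<and>
    (\<forall>u c. Poly_Mapping.keys u \<subseteq> Vxyz \<longrightarrow> (\<lambda>s. G s u c) \<in> addhom S N) \<and>
    (\<forall>s\<in>carrier S. \<forall>u' u c' c. Poly_Mapping.keys u' \<subseteq> yvars m \<longrightarrow> Poly_Mapping.keys u \<subseteq> Vxyz \<longrightarrow>
       G s (u' + u) (c' * c) = G (Poly_Mapping.single u' c' \<odot>\<^bsub>S\<^esub> s) u c)"

definition coordL :: "('c, 'd) ring_scheme \<Rightarrow> ('s \<Rightarrow> (pvar \<Rightarrow>\<^sub>0 nat) \<Rightarrow> 'k \<Rightarrow> 'c) \<Rightarrow> 'a \<Rightarrow> 'b \<Rightarrow> (('y \<times> 's \<times> 'x) \<Rightarrow>\<^sub>0 int) set \<Rightarrow> 'c" where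
  "coordL N G a b = tensor_lift Ry YY S XX (add_monoid N) (\<lambda>y s x. polysum N (G s) (cY y a * cX x b))"

context
  fixes N :: "('c, 'd) ring_scheme" and G
  assumes G: "coordG N G"
begin

interpretation N: abelian_group N using G by (simp add: coordG_def)

lemma G_summable: "s \<in> carrier S \<Longrightarrow> polysummable N Vxyz (G s)"
  using G by (simp add: coordG_def)

lemma G_hom: "Poly_Mapping.keys u \<subseteq> Vxyz \<Longrightarrow> (\<lambda>s. G s u c) \<in> addhom S N"
  using G by (simp add: coordG_def)

lemma G_shift: "s \<in> carrier S \<Longrightarrow> Poly_Mapping.keys u' \<subseteq> yvars m \<Longrightarrow> Poly_Mapping.keys u \<subseteq> Vxyz \<Longrightarrow>
       G s (u' + u) (c' * c) = G (Poly_Mapping.single u' c' \<odot>\<^bsub>S\<^esub> s) u c"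
  using G by (simp add: coordG_def)

text \<open>The shift law for monomials extends biadditively to polynomials. It lets a scalar from
  k[y] move from the polynomial into \<open>s\<close>, which is the balancedness needed to define
  \<open>coordL\<close>.\<close>

lemma polysum_G_smult:
  assumes r: "r \<in> carrier Ry" and p: "p \<in> carrier R" and s: "s \<in> carrier S"
  shows "polysum N (G s) (r * p) = polysum N (G (r \<odot>\<^bsub>S\<^esub> s)) p"
  using r
proof (induction r rule: mpoly_induct)
  case zero
  have "(\<lambda>s. polysum N (G s) p) \<in> addhom S N"
    by (rule polysum_addhom[OF G_hom N.abelian_group_axioms p])
  then have "polysum N (G \<zero>\<^bsub>S\<^esub>) p = \<zero>\<^bsub>N\<^esub>" by (rule addhom_zero[OF _ S_ab N.abelian_group_axioms])
  then show ?case using S.smult_l_null[OF s] polysum_0[OF G_summable[OF s]] by simp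
next
  case (add r r')
  have h: "(\<lambda>s. polysum N (G s) p) \<in> addhom S N"
    by (rule polysum_addhom[OF G_hom N.abelian_group_axioms p])
  have "polysum N (G s) ((r + r') * p) = polysum N (G s) (r * p) \<oplus>\<^bsub>N\<^esub> polysum N (G s) (r' * p)"
    unfolding distrib_right using add(1,2)[THEN Ry_R] p by (intro polysum_add[OF G_summable[OF s]] mpoly_mult)
  then show ?case using add S.smult_l_distr[OF add(1,2) s] addhom_add[OF h S.smult_closed[OF add(1) s] S.smult_closed[OF add(2) s]]
    by simp
next
  case (single u' c')
  have r: "Poly_Mapping.single u' c' \<in> carrier Ry" using single by (rule mpoly_single)
  note rs = S.smult_closed[OF r s]
  have uV: "Poly_Mapping.keys u' \<subseteq> Vxyz" using single by blast
  show ?case using p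
  proof (induction p rule: mpoly_induct)
    case zero
    show ?case using polysum_0[OF G_summable[OF s]] polysum_0[OF G_summable[OF rs]] by simp
  next
    case (add p q)
    have "polysum N (G s) (Poly_Mapping.single u' c' * (p + q)) = polysum N (G s) (Poly_Mapping.single u' c' * p) \<oplus>\<^bsub>N\<^esub> polysum N (G s) (Poly_Mapping.single u' c' * q)"
      unfolding distrib_left using add(1,2) r[THEN Ry_R] by (intro polysum_add[OF G_summable[OF s]] mpoly_mult)
    then show ?case using add polysum_add[OF G_summable[OF rs] add(1,2)] by simp
  next
    case (single u c)
    have "Poly_Mapping.keys (u' + u) \<subseteq> Vxyz" using keys_add[of u' u] uV single by blast
    then show ?case
      using polysum_single[OF G_summable[OF s], of "u' + u" "c' * c"] polysum_single[OF G_summable[OF rs] single, of c]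
        G_shift[OF s \<open>Poly_Mapping.keys u' \<subseteq> yvars m\<close> single, of c' c] by (simp add: mult_single)
  qed
qed

lemma coordL_balanced:
  assumes a: "a \<in> A" and b: "b \<in> B"
  shows "balanced Ry YY S XX (add_monoid N) (\<lambda>y s x. polysum N (G s) (cY y a * cX x b))"
proof (rule balancedI)
  have cp: "cY y a \<in> carrier R" "cX x b \<in> carrier R" "cY y a * cX x b \<in> carrier R" if "y \<in> carrier YY" "x \<in> carrier XX" for y x
    using coords_closed[OF YYm eB that(1) a, THEN Ryz_R] coords_closed[OF XXm fB that(2) b, THEN Rxy_R]
    by (simp_all add: mpoly_mult)
  fix y s x assume y: "y \<in> carrier YY" and s: "s \<in> carrier S" and x: "x \<in> carrier XX"
  show "polysum N (G s) (cY y a * cX x b) \<in> carrier (add_monoid N)"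
    using polysum_closed[OF G_summable[OF s] cp(3)[OF y x]] by simp
  show "polysum N (G s) (cY (y \<oplus>\<^bsub>YY\<^esub> y') a * cX x b) = polysum N (G s) (cY y a * cX x b) \<otimes>\<^bsub>add_monoid N\<^esub> polysum N (G s) (cY y' a * cX x b)"
    if y': "y' \<in> carrier YY" for y'
    unfolding coords_add[OF YYm eB y y' a] distrib_right
    using polysum_add[OF G_summable[OF s] cp(3)[OF y x] cp(3)[OF y' x]] by simp
  show "polysum N (G s) (cY y a * cX (x \<oplus>\<^bsub>XX\<^esub> x') b) = polysum N (G s) (cY y a * cX x b) \<otimes>\<^bsub>add_monoid N\<^esub> polysum N (G s) (cY y a * cX x' b)"
    if x': "x' \<in> carrier XX" for x'
    unfolding coords_add[OF XXm fB x x' b] distrib_left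
    using polysum_add[OF G_summable[OF s] cp(3)[OF y x] cp(3)[OF y x']] by simp
  show "polysum N (G (s \<oplus>\<^bsub>S\<^esub> s')) (cY y a * cX x b) = polysum N (G s) (cY y a * cX x b) \<otimes>\<^bsub>add_monoid N\<^esub> polysum N (G s') (cY y a * cX x b)"
    if s': "s' \<in> carrier S" for s'
    using addhom_add[OF polysum_addhom[OF G_hom N.abelian_group_axioms cp(3)[OF y x]] s s'] by simp
  fix r assume r: "r \<in> carrier Ry"
  show "polysum N (G s) (cY (r \<odot>\<^bsub>YY\<^esub> y) a * cX x b) = polysum N (G (r \<odot>\<^bsub>S\<^esub> s)) (cY y a * cX x b)"
    unfolding coords_smult[OF YYm eB Ry_Ryz[OF r] y a] mult.assoc by (rule polysum_G_smult[OF r cp(3)[OF y x] s])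
  show "polysum N (G s) (cY y a * cX (r \<odot>\<^bsub>XX\<^esub> x) b) = polysum N (G (r \<odot>\<^bsub>S\<^esub> s)) (cY y a * cX x b)"
    unfolding coords_smult[OF XXm fB Ry_Rxy[OF r] x b] mult.left_commute[of _ r] by (rule polysum_G_smult[OF r cp(3)[OF y x] s])
qed

lemma coordL_hom: "a \<in> A \<Longrightarrow> b \<in> B \<Longrightarrow> coordL N G a b \<in> addhom M N"
  unfolding coordL_def by (rule M_lift(1)[OF N.abelian_group_axioms coordL_balanced])

lemma coordL_basis:
  assumes a: "a \<in> A" and b: "b \<in> B" and a': "a' \<in> A" and b': "b' \<in> B" and s: "s \<in> carrier S" and p: "p \<in> carrier R"
  shows "coordL N G a b (p \<odot>\<^bsub>M\<^esub> \<tau> (e a') s (f b')) = (if a = a' \<and> b = b' then polysum N (G s) p else \<zero>\<^bsub>N\<^esub>)"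
  using p
proof (induction p rule: mpoly_induct)
  case zero
  then show ?case
    using smult_0[OF \<tau>M[OF ec[OF a'] s fc[OF b']]] addhom_zero[OF coordL_hom[OF a b] M_ab N.abelian_group_axioms]
      polysum_0[OF G_summable[OF s]] by simp
next
  case (add p q)
  then show ?case
    using smult_add[OF add(1,2) \<tau>M[OF ec[OF a'] s fc[OF b']]] addhom_add[OF coordL_hom[OF a b]]
      polysum_add[OF G_summable[OF s] add(1,2)] smult_\<tau>[OF _ ec[OF a'] s fc[OF b']] by simp
next
  case (single u c)
  let ?z = "mon_restrict (range Zv) u" and ?y = "mon_restrict (range Yv) u" and ?x = "mon_restrict (range Xv) u"
  note mp = mon_parts[OF single]
  have kzx: "Poly_Mapping.keys (?z + ?x) \<subseteq> Vxyz" using keys_add[of ?z ?x] single by auto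
  note ez = YZ.smult_closed[OF mp(1) ec[OF a']] and ys = S.smult_closed[OF mp(2) s] and xf = XY.smult_closed[OF mp(3) fc[OF b']]
  have "coordL N G a b (Poly_Mapping.single u c \<odot>\<^bsub>M\<^esub> \<tau> (e a') s (f b'))
    = coordL N G a b (\<tau> (Poly_Mapping.single ?z 1 \<odot>\<^bsub>YY\<^esub> e a') (Poly_Mapping.single ?y 1 \<odot>\<^bsub>S\<^esub> s) (Poly_Mapping.single ?x c \<odot>\<^bsub>XX\<^esub> f b'))"
    using smult_single[OF single \<tau>M[OF ec[OF a'] s fc[OF b']]] monop(2)[OF single ec[OF a'] s fc[OF b']] by simp
  also have "\<dots> = polysum N (G (Poly_Mapping.single ?y 1 \<odot>\<^bsub>S\<^esub> s))
      (cY (Poly_Mapping.single ?z 1 \<odot>\<^bsub>YY\<^esub> e a') a * cX (Poly_Mapping.single ?x c \<odot>\<^bsub>XX\<^esub> f b') b)"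
    unfolding coordL_def by (rule M_lift(3)[OF N.abelian_group_axioms coordL_balanced[OF a b] ez ys xf])
  also have "\<dots> = (if a = a' \<and> b = b' then polysum N (G s) (Poly_Mapping.single u c) else \<zero>\<^bsub>N\<^esub>)"
  proof (cases "a = a' \<and> b = b'")
    case False
    then show ?thesis
      using coords_smult[OF YYm eB mp(1) ec[OF a'] a] coords_smult[OF XXm fB mp(3) fc[OF b'] b]
        coords_basis[OF YYm eB a' a] coords_basis[OF XXm fB b' b] polysum_0[OF G_summable[OF ys]] by auto
  next
    case True
    \<comment> \<open>The y-part of \<open>u\<close> went into the middle factor, while the z-part
      and the x-part reappear in the coordinates of the outer factors. The shift law puts the three
      parts together again.\<close>
    have "Poly_Mapping.keys ?y \<subseteq> yvars m" using single by auto
    then have "G (Poly_Mapping.single ?y 1 \<odot>\<^bsub>S\<^esub> s) (?z + ?x) c = G s (?y + (?z + ?x)) c"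
      using G_shift[OF s _ kzx, of ?y 1 c] by simp
    also have "?y + (?z + ?x) = u" using mon_restrict_xyz[of u] by (simp add: ac_simps)
    finally have "G (Poly_Mapping.single ?y 1 \<odot>\<^bsub>S\<^esub> s) (?z + ?x) c = G s u c" .
    then have "polysum N (G (Poly_Mapping.single ?y 1 \<odot>\<^bsub>S\<^esub> s)) (Poly_Mapping.single (?z + ?x) c) = polysum N (G s) (Poly_Mapping.single u c)"
      using polysum_single[OF G_summable[OF ys] kzx] polysum_single[OF G_summable[OF s] single] by simp
    then show ?thesis using True
        coords_smult[OF YYm eB mp(1) ec[OF a'] a] coords_smult[OF XXm fB mp(3) fc[OF b'] b]
        coords_basis[OF YYm eB a' a] coords_basis[OF XXm fB b' b] by (simp add: mult_single)
  qed
  finally show ?case .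
qed

end

end

lemma finsum_if_eq:
  assumes "abelian_group N" "v \<in> carrier N" "finite C" "i \<in> C"
  shows "(\<Oplus>\<^bsub>N\<^esub>j\<in>C. if j = i then v else \<zero>\<^bsub>N\<^esub>) = v"
proof -
  interpret N: abelian_group N by fact
  show ?thesis using N.finsum_singleton[of i C "\<lambda>_. v"] assms by (simp add: eq_commute[of _ i])
qed

lemma finsum_all_zero:
  assumes "abelian_group N" "\<And>i. i \<in> C \<Longrightarrow> g i = \<zero>\<^bsub>N\<^esub>"
  shows "(\<Oplus>\<^bsub>N\<^esub>i\<in>C. g i) = \<zero>\<^bsub>N\<^esub>"
proof -
  interpret N: abelian_group N by fact
  have "(\<Oplus>\<^bsub>N\<^esub>i\<in>C. g i) = (\<Oplus>\<^bsub>N\<^esub>i\<in>C. \<zero>\<^bsub>N\<^esub>)" by (rule N.finsum_cong') (auto simp: assms)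
  then show ?thesis by simp
qed

context cut_basis
begin

subsection \<open>Coefficients with respect to the bases and the monomials in x and z\<close>

text \<open>As a module over \<open>S\<close>-coefficients, the tensor product of \<open>S\<close>
  with k[x,y,z] over k[y] is a direct sum of copies of \<open>S\<close>, one for each monomial in x
  and z. This is the projection to the summand of \<open>w\<close>.\<close>

definition coefterm :: "(pvar \<Rightarrow>\<^sub>0 nat) \<Rightarrow> 's \<Rightarrow> (pvar \<Rightarrow>\<^sub>0 nat) \<Rightarrow> 'k \<Rightarrow> 's" where
  "coefterm w s u c = (if mr u = w then Poly_Mapping.single (my u) c \<odot>\<^bsub>S\<^esub> s else \<zero>\<^bsub>S\<^esub>)"

lemma my_mem: "Poly_Mapping.keys u \<subseteq> Vxyz \<Longrightarrow> Poly_Mapping.single (my u) c \<in> carrier Ry"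
  by (rule mpoly_single) (rule keys_my)

lemma mr_mem: "Poly_Mapping.keys u \<subseteq> Vxyz \<Longrightarrow> Poly_Mapping.single (mr u) c \<in> carrier R"
  using keys_mr[of u] by (intro mpoly_single) blast

lemma smult_S_hom: "r \<in> carrier Ry \<Longrightarrow> (\<lambda>s. r \<odot>\<^bsub>S\<^esub> s) \<in> addhom S S"
  by (rule is_linear_addhom[OF smult_lin(2)])

lemma coefterm_coordG: "coordG S (coefterm w)"
  unfolding coordG_def
proof (intro conjI ballI allI impI S_ab)
  fix s assume s: "s \<in> carrier S"
  show "polysummable S Vxyz (coefterm w s)"
  proof (rule polysummableI[OF S_ab])
    fix u :: "pvar \<Rightarrow>\<^sub>0 nat" and c c' assume u: "Poly_Mapping.keys u \<subseteq> Vxyz"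
    show "coefterm w s u c \<in> carrier S" using S.smult_closed[OF my_mem[OF u] s] by (simp add: coefterm_def)
    show "coefterm w s u (c + c') = coefterm w s u c \<oplus>\<^bsub>S\<^esub> coefterm w s u c'"
      using S.smult_l_distr[OF my_mem[OF u] my_mem[OF u] s, of c c'] by (simp add: coefterm_def single_add)
  qed
next
  fix u :: "pvar \<Rightarrow>\<^sub>0 nat" and c assume u: "Poly_Mapping.keys u \<subseteq> Vxyz"
  show "(\<lambda>s. coefterm w s u c) \<in> addhom S S"
    unfolding coefterm_def by (intro addhom_if S_ab smult_S_hom my_mem u)
next
  fix s and u' u :: "pvar \<Rightarrow>\<^sub>0 nat" and c' c assume s: "s \<in> carrier S" and u': "Poly_Mapping.keys u' \<subseteq> yvars m" and u: "Poly_Mapping.keys u \<subseteq> Vxyz"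
  have "Poly_Mapping.single (u' + my u) (c' * c) \<odot>\<^bsub>S\<^esub> s = Poly_Mapping.single (my u) c \<odot>\<^bsub>S\<^esub> (Poly_Mapping.single u' c' \<odot>\<^bsub>S\<^esub> s)"
    using S.smult_assoc1[OF my_mem[OF u] mpoly_single[OF u'] s, of c c'] by (simp add: mult_single ac_simps)
  then show "coefterm w s (u' + u) (c' * c) = coefterm w (Poly_Mapping.single u' c' \<odot>\<^bsub>S\<^esub> s) u c"
    by (simp add: coefterm_def mr_y[OF u'] my_y[OF u'])
qed

definition coef :: "(pvar \<Rightarrow>\<^sub>0 nat) \<Rightarrow> 'a \<Rightarrow> 'b \<Rightarrow> (('y \<times> 's \<times> 'x) \<Rightarrow>\<^sub>0 int) set \<Rightarrow> 's" where
  "coef w = coordL S (coefterm w)"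

lemma coef_hom: "a \<in> A \<Longrightarrow> b \<in> B \<Longrightarrow> coef w a b \<in> addhom M S"
  unfolding coef_def by (rule coordL_hom[OF coefterm_coordG])

lemmas coef_closed = coef_hom[THEN addhom_closed]

lemma polysum_coefterm:
  assumes "p \<in> carrier Rxz" and s: "s \<in> carrier S"
  shows "polysum S (coefterm w s) p = cpoly (Poly_Mapping.lookup p w) \<odot>\<^bsub>S\<^esub> s"
  using assms(1)
proof (induction p rule: mpoly_induct)
  case zero
  then show ?case using polysum_0[OF G_summable[OF coefterm_coordG s]] S.smult_l_null[OF s] by (simp add: cpoly_simps)
next
  case (single u c)
  then have u: "Poly_Mapping.keys u \<subseteq> Vxyz" by blast
  have "polysum S (coefterm w s) (Poly_Mapping.single u c) = coefterm w s u c"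
    by (rule polysum_single[OF G_summable[OF coefterm_coordG s] u])
  also have "\<dots> = cpoly (Poly_Mapping.lookup (Poly_Mapping.single u c) w) \<odot>\<^bsub>S\<^esub> s"
    unfolding coefterm_def mr_xz[OF single] my_xz[OF single]
    using S.smult_l_null[OF s] by (simp add: lookup_single when_def cpoly_def)
  finally show ?case .
next
  case (add p q)
  show ?case
    unfolding polysum_add[OF G_summable[OF coefterm_coordG s] add(1,2)[THEN Rxz_R]] lookup_add cpoly_simps add.IH
    using S.smult_l_distr[OF cpoly_mem cpoly_mem s] by simp
qed

lemma coef_basis:
  assumes "a \<in> A" "b \<in> B" "a' \<in> A" "b' \<in> B" "s \<in> carrier S" "p \<in> carrier Rxz"
  shows "coef w a b (p \<odot>\<^bsub>M\<^esub> \<tau> (e a') s (f b')) = (if a = a' \<and> b = b' then cpoly (Poly_Mapping.lookup p w) \<odot>\<^bsub>S\<^esub> s else \<zero>\<^bsub>S\<^esub>)"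
  unfolding coef_def coordL_basis[OF coefterm_coordG assms(1-5) Rxz_R[OF assms(6)]] polysum_coefterm[OF assms(6,5)] ..

text \<open>There are infinitely many monomials in x and z, and no finite set of them serves all
  elements; hence the explicit set \<open>F\<close>, which is adapted to \<open>v\<close>
  afterwards.\<close>

definition expand :: "(pvar \<Rightarrow>\<^sub>0 nat) set \<Rightarrow> (('y \<times> 's \<times> 'x) \<Rightarrow>\<^sub>0 int) set \<Rightarrow> (('y \<times> 's \<times> 'x) \<Rightarrow>\<^sub>0 int) set" where
  "expand F v = (\<Oplus>\<^bsub>M\<^esub>a\<in>A. \<Oplus>\<^bsub>M\<^esub>b\<in>B. \<Oplus>\<^bsub>M\<^esub>w\<in>F. Poly_Mapping.single w 1 \<odot>\<^bsub>M\<^esub> \<tau> (e a) (coef w a b v) (f b))"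

lemma single_Rxz: "Poly_Mapping.keys w \<subseteq> Vxz \<Longrightarrow> Poly_Mapping.single w c \<in> carrier Rxz"
  by (rule mpoly_single)

lemma expand_hom: "F \<subseteq> {w. Poly_Mapping.keys w \<subseteq> Vxz} \<Longrightarrow> expand F \<in> addhom M M"
proof -
  assume F: "F \<subseteq> {w. Poly_Mapping.keys w \<subseteq> Vxz}"
  have "(\<lambda>v. Poly_Mapping.single w 1 \<odot>\<^bsub>M\<^esub> \<tau> (e a) (coef w a b v) (f b)) \<in> addhom M M" if "a \<in> A" "b \<in> B" "w \<in> F" for a b w
    using F that(3)
    by (intro addhom_comp[OF addhom_comp[OF coef_hom[OF that(1,2)] \<tau>_homS[OF ec[OF that(1)] fc[OF that(2)]]] smult_addhom] Rxz_R single_Rxz) blast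
  then show ?thesis unfolding expand_def[abs_def] by (intro addhom_finsum_map M_ab)
qed

lemma expand_basis:
  assumes F: "finite F" "w \<in> F" "F \<subseteq> {w. Poly_Mapping.keys w \<subseteq> Vxz}" and a: "a \<in> A" and b: "b \<in> B" and s: "s \<in> carrier S"
  shows "expand F (Poly_Mapping.single w 1 \<odot>\<^bsub>M\<^esub> \<tau> (e a) s (f b)) = Poly_Mapping.single w 1 \<odot>\<^bsub>M\<^esub> \<tau> (e a) s (f b)"
    (is "expand F ?v = ?v")
proof -
  have w: "Poly_Mapping.keys w \<subseteq> Vxz" using F by blast
  have vM: "?v \<in> carrier M" by (rule smult_\<tau>[OF Rxz_R[OF single_Rxz[OF w]] ec[OF a] s fc[OF b]])
  have t: "Poly_Mapping.single w' 1 \<odot>\<^bsub>M\<^esub> \<tau> (e a') (coef w' a' b' ?v) (f b') = (if w' = w then (if a' = a \<and> b' = b then ?v else \<zero>\<^bsub>M\<^esub>) else \<zero>\<^bsub>M\<^esub>)"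
    if "w' \<in> F" "a' \<in> A" "b' \<in> B" for w' a' b'
  proof -
    have w': "Poly_Mapping.keys w' \<subseteq> Vxz" using F that by blast
    have "coef w' a' b' ?v = (if w' = w \<and> a' = a \<and> b' = b then s else \<zero>\<^bsub>S\<^esub>)"
      unfolding coef_basis[OF that(2,3) a b s single_Rxz[OF w]]
      using S.smult_l_null[OF s] S.smult_one[OF s] by (auto simp: lookup_single when_def cpoly_simps)
    then show ?thesis
      using \<tau>_zeroS[OF ec[OF that(2)] fc[OF that(3)]] addhom_zero[OF smult_addhom[OF Rxz_R[OF single_Rxz[OF w']]] M_ab M_ab]
      by auto
  qed
  have 1: "(\<Oplus>\<^bsub>M\<^esub>w'\<in>F. Poly_Mapping.single w' 1 \<odot>\<^bsub>M\<^esub> \<tau> (e a') (coef w' a' b' ?v) (f b')) = (if b' = b then (if a' = a then ?v else \<zero>\<^bsub>M\<^esub>) else \<zero>\<^bsub>M\<^esub>)"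
    if "a' \<in> A" "b' \<in> B" for a' b'
  proof -
    have "(\<Oplus>\<^bsub>M\<^esub>w'\<in>F. Poly_Mapping.single w' 1 \<odot>\<^bsub>M\<^esub> \<tau> (e a') (coef w' a' b' ?v) (f b')) =
      (\<Oplus>\<^bsub>M\<^esub>w'\<in>F. if w' = w then (if a' = a \<and> b' = b then ?v else \<zero>\<^bsub>M\<^esub>) else \<zero>\<^bsub>M\<^esub>)"
      using t[OF _ that] vM by (intro M.finsum_cong') auto
    also have "\<dots> = (if a' = a \<and> b' = b then ?v else \<zero>\<^bsub>M\<^esub>)"
      using vM by (intro finsum_if_eq[OF M_ab _ F(1,2)]) auto
    finally show ?thesis by simp
  qed
  have 2: "(\<Oplus>\<^bsub>M\<^esub>b'\<in>B. \<Oplus>\<^bsub>M\<^esub>w'\<in>F. Poly_Mapping.single w' 1 \<odot>\<^bsub>M\<^esub> \<tau> (e a') (coef w' a' b' ?v) (f b')) = (if a' = a then ?v else \<zero>\<^bsub>M\<^esub>)"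
    if "a' \<in> A" for a'
  proof -
    have "(\<Oplus>\<^bsub>M\<^esub>b'\<in>B. \<Oplus>\<^bsub>M\<^esub>w'\<in>F. Poly_Mapping.single w' 1 \<odot>\<^bsub>M\<^esub> \<tau> (e a') (coef w' a' b' ?v) (f b')) =
      (\<Oplus>\<^bsub>M\<^esub>b'\<in>B. if b' = b then (if a' = a then ?v else \<zero>\<^bsub>M\<^esub>) else \<zero>\<^bsub>M\<^esub>)"
      using 1[OF that] vM by (intro M.finsum_cong') auto
    also have "\<dots> = (if a' = a then ?v else \<zero>\<^bsub>M\<^esub>)"
      using vM by (intro finsum_if_eq[OF M_ab _ Bfin b]) auto
    finally show ?thesis .
  qed
  have "expand F ?v = (\<Oplus>\<^bsub>M\<^esub>a'\<in>A. if a' = a then ?v else \<zero>\<^bsub>M\<^esub>)"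
    unfolding expand_def using 2 vM by (intro M.finsum_cong') auto
  also have "\<dots> = ?v" by (rule finsum_if_eq[OF M_ab vM Afin a])
  finally show ?thesis .
qed

lemma expand_exists:
  assumes "v \<in> carrier M"
  shows "\<exists>F. finite F \<and> F \<subseteq> {w. Poly_Mapping.keys w \<subseteq> Vxz} \<and> expand F v = v"
proof -
  \<comment> \<open>The claim is strengthened to all larger finite sets, so that the sets found for
    two summands can be united.\<close>
  have "\<exists>F0. finite F0 \<and> F0 \<subseteq> {w. Poly_Mapping.keys w \<subseteq> Vxz} \<and>
    (\<forall>F. finite F \<longrightarrow> F0 \<subseteq> F \<longrightarrow> F \<subseteq> {w. Poly_Mapping.keys w \<subseteq> Vxz} \<longrightarrow> expand F v = v)"
    using assms
  proof (induction v rule: basis_induct)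
    case zero
    have "expand F \<zero>\<^bsub>M\<^esub> = \<zero>\<^bsub>M\<^esub>" if "F \<subseteq> {w. Poly_Mapping.keys w \<subseteq> Vxz}" for F
      by (rule addhom_zero[OF expand_hom[OF that] M_ab M_ab])
    then show ?case by (intro exI[of _ "{}"]) auto
  next
    case (basis w a s b)
    then show ?case
      by (intro exI[of _ "{w}"]) (use expand_basis[OF _ _ _ basis(2,4,3)] in auto)
  next
    case (add v v')
    obtain F0 where F0: "finite F0" "F0 \<subseteq> {w. Poly_Mapping.keys w \<subseteq> Vxz}"
      "\<And>F. finite F \<Longrightarrow> F0 \<subseteq> F \<Longrightarrow> F \<subseteq> {w. Poly_Mapping.keys w \<subseteq> Vxz} \<Longrightarrow> expand F v = v" using add(3) by blast
    obtain F1 where F1: "finite F1" "F1 \<subseteq> {w. Poly_Mapping.keys w \<subseteq> Vxz}"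
      "\<And>F. finite F \<Longrightarrow> F1 \<subseteq> F \<Longrightarrow> F \<subseteq> {w. Poly_Mapping.keys w \<subseteq> Vxz} \<Longrightarrow> expand F v' = v'" using add(4) by blast
    have "expand F (v \<oplus>\<^bsub>M\<^esub> v') = v \<oplus>\<^bsub>M\<^esub> v'" if "finite F" "F0 \<union> F1 \<subseteq> F" "F \<subseteq> {w. Poly_Mapping.keys w \<subseteq> Vxz}" for F
      using addhom_add[OF expand_hom[OF that(3)] add(1,2)] F0(3)[OF that(1) _ that(3)] F1(3)[OF that(1) _ that(3)] that(2) by simp
    then show ?case using F0(1,2) F1(1,2) by (intro exI[of _ "F0 \<union> F1"]) simp
  qed
  then obtain F0 where F0: "finite F0 \<and> F0 \<subseteq> {w. Poly_Mapping.keys w \<subseteq> Vxz} \<and>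
    (\<forall>F. finite F \<longrightarrow> F0 \<subseteq> F \<longrightarrow> F \<subseteq> {w. Poly_Mapping.keys w \<subseteq> Vxz} \<longrightarrow> expand F v = v)" by (elim exE)
  then show ?thesis by (intro exI[of _ F0]) simp
qed

subsection \<open>Coefficientwise extension of maps of the middle factor\<close>

text \<open>A map \<open>g\<close> of \<open>S\<close> that is only \<open>k\<close>-linear does not induce a map of the tensor product over \<open>k[y]\<close>; its
  extension \<open>middleext g\<close> acts on coordinates and depends on the chosen bases.\<close>

definition middleterm :: "('s \<Rightarrow> 's) \<Rightarrow> 'a \<Rightarrow> 'b \<Rightarrow> 's \<Rightarrow> (pvar \<Rightarrow>\<^sub>0 nat) \<Rightarrow> 'k \<Rightarrow> (('y \<times> 's \<times> 'x) \<Rightarrow>\<^sub>0 int) set" where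
  "middleterm g a b s u c = Poly_Mapping.single (mr u) 1 \<odot>\<^bsub>M\<^esub> \<tau> (e a) (g (Poly_Mapping.single (my u) c \<odot>\<^bsub>S\<^esub> s)) (f b)"

definition middleext :: "('s \<Rightarrow> 's) \<Rightarrow> (('y \<times> 's \<times> 'x) \<Rightarrow>\<^sub>0 int) set \<Rightarrow> (('y \<times> 's \<times> 'x) \<Rightarrow>\<^sub>0 int) set" where
  "middleext g v = (\<Oplus>\<^bsub>M\<^esub>a\<in>A. \<Oplus>\<^bsub>M\<^esub>b\<in>B. coordL M (middleterm g a b) a b v)"

context
  fixes g :: "'s \<Rightarrow> 's"
  assumes g: "g \<in> addhom S S"
    and gk: "\<And>c s. s \<in> carrier S \<Longrightarrow> g (cpoly c \<odot>\<^bsub>S\<^esub> s) = cpoly c \<odot>\<^bsub>S\<^esub> g s"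
begin

lemmas gc = addhom_closed[OF g]

lemma middleterm_hom_S:
  assumes a: "a \<in> A" and b: "b \<in> B" and u: "Poly_Mapping.keys u \<subseteq> Vxyz"
  shows "(\<lambda>s. Poly_Mapping.single (mr u) 1 \<odot>\<^bsub>M\<^esub> \<tau> (e a) (g s) (f b)) \<in> addhom S M"
  by (rule addhom_comp[OF addhom_comp[OF g \<tau>_homS[OF ec[OF a] fc[OF b]]] smult_addhom[OF mr_mem[OF u]]])

lemma middleterm_coordG:
  assumes a: "a \<in> A" and b: "b \<in> B" shows "coordG M (middleterm g a b)"
  unfolding coordG_def
proof (intro conjI ballI allI impI M_ab)
  fix s assume s: "s \<in> carrier S"
  show "polysummable M Vxyz (middleterm g a b s)"
  proof (rule polysummableI[OF M_ab])
    fix u :: "pvar \<Rightarrow>\<^sub>0 nat" and c c' assume u: "Poly_Mapping.keys u \<subseteq> Vxyz"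
    note h = middleterm_hom_S[OF a b u]
    show "middleterm g a b s u c \<in> carrier M" unfolding middleterm_def by (rule addhom_closed[OF h S.smult_closed[OF my_mem[OF u] s]])
    show "middleterm g a b s u (c + c') = middleterm g a b s u c \<oplus>\<^bsub>M\<^esub> middleterm g a b s u c'"
      using S.smult_l_distr[OF my_mem[OF u] my_mem[OF u] s, of c c']
        addhom_add[OF h S.smult_closed[OF my_mem[OF u] s] S.smult_closed[OF my_mem[OF u] s], of c c']
      by (simp add: middleterm_def single_add)
  qed
next
  fix u :: "pvar \<Rightarrow>\<^sub>0 nat" and c assume u: "Poly_Mapping.keys u \<subseteq> Vxyz"
  show "(\<lambda>s. middleterm g a b s u c) \<in> addhom S M"
    unfolding middleterm_def by (rule addhom_comp[OF smult_S_hom[OF my_mem[OF u]] middleterm_hom_S[OF a b u]])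
next
  fix s and u' u :: "pvar \<Rightarrow>\<^sub>0 nat" and c' c assume s: "s \<in> carrier S" and u': "Poly_Mapping.keys u' \<subseteq> yvars m" and u: "Poly_Mapping.keys u \<subseteq> Vxyz"
  have "Poly_Mapping.single (u' + my u) (c' * c) \<odot>\<^bsub>S\<^esub> s = Poly_Mapping.single (my u) c \<odot>\<^bsub>S\<^esub> (Poly_Mapping.single u' c' \<odot>\<^bsub>S\<^esub> s)"
    using S.smult_assoc1[OF my_mem[OF u] mpoly_single[OF u'] s, of c c'] by (simp add: mult_single ac_simps)
  then show "middleterm g a b s (u' + u) (c' * c) = middleterm g a b (Poly_Mapping.single u' c' \<odot>\<^bsub>S\<^esub> s) u c"
    by (simp add: middleterm_def mr_y[OF u'] my_y[OF u'])
qed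

lemma middleext_hom: "middleext g \<in> addhom M M"
  unfolding middleext_def[abs_def] by (intro addhom_finsum_map M_ab coordL_hom middleterm_coordG)

lemmas middleext_closed = addhom_closed[OF middleext_hom]

text \<open>The hypothesis that \<open>g\<close> commutes with constants enters here: the
  coefficient of each monomial has to pass through \<open>g\<close>, since only the monomial itself
  stays outside.\<close>

lemma polysum_middleterm:
  assumes a: "a \<in> A" and b: "b \<in> B" and s: "s \<in> carrier S" and "p \<in> carrier Rxz"
  shows "polysum M (middleterm g a b s) p = p \<odot>\<^bsub>M\<^esub> \<tau> (e a) (g s) (f b)"
  using assms(4)
proof (induction p rule: mpoly_induct)
  case zero
  show ?case unfolding polysum_0[OF G_summable[OF middleterm_coordG[OF a b] s]]
    by (rule smult_0[symmetric]) (intro \<tau>M ec fc a b gc s)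
next
  case (single u c)
  then have u: "Poly_Mapping.keys u \<subseteq> Vxyz" by blast
  have "Poly_Mapping.single u c = Poly_Mapping.single u 1 * cpoly c" by (simp add: cpoly_def mult_single)
  then have "Poly_Mapping.single u c \<odot>\<^bsub>M\<^esub> \<tau> (e a) (g s) (f b) = Poly_Mapping.single u 1 \<odot>\<^bsub>M\<^esub> (cpoly c \<odot>\<^bsub>M\<^esub> \<tau> (e a) (g s) (f b))"
    using smult_assoc[OF mpoly_single[OF u] cpoly_mem \<tau>M[OF ec[OF a] gc[OF s] fc[OF b]]] by simp
  also have "\<dots> = Poly_Mapping.single u 1 \<odot>\<^bsub>M\<^esub> \<tau> (e a) (g (cpoly c \<odot>\<^bsub>S\<^esub> s)) (f b)"
    unfolding smult_pure_S[OF cpoly_mem ec[OF a] gc[OF s] fc[OF b]] gk[OF s] ..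
  also have "\<dots> = middleterm g a b s u c" unfolding middleterm_def mr_xz[OF single] my_xz[OF single] cpoly_def ..
  finally show ?case using polysum_single[OF G_summable[OF middleterm_coordG[OF a b] s] u, of c] by simp
next
  case (add p q)
  show ?case unfolding polysum_add[OF G_summable[OF middleterm_coordG[OF a b] s] add(1,2)[THEN Rxz_R]] add.IH
    by (rule smult_add[OF add(1,2)[THEN Rxz_R], symmetric]) (intro \<tau>M ec fc a b gc s)
qed

lemma middleext_basis:
  assumes a: "a \<in> A" and b: "b \<in> B" and s: "s \<in> carrier S" and p: "p \<in> carrier Rxz"
  shows "middleext g (p \<odot>\<^bsub>M\<^esub> \<tau> (e a) s (f b)) = p \<odot>\<^bsub>M\<^esub> \<tau> (e a) (g s) (f b)" (is "middleext g ?v = ?w")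
proof -
  have w: "?w \<in> carrier M" by (intro smult_\<tau> Rxz_R p ec fc a b gc s)
  have 1: "coordL M (middleterm g a' b') a' b' ?v = (if b' = b then (if a' = a then ?w else \<zero>\<^bsub>M\<^esub>) else \<zero>\<^bsub>M\<^esub>)"
    if "a' \<in> A" "b' \<in> B" for a' b'
    unfolding coordL_basis[OF middleterm_coordG[OF that] that a b s Rxz_R[OF p]] polysum_middleterm[OF that s p] by auto
  have 2: "(\<Oplus>\<^bsub>M\<^esub>b'\<in>B. coordL M (middleterm g a' b') a' b' ?v) = (if a' = a then ?w else \<zero>\<^bsub>M\<^esub>)" if "a' \<in> A" for a'
  proof -
    have "(\<Oplus>\<^bsub>M\<^esub>b'\<in>B. coordL M (middleterm g a' b') a' b' ?v) = (\<Oplus>\<^bsub>M\<^esub>b'\<in>B. if b' = b then (if a' = a then ?w else \<zero>\<^bsub>M\<^esub>) else \<zero>\<^bsub>M\<^esub>)"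
      using 1[OF that] w by (intro M.finsum_cong') auto
    also have "\<dots> = (if a' = a then ?w else \<zero>\<^bsub>M\<^esub>)" using w by (intro finsum_if_eq[OF M_ab _ Bfin b]) auto
    finally show ?thesis .
  qed
  have "middleext g ?v = (\<Oplus>\<^bsub>M\<^esub>a'\<in>A. if a' = a then ?w else \<zero>\<^bsub>M\<^esub>)"
    unfolding middleext_def using 2 w by (intro M.finsum_cong') auto
  also have "\<dots> = ?w" by (rule finsum_if_eq[OF M_ab w Afin a])
  finally show ?thesis .
qed

lemma middleext_linear: "is_linear Rxz M M (middleext g)"
proof (rule is_linearI[OF middleext_hom])
  fix p v assume p: "p \<in> carrier Rxz" and "v \<in> carrier M"
  from this(2) show "middleext g (p \<odot>\<^bsub>M\<^esub> v) = p \<odot>\<^bsub>M\<^esub> middleext g v"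
  proof (induction v rule: basis_induct)
    case zero
    show ?case unfolding addhom_zero[OF smult_addhom[OF Rxz_R[OF p]] M_ab M_ab] addhom_zero[OF middleext_hom M_ab M_ab]
      by (simp add: addhom_zero[OF smult_addhom[OF Rxz_R[OF p]] M_ab M_ab])
  next
    case (basis w a s b)
    note w = single_Rxz[OF basis(1), of 1]
    show ?case
      unfolding smult_assoc[OF Rxz_R[OF p] Rxz_R[OF w] \<tau>M[OF ec[OF basis(2)] basis(3) fc[OF basis(4)]], symmetric]
        middleext_basis[OF basis(2,4,3) mpoly_mult[OF p w]] middleext_basis[OF basis(2,4,3) w]
      by (rule smult_assoc[OF Rxz_R[OF p] Rxz_R[OF w] \<tau>M[OF ec[OF basis(2)] gc[OF basis(3)] fc[OF basis(4)]]])
  next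
    case (add v v')
    then show ?case using addhom_add[OF smult_addhom[OF Rxz_R[OF p]]] addhom_add[OF middleext_hom] smult_closed[OF Rxz_R[OF p]] middleext_closed
      by simp
  qed
qed

text \<open>The condition \<open>P\<close> will be i = j, so that both values of \<delta>_ij in the
  rule [\<partial>_i, t_j] = \<delta>_ij are covered at once.\<close>

lemma middleext_leibniz:
  assumes t: "t \<in> carrier Ry" and gt: "\<And>s. s \<in> carrier S \<Longrightarrow> g (t \<odot>\<^bsub>S\<^esub> s) = t \<odot>\<^bsub>S\<^esub> g s \<oplus>\<^bsub>S\<^esub> (if P then s else \<zero>\<^bsub>S\<^esub>)"
    and v: "v \<in> carrier M"
  shows "middleext g (t \<odot>\<^bsub>M\<^esub> v) = t \<odot>\<^bsub>M\<^esub> middleext g v \<oplus>\<^bsub>M\<^esub> (if P then v else \<zero>\<^bsub>M\<^esub>)"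
  using v
proof (induction v rule: basis_induct)
  note tR = Ry_R[OF t]
  have h: "(\<lambda>v. middleext g (t \<odot>\<^bsub>M\<^esub> v)) \<in> addhom M M" "(\<lambda>v. t \<odot>\<^bsub>M\<^esub> middleext g v \<oplus>\<^bsub>M\<^esub> (if P then v else \<zero>\<^bsub>M\<^esub>)) \<in> addhom M M"
    by (rule addhom_comp[OF smult_addhom[OF tR] middleext_hom],
        intro addhom_plus addhom_comp[OF middleext_hom smult_addhom[OF tR]] addhom_if M_ab is_linear_addhom[OF is_linear_id])
  {
    case zero
    show ?case using addhom_zero[OF h(1) M_ab M_ab] addhom_zero[OF h(2) M_ab M_ab] by simp
  next
    case (add v w)
    then show ?case using addhom_add[OF h(1) add(1,2)] addhom_add[OF h(2) add(1,2)] by simp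
  next
    case (basis w a s b)
    note w = single_Rxz[OF basis(1), of 1]
    note aa = ec[OF basis(2)] and bb = fc[OF basis(4)] and s = basis(3)
    let ?w = "Poly_Mapping.single w (1::'k)"
    note ts = S.smult_closed[OF t s]
    \<comment> \<open>Multiplication by an element of k[y] is moved past the monomial in x and z and
      into the middle factor, where the rule for \<open>g\<close> applies.\<close>
    have sw: "t \<odot>\<^bsub>M\<^esub> (?w \<odot>\<^bsub>M\<^esub> \<tau> (e a) s' (f b)) = ?w \<odot>\<^bsub>M\<^esub> \<tau> (e a) (t \<odot>\<^bsub>S\<^esub> s') (f b)" if s': "s' \<in> carrier S" for s'
      unfolding smult_assoc[OF tR Rxz_R[OF w] \<tau>M[OF aa s' bb], symmetric] smult_pure_S[OF t aa s' bb, symmetric]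
        smult_assoc[OF Rxz_R[OF w] tR \<tau>M[OF aa s' bb], symmetric] by (simp only: mult.commute)
    have hS: "(\<lambda>s. ?w \<odot>\<^bsub>M\<^esub> \<tau> (e a) s (f b)) \<in> addhom S M"
      by (rule addhom_comp[OF \<tau>_homS[OF aa bb] smult_addhom[OF Rxz_R[OF w]]])
    have "(if P then s else \<zero>\<^bsub>S\<^esub>) \<in> carrier S" using s by simp
    note * = addhom_add[OF hS S.smult_closed[OF t gc[OF s]] this]
    show ?case
      unfolding sw[OF s] middleext_basis[OF basis(2,4) ts w] gt[OF s] * middleext_basis[OF basis(2,4) s w] sw[OF gc[OF s]]
      using addhom_zero[OF hS S_ab M_ab] by simp
  }
qed

text \<open>The extension is even because the bases are homogeneous: each basis tensor is an
  eigenvector of \<open>eps\<close>, and the extension only changes its middle factor, which carries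
  no parity.\<close>

lemma middleext_eps: "v \<in> carrier M \<Longrightarrow> eps (middleext g v) = middleext g (eps v)"
proof (induction v rule: basis_induct)
  case zero
  show ?case by (simp add: addhom_zero[OF middleext_hom M_ab M_ab] addhom_zero[OF eps_hom M_ab M_ab])
next
  case (add v w)
  then show ?case by (simp add: addhom_add[OF middleext_hom] addhom_add[OF eps_hom] eps_closed middleext_closed)
next
  case (basis w a s b)
  note w = single_Rxz[OF basis(1), of 1]
  note aa = ec[OF basis(2)] and bb = fc[OF basis(4)]
  obtain p q where pq: "e a \<in> homog YY p" "f b \<in> homog XX q" using eb fb basis unfolding homogeneous_basis_def by blast
  have 1: "eps (Poly_Mapping.single w 1 \<odot>\<^bsub>M\<^esub> \<tau> (e a) s' (f b)) = psgn M (p + q) (Poly_Mapping.single w 1 \<odot>\<^bsub>M\<^esub> \<tau> (e a) s' (f b))" if s': "s' \<in> carrier S" for s'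
    unfolding is_linear_smult[OF eps_linear Rxz_R[OF w] \<tau>M[OF aa s' bb]] eps_pure[OF aa s' bb]
      parity_inv_homog[OF gY pq(1)] parity_inv_homog[OF gX pq(2)] \<tau>_psgn[OF aa s' bb]
    by (rule is_linear_smult[OF is_linear_psgn[OF M_module] Rxz_R[OF w] \<tau>M[OF aa s' bb], symmetric])
  show ?case unfolding 1[OF basis(3)] addhom_psgn[OF middleext_hom M_ab smult_\<tau>[OF Rxz_R[OF w] aa basis(3) bb]]
     middleext_basis[OF basis(2,4,3) w] by (rule 1[OF gc[OF basis(3)]])
qed

text \<open>This is what will identify the extension with the operator that \<open>nabla\<close>
  picks by a definite description.\<close>

lemma middleext_unique:
  assumes D: "is_linear Rxz M M D" "\<And>a s b. a \<in> A \<Longrightarrow> s \<in> carrier S \<Longrightarrow> b \<in> B \<Longrightarrow> D (\<tau> (e a) s (f b)) = \<tau> (e a) (g s) (f b)"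
    and v: "v \<in> carrier M"
  shows "D v = middleext g v"
  using v
proof (induction v rule: basis_induct)
  case zero
  show ?case by (simp add: addhom_zero[OF middleext_hom M_ab M_ab] addhom_zero[OF is_linear_addhom[OF D(1)] M_ab M_ab])
next
  case (add v w)
  then show ?case by (simp add: addhom_add[OF middleext_hom] addhom_add[OF is_linear_addhom[OF D(1)]])
next
  case (basis w a s b)
  note w = single_Rxz[OF basis(1), of 1]
  show ?case unfolding middleext_basis[OF basis(2,4,3) w] is_linear_smult[OF D(1) w \<tau>M[OF ec[OF basis(2)] basis(3) fc[OF basis(4)]]]
    D(2)[OF basis(2,3,4)] ..
qed

lemma middleext_pure:
  assumes "a \<in> A" "s \<in> carrier S" "b \<in> B" shows "middleext g (\<tau> (e a) s (f b)) = \<tau> (e a) (g s) (f b)"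
  using middleext_basis[OF assms(1,3,2) mpoly_1] assms by (simp add: smult_1 ec fc gc)

end

subsection \<open>A finite basis\<close>

text \<open>Induction over basis tensors gives generation. For independence, the coefficient maps
  reduce an equation over k[x,z] to one equation over k in the middle factor for every monomial and
  every pair of outer basis vectors.\<close>

lemma M_finite_basis:
  assumes jb: "finite_basis (mpoly_ring {}) S J g"
  shows "finite_basis Rxz M (A \<times> B \<times> J) (\<lambda>(a, b, j). \<tau> (e a) (g j) (f b))"
proof -
  let ?I = "A \<times> B \<times> J" and ?g = "\<lambda>(a, b, j). \<tau> (e a) (g j) (f b)"
  have S0: "module (mpoly_ring {}) S" by (rule module_mpoly_mono[OF Sm]) simp
  interpret S0: module "mpoly_ring {}" S by (rule S0)
  have Jfin: "finite J" and jc: "\<And>j. j \<in> J \<Longrightarrow> g j \<in> carrier S"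
    by (rule fb_finite[OF S0 jb], rule fb_closed[OF S0 jb])
  have Ifin: "finite ?I" by (intro finite_cartesian_product Afin Bfin Jfin)
  have gI: "?g i \<in> carrier M" if "i \<in> ?I" for i using that by (auto simp: ec fc jc)
  have cg: "(\<lambda>i. c i \<odot>\<^bsub>M\<^esub> ?g i) \<in> ?I \<rightarrow> carrier M" if "\<And>i. i \<in> ?I \<Longrightarrow> c i \<in> carrier Rxz" for c
    using smult_closed[OF Rxz_R[OF that] gI] by blast
  let ?P = "\<lambda>v. \<exists>c. (\<forall>i\<in>?I. c i \<in> carrier Rxz) \<and> v = (\<Oplus>\<^bsub>M\<^esub>i\<in>?I. c i \<odot>\<^bsub>M\<^esub> ?g i)"
  have P0: "?P \<zero>\<^bsub>M\<^esub>"
  proof (intro exI conjI ballI)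
    show "\<zero>\<^bsub>M\<^esub> = (\<Oplus>\<^bsub>M\<^esub>i\<in>?I. 0 \<odot>\<^bsub>M\<^esub> ?g i)" by (rule finsum_all_zero[OF M_ab, symmetric]) (rule smult_0[OF gI])
  qed simp
  have Padd: "?P (v \<oplus>\<^bsub>M\<^esub> w)" if Pv: "?P v" and Pw: "?P w" for v w
  proof -
    obtain c where c0: "(\<forall>i\<in>?I. c i \<in> carrier Rxz) \<and> v = (\<Oplus>\<^bsub>M\<^esub>i\<in>?I. c i \<odot>\<^bsub>M\<^esub> ?g i)" using Pv by (elim exE)
    obtain c' where c0': "(\<forall>i\<in>?I. c' i \<in> carrier Rxz) \<and> w = (\<Oplus>\<^bsub>M\<^esub>i\<in>?I. c' i \<odot>\<^bsub>M\<^esub> ?g i)" using Pw by (elim exE)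
    note c = bspec[OF conjunct1[OF c0]] conjunct2[OF c0] and c' = bspec[OF conjunct1[OF c0']] conjunct2[OF c0']
    have "v \<oplus>\<^bsub>M\<^esub> w = (\<Oplus>\<^bsub>M\<^esub>i\<in>?I. c i \<odot>\<^bsub>M\<^esub> ?g i \<oplus>\<^bsub>M\<^esub> c' i \<odot>\<^bsub>M\<^esub> ?g i)"
      unfolding c(2) c'(2) by (rule M.finsum_addf[OF cg[OF c(1)] cg[OF c'(1)], symmetric])
    also have "\<dots> = (\<Oplus>\<^bsub>M\<^esub>i\<in>?I. (c i + c' i) \<odot>\<^bsub>M\<^esub> ?g i)"
    proof (rule M.finsum_cong'[OF refl])
      show "(\<lambda>i. (c i + c' i) \<odot>\<^bsub>M\<^esub> ?g i) \<in> ?I \<rightarrow> carrier M" by (rule cg) (intro mpoly_add c c')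
      fix i assume i: "i \<in> ?I"
      show "c i \<odot>\<^bsub>M\<^esub> ?g i \<oplus>\<^bsub>M\<^esub> c' i \<odot>\<^bsub>M\<^esub> ?g i = (c i + c' i) \<odot>\<^bsub>M\<^esub> ?g i"
        by (rule smult_add[OF Rxz_R[OF c(1)[OF i]] Rxz_R[OF c'(1)[OF i]] gI[OF i], symmetric])
    qed
    finally show ?thesis using c(1) c'(1) by (intro exI[of _ "\<lambda>i. c i + c' i"] conjI ballI mpoly_add)
  qed
  have Pel: "?P (r \<odot>\<^bsub>M\<^esub> ?g i)" if r: "r \<in> carrier Rxz" and i: "i \<in> ?I" for r i
  proof (intro exI conjI ballI)
    have "(\<Oplus>\<^bsub>M\<^esub>i'\<in>?I. (if i' = i then r else 0) \<odot>\<^bsub>M\<^esub> ?g i') = (\<Oplus>\<^bsub>M\<^esub>i'\<in>?I. if i' = i then r \<odot>\<^bsub>M\<^esub> ?g i else \<zero>\<^bsub>M\<^esub>)"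
      using smult_0[OF gI] smult_closed[OF Rxz_R[OF r] gI[OF i]] by (intro M.finsum_cong') auto
    also have "\<dots> = r \<odot>\<^bsub>M\<^esub> ?g i" by (rule finsum_if_eq[OF M_ab smult_closed[OF Rxz_R[OF r] gI[OF i]] Ifin i])
    finally show "r \<odot>\<^bsub>M\<^esub> ?g i = (\<Oplus>\<^bsub>M\<^esub>i'\<in>?I. (if i' = i then r else 0) \<odot>\<^bsub>M\<^esub> ?g i')" by simp
  qed (use r in simp)
  have Psum: "?P (\<Oplus>\<^bsub>M\<^esub>j\<in>C. h j)" if "finite C" "\<And>j. j \<in> C \<Longrightarrow> h j \<in> carrier M" "\<And>j. j \<in> C \<Longrightarrow> ?P (h j)" for C :: "'j set" and h
    using that
  proof (induction C rule: finite_induct)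
    case empty
    show ?case using P0 by simp
  next
    case (insert j C)
    have "(\<Oplus>\<^bsub>M\<^esub>j\<in>insert j C. h j) = h j \<oplus>\<^bsub>M\<^esub> (\<Oplus>\<^bsub>M\<^esub>j\<in>C. h j)" using insert by (intro M.finsum_insert) auto
    then show ?case using Padd[of "h j" "\<Oplus>\<^bsub>M\<^esub>j\<in>C. h j"] insert by simp
  qed
  have ex: "?P v" if "v \<in> carrier M" for v
    using that
  proof (induction v rule: basis_induct)
    case zero show ?case by (rule P0)
  next
    case (add v w)
    then show ?case by (intro Padd)
  next
    case (basis w a s b)
    note w = single_Rxz[OF basis(1), of 1] and aa = ec[OF basis(2)] and bb = fc[OF basis(4)] and s = basis(3)
    let ?w = "Poly_Mapping.single w (1::'k)" and ?c = "coords (mpoly_ring {}) S J g s"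
    have hS: "(\<lambda>s. ?w \<odot>\<^bsub>M\<^esub> \<tau> (e a) s (f b)) \<in> addhom S M"
      by (rule addhom_comp[OF \<tau>_homS[OF aa bb] smult_addhom[OF Rxz_R[OF w]]])
    have cc: "?c j \<in> carrier (mpoly_ring {})" if "j \<in> J" for j by (rule coords_closed[OF S0 jb s that])
    have cl: "(\<lambda>j. ?c j \<odot>\<^bsub>S\<^esub> g j) \<in> J \<rightarrow> carrier S" using S0.smult_closed[OF cc jc] by blast
    have "?w \<odot>\<^bsub>M\<^esub> \<tau> (e a) s (f b) = (\<Oplus>\<^bsub>M\<^esub>j\<in>J. ?w \<odot>\<^bsub>M\<^esub> \<tau> (e a) (?c j \<odot>\<^bsub>S\<^esub> g j) (f b))"
      by (subst coords_expand[OF S0 jb s], rule addhom_finsum[OF hS S_ab M_ab cl])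
    moreover have "?P \<dots>"
    proof (rule Psum[OF Jfin])
      fix j assume j: "j \<in> J"
      show "?w \<odot>\<^bsub>M\<^esub> \<tau> (e a) (?c j \<odot>\<^bsub>S\<^esub> g j) (f b) \<in> carrier M" by (rule addhom_closed[OF hS funcset_mem[OF cl j]])
      have cy: "?c j \<in> carrier Ry" by (rule mpoly_mono[OF _ cc[OF j]]) simp
      have cxz: "?c j \<in> carrier Rxz" by (rule mpoly_mono[OF _ cc[OF j]]) simp
      have "?w \<odot>\<^bsub>M\<^esub> \<tau> (e a) (?c j \<odot>\<^bsub>S\<^esub> g j) (f b) = (?w * ?c j) \<odot>\<^bsub>M\<^esub> \<tau> (e a) (g j) (f b)"
        unfolding smult_pure_S[OF cy aa jc[OF j] bb, symmetric]
        by (rule smult_assoc[OF Rxz_R[OF w] Ry_R[OF cy] \<tau>M[OF aa jc[OF j] bb], symmetric])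
      then show "?P (?w \<odot>\<^bsub>M\<^esub> \<tau> (e a) (?c j \<odot>\<^bsub>S\<^esub> g j) (f b))"
        using Pel[OF mpoly_mult[OF w cxz], of "(a, b, j)"] basis j by simp
    qed
    ultimately show ?case by simp
  qed
  \<comment> \<open>Applied to a combination with polynomial coefficients, a coefficient map returns
    a combination of the \<open>g j\<close> over k, whose scalars are the coefficients of
    \<open>w\<close> in those polynomials. Uniqueness of coordinates in \<open>S\<close> then
    determines them.\<close>
  have kapsum: "coef w a b (\<Oplus>\<^bsub>M\<^esub>i\<in>?I. c i \<odot>\<^bsub>M\<^esub> ?g i) = (\<Oplus>\<^bsub>S\<^esub>j\<in>J. cpoly (Poly_Mapping.lookup (c (a, b, j)) w) \<odot>\<^bsub>S\<^esub> g j)"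
    if c: "\<And>i. i \<in> ?I \<Longrightarrow> c i \<in> carrier Rxz" and a: "a \<in> A" and b: "b \<in> B" for c w a b
  proof -
    let ?h = "\<lambda>i. if fst i = a \<and> fst (snd i) = b then cpoly (Poly_Mapping.lookup (c i) w) \<odot>\<^bsub>S\<^esub> g (snd (snd i)) else \<zero>\<^bsub>S\<^esub>"
    have hc: "?h \<in> ?I \<rightarrow> carrier S" using S.smult_closed[OF cpoly_mem jc] by auto
    have "coef w a b (\<Oplus>\<^bsub>M\<^esub>i\<in>?I. c i \<odot>\<^bsub>M\<^esub> ?g i) = (\<Oplus>\<^bsub>S\<^esub>i\<in>?I. coef w a b (c i \<odot>\<^bsub>M\<^esub> ?g i))"
      by (rule addhom_finsum[OF coef_hom[OF a b] M_ab S_ab cg[OF c]])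
    also have "\<dots> = (\<Oplus>\<^bsub>S\<^esub>i\<in>?I. ?h i)"
    proof (rule S.finsum_cong'[OF refl hc])
      fix i assume i: "i \<in> ?I"
      obtain a' b' j where ii: "i = (a', b', j)" by (cases i)
      then show "coef w a b (c i \<odot>\<^bsub>M\<^esub> ?g i) = ?h i"
        using i coef_basis[OF a b _ _ jc c[OF i], of a' b' j w] by auto
    qed
    also have "\<dots> = (\<Oplus>\<^bsub>S\<^esub>i\<in>(\<lambda>j. (a, b, j)) ` J. ?h i)"
      using Ifin a b hc by (intro S.add.finprod_mono_neutral_cong_right) auto
    also have "\<dots> = (\<Oplus>\<^bsub>S\<^esub>j\<in>J. ?h (a, b, j))"
      using a b S.smult_closed[OF cpoly_mem jc] by (intro S.finsum_reindex) (auto simp: inj_on_def)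
    finally show ?thesis by simp
  qed
  show ?thesis unfolding finite_basis_def
  proof (intro conjI ballI Ifin)
    show "?g \<in> ?I \<rightarrow> carrier M" using gI by blast
    fix v assume "v \<in> carrier M"
    from ex[OF this] obtain c where c0: "(\<forall>i\<in>?I. c i \<in> carrier Rxz) \<and> v = (\<Oplus>\<^bsub>M\<^esub>i\<in>?I. c i \<odot>\<^bsub>M\<^esub> ?g i)" by (elim exE)
    note c = conjunct1[OF c0] conjunct2[OF c0]
    show "\<exists>!c. c \<in> ?I \<rightarrow>\<^sub>E carrier Rxz \<and> v = (\<Oplus>\<^bsub>M\<^esub>i\<in>?I. c i \<odot>\<^bsub>M\<^esub> ?g i)"
    proof (rule ex_ex1I)
      have "v = (\<Oplus>\<^bsub>M\<^esub>i\<in>?I. restrict c ?I i \<odot>\<^bsub>M\<^esub> ?g i)"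
        unfolding c(2) by (rule M.finsum_cong'[OF refl cg]) (simp_all add: c(1)[rule_format])
      then show "\<exists>c. c \<in> ?I \<rightarrow>\<^sub>E carrier Rxz \<and> v = (\<Oplus>\<^bsub>M\<^esub>i\<in>?I. c i \<odot>\<^bsub>M\<^esub> ?g i)"
        using c(1) by (intro exI[of _ "restrict c ?I"] conjI) auto
    next
      fix c c' assume c: "c \<in> ?I \<rightarrow>\<^sub>E carrier Rxz \<and> v = (\<Oplus>\<^bsub>M\<^esub>i\<in>?I. c i \<odot>\<^bsub>M\<^esub> ?g i)"
        and c': "c' \<in> ?I \<rightarrow>\<^sub>E carrier Rxz \<and> v = (\<Oplus>\<^bsub>M\<^esub>i\<in>?I. c' i \<odot>\<^bsub>M\<^esub> ?g i)"
      have cI: "\<And>i. i \<in> ?I \<Longrightarrow> c i \<in> carrier Rxz" "\<And>i. i \<in> ?I \<Longrightarrow> c' i \<in> carrier Rxz" using c c' by (auto simp: PiE_iff)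
      show "c = c'"
      proof (rule PiE_ext[OF conjunct1[OF c] conjunct1[OF c']])
        fix i assume i: "i \<in> ?I"
        obtain a b j where ii: "i = (a, b, j)" "a \<in> A" "b \<in> B" "j \<in> J" using i by auto
        show "c i = c' i"
        proof (rule poly_mapping_eqI)
          fix w
          let ?s = "coef w a b v"
          have "coords (mpoly_ring {}) S J g ?s j = cpoly (Poly_Mapping.lookup (c (a, b, j)) w)"
            using kapsum[OF cI(1) ii(2,3)] c by (intro coords_unique[OF S0 jb _ _ ii(4)]) auto
          moreover have "coords (mpoly_ring {}) S J g ?s j = cpoly (Poly_Mapping.lookup (c' (a, b, j)) w)"
            using kapsum[OF cI(2) ii(2,3)] c' by (intro coords_unique[OF S0 jb _ _ ii(4)]) auto
          ultimately have "cpoly (Poly_Mapping.lookup (c i) w) = cpoly (Poly_Mapping.lookup (c' i) w)" by (simp add: ii)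
          then show "Poly_Mapping.lookup (c i) w = Poly_Mapping.lookup (c' i) w"
            unfolding cpoly_def by (metis lookup_single_eq)
        qed
      qed
    qed
  qed
qed

end

lemmas (in abelian_group) abelian_group_simprules
  [algebra ring "ring.zero G" "ring.add G" "a_inv G" "a_minus G" "monoid.one G" "monoid.mult G"] =
  a_closed zero_closed a_inv_closed minus_closed
  a_assoc l_zero l_neg a_comm minus_eq r_zero r_neg r_neg2 r_neg1 minus_add minus_minus minus_zero a_lcomm

text \<open>The additive content of the graded Jacobi identity for d, an even \<nabla> and an odd Q.
  The six terms stand for a = d\<nabla>Q, b = dQ\<nabla>, c = \<nabla>Qd, e = Q\<nabla>d, f =
  \<nabla>dQ and g = Qd\<nabla>.\<close>

lemma (in abelian_group) commutator_rearrange: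
  assumes "a \<in> carrier G" "b \<in> carrier G" "c \<in> carrier G" "e \<in> carrier G" "f \<in> carrier G" "g \<in> carrier G"
  shows "(a \<ominus> b) \<oplus> (c \<ominus> e) = ((a \<ominus> f) \<oplus> (g \<ominus> e)) \<oplus> ((f \<oplus> c) \<ominus> (b \<oplus> g))"
  using assms by algebra

section \<open>Reduction of operators modulo t\<close>

text \<open>The prefix \<open>J\<close> refers to the reduced middle factor \<open>S\<close> and
  \<open>H\<close> to the completed one \<open>S'\<close>. The assumptions present \<open>S\<close>
  as the quotient of \<open>S'\<close> by the t_j, which is all that the reduction of operators
  uses.\<close>

locale cut_pair =
  J: cut_basis n m l YY XX S U V W hf A e B f + H: cut_basis n m l YY XX S' U V W hf A e B f
  for n m l and YY :: "(('k::comm_ring_1) pol, 'y) mf" and XX :: "('k pol, 'x) mf"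
    and S :: "('k pol, 's) module" and S' :: "('k pol, 'h) module" and U V W hf
    and A :: "'a set" and e and B :: "'b set" and f +
  fixes q :: "'h \<Rightarrow> 's" and t :: "nat \<Rightarrow> 'k pol"
  assumes q: "is_linear (mpoly_ring (yvars m)) S' S q"
    and q_surj: "\<And>s. s \<in> carrier S \<Longrightarrow> \<exists>h\<in>carrier S'. q h = s"
    and t: "\<And>j. j < m \<Longrightarrow> t j \<in> carrier (mpoly_ring (yvars m))"
    and q_kernel: "\<And>h. h \<in> carrier S' \<Longrightarrow> q h = \<zero>\<^bsub>S\<^esub> \<Longrightarrow>
      \<exists>c. (\<forall>j<m. c j \<in> carrier S') \<and> h = (\<Oplus>\<^bsub>S'\<^esub>j\<in>{..<m}. t j \<odot>\<^bsub>S'\<^esub> c j)"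
    and t_zero: "\<And>j s. j < m \<Longrightarrow> s \<in> carrier S \<Longrightarrow> t j \<odot>\<^bsub>S\<^esub> s = \<zero>\<^bsub>S\<^esub>"
begin

lemmas qc = is_linear_closed[OF q]

definition reduce :: "(('y \<times> 'h \<times> 'x) \<Rightarrow>\<^sub>0 int) set \<Rightarrow> (('y \<times> 's \<times> 'x) \<Rightarrow>\<^sub>0 int) set" where
  "reduce = tensor_lift J.Ry YY S' XX J.T (\<lambda>y h x. J.\<tau> y (q h) x)"

lemma reduce_balanced: "balanced J.Ry YY S' XX J.T (\<lambda>y h x. J.\<tau> y (q h) x)"
  by (rule balanced_maps[OF H.tensor3_axioms J.tensor3_axioms is_linear_id q is_linear_id])

lemma reduce_hom: "reduce \<in> addhom H.M J.M"
  unfolding reduce_def using H.lift(1)[OF J.T_comm_group reduce_balanced] unfolding H.homT J.homT .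

lemma reduce_pure: "y \<in> carrier YY \<Longrightarrow> h \<in> carrier S' \<Longrightarrow> x \<in> carrier XX \<Longrightarrow> reduce (H.\<tau> y h x) = J.\<tau> y (q h) x"
  unfolding reduce_def by (rule H.lift(3)[OF J.T_comm_group reduce_balanced])

lemma reduce_linear: "is_linear J.R H.M J.M reduce"
proof (rule H.M_linearI[OF J.M_module reduce_hom])
  fix p y s x assume c: "p \<in> carrier J.Ryz" "y \<in> carrier YY" "s \<in> carrier S'" "x \<in> carrier XX"
  show "reduce (H.\<tau> (p \<odot>\<^bsub>YY\<^esub> y) s x) = p \<odot>\<^bsub>J.M\<^esub> reduce (H.\<tau> y s x)"
    unfolding reduce_pure[OF J.YZ.smult_closed[OF c(1,2)] c(3,4)] reduce_pure[OF c(2-4)]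
    by (rule J.smult_pure_YZ[OF c(1,2) qc[OF c(3)] c(4), symmetric])
next
  fix p y s x assume c: "p \<in> carrier J.Rxy" "y \<in> carrier YY" "s \<in> carrier S'" "x \<in> carrier XX"
  show "reduce (H.\<tau> y s (p \<odot>\<^bsub>XX\<^esub> x)) = p \<odot>\<^bsub>J.M\<^esub> reduce (H.\<tau> y s x)"
    unfolding reduce_pure[OF c(2,3) J.XY.smult_closed[OF c(1,4)]] reduce_pure[OF c(2-4)]
    by (rule J.smult_pure_XY[OF c(1,2) qc[OF c(3)] c(4), symmetric])
qed

lemmas reduce_closed = is_linear_closed[OF reduce_linear] and reduce_smult = is_linear_smult[OF reduce_linear] and reduce_add = addhom_add[OF reduce_hom]

lemma reduce_minus: "v \<in> carrier H.M \<Longrightarrow> w \<in> carrier H.M \<Longrightarrow> reduce (v \<ominus>\<^bsub>H.M\<^esub> w) = reduce v \<ominus>\<^bsub>J.M\<^esub> reduce w"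
  by (rule addhom_minus[OF reduce_hom H.M_ab J.M_ab])

lemma reduce_psgn: "v \<in> carrier H.M \<Longrightarrow> reduce (psgn H.M p v) = psgn J.M p (reduce v)"
  by (simp add: psgn_def addhom_neg[OF reduce_hom H.M_ab J.M_ab])

lemma reduce_tmap:
  assumes g: "is_linear J.Ryz YY YY g" and h: "is_linear J.Rxy XX XX h" and v: "v \<in> carrier H.M"
  shows "reduce (H.tmap g h v) = J.tmap g h (reduce v)"
proof (rule H.M_addhom_eqI[OF _ _ J.M_ab _ v])
  show "(\<lambda>v. reduce (H.tmap g h v)) \<in> addhom H.M J.M" by (rule addhom_comp[OF is_linear_addhom[OF H.tmap_linear[OF g h]] reduce_hom])
  show "(\<lambda>v. J.tmap g h (reduce v)) \<in> addhom H.M J.M" by (rule addhom_comp[OF reduce_hom is_linear_addhom[OF J.tmap_linear[OF g h]]])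
  fix y s x assume c: "y \<in> carrier YY" "s \<in> carrier S'" "x \<in> carrier XX"
  show "reduce (H.tmap g h (H.\<tau> y s x)) = J.tmap g h (reduce (H.\<tau> y s x))"
    unfolding H.tmap_pure[OF g h c] reduce_pure[OF c] J.tmap_pure[OF g h c(1) qc[OF c(2)] c(3)]
    by (rule reduce_pure[OF is_linear_closed[OF g c(1)] c(2) is_linear_closed[OF h c(3)]])
qed

lemma reduce_d: "v \<in> carrier H.M \<Longrightarrow> reduce (H.d v) = J.d (reduce v)"
  unfolding H.d_eq J.d_eq[OF reduce_closed]
  using is_linear_closed[OF H.tmap_linear[OF J.dY J.id_X]] is_linear_closed[OF H.tmap_linear[OF J.PYl J.dX]]
  by (simp add: reduce_add reduce_tmap[OF J.dY J.id_X] reduce_tmap[OF J.PYl J.dX])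

lemma reduce_eps: "v \<in> carrier H.M \<Longrightarrow> reduce (H.eps v) = J.eps (reduce v)"
  by (rule reduce_tmap[OF J.PYl J.PXl])

lemma reduce_surj: "v \<in> carrier J.M \<Longrightarrow> \<exists>u\<in>carrier H.M. reduce u = v"
proof (induction v rule: J.M_induct)
  case zero
  show ?case using addhom_zero[OF reduce_hom H.M_ab J.M_ab] by (intro bexI[of _ "\<zero>\<^bsub>H.M\<^esub>"]) auto
next
  case (pure y s x)
  obtain h where h: "h \<in> carrier S'" "q h = s" using q_surj[OF pure(2)] by (elim bexE)
  then show ?case using pure by (intro bexI[of _ "H.\<tau> y h x"]) (simp_all add: reduce_pure)
next
  case (add v w)
  then obtain u u' where "u \<in> carrier H.M" "reduce u = v" "u' \<in> carrier H.M" "reduce u' = w" by (elim bexE)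
  then show ?case by (intro bexI[of _ "u \<oplus>\<^bsub>H.M\<^esub> u'"]) (simp_all add: reduce_add)
qed

lemma J_t_zero:
  assumes "j < m" "v \<in> carrier J.M" shows "t j \<odot>\<^bsub>J.M\<^esub> v = \<zero>\<^bsub>J.M\<^esub>"
proof (rule J.M_addhom_eqI[OF J.smult_addhom[OF J.Ry_R[OF t[OF assms(1)]]] addhom_const_zero[OF J.M_ab] J.M_ab _ assms(2)])
  fix y s x assume c: "y \<in> carrier YY" "s \<in> carrier S" "x \<in> carrier XX"
  show "t j \<odot>\<^bsub>J.M\<^esub> J.\<tau> y s x = \<zero>\<^bsub>J.M\<^esub>"
    unfolding J.smult_pure_S[OF t[OF assms(1)] c] t_zero[OF assms(1) c(2)] by (rule J.\<tau>_zeroS[OF c(1,3)])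
qed

lemma reduce_t:
  assumes "j < m" "v \<in> carrier H.M" shows "reduce (t j \<odot>\<^bsub>H.M\<^esub> v) = \<zero>\<^bsub>J.M\<^esub>"
  unfolding reduce_smult[OF J.Ry_R[OF t[OF assms(1)]] assms(2)] by (rule J_t_zero[OF assms(1) reduce_closed[OF assms(2)]])

lemma coef_reduce:
  assumes a: "a \<in> A" and b: "b \<in> B" and v: "v \<in> carrier H.M"
  shows "J.coef w a b (reduce v) = q (H.coef w a b v)"
proof -
  have h: "(\<lambda>v. J.coef w a b (reduce v)) \<in> addhom H.M S" "(\<lambda>v. q (H.coef w a b v)) \<in> addhom H.M S"
    by (rule addhom_comp[OF reduce_hom J.coef_hom[OF a b]], rule addhom_comp[OF H.coef_hom[OF a b] is_linear_addhom[OF q]])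
  show ?thesis using v
  proof (induction v rule: H.basis_induct)
    case zero
    show ?case using addhom_zero[OF h(1) H.M_ab J.S_ab] addhom_zero[OF h(2) H.M_ab J.S_ab] by simp
  next
    case (add v w)
    then show ?case using addhom_add[OF h(1) add(1,2)] addhom_add[OF h(2) add(1,2)] by simp
  next
    case (basis w' a' s b')
    note w' = J.single_Rxz[OF basis(1), of 1]
    have "reduce (Poly_Mapping.single w' 1 \<odot>\<^bsub>H.M\<^esub> H.\<tau> (e a') s (f b')) = Poly_Mapping.single w' 1 \<odot>\<^bsub>J.M\<^esub> J.\<tau> (e a') (q s) (f b')"
      unfolding reduce_smult[OF J.Rxz_R[OF w'] H.\<tau>M[OF J.ec[OF basis(2)] basis(3) J.fc[OF basis(4)]]]
        reduce_pure[OF J.ec[OF basis(2)] basis(3) J.fc[OF basis(4)]] ..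
    then show ?case
      using J.coef_basis[OF a b basis(2,4) qc[OF basis(3)] w', of w] H.coef_basis[OF a b basis(2,4,3) w', of w]
        is_linear_smult[OF q cpoly_mem basis(3)] addhom_zero[OF is_linear_addhom[OF q] H.S_ab J.S_ab] by simp
  qed
qed

text \<open>All coefficients of an element of the kernel lie in the kernel of \<open>q\<close>,
  hence are combinations of the t_j; so the element itself is a combination of multiples of the t_j.
  Stating this for an additive map \<open>G\<close> that kills such multiples avoids assembling that
  combination.\<close>

lemma reduce_kernel:
  assumes G: "G \<in> addhom H.M N" "abelian_group N"
    and Gt: "\<And>j u. j < m \<Longrightarrow> u \<in> carrier H.M \<Longrightarrow> G (t j \<odot>\<^bsub>H.M\<^esub> u) = \<zero>\<^bsub>N\<^esub>"
    and v: "v \<in> carrier H.M" "reduce v = \<zero>\<^bsub>J.M\<^esub>"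
  shows "G v = \<zero>\<^bsub>N\<^esub>"
proof -
  interpret N: abelian_group N by fact
  obtain F where F: "finite F \<and> F \<subseteq> {w. Poly_Mapping.keys w \<subseteq> J.Vxz} \<and> H.expand F v = v"
    using H.expand_exists[OF v(1)] by (elim exE)
  have term0: "G (Poly_Mapping.single w 1 \<odot>\<^bsub>H.M\<^esub> H.\<tau> (e a) (H.coef w a b v) (f b)) = \<zero>\<^bsub>N\<^esub>"
    and termc: "Poly_Mapping.single w 1 \<odot>\<^bsub>H.M\<^esub> H.\<tau> (e a) (H.coef w a b v) (f b) \<in> carrier H.M"
    if a: "a \<in> A" and b: "b \<in> B" and w: "w \<in> F" for a b w
  proof -
    have wR: "Poly_Mapping.single w 1 \<in> carrier J.R"
      by (rule J.Rxz_R[OF J.single_Rxz]) (use F w in blast)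
    let ?h = "H.coef w a b v"
    have hc: "?h \<in> carrier S'" by (rule H.coef_closed[OF a b v(1)])
    have "q ?h = J.coef w a b \<zero>\<^bsub>J.M\<^esub>" using coef_reduce[OF a b v(1), of w] v(2) by simp
    then have "q ?h = \<zero>\<^bsub>S\<^esub>" using addhom_zero[OF J.coef_hom[OF a b] J.M_ab J.S_ab] by simp
    from q_kernel[OF hc this] obtain c where c0: "(\<forall>j<m. c j \<in> carrier S') \<and> ?h = (\<Oplus>\<^bsub>S'\<^esub>j\<in>{..<m}. t j \<odot>\<^bsub>S'\<^esub> c j)"
      by (elim exE)
    have c: "c j \<in> carrier S'" if "j < m" for j using c0 that by blast
    let ?L = "\<lambda>s. Poly_Mapping.single w 1 \<odot>\<^bsub>H.M\<^esub> H.\<tau> (e a) s (f b)"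
    have L: "?L \<in> addhom S' H.M"
      by (rule addhom_comp[OF H.\<tau>_homS[OF J.ec[OF a] J.fc[OF b]] H.smult_addhom[OF wR]])
    show "?L ?h \<in> carrier H.M" by (rule addhom_closed[OF L hc])
    have tc: "(\<lambda>j. t j \<odot>\<^bsub>S'\<^esub> c j) \<in> {..<m} \<rightarrow> carrier S'" using H.S.smult_closed[OF t c] by auto
    have "G (?L ?h) = (\<Oplus>\<^bsub>N\<^esub>j\<in>{..<m}. G (?L (t j \<odot>\<^bsub>S'\<^esub> c j)))"
      by (subst conjunct2[OF c0], rule addhom_finsum[OF addhom_comp[OF L G(1)] H.S_ab G(2) tc])
    also have "\<dots> = \<zero>\<^bsub>N\<^esub>"
    proof (rule finsum_all_zero[OF G(2)])
      fix j assume "j \<in> {..<m}"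
      then have j: "j < m" by simp
      note cc = H.\<tau>M[OF J.ec[OF a] c[OF j] J.fc[OF b]]
      have "?L (t j \<odot>\<^bsub>S'\<^esub> c j) = t j \<odot>\<^bsub>H.M\<^esub> ?L (c j)"
        unfolding H.smult_pure_S[OF t[OF j] J.ec[OF a] c[OF j] J.fc[OF b], symmetric]
          H.smult_assoc[OF wR J.Ry_R[OF t[OF j]] cc, symmetric] H.smult_assoc[OF J.Ry_R[OF t[OF j]] wR cc, symmetric]
        by (simp only: mult.commute)
      then show "G (?L (t j \<odot>\<^bsub>S'\<^esub> c j)) = \<zero>\<^bsub>N\<^esub>" using Gt[OF j addhom_closed[OF L c[OF j]]] by simp
    qed
    finally show "G (?L ?h) = \<zero>\<^bsub>N\<^esub>" .
  qed
  have "G v = G (H.expand F v)" using F by simp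
  also have "\<dots> = (\<Oplus>\<^bsub>N\<^esub>a\<in>A. G (\<Oplus>\<^bsub>H.M\<^esub>b\<in>B. \<Oplus>\<^bsub>H.M\<^esub>w\<in>F. Poly_Mapping.single w 1 \<odot>\<^bsub>H.M\<^esub> H.\<tau> (e a) (H.coef w a b v) (f b)))"
    unfolding H.expand_def using termc by (intro addhom_finsum[OF G(1) H.M_ab G(2)]) (auto intro!: H.M.finsum_closed)
  also have "\<dots> = \<zero>\<^bsub>N\<^esub>"
  proof (rule finsum_all_zero[OF G(2)])
    fix a assume a: "a \<in> A"
    have "G (\<Oplus>\<^bsub>H.M\<^esub>b\<in>B. \<Oplus>\<^bsub>H.M\<^esub>w\<in>F. Poly_Mapping.single w 1 \<odot>\<^bsub>H.M\<^esub> H.\<tau> (e a) (H.coef w a b v) (f b))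
      = (\<Oplus>\<^bsub>N\<^esub>b\<in>B. G (\<Oplus>\<^bsub>H.M\<^esub>w\<in>F. Poly_Mapping.single w 1 \<odot>\<^bsub>H.M\<^esub> H.\<tau> (e a) (H.coef w a b v) (f b)))"
      using termc[OF a] by (intro addhom_finsum[OF G(1) H.M_ab G(2)]) (auto intro!: H.M.finsum_closed)
    also have "\<dots> = \<zero>\<^bsub>N\<^esub>"
    proof (rule finsum_all_zero[OF G(2)])
      fix b assume b: "b \<in> B"
      have "G (\<Oplus>\<^bsub>H.M\<^esub>w\<in>F. Poly_Mapping.single w 1 \<odot>\<^bsub>H.M\<^esub> H.\<tau> (e a) (H.coef w a b v) (f b))
        = (\<Oplus>\<^bsub>N\<^esub>w\<in>F. G (Poly_Mapping.single w 1 \<odot>\<^bsub>H.M\<^esub> H.\<tau> (e a) (H.coef w a b v) (f b)))"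
        using termc[OF a b] by (intro addhom_finsum[OF G(1) H.M_ab G(2)]) auto
      also have "\<dots> = \<zero>\<^bsub>N\<^esub>" by (rule finsum_all_zero[OF G(2) term0[OF a b]])
      finally show "G (\<Oplus>\<^bsub>H.M\<^esub>w\<in>F. Poly_Mapping.single w 1 \<odot>\<^bsub>H.M\<^esub> H.\<tau> (e a) (H.coef w a b v) (f b)) = \<zero>\<^bsub>N\<^esub>" .
    qed
    finally show "G (\<Oplus>\<^bsub>H.M\<^esub>b\<in>B. \<Oplus>\<^bsub>H.M\<^esub>w\<in>F. Poly_Mapping.single w 1 \<odot>\<^bsub>H.M\<^esub> H.\<tau> (e a) (H.coef w a b v) (f b)) = \<zero>\<^bsub>N\<^esub>" .
  qed
  finally show ?thesis .
qed

text \<open>The operators that descend modulo \<open>t\<close>.\<close>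

definition tlin :: "((('y \<times> 'h \<times> 'x) \<Rightarrow>\<^sub>0 int) set \<Rightarrow> (('y \<times> 'h \<times> 'x) \<Rightarrow>\<^sub>0 int) set) \<Rightarrow> bool" where
  "tlin F \<longleftrightarrow> is_linear J.Rxz H.M H.M F \<and> (\<forall>j<m. \<forall>v\<in>carrier H.M. F (t j \<odot>\<^bsub>H.M\<^esub> v) = t j \<odot>\<^bsub>H.M\<^esub> F v)"

definition descend :: "((('y \<times> 'h \<times> 'x) \<Rightarrow>\<^sub>0 int) set \<Rightarrow> (('y \<times> 'h \<times> 'x) \<Rightarrow>\<^sub>0 int) set) \<Rightarrow>
    (('y \<times> 's \<times> 'x) \<Rightarrow>\<^sub>0 int) set \<Rightarrow> (('y \<times> 's \<times> 'x) \<Rightarrow>\<^sub>0 int) set" where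
  "descend F = (\<lambda>u\<in>carrier J.M. reduce (F (SOME v. v \<in> carrier H.M \<and> reduce v = u)))"

context
  fixes F
  assumes F: "tlin F"
begin

lemma tlin_linear: "is_linear J.Rxz H.M H.M F"
  using F by (simp add: tlin_def)

lemmas tlin_hom = is_linear_addhom[OF tlin_linear] and tlin_closed = is_linear_closed[OF tlin_linear]

text \<open>The lift chosen in \<open>descend\<close> does not matter: two lifts differ by an
  element of the kernel, and \<open>F\<close> commutes with the t_j, so it maps multiples of t_j to
  elements that reduce to zero.\<close>

lemma descend_reduce: assumes v: "v \<in> carrier H.M" shows "descend F (reduce v) = reduce (F v)"
proof -
  let ?v = "SOME u. u \<in> carrier H.M \<and> reduce u = reduce v"
  have "\<exists>u. u \<in> carrier H.M \<and> reduce u = reduce v" using v by (intro exI conjI) auto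
  then have u: "?v \<in> carrier H.M \<and> reduce ?v = reduce v" by (rule someI_ex)
  have G: "(\<lambda>v. reduce (F v)) \<in> addhom H.M J.M" by (rule addhom_comp[OF tlin_hom reduce_hom])
  have "reduce (F (?v \<ominus>\<^bsub>H.M\<^esub> v)) = \<zero>\<^bsub>J.M\<^esub>"
  proof (rule reduce_kernel[OF G J.M_ab])
    show "reduce (F (t j \<odot>\<^bsub>H.M\<^esub> u)) = \<zero>\<^bsub>J.M\<^esub>" if "j < m" "u \<in> carrier H.M" for j u
      using F reduce_t[OF that(1) tlin_closed[OF that(2)]] that by (simp add: tlin_def)
    show "?v \<ominus>\<^bsub>H.M\<^esub> v \<in> carrier H.M" using u v by simp
    show "reduce (?v \<ominus>\<^bsub>H.M\<^esub> v) = \<zero>\<^bsub>J.M\<^esub>" using u v reduce_minus[of ?v v] reduce_closed[OF v] by (simp add: J.M.r_neg a_minus_def)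
  qed
  then have 0: "reduce (F ?v) \<ominus>\<^bsub>J.M\<^esub> reduce (F v) = \<zero>\<^bsub>J.M\<^esub>" using addhom_minus[OF G H.M_ab J.M_ab conjunct1[OF u] v] by simp
  have c: "reduce (F ?v) \<in> carrier J.M" "reduce (F v) \<in> carrier J.M" using reduce_closed[OF tlin_closed] u v by simp_all
  have "reduce (F ?v) = (reduce (F ?v) \<ominus>\<^bsub>J.M\<^esub> reduce (F v)) \<oplus>\<^bsub>J.M\<^esub> reduce (F v)" using c by (simp add: a_minus_def J.M.a_assoc J.M.l_neg)
  then have "reduce (F ?v) = reduce (F v)" using c unfolding 0 by simp
  then show ?thesis using reduce_closed[OF v] by (simp add: descend_def)
qed

lemma descend_linear: "is_linear J.Rxz J.M J.M (descend F)"
proof (intro is_linearI addhomI)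
  fix v assume v: "v \<in> carrier J.M"
  obtain u where u: "u \<in> carrier H.M" "reduce u = v" using reduce_surj[OF v] by (elim bexE)
  show "descend F v \<in> carrier J.M" unfolding u(2)[symmetric] descend_reduce[OF u(1)] by (rule reduce_closed[OF tlin_closed[OF u(1)]])
  show "descend F (v \<oplus>\<^bsub>J.M\<^esub> w) = descend F v \<oplus>\<^bsub>J.M\<^esub> descend F w" if w: "w \<in> carrier J.M" for w
  proof -
    obtain u' where u': "u' \<in> carrier H.M" "reduce u' = w" using reduce_surj[OF w] by (elim bexE)
    show ?thesis unfolding u(2)[symmetric] u'(2)[symmetric] reduce_add[OF u(1) u'(1), symmetric]
        descend_reduce[OF u(1)] descend_reduce[OF u'(1)] descend_reduce[OF H.M.a_closed[OF u(1) u'(1)]] addhom_add[OF tlin_hom u(1) u'(1)]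
      by (rule reduce_add[OF tlin_closed[OF u(1)] tlin_closed[OF u'(1)]])
  qed
  show "descend F (p \<odot>\<^bsub>J.M\<^esub> v) = p \<odot>\<^bsub>J.M\<^esub> descend F v" if p: "p \<in> carrier J.Rxz" for p
    unfolding u(2)[symmetric] reduce_smult[OF J.Rxz_R[OF p] u(1), symmetric] descend_reduce[OF u(1)]
      descend_reduce[OF H.smult_closed[OF J.Rxz_R[OF p] u(1)]] is_linear_smult[OF tlin_linear p u(1)]
    by (rule reduce_smult[OF J.Rxz_R[OF p] tlin_closed[OF u(1)]])
qed

lemma descend_eps:
  assumes p: "\<And>v. v \<in> carrier H.M \<Longrightarrow> H.eps (F v) = psgn H.M p (F (H.eps v))" and v: "v \<in> carrier J.M"
  shows "J.eps (descend F v) = psgn J.M p (descend F (J.eps v))"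
proof -
  obtain u where u: "u \<in> carrier H.M" "reduce u = v" using reduce_surj[OF v] by (elim bexE)
  show ?thesis
    unfolding u(2)[symmetric] descend_reduce[OF u(1)] reduce_eps[OF u(1), symmetric] descend_reduce[OF H.eps_closed[OF u(1)]]
      reduce_eps[OF tlin_closed[OF u(1)], symmetric] p[OF u(1)]
    by (rule reduce_psgn[OF tlin_closed[OF H.eps_closed[OF u(1)]]])
qed

lemma descend_anticommutator:
  assumes Fp: "\<And>v. v \<in> carrier H.M \<Longrightarrow> H.d (F v) \<oplus>\<^bsub>H.M\<^esub> F (H.d v) = p \<odot>\<^bsub>H.M\<^esub> v" and p: "p \<in> carrier J.R" and v: "v \<in> carrier J.M"
  shows "J.d (descend F v) \<oplus>\<^bsub>J.M\<^esub> descend F (J.d v) = p \<odot>\<^bsub>J.M\<^esub> v"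
proof -
  obtain u where u: "u \<in> carrier H.M" "reduce u = v" using reduce_surj[OF v] by (elim bexE)
  note c = tlin_closed[OF u(1)] tlin_closed[OF H.d_closed[OF u(1)]]
  show ?thesis
    unfolding u(2)[symmetric] descend_reduce[OF u(1)] reduce_d[OF u(1), symmetric] descend_reduce[OF H.d_closed[OF u(1)]] reduce_d[OF c(1), symmetric]
      reduce_add[OF H.d_closed[OF c(1)] c(2), symmetric] Fp[OF u(1)]
    by (rule reduce_smult[OF p u(1)])
qed

lemma descend_unique:
  assumes "g \<in> extensional (carrier J.M)" "\<And>v. v \<in> carrier H.M \<Longrightarrow> g (reduce v) = reduce (F v)"
  shows "g = descend F"
proof (rule extensionalityI[OF assms(1)])
  show "descend F \<in> extensional (carrier J.M)" by (simp add: descend_def)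
  fix v assume v: "v \<in> carrier J.M"
  obtain u where u: "u \<in> carrier H.M" "reduce u = v" using reduce_surj[OF v] by (elim bexE)
  show "g v = descend F v" unfolding u(2)[symmetric] assms(2)[OF u(1)] descend_reduce[OF u(1)] ..
qed

end

subsection \<open>Commutators with the connection\<close>

text \<open>The sign-free commutator is the graded one as soon as one argument is even. It is used
  only with the connection in one of the two places.\<close>

definition commutator :: "((('y \<times> 'h \<times> 'x) \<Rightarrow>\<^sub>0 int) set \<Rightarrow> (('y \<times> 'h \<times> 'x) \<Rightarrow>\<^sub>0 int) set) \<Rightarrow>
    ((('y \<times> 'h \<times> 'x) \<Rightarrow>\<^sub>0 int) set \<Rightarrow> (('y \<times> 'h \<times> 'x) \<Rightarrow>\<^sub>0 int) set) \<Rightarrow>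
    (('y \<times> 'h \<times> 'x) \<Rightarrow>\<^sub>0 int) set \<Rightarrow> (('y \<times> 'h \<times> 'x) \<Rightarrow>\<^sub>0 int) set" where
  "commutator D Q v = D (Q v) \<ominus>\<^bsub>H.M\<^esub> Q (D v)"

lemma tlinD: "tlin Q \<Longrightarrow> j < m \<Longrightarrow> v \<in> carrier H.M \<Longrightarrow> Q (t j \<odot>\<^bsub>H.M\<^esub> v) = t j \<odot>\<^bsub>H.M\<^esub> Q v"
  by (simp add: tlin_def)

lemma H_Rxz: "module J.Rxz H.M"
  by (rule module_mpoly_mono[OF H.M_module]) auto

lemma R_tlin: "is_linear J.R H.M H.M Q \<Longrightarrow> tlin Q"
  unfolding tlin_def
proof (intro conjI allI ballI impI)
  assume Q: "is_linear J.R H.M H.M Q"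
  show "is_linear J.Rxz H.M H.M Q" by (rule is_linear_mpoly_mono[OF Q]) auto
  show "Q (t j \<odot>\<^bsub>H.M\<^esub> v) = t j \<odot>\<^bsub>H.M\<^esub> Q v" if "j < m" "v \<in> carrier H.M" for j v
    by (rule is_linear_smult[OF Q J.Ry_R[OF t[OF that(1)]] that(2)])
qed

lemma d_tlin: "tlin H.d"
  by (rule R_tlin[OF H.d_linear])

definition connection :: "(nat \<Rightarrow> 'h \<Rightarrow> 'h) \<Rightarrow> bool" where
  "connection g \<longleftrightarrow> (\<forall>i<m. g i \<in> addhom S' S' \<and>
     (\<forall>s\<in>carrier S'. (\<forall>c. g i (cpoly c \<odot>\<^bsub>S'\<^esub> s) = cpoly c \<odot>\<^bsub>S'\<^esub> g i s) \<and>
       (\<forall>j<m. g i (t j \<odot>\<^bsub>S'\<^esub> s) = t j \<odot>\<^bsub>S'\<^esub> g i s \<oplus>\<^bsub>S'\<^esub> (if i = j then s else \<zero>\<^bsub>S'\<^esub>))))"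

context
  fixes g :: "nat \<Rightarrow> 'h \<Rightarrow> 'h"
  assumes conn: "connection g"
begin

lemma connection_hom: "i < m \<Longrightarrow> g i \<in> addhom S' S'"
  and connection_const: "i < m \<Longrightarrow> s \<in> carrier S' \<Longrightarrow> g i (cpoly c \<odot>\<^bsub>S'\<^esub> s) = cpoly c \<odot>\<^bsub>S'\<^esub> g i s"
  and connection_leibniz: "i < m \<Longrightarrow> j < m \<Longrightarrow> s \<in> carrier S' \<Longrightarrow>
       g i (t j \<odot>\<^bsub>S'\<^esub> s) = t j \<odot>\<^bsub>S'\<^esub> g i s \<oplus>\<^bsub>S'\<^esub> (if i = j then s else \<zero>\<^bsub>S'\<^esub>)"
  using conn unfolding connection_def by simp_all

abbreviation "nab i \<equiv> H.middleext (g i)"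

lemma nab_linear: "i < m \<Longrightarrow> is_linear J.Rxz H.M H.M (nab i)"
  by (rule H.middleext_linear[OF connection_hom connection_const])

lemmas nab_hom = is_linear_addhom[OF nab_linear] and nab_closed = is_linear_closed[OF nab_linear]

lemma nab_t: "i < m \<Longrightarrow> j < m \<Longrightarrow> v \<in> carrier H.M \<Longrightarrow>
   nab i (t j \<odot>\<^bsub>H.M\<^esub> v) = t j \<odot>\<^bsub>H.M\<^esub> nab i v \<oplus>\<^bsub>H.M\<^esub> (if i = j then v else \<zero>\<^bsub>H.M\<^esub>)"
  by (rule H.middleext_leibniz[OF connection_hom connection_const t connection_leibniz])

lemma nab_eps: "i < m \<Longrightarrow> v \<in> carrier H.M \<Longrightarrow> H.eps (nab i v) = nab i (H.eps v)"
  by (rule H.middleext_eps[OF connection_hom connection_const])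

abbreviation "nb i \<equiv> commutator (nab i)"

text \<open>The connection does not commute with t_j, but its commutator with \<open>Q\<close> does:
  the error term \<open>Q v\<close>, present when i = j, arises once from each of the two products,
  and the two copies cancel.\<close>

lemma nb_tlin:
  assumes i: "i < m" and Q: "tlin Q" shows "tlin (nb i Q)"
  unfolding tlin_def
proof (intro conjI allI ballI impI)
  show "is_linear J.Rxz H.M H.M (nb i Q)" unfolding commutator_def[abs_def]
    by (intro is_linear_diff is_linear_comp[OF tlin_linear[OF Q] nab_linear[OF i]] is_linear_comp[OF nab_linear[OF i] tlin_linear[OF Q]] H_Rxz)
  fix j v assume j: "j < m" and v: "v \<in> carrier H.M"
  note Xv = tlin_closed[OF Q v] and nv = nab_closed[OF i v]
  have tR: "t j \<in> carrier J.R" by (rule J.Ry_R[OF t[OF j]])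
  have dc: "(if i = j then v else \<zero>\<^bsub>H.M\<^esub>) \<in> carrier H.M" using v by simp
  have Xd: "Q (if i = j then v else \<zero>\<^bsub>H.M\<^esub>) = (if i = j then Q v else \<zero>\<^bsub>H.M\<^esub>)"
    using addhom_zero[OF tlin_hom[OF Q] H.M_ab H.M_ab] by simp
  have "nb i Q (t j \<odot>\<^bsub>H.M\<^esub> v) = (t j \<odot>\<^bsub>H.M\<^esub> nab i (Q v) \<oplus>\<^bsub>H.M\<^esub> (if i = j then Q v else \<zero>\<^bsub>H.M\<^esub>))
    \<ominus>\<^bsub>H.M\<^esub> (t j \<odot>\<^bsub>H.M\<^esub> Q (nab i v) \<oplus>\<^bsub>H.M\<^esub> (if i = j then Q v else \<zero>\<^bsub>H.M\<^esub>))"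
    unfolding commutator_def tlinD[OF Q j v] nab_t[OF i j Xv] nab_t[OF i j v]
      addhom_add[OF tlin_hom[OF Q] H.smult_closed[OF tR nv] dc] tlinD[OF Q j nv] Xd ..
  also have "\<dots> = t j \<odot>\<^bsub>H.M\<^esub> nab i (Q v) \<ominus>\<^bsub>H.M\<^esub> t j \<odot>\<^bsub>H.M\<^esub> Q (nab i v)"
  proof -
    have *: "(x \<oplus>\<^bsub>H.M\<^esub> z) \<ominus>\<^bsub>H.M\<^esub> (y \<oplus>\<^bsub>H.M\<^esub> z) = x \<ominus>\<^bsub>H.M\<^esub> y"
      if "x \<in> carrier H.M" "y \<in> carrier H.M" "z \<in> carrier H.M" for x y z using that by algebra
    show ?thesis by (rule *) (use Xv nv nab_closed[OF i Xv] tlin_closed[OF Q nv] H.smult_closed[OF tR] in auto)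
  qed
  also have "\<dots> = t j \<odot>\<^bsub>H.M\<^esub> nb i Q v" unfolding commutator_def
    by (rule addhom_minus[OF H.smult_addhom[OF tR] H.M_ab H.M_ab nab_closed[OF i Xv] tlin_closed[OF Q nv], symmetric])
  finally show "nb i Q (t j \<odot>\<^bsub>H.M\<^esub> v) = t j \<odot>\<^bsub>H.M\<^esub> nb i Q v" .
qed

lemma nb_parity:
  assumes i: "i < m" and Q: "tlin Q" and Xp: "\<And>v. v \<in> carrier H.M \<Longrightarrow> H.eps (Q v) = psgn H.M p (Q (H.eps v))" and v: "v \<in> carrier H.M"
  shows "H.eps (nb i Q v) = psgn H.M p (nb i Q (H.eps v))"
proof -
  have ev: "H.eps v \<in> carrier H.M" by (rule H.eps_closed[OF v])
  have "H.eps (nb i Q v) = H.eps (nab i (Q v)) \<ominus>\<^bsub>H.M\<^esub> H.eps (Q (nab i v))"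
    unfolding commutator_def by (rule addhom_minus[OF H.eps_hom H.M_ab H.M_ab nab_closed[OF i tlin_closed[OF Q v]] tlin_closed[OF Q nab_closed[OF i v]]])
  also have "\<dots> = psgn H.M p (nab i (Q (H.eps v))) \<ominus>\<^bsub>H.M\<^esub> psgn H.M p (Q (nab i (H.eps v)))"
    unfolding nab_eps[OF i tlin_closed[OF Q v]] Xp[OF v] Xp[OF nab_closed[OF i v]] nab_eps[OF i v]
      addhom_psgn[OF nab_hom[OF i] H.M_ab tlin_closed[OF Q ev]] ..
  also have "\<dots> = psgn H.M p (nb i Q (H.eps v))" unfolding commutator_def
    by (rule addhom_minus[OF is_linear_addhom[OF is_linear_psgn[OF H.M_module]] H.M_ab H.M_ab nab_closed[OF i tlin_closed[OF Q ev]] tlin_closed[OF Q nab_closed[OF i ev]], symmetric])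
  finally show ?thesis .
qed

abbreviation "ath i \<equiv> commutator H.d (nab i)"

text \<open>Up to sign the Atiyah class is the commutator of the connection with \<open>Q\<close>
  equal to the differential, so its t-linearity and its parity come from the general case.\<close>

lemma ath_nb: "i < m \<Longrightarrow> v \<in> carrier H.M \<Longrightarrow> ath i v = \<ominus>\<^bsub>H.M\<^esub> nb i H.d v"
proof -
  assume i: "i < m" and v: "v \<in> carrier H.M"
  have *: "x \<ominus>\<^bsub>H.M\<^esub> y = \<ominus>\<^bsub>H.M\<^esub> (y \<ominus>\<^bsub>H.M\<^esub> x)" if "x \<in> carrier H.M" "y \<in> carrier H.M" for x y
    using that by algebra
  show ?thesis unfolding commutator_def by (rule *[OF H.d_closed[OF nab_closed[OF i v]] nab_closed[OF i H.d_closed[OF v]]])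
qed

lemma ath_tlin: assumes i: "i < m" shows "tlin (ath i)"
  unfolding tlin_def
proof (intro conjI allI ballI impI)
  note n = nb_tlin[OF i d_tlin]
  show "is_linear J.Rxz H.M H.M (ath i)" unfolding commutator_def[abs_def]
    by (intro is_linear_diff is_linear_comp[OF tlin_linear[OF d_tlin] nab_linear[OF i]] is_linear_comp[OF nab_linear[OF i] tlin_linear[OF d_tlin]] H_Rxz)
  fix j v assume j: "j < m" and v: "v \<in> carrier H.M"
  have tR: "t j \<in> carrier J.R" by (rule J.Ry_R[OF t[OF j]])
  show "ath i (t j \<odot>\<^bsub>H.M\<^esub> v) = t j \<odot>\<^bsub>H.M\<^esub> ath i v"
    unfolding ath_nb[OF i v] ath_nb[OF i H.smult_closed[OF tR v]] tlinD[OF n j v]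
    by (rule addhom_neg[OF H.smult_addhom[OF tR] H.M_ab H.M_ab tlin_closed[OF n v], symmetric])
qed

lemma ath_eps:
  assumes i: "i < m" and v: "v \<in> carrier H.M" shows "H.eps (ath i v) = psgn H.M 1 (ath i (H.eps v))"
proof -
  note n = nb_tlin[OF i d_tlin]
  have "H.eps (ath i v) = \<ominus>\<^bsub>H.M\<^esub> H.eps (nb i H.d v)"
    unfolding ath_nb[OF i v] by (rule addhom_neg[OF H.eps_hom H.M_ab H.M_ab tlin_closed[OF n v]])
  also have "\<dots> = \<ominus>\<^bsub>H.M\<^esub> psgn H.M 1 (nb i H.d (H.eps v))" by (rule arg_cong[OF nb_parity[OF i d_tlin H.d_eps v]])
  finally show ?thesis unfolding ath_nb[OF i H.eps_closed[OF v]] by (simp add: psgn_def)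
qed

lemma UW: "U - W \<in> carrier J.Rxz"
  using mpoly_mono[OF _ J.U, of J.Vxz] mpoly_mono[OF _ J.W, of J.Vxz] by auto

text \<open>The anticommutator of d with [d, \<nabla>] is [d^2, \<nabla>], and d^2 is multiplication
  by U - W, a polynomial in x and z with which the connection commutes. Zero is written as a scalar
  multiple to fit the shape in which anticommutators descend.\<close>

lemma d_ath:
  assumes i: "i < m" and v: "v \<in> carrier H.M" shows "H.d (ath i v) \<oplus>\<^bsub>H.M\<^esub> ath i (H.d v) = 0 \<odot>\<^bsub>H.M\<^esub> v"
proof -
  note nv = nab_closed[OF i v] and dv = H.d_closed[OF v]
  note dn = H.d_closed[OF nv] and nd = nab_closed[OF i dv]
  have "H.d (H.d (nab i v)) = nab i (H.d (H.d v))"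
    unfolding H.d_d[OF v] H.d_d[OF nv] by (rule is_linear_smult[OF nab_linear[OF i] UW v, symmetric])
  moreover have "H.d (ath i v) = H.d (H.d (nab i v)) \<ominus>\<^bsub>H.M\<^esub> H.d (nab i (H.d v))"
    unfolding commutator_def by (rule addhom_minus[OF H.d_hom H.M_ab H.M_ab dn nd])
  moreover have *: "(x \<ominus>\<^bsub>H.M\<^esub> y) \<oplus>\<^bsub>H.M\<^esub> (y \<ominus>\<^bsub>H.M\<^esub> x) = \<zero>\<^bsub>H.M\<^esub>" if "x \<in> carrier H.M" "y \<in> carrier H.M" for x y
    using that by algebra
  ultimately show ?thesis
    using *[OF nab_closed[OF i H.d_closed[OF dv]] H.d_closed[OF nd]] by (simp add: commutator_def H.smult_0[OF v])
qed

text \<open>The graded Jacobi identity for \<open>d\<close>, \<open>nab i\<close> and \<open>Q\<close>: the commutator of \<open>nab i\<close> with \<open>Q\<close> is a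
  homotopy for the commutator of the Atiyah class with \<open>Q\<close>, up to the contribution of \<open>[d, Q]\<close>.\<close>

lemma homotopy_odd:
  assumes i: "i < m" and Q: "tlin Q" and v: "v \<in> carrier H.M"
  shows "H.d (nb i Q v) \<oplus>\<^bsub>H.M\<^esub> nb i Q (H.d v) = (ath i (Q v) \<oplus>\<^bsub>H.M\<^esub> Q (ath i v)) \<oplus>\<^bsub>H.M\<^esub>
     (nab i (H.d (Q v) \<oplus>\<^bsub>H.M\<^esub> Q (H.d v)) \<ominus>\<^bsub>H.M\<^esub> (H.d (Q (nab i v)) \<oplus>\<^bsub>H.M\<^esub> Q (H.d (nab i v))))"
proof -
  note c = nab_closed[OF i] H.d_closed tlin_closed[OF Q]
  show ?thesis unfolding commutator_def
    addhom_minus[OF H.d_hom H.M_ab H.M_ab c(1)[OF c(3)[OF v]] c(3)[OF c(1)[OF v]]]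
    addhom_minus[OF tlin_hom[OF Q] H.M_ab H.M_ab c(2)[OF c(1)[OF v]] c(1)[OF c(2)[OF v]]]
    addhom_add[OF nab_hom[OF i] c(2)[OF c(3)[OF v]] c(3)[OF c(2)[OF v]]]
    by (rule H.M.commutator_rearrange) (intro c v)+
qed

text \<open>If \<open>Q\<close> commutes with the differential, the contribution of [d, Q] vanishes.
  The case of interest is multiplication by an element of k[y], which the connection does not
  commute with.\<close>

lemma homotopy_even:
  assumes i: "i < m" and Q: "tlin Q" and Qd: "\<And>v. v \<in> carrier H.M \<Longrightarrow> H.d (Q v) = Q (H.d v)" and v: "v \<in> carrier H.M"
  shows "H.d (nb i Q v) \<ominus>\<^bsub>H.M\<^esub> nb i Q (H.d v) = ath i (Q v) \<ominus>\<^bsub>H.M\<^esub> Q (ath i v)"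
proof -
  note c = nab_closed[OF i] H.d_closed tlin_closed[OF Q]
  have *: "(a \<ominus>\<^bsub>H.M\<^esub> g) \<ominus>\<^bsub>H.M\<^esub> (c \<ominus>\<^bsub>H.M\<^esub> e) = (a \<ominus>\<^bsub>H.M\<^esub> c) \<ominus>\<^bsub>H.M\<^esub> (g \<ominus>\<^bsub>H.M\<^esub> e)"
    if "a \<in> carrier H.M" "c \<in> carrier H.M" "e \<in> carrier H.M" "g \<in> carrier H.M" for a c e g
    using that by algebra
  show ?thesis unfolding commutator_def
    addhom_minus[OF H.d_hom H.M_ab H.M_ab c(1)[OF c(3)[OF v]] c(3)[OF c(1)[OF v]]]
    addhom_minus[OF tlin_hom[OF Q] H.M_ab H.M_ab c(2)[OF c(1)[OF v]] c(1)[OF c(2)[OF v]]]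
    Qd[OF v] Qd[OF c(1)[OF v]]
    by (rule *) (intro c v)+
qed

text \<open>When [d, Q] is multiplication by \<open>p\<close>, the extra term in the Jacobi identity
  is [\<nabla>_i, p]. In the applications it is 0 or the identity, according to \<open>b\<close>: p
  = 0 for an Atiyah class, and p = t_j for the derivative of the differential.\<close>

lemma descend_homotopy_odd:
  assumes i: "i < m" and Q: "tlin Q" and p: "p \<in> carrier J.R"
    and Qp: "\<And>v. v \<in> carrier H.M \<Longrightarrow> H.d (Q v) \<oplus>\<^bsub>H.M\<^esub> Q (H.d v) = p \<odot>\<^bsub>H.M\<^esub> v"
    and pi: "\<And>v. v \<in> carrier H.M \<Longrightarrow> nab i (p \<odot>\<^bsub>H.M\<^esub> v) = p \<odot>\<^bsub>H.M\<^esub> nab i v \<oplus>\<^bsub>H.M\<^esub> (if b then v else \<zero>\<^bsub>H.M\<^esub>)"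
    and u: "u \<in> carrier J.M"
  shows "J.d (descend (nb i Q) u) \<oplus>\<^bsub>J.M\<^esub> descend (nb i Q) (J.d u) = (descend (ath i) (descend Q u) \<oplus>\<^bsub>J.M\<^esub> descend Q (descend (ath i) u)) \<oplus>\<^bsub>J.M\<^esub> (if b then u else \<zero>\<^bsub>J.M\<^esub>)"
proof -
  obtain v where v: "v \<in> carrier H.M" "reduce v = u" using reduce_surj[OF u] by (elim bexE)
  note n = nb_tlin[OF i Q] and a = ath_tlin[OF i]
  note c = nab_closed[OF i] H.d_closed tlin_closed[OF Q] tlin_closed[OF n] tlin_closed[OF a]
  have *: "(x \<oplus>\<^bsub>H.M\<^esub> y) \<ominus>\<^bsub>H.M\<^esub> x = y" if "x \<in> carrier H.M" "y \<in> carrier H.M" for x y using that by algebra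
  have "H.d (nb i Q v) \<oplus>\<^bsub>H.M\<^esub> nb i Q (H.d v) = (ath i (Q v) \<oplus>\<^bsub>H.M\<^esub> Q (ath i v)) \<oplus>\<^bsub>H.M\<^esub> (if b then v else \<zero>\<^bsub>H.M\<^esub>)"
    unfolding homotopy_odd[OF i Q v(1)] Qp[OF v(1)] Qp[OF c(1)[OF v(1)]] pi[OF v(1)]
    using v(1) by (subst *) (auto intro!: H.smult_closed p c)
  then have "reduce (H.d (nb i Q v) \<oplus>\<^bsub>H.M\<^esub> nb i Q (H.d v)) = reduce ((ath i (Q v) \<oplus>\<^bsub>H.M\<^esub> Q (ath i v)) \<oplus>\<^bsub>H.M\<^esub> (if b then v else \<zero>\<^bsub>H.M\<^esub>))"
    by (rule arg_cong)
  also have "\<dots> = (reduce (ath i (Q v)) \<oplus>\<^bsub>J.M\<^esub> reduce (Q (ath i v))) \<oplus>\<^bsub>J.M\<^esub> (if b then u else \<zero>\<^bsub>J.M\<^esub>)"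
    using c v addhom_zero[OF reduce_hom H.M_ab J.M_ab] by (simp add: reduce_add)
  finally have "reduce (H.d (nb i Q v)) \<oplus>\<^bsub>J.M\<^esub> reduce (nb i Q (H.d v)) = (reduce (ath i (Q v)) \<oplus>\<^bsub>J.M\<^esub> reduce (Q (ath i v))) \<oplus>\<^bsub>J.M\<^esub> (if b then u else \<zero>\<^bsub>J.M\<^esub>)"
    unfolding reduce_add[OF c(2)[OF c(4)[OF v(1)]] c(4)[OF c(2)[OF v(1)]]] .
  then show ?thesis
    unfolding v(2)[symmetric] descend_reduce[OF n v(1)] descend_reduce[OF Q v(1)] descend_reduce[OF a v(1)] descend_reduce[OF a c(3)[OF v(1)]]
      descend_reduce[OF Q c(5)[OF v(1)]] reduce_d[OF v(1), symmetric] descend_reduce[OF n c(2)[OF v(1)]] reduce_d[OF c(4)[OF v(1)], symmetric] .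
qed

lemma descend_homotopy_even:
  assumes i: "i < m" and Q: "tlin Q" and Qd: "\<And>v. v \<in> carrier H.M \<Longrightarrow> H.d (Q v) = Q (H.d v)"
    and u: "u \<in> carrier J.M"
  shows "J.d (descend (nb i Q) u) \<ominus>\<^bsub>J.M\<^esub> descend (nb i Q) (J.d u) = descend (ath i) (descend Q u) \<ominus>\<^bsub>J.M\<^esub> descend Q (descend (ath i) u)"
proof -
  obtain v where v: "v \<in> carrier H.M" "reduce v = u" using reduce_surj[OF u] by (elim bexE)
  note n = nb_tlin[OF i Q] and a = ath_tlin[OF i]
  note c = nab_closed[OF i] H.d_closed tlin_closed[OF Q] tlin_closed[OF n] tlin_closed[OF a]
  have "reduce (H.d (nb i Q v)) \<ominus>\<^bsub>J.M\<^esub> reduce (nb i Q (H.d v)) = reduce (ath i (Q v)) \<ominus>\<^bsub>J.M\<^esub> reduce (Q (ath i v))"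
    unfolding reduce_minus[OF c(2)[OF c(4)[OF v(1)]] c(4)[OF c(2)[OF v(1)]], symmetric]
      reduce_minus[OF c(5)[OF c(3)[OF v(1)]] c(3)[OF c(5)[OF v(1)]], symmetric]
    by (rule arg_cong[OF homotopy_even[OF i Q Qd v(1)]])
  then show ?thesis
    unfolding v(2)[symmetric] descend_reduce[OF n v(1)] descend_reduce[OF Q v(1)] descend_reduce[OF a v(1)] descend_reduce[OF a c(3)[OF v(1)]]
      descend_reduce[OF Q c(5)[OF v(1)]] reduce_d[OF v(1), symmetric] descend_reduce[OF n c(2)[OF v(1)]] reduce_d[OF c(4)[OF v(1)], symmetric] .
qed

end

end

section \<open>Entrywise derivatives\<close>

text \<open>For a derivation \<partial> and an operator D, with a = \<partial>DD, b = D\<partial>D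
  and c = DD\<partial>: the anticommutator of D with [\<partial>, D] is [\<partial>, D^2].\<close>

lemma (in abelian_group) commutator_square:
  assumes "a \<in> carrier G" "b \<in> carrier G" "c \<in> carrier G"
  shows "(b \<ominus> c) \<oplus> (a \<ominus> b) = a \<ominus> c"
  using assms by algebra

text \<open>The derivation \<partial> applied to the anticommutator of D and Q, with a =
  D\<partial>Q, b = DQ\<partial>, c = \<partial>QD, d = Q\<partial>D, e = \<partial>DQ and f =
  QD\<partial>.\<close>

lemma (in abelian_group) commutator_anticommutator:
  assumes "a \<in> carrier G" "b \<in> carrier G" "c \<in> carrier G" "d \<in> carrier G" "e \<in> carrier G" "f \<in> carrier G"
  shows "((a \<ominus> b) \<oplus> (c \<ominus> d)) \<oplus> ((e \<ominus> a) \<oplus> (d \<ominus> f)) = (e \<oplus> c) \<ominus> (b \<oplus> f)"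
  using assms by algebra

lemma (in abelian_group) add_minus_cancel:
  assumes "a \<in> carrier G" "b \<in> carrier G" "c \<in> carrier G"
  shows "(c \<oplus> a) \<ominus> (c \<oplus> b) = a \<ominus> b"
  using assms by algebra

lemma (in abelian_group) add_minus_left:
  assumes "a \<in> carrier G" "b \<in> carrier G"
  shows "(a \<oplus> b) \<ominus> b = a"
  using assms by algebra

lemma finsum_swap:
  assumes "abelian_group N" "finite I" "finite J" "\<And>i j. i \<in> I \<Longrightarrow> j \<in> J \<Longrightarrow> h i j \<in> carrier N"
  shows "(\<Oplus>\<^bsub>N\<^esub>i\<in>I. \<Oplus>\<^bsub>N\<^esub>j\<in>J. h i j) = (\<Oplus>\<^bsub>N\<^esub>j\<in>J. \<Oplus>\<^bsub>N\<^esub>i\<in>I. h i j)"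
proof -
  interpret N: abelian_group N by fact
  show ?thesis using assms(2,4)
  proof (induction I rule: finite_induct)
    case empty
    show ?case using finsum_all_zero[OF assms(1), of J "\<lambda>_. \<zero>\<^bsub>N\<^esub>"] by simp
  next
    case (insert i I)
    have c: "(\<Oplus>\<^bsub>N\<^esub>i\<in>I. h i j) \<in> carrier N" if "j \<in> J" for j using insert that by (intro N.finsum_closed) auto
    have ci: "(\<Oplus>\<^bsub>N\<^esub>j\<in>J. h i' j) \<in> carrier N" if "i' \<in> insert i I" for i'
      using insert(4)[OF that] by (intro N.finsum_closed) auto
    have "(\<Oplus>\<^bsub>N\<^esub>j\<in>J. \<Oplus>\<^bsub>N\<^esub>i\<in>insert i I. h i j) = (\<Oplus>\<^bsub>N\<^esub>j\<in>J. h i j \<oplus>\<^bsub>N\<^esub> (\<Oplus>\<^bsub>N\<^esub>i\<in>I. h i j))"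
      using insert c by (intro N.finsum_cong' N.finsum_insert) auto
    also have "\<dots> = (\<Oplus>\<^bsub>N\<^esub>j\<in>J. h i j) \<oplus>\<^bsub>N\<^esub> (\<Oplus>\<^bsub>N\<^esub>j\<in>J. \<Oplus>\<^bsub>N\<^esub>i\<in>I. h i j)"
      using insert(4)[of i] c by (intro N.finsum_addf) auto
    also have "(\<Oplus>\<^bsub>N\<^esub>j\<in>J. \<Oplus>\<^bsub>N\<^esub>i\<in>I. h i j) = (\<Oplus>\<^bsub>N\<^esub>i\<in>I. \<Oplus>\<^bsub>N\<^esub>j\<in>J. h i j)"
      using insert by simp
    finally show ?case using insert(1,2) ci by simp
  qed
qed

context
  fixes V :: "pvar set" and M :: "(('k::comm_ring_1) pol, 'b) mf" and B :: "'i set" and e and x :: pvar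
  assumes gr: "graded_module (mpoly_ring V) M" and hb: "homogeneous_basis (mpoly_ring V) M B e"
begin

abbreviation (input) "RV \<equiv> mpoly_ring V :: 'k pol ring"

lemma gb_module: "module RV M" by (rule gm_module[OF gr])
lemma gb_basis: "finite_basis RV M B e" using hb by (simp add: homogeneous_basis_def)

interpretation M: module RV M by (rule gb_module)

lemma gb_ab: "abelian_group M" by (rule M.abelian_group_axioms)

abbreviation (input) "co \<equiv> coords RV M B e"

lemmas co_closed = coords_closed[OF gb_module gb_basis] and bas_closed = fb_closed[OF gb_module gb_basis]

text \<open>The derivation of \<open>M\<close> that is flat on the given basis: the entrywise derivative of the
  matrix of \<open>D\<close> is its commutator with \<open>D\<close>.\<close>

definition basis_pd :: "'b \<Rightarrow> 'b" where
  "basis_pd v = (\<Oplus>\<^bsub>M\<^esub>b\<in>B. pd x (co v b) \<odot>\<^bsub>M\<^esub> e b)"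

lemma basis_pd_term: "v \<in> carrier M \<Longrightarrow> b \<in> B \<Longrightarrow> pd x (co v b) \<odot>\<^bsub>M\<^esub> e b \<in> carrier M"
  by (intro M.smult_closed pd_mem co_closed bas_closed)

lemma basis_pd_closed: "v \<in> carrier M \<Longrightarrow> basis_pd v \<in> carrier M"
  unfolding basis_pd_def using basis_pd_term by (intro M.finsum_closed) auto

lemma basis_pd_hom: "basis_pd \<in> addhom M M"
proof (rule addhomI)
  fix v w assume v: "v \<in> carrier M" and w: "w \<in> carrier M"
  have "basis_pd (v \<oplus>\<^bsub>M\<^esub> w) = (\<Oplus>\<^bsub>M\<^esub>b\<in>B. pd x (co v b) \<odot>\<^bsub>M\<^esub> e b \<oplus>\<^bsub>M\<^esub> pd x (co w b) \<odot>\<^bsub>M\<^esub> e b)"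
    unfolding basis_pd_def
  proof (rule M.finsum_cong')
    fix b assume b: "b \<in> B"
    show "pd x (co (v \<oplus>\<^bsub>M\<^esub> w) b) \<odot>\<^bsub>M\<^esub> e b = pd x (co v b) \<odot>\<^bsub>M\<^esub> e b \<oplus>\<^bsub>M\<^esub> pd x (co w b) \<odot>\<^bsub>M\<^esub> e b"
      unfolding coords_add[OF gb_module gb_basis v w b] pd_add
      using M.smult_l_distr[OF pd_mem[OF co_closed[OF v b]] pd_mem[OF co_closed[OF w b]] bas_closed[OF b]] by simp
  qed (use basis_pd_term[OF v] basis_pd_term[OF w] in auto)
  also have "\<dots> = basis_pd v \<oplus>\<^bsub>M\<^esub> basis_pd w" unfolding basis_pd_def
    using basis_pd_term[OF v] basis_pd_term[OF w] by (intro M.finsum_addf) auto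
  finally show "basis_pd (v \<oplus>\<^bsub>M\<^esub> w) = basis_pd v \<oplus>\<^bsub>M\<^esub> basis_pd w" .
qed (rule basis_pd_closed)

lemma basis_pd_leibniz:
  assumes p: "p \<in> carrier RV" and v: "v \<in> carrier M"
  shows "basis_pd (p \<odot>\<^bsub>M\<^esub> v) = pd x p \<odot>\<^bsub>M\<^esub> v \<oplus>\<^bsub>M\<^esub> p \<odot>\<^bsub>M\<^esub> basis_pd v"
proof -
  have t1: "pd x p \<odot>\<^bsub>M\<^esub> (co v b \<odot>\<^bsub>M\<^esub> e b) \<in> carrier M" "p \<odot>\<^bsub>M\<^esub> (pd x (co v b) \<odot>\<^bsub>M\<^esub> e b) \<in> carrier M" if b: "b \<in> B" for b
    by (rule M.smult_closed[OF pd_mem[OF p] M.smult_closed[OF co_closed[OF v b] bas_closed[OF b]]],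
        rule M.smult_closed[OF p basis_pd_term[OF v b]])
  have "basis_pd (p \<odot>\<^bsub>M\<^esub> v) = (\<Oplus>\<^bsub>M\<^esub>b\<in>B. pd x p \<odot>\<^bsub>M\<^esub> (co v b \<odot>\<^bsub>M\<^esub> e b) \<oplus>\<^bsub>M\<^esub> p \<odot>\<^bsub>M\<^esub> (pd x (co v b) \<odot>\<^bsub>M\<^esub> e b))"
    unfolding basis_pd_def
  proof (rule M.finsum_cong')
    fix b assume b: "b \<in> B"
    note c = co_closed[OF v b] note pc = pd_mem[OF c] note pp = pd_mem[OF p]
    show "pd x (co (p \<odot>\<^bsub>M\<^esub> v) b) \<odot>\<^bsub>M\<^esub> e b = pd x p \<odot>\<^bsub>M\<^esub> (co v b \<odot>\<^bsub>M\<^esub> e b) \<oplus>\<^bsub>M\<^esub> p \<odot>\<^bsub>M\<^esub> (pd x (co v b) \<odot>\<^bsub>M\<^esub> e b)"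
      unfolding coords_smult[OF gb_module gb_basis p v b] pd_mult
      using M.smult_l_distr[OF mpoly_mult[OF pp c] mpoly_mult[OF p pc] bas_closed[OF b]]
        M.smult_assoc1[OF pp c bas_closed[OF b]] M.smult_assoc1[OF p pc bas_closed[OF b]] by simp
  qed (use t1 in auto)
  also have "\<dots> = (\<Oplus>\<^bsub>M\<^esub>b\<in>B. pd x p \<odot>\<^bsub>M\<^esub> (co v b \<odot>\<^bsub>M\<^esub> e b)) \<oplus>\<^bsub>M\<^esub> (\<Oplus>\<^bsub>M\<^esub>b\<in>B. p \<odot>\<^bsub>M\<^esub> (pd x (co v b) \<odot>\<^bsub>M\<^esub> e b))"
    using t1 by (intro M.finsum_addf) auto
  also have "(\<Oplus>\<^bsub>M\<^esub>b\<in>B. p \<odot>\<^bsub>M\<^esub> (pd x (co v b) \<odot>\<^bsub>M\<^esub> e b)) = p \<odot>\<^bsub>M\<^esub> basis_pd v" unfolding basis_pd_def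
    using basis_pd_term[OF v] by (intro M.finsum_smult_ldistr[OF fb_finite[OF gb_module gb_basis] p, symmetric]) auto
  also have "(\<Oplus>\<^bsub>M\<^esub>b\<in>B. pd x p \<odot>\<^bsub>M\<^esub> (co v b \<odot>\<^bsub>M\<^esub> e b)) = pd x p \<odot>\<^bsub>M\<^esub> (\<Oplus>\<^bsub>M\<^esub>b\<in>B. co v b \<odot>\<^bsub>M\<^esub> e b)"
    using M.smult_closed[OF co_closed[OF v] bas_closed] by (intro M.finsum_smult_ldistr[OF fb_finite[OF gb_module gb_basis] pd_mem[OF p], symmetric]) auto
  also have "(\<Oplus>\<^bsub>M\<^esub>b\<in>B. co v b \<odot>\<^bsub>M\<^esub> e b) = v" by (rule coords_expand[OF gb_module gb_basis v, symmetric])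
  finally show ?thesis .
qed

lemma basis_pd_basis: assumes b: "b \<in> B" shows "basis_pd (e b) = \<zero>\<^bsub>M\<^esub>"
  unfolding basis_pd_def
proof (rule finsum_all_zero[OF gb_ab])
  fix b' assume b': "b' \<in> B"
  have "pd x (co (e b) b') = 0" unfolding coords_basis[OF gb_module gb_basis b b'] by simp
  then show "pd x (co (e b) b') \<odot>\<^bsub>M\<^esub> e b' = \<zero>\<^bsub>M\<^esub>" using M.smult_l_null[OF bas_closed[OF b']] by simp
qed

lemma basis_pd_smult_basis:
  assumes p: "p \<in> carrier RV" and b: "b \<in> B" shows "basis_pd (p \<odot>\<^bsub>M\<^esub> e b) = pd x p \<odot>\<^bsub>M\<^esub> e b"
  unfolding basis_pd_leibniz[OF p bas_closed[OF b]] basis_pd_basis[OF b]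
  using M.smult_r_null[OF p] M.smult_closed[OF pd_mem[OF p] bas_closed[OF b]] by simp

text \<open>Since the basis is homogeneous, the parity involution has constant coefficients in it,
  and differentiating coefficients does not disturb them.\<close>

lemma basis_pd_parity_inv:
  assumes v: "v \<in> carrier M" shows "parity_inv M (basis_pd v) = basis_pd (parity_inv M v)"
proof (rule basis_addhom_eqI[OF gb_module gb_basis _ _ gb_ab _ v])
  note P = parity_inv_linear[OF gr]
  show "(\<lambda>v. parity_inv M (basis_pd v)) \<in> addhom M M" by (rule addhom_comp[OF basis_pd_hom is_linear_addhom[OF P]])
  show "(\<lambda>v. basis_pd (parity_inv M v)) \<in> addhom M M" by (rule addhom_comp[OF is_linear_addhom[OF P] basis_pd_hom])
  fix p b assume p: "p \<in> carrier RV" and b: "b \<in> B"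
  obtain q where "e b \<in> homog M q" using hb b by (auto simp: homogeneous_basis_def)
  then have q: "parity_inv M (e b) = psgn M q (e b)" by (rule parity_inv_homog[OF gr])
  note eb = bas_closed[OF b]
  have "basis_pd (parity_inv M (p \<odot>\<^bsub>M\<^esub> e b)) = basis_pd (psgn M q (p \<odot>\<^bsub>M\<^esub> e b))"
    unfolding is_linear_smult[OF P p eb] q is_linear_smult[OF is_linear_psgn[OF gb_module] p eb] ..
  also have "\<dots> = psgn M q (pd x p \<odot>\<^bsub>M\<^esub> e b)"
    unfolding addhom_psgn[OF basis_pd_hom gb_ab M.smult_closed[OF p eb]] basis_pd_smult_basis[OF p b] ..
  also have "\<dots> = parity_inv M (pd x p \<odot>\<^bsub>M\<^esub> e b)"
    unfolding is_linear_smult[OF P pd_mem[OF p] eb] q is_linear_smult[OF is_linear_psgn[OF gb_module] pd_mem[OF p] eb] ..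
  finally show "parity_inv M (basis_pd (p \<odot>\<^bsub>M\<^esub> e b)) = basis_pd (parity_inv M (p \<odot>\<^bsub>M\<^esub> e b))"
    unfolding basis_pd_smult_basis[OF p b] by (rule sym)
qed

context
  fixes D
  assumes D: "is_linear RV M M D"
begin

lemma D_hom: "D \<in> addhom M M" by (rule is_linear_addhom[OF D])
lemma D_closed: "v \<in> carrier M \<Longrightarrow> D v \<in> carrier M" by (rule is_linear_closed[OF D])

text \<open>The derivation itself is not linear, but the terms coming from the derivative of the
  scalar cancel in a commutator with a linear map.\<close>

lemma basis_pd_comm_linear: "is_linear RV M M (\<lambda>v. basis_pd (D v) \<ominus>\<^bsub>M\<^esub> D (basis_pd v))"
proof (rule is_linearI)
  show "(\<lambda>v. basis_pd (D v) \<ominus>\<^bsub>M\<^esub> D (basis_pd v)) \<in> addhom M M"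
    by (rule addhom_diff[OF addhom_comp[OF D_hom basis_pd_hom] addhom_comp[OF basis_pd_hom D_hom] gb_ab])
  fix p v assume p: "p \<in> carrier RV" and v: "v \<in> carrier M"
  note pp = pd_mem[OF p, of x] and dv = basis_pd_closed[OF v]
  have "basis_pd (D (p \<odot>\<^bsub>M\<^esub> v)) \<ominus>\<^bsub>M\<^esub> D (basis_pd (p \<odot>\<^bsub>M\<^esub> v)) =
     (pd x p \<odot>\<^bsub>M\<^esub> D v \<oplus>\<^bsub>M\<^esub> p \<odot>\<^bsub>M\<^esub> basis_pd (D v)) \<ominus>\<^bsub>M\<^esub> (pd x p \<odot>\<^bsub>M\<^esub> D v \<oplus>\<^bsub>M\<^esub> p \<odot>\<^bsub>M\<^esub> D (basis_pd v))"
    unfolding is_linear_smult[OF D p v] basis_pd_leibniz[OF p D_closed[OF v]] basis_pd_leibniz[OF p v]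
      addhom_add[OF D_hom M.smult_closed[OF pp v] M.smult_closed[OF p dv]] is_linear_smult[OF D pp v] is_linear_smult[OF D p dv] ..
  also have "\<dots> = p \<odot>\<^bsub>M\<^esub> basis_pd (D v) \<ominus>\<^bsub>M\<^esub> p \<odot>\<^bsub>M\<^esub> D (basis_pd v)"
    by (intro M.M.add_minus_cancel M.smult_closed p pp D_closed v basis_pd_closed)
  also have "\<dots> = p \<odot>\<^bsub>M\<^esub> (basis_pd (D v) \<ominus>\<^bsub>M\<^esub> D (basis_pd v))"
    by (rule addhom_minus[OF is_linear_addhom[OF is_linear_smult_map[OF gb_module cring_mpoly p]] gb_ab gb_ab basis_pd_closed[OF D_closed[OF v]] D_closed[OF dv], symmetric])
  finally show "basis_pd (D (p \<odot>\<^bsub>M\<^esub> v)) \<ominus>\<^bsub>M\<^esub> D (basis_pd (p \<odot>\<^bsub>M\<^esub> v)) = p \<odot>\<^bsub>M\<^esub> (basis_pd (D v) \<ominus>\<^bsub>M\<^esub> D (basis_pd v))" .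
qed

abbreviation (input) "epd \<equiv> entrywise_pd x RV M B e D"

lemma pd_matrix_closed: "b \<in> B \<Longrightarrow> b' \<in> B \<Longrightarrow> pd x (co (D (e b)) b') \<in> carrier RV"
  by (intro pd_mem co_closed D_closed bas_closed)

text \<open>Both sides are linear and agree on the basis: the derivation kills basis vectors, so the
  commutator sends \<open>e b\<close> to the derivative of column \<open>b\<close> of the matrix.
  This replaces matrix computations by identities between operators.\<close>

lemma entrywise_pd_eq:
  assumes v: "v \<in> carrier M" shows "epd v = basis_pd (D v) \<ominus>\<^bsub>M\<^esub> D (basis_pd v)"
proof -
  let ?E = "\<lambda>v. basis_pd (D v) \<ominus>\<^bsub>M\<^esub> D (basis_pd v)"
  have Eb: "?E (e b) = (\<Oplus>\<^bsub>M\<^esub>b'\<in>B. pd x (co (D (e b)) b') \<odot>\<^bsub>M\<^esub> e b')" if b: "b \<in> B" for b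
    unfolding basis_pd_basis[OF b] addhom_zero[OF D_hom gb_ab gb_ab]
    using basis_pd_closed[OF D_closed[OF bas_closed[OF b]]] by (simp add: a_minus_def) (simp add: basis_pd_def)
  have T: "(pd x (co (D (e b)) b') * co v b) \<odot>\<^bsub>M\<^esub> e b' \<in> carrier M" if "b \<in> B" "b' \<in> B" for b b'
    using that by (intro M.smult_closed mpoly_mult pd_matrix_closed co_closed v bas_closed)
  have "epd v = (\<Oplus>\<^bsub>M\<^esub>b'\<in>B. \<Oplus>\<^bsub>M\<^esub>b\<in>B. (pd x (co (D (e b)) b') * co v b) \<odot>\<^bsub>M\<^esub> e b')"
    unfolding entrywise_pd_def
  proof (rule M.finsum_cong')
    fix b' assume b': "b' \<in> B"
    have h: "(\<lambda>p. p \<odot>\<^bsub>M\<^esub> e b') \<in> addhom RV M"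
      using M.smult_closed[OF _ bas_closed[OF b']] M.smult_l_distr[OF _ _ bas_closed[OF b']] by (intro addhomI) auto
    have t: "(\<lambda>b. pd x (co (D (e b)) b') * co v b) \<in> B \<rightarrow> carrier RV"
      using mpoly_mult[OF pd_matrix_closed[OF _ b'] co_closed[OF v]] by auto
    have "(\<Sum>b\<in>B. pd x (co (D (e b)) b') * co v b) \<odot>\<^bsub>M\<^esub> e b' = (\<Oplus>\<^bsub>RV\<^esub>b\<in>B. pd x (co (D (e b)) b') * co v b) \<odot>\<^bsub>M\<^esub> e b'"
      using finsum_mpoly[of "\<lambda>b. pd x (co (D (e b)) b') * co v b" B V] t by simp
    also have "\<dots> = (\<Oplus>\<^bsub>M\<^esub>b\<in>B. (pd x (co (D (e b)) b') * co v b) \<odot>\<^bsub>M\<^esub> e b')"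
      by (rule addhom_finsum[OF h M.R.abelian_group_axioms gb_ab t])
    finally show "(\<Sum>b\<in>B. pd x (co (D (e b)) b') * co v b) \<odot>\<^bsub>M\<^esub> e b' = (\<Oplus>\<^bsub>M\<^esub>b\<in>B. (pd x (co (D (e b)) b') * co v b) \<odot>\<^bsub>M\<^esub> e b')" .
  qed (use T in \<open>auto intro!: M.finsum_closed\<close>)
  also have "\<dots> = (\<Oplus>\<^bsub>M\<^esub>b\<in>B. \<Oplus>\<^bsub>M\<^esub>b'\<in>B. (pd x (co (D (e b)) b') * co v b) \<odot>\<^bsub>M\<^esub> e b')"
    using T by (intro finsum_swap[OF gb_ab fb_finite[OF gb_module gb_basis] fb_finite[OF gb_module gb_basis]]) auto
  also have "\<dots> = (\<Oplus>\<^bsub>M\<^esub>b\<in>B. co v b \<odot>\<^bsub>M\<^esub> ?E (e b))"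
  proof (rule M.finsum_cong')
    fix b assume b: "b \<in> B"
    have "co v b \<odot>\<^bsub>M\<^esub> ?E (e b) = (\<Oplus>\<^bsub>M\<^esub>b'\<in>B. co v b \<odot>\<^bsub>M\<^esub> (pd x (co (D (e b)) b') \<odot>\<^bsub>M\<^esub> e b'))"
      unfolding Eb[OF b] using pd_matrix_closed[OF b] bas_closed
      by (intro M.finsum_smult_ldistr[OF fb_finite[OF gb_module gb_basis] co_closed[OF v b]]) auto
    also have "\<dots> = (\<Oplus>\<^bsub>M\<^esub>b'\<in>B. (pd x (co (D (e b)) b') * co v b) \<odot>\<^bsub>M\<^esub> e b')"
    proof (rule M.finsum_cong')
      fix b' assume b': "b' \<in> B"
      show "co v b \<odot>\<^bsub>M\<^esub> (pd x (co (D (e b)) b') \<odot>\<^bsub>M\<^esub> e b') = (pd x (co (D (e b)) b') * co v b) \<odot>\<^bsub>M\<^esub> e b'"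
        using M.smult_assoc1[OF co_closed[OF v b] pd_matrix_closed[OF b b'] bas_closed[OF b']] by (simp add: mult.commute)
    qed (use T[OF b] in auto)
    finally show "(\<Oplus>\<^bsub>M\<^esub>b'\<in>B. (pd x (co (D (e b)) b') * co v b) \<odot>\<^bsub>M\<^esub> e b') = co v b \<odot>\<^bsub>M\<^esub> ?E (e b)" by (rule sym)
  qed (use M.smult_closed[OF co_closed[OF v] is_linear_closed[OF basis_pd_comm_linear bas_closed]] in auto)
  also have "\<dots> = (\<Oplus>\<^bsub>M\<^esub>b\<in>B. ?E (co v b \<odot>\<^bsub>M\<^esub> e b))"
    using is_linear_smult[OF basis_pd_comm_linear co_closed[OF v] bas_closed]
      M.smult_closed[OF co_closed[OF v] is_linear_closed[OF basis_pd_comm_linear bas_closed]] by (intro M.finsum_cong') auto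
  also have "\<dots> = ?E (\<Oplus>\<^bsub>M\<^esub>b\<in>B. co v b \<odot>\<^bsub>M\<^esub> e b)"
    using M.smult_closed[OF co_closed[OF v] bas_closed]
    by (intro addhom_finsum[OF is_linear_addhom[OF basis_pd_comm_linear] gb_ab gb_ab, symmetric]) auto
  also have "\<dots> = ?E v" unfolding coords_expand[OF gb_module gb_basis v, symmetric] ..
  finally show ?thesis .
qed

lemma entrywise_pd_linear: "is_linear RV M M epd"
proof (intro is_linearI addhomI)
  fix v assume v: "v \<in> carrier M"
  show "epd v \<in> carrier M" unfolding entrywise_pd_eq[OF v] by (rule is_linear_closed[OF basis_pd_comm_linear v])
  show "epd (v \<oplus>\<^bsub>M\<^esub> w) = epd v \<oplus>\<^bsub>M\<^esub> epd w" if w: "w \<in> carrier M" for w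
    unfolding entrywise_pd_eq[OF v] entrywise_pd_eq[OF w] entrywise_pd_eq[OF M.M.a_closed[OF v w]]
    by (rule addhom_add[OF is_linear_addhom[OF basis_pd_comm_linear] v w])
  show "epd (p \<odot>\<^bsub>M\<^esub> v) = p \<odot>\<^bsub>M\<^esub> epd v" if p: "p \<in> carrier RV" for p
    unfolding entrywise_pd_eq[OF v] entrywise_pd_eq[OF M.smult_closed[OF p v]]
    by (rule is_linear_smult[OF basis_pd_comm_linear p v])
qed

lemma entrywise_pd_odd:
  assumes odd: "\<And>v. v \<in> carrier M \<Longrightarrow> parity_inv M (D v) = \<ominus>\<^bsub>M\<^esub> D (parity_inv M v)" and v: "v \<in> carrier M"
  shows "parity_inv M (epd v) = \<ominus>\<^bsub>M\<^esub> epd (parity_inv M v)"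
proof -
  note P = parity_inv_linear[OF gr] and Pc = parity_inv_closed[OF gr]
  note dv = basis_pd_closed[OF v]
  have "parity_inv M (epd v) = \<ominus>\<^bsub>M\<^esub> basis_pd (D (parity_inv M v)) \<ominus>\<^bsub>M\<^esub> (\<ominus>\<^bsub>M\<^esub> D (basis_pd (parity_inv M v)))"
    unfolding entrywise_pd_eq[OF v] addhom_minus[OF is_linear_addhom[OF P] gb_ab gb_ab basis_pd_closed[OF D_closed[OF v]] D_closed[OF dv]]
      basis_pd_parity_inv[OF D_closed[OF v]] odd[OF v] odd[OF dv] basis_pd_parity_inv[OF v]
      addhom_neg[OF basis_pd_hom gb_ab gb_ab D_closed[OF Pc[OF v]]] ..
  also have "\<dots> = \<ominus>\<^bsub>M\<^esub> epd (parity_inv M v)" unfolding entrywise_pd_eq[OF Pc[OF v]]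
    by (rule addhom_minus[OF addhom_uminus[OF is_linear_addhom[OF is_linear_id] gb_ab] gb_ab gb_ab basis_pd_closed[OF D_closed[OF Pc[OF v]]] D_closed[OF basis_pd_closed[OF Pc[OF v]]], symmetric])
  finally show ?thesis .
qed

text \<open>The left side is the commutator of the derivation with the square of \<open>D\<close>,
  that is, with multiplication by \<open>p\<close>. For the differential of \<open>XX\<close> and a
  variable y_j it yields t_j.\<close>

lemma entrywise_pd_square:
  assumes p: "p \<in> carrier RV" and DD: "\<And>v. v \<in> carrier M \<Longrightarrow> D (D v) = p \<odot>\<^bsub>M\<^esub> v" and v: "v \<in> carrier M"
  shows "D (epd v) \<oplus>\<^bsub>M\<^esub> epd (D v) = pd x p \<odot>\<^bsub>M\<^esub> v"
proof -
  note dv = basis_pd_closed[OF v] note Dv = D_closed[OF v]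
  have "D (epd v) \<oplus>\<^bsub>M\<^esub> epd (D v) = (D (basis_pd (D v)) \<ominus>\<^bsub>M\<^esub> D (D (basis_pd v))) \<oplus>\<^bsub>M\<^esub> (basis_pd (D (D v)) \<ominus>\<^bsub>M\<^esub> D (basis_pd (D v)))"
    unfolding entrywise_pd_eq[OF v] entrywise_pd_eq[OF Dv] addhom_minus[OF D_hom gb_ab gb_ab basis_pd_closed[OF Dv] D_closed[OF dv]] ..
  also have "\<dots> = basis_pd (D (D v)) \<ominus>\<^bsub>M\<^esub> D (D (basis_pd v))"
    by (intro M.M.commutator_square basis_pd_closed D_closed v)
  also have "\<dots> = pd x p \<odot>\<^bsub>M\<^esub> v" unfolding DD[OF v] DD[OF dv] basis_pd_leibniz[OF p v]
    by (intro M.M.add_minus_left M.smult_closed p pd_mem dv v)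
  finally show ?thesis .
qed

end

text \<open>The derivation is applied to the relation DQ + QD = p. With \<open>Q\<close> itself a
  derivative of \<open>D\<close>, this is the result of differentiating the square of
  \<open>D\<close> a second time.\<close>

lemma entrywise_pd_anticommutator:
  assumes D: "is_linear RV M M D" and Q: "is_linear RV M M Q" and p: "p \<in> carrier RV"
    and DQ: "\<And>v. v \<in> carrier M \<Longrightarrow> D (Q v) \<oplus>\<^bsub>M\<^esub> Q (D v) = p \<odot>\<^bsub>M\<^esub> v" and v: "v \<in> carrier M"
  shows "(D (entrywise_pd x RV M B e Q v) \<oplus>\<^bsub>M\<^esub> entrywise_pd x RV M B e Q (D v)) \<oplus>\<^bsub>M\<^esub>
     (entrywise_pd x RV M B e D (Q v) \<oplus>\<^bsub>M\<^esub> Q (entrywise_pd x RV M B e D v)) = pd x p \<odot>\<^bsub>M\<^esub> v"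
proof -
  note Dc = is_linear_closed[OF D] and Qc = is_linear_closed[OF Q] and Dh = is_linear_addhom[OF D] and Qh = is_linear_addhom[OF Q]
  note dv = basis_pd_closed[OF v]
  have "(D (entrywise_pd x RV M B e Q v) \<oplus>\<^bsub>M\<^esub> entrywise_pd x RV M B e Q (D v)) \<oplus>\<^bsub>M\<^esub>
     (entrywise_pd x RV M B e D (Q v) \<oplus>\<^bsub>M\<^esub> Q (entrywise_pd x RV M B e D v))
    = ((D (basis_pd (Q v)) \<ominus>\<^bsub>M\<^esub> D (Q (basis_pd v))) \<oplus>\<^bsub>M\<^esub> (basis_pd (Q (D v)) \<ominus>\<^bsub>M\<^esub> Q (basis_pd (D v)))) \<oplus>\<^bsub>M\<^esub>
      ((basis_pd (D (Q v)) \<ominus>\<^bsub>M\<^esub> D (basis_pd (Q v))) \<oplus>\<^bsub>M\<^esub> (Q (basis_pd (D v)) \<ominus>\<^bsub>M\<^esub> Q (D (basis_pd v))))"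
    unfolding entrywise_pd_eq[OF Q v] entrywise_pd_eq[OF Q Dc[OF v]] entrywise_pd_eq[OF D Qc[OF v]] entrywise_pd_eq[OF D v]
      addhom_minus[OF Dh gb_ab gb_ab basis_pd_closed[OF Qc[OF v]] Qc[OF dv]] addhom_minus[OF Qh gb_ab gb_ab basis_pd_closed[OF Dc[OF v]] Dc[OF dv]] ..
  also have "\<dots> = (basis_pd (D (Q v)) \<oplus>\<^bsub>M\<^esub> basis_pd (Q (D v))) \<ominus>\<^bsub>M\<^esub> (D (Q (basis_pd v)) \<oplus>\<^bsub>M\<^esub> Q (D (basis_pd v)))"
    by (rule M.M.commutator_anticommutator; intro basis_pd_closed Dc Qc v)
  also have "\<dots> = pd x p \<odot>\<^bsub>M\<^esub> v"
    unfolding addhom_add[OF basis_pd_hom Dc[OF Qc[OF v]] Qc[OF Dc[OF v]], symmetric] DQ[OF v] DQ[OF dv] basis_pd_leibniz[OF p v]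
    by (intro M.M.add_minus_left M.smult_closed p pd_mem dv v)
  finally show ?thesis .
qed

end

section \<open>The completed polynomial ring and its connection\<close>

locale pot =
  fixes m :: nat and V :: "('k::comm_ring_1) pol"
  assumes pot: "potential Yv m V"
begin

abbreviation "R \<equiv> mpoly_ring (yvars m) :: 'k pol ring"
abbreviation "I \<equiv> jac_ideal Yv m V"
abbreviation "P N \<equiv> ideal_pow R I N"
abbreviation "K \<equiv> ky_hat m V"
abbreviation "J \<equiv> JV m V"
abbreviation "tp \<equiv> t_pow m V"
definition "t i = pd (Yv i) V"

sublocale R: cring R by simp

lemma V_mem: "V \<in> carrier R" and qr: "quasi_regular R m (\<lambda>i. pd (Yv i) V)"
  and J_basis: "\<exists>B. finite_basis (mpoly_ring {} :: 'k pol ring) J B (\<lambda>b. b)"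
  using pot by (simp_all add: potential_def Let_def)

lemma t_mem [simp, intro]: "t i \<in> carrier R"
  unfolding t_def by (intro pd_mem V_mem)

lemma I_eq: "I = Idl\<^bsub>R\<^esub> (t ` {..<m})"
  by (simp add: jac_ideal_def t_def[abs_def])

lemma I_ideal: "ideal I R"
  unfolding I_eq by (rule R.genideal_ideal) auto

lemma P_ideal: "ideal (P N) R"
  by (induction N) (simp_all add: R.oneideal R.ideal_prod_is_ideal I_ideal)

lemma P_carrier: "p \<in> P N \<Longrightarrow> p \<in> carrier R"
  by (rule ideal.Icarr[OF P_ideal])

lemma P_0 [simp]: "0 \<in> P N"
proof -
  interpret ideal "P N" R by (rule P_ideal)
  show ?thesis using zero_closed by simp
qed

lemma P_add [intro]: "p \<in> P N \<Longrightarrow> q \<in> P N \<Longrightarrow> p + q \<in> P N"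
proof -
  interpret ideal "P N" R by (rule P_ideal)
  show "p \<in> P N \<Longrightarrow> q \<in> P N \<Longrightarrow> p + q \<in> P N" using a_closed[of p q] by simp
qed

lemma P_mult: "r \<in> carrier R \<Longrightarrow> p \<in> P N \<Longrightarrow> r * p \<in> P N"
  using ideal.I_l_closed[OF P_ideal, of p N r] by simp

lemma P_uminus: "p \<in> P N \<Longrightarrow> - p \<in> P N"
  using P_mult[of "-1" p N] by simp

lemma P_diff: "p \<in> P N \<Longrightarrow> q \<in> P N \<Longrightarrow> p - q \<in> P N"
  using P_add[OF _ P_uminus, of p N q] by simp

lemma P_sum: "(\<And>i. i \<in> F \<Longrightarrow> f i \<in> P N) \<Longrightarrow> sum f F \<in> P N"
  by (induction F rule: infinite_finite_induct) auto

lemma P_swap: "p - q \<in> P N \<Longrightarrow> q - p \<in> P N"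
  using P_uminus[of "p - q" N] by simp

lemma P_trans: "p - q \<in> P N \<Longrightarrow> q - r \<in> P N \<Longrightarrow> p - r \<in> P N"
  using P_add[of "p - q" N "q - r"] by simp

lemma P_Suc_subset: "p \<in> P (Suc N) \<Longrightarrow> p \<in> P N"
proof -
  assume "p \<in> P (Suc N)"
  then have "p \<in> ideal_prod R (P N) I" by simp
  then show "p \<in> P N"
  proof (induction p rule: ideal_prod.induct)
    case (prod i j)
    then show ?case using P_mult[of j i N] ideal.Icarr[OF I_ideal, of j] by (simp add: mult.commute)
  next
    case (sum s1 s2)
    then show ?case by auto
  qed
qed

lemma P_le: "N \<le> N' \<Longrightarrow> p \<in> P N' \<Longrightarrow> p \<in> P N"
  by (induction N' rule: dec_induct) (use P_Suc_subset in auto)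

lemma P_Suc_mult: "p \<in> P N \<Longrightarrow> q \<in> I \<Longrightarrow> p * q \<in> P (Suc N)"
  using ideal_prod.prod[of p "P N" q I R] by simp

lemma P_1: "P 1 = I"
proof
  show "P 1 \<subseteq> I"
  proof
    fix p assume "p \<in> P 1"
    then have "p \<in> ideal_prod R (carrier R) I" by simp
    then show "p \<in> I"
    proof (induction p rule: ideal_prod.induct)
      case (prod i j)
      then show ?case using ideal.I_l_closed[OF I_ideal] by blast
    next
      case (sum s1 s2)
      interpret ideal I R by (rule I_ideal)
      show ?case using sum a_closed by blast
    qed
  qed
  show "I \<subseteq> P 1" using P_Suc_mult[of 1 0] by auto
qed

lemma I_P: "q \<in> I \<longleftrightarrow> q \<in> P 1" using P_1 by simp

lemma t_I: "i < m \<Longrightarrow> t i \<in> I"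
  unfolding I_eq by (rule subsetD[OF R.genideal_self]) auto

text \<open>Each generator of I^(N+1) is a product of an element of I^N with a combination of the
  t_i; multiplying through, the first factor enters the coefficients, which is why they can be taken
  in I^N.\<close>

lemma P_Suc_rep:
  assumes "p \<in> P (Suc N)"
  shows "\<exists>c. (\<forall>i. c i \<in> P N) \<and> p = (\<Sum>i<m. c i * t i)"
proof -
  have Irep: "\<exists>c. (\<forall>i. c i \<in> carrier R) \<and> p = (\<Sum>i<m. c i * t i)" if "p \<in> I" for p
  proof -
    let ?C = "{p. \<exists>c. (\<forall>i. c i \<in> carrier R) \<and> p = (\<Sum>i<m. c i * t i)}"
    have "ideal ?C R"
    proof (rule idealI[OF R.ring_axioms])
      show "subgroup ?C (add_monoid R)"
      proof (rule R.add.subgroupI)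
        show "?C \<subseteq> carrier R" by auto
        show "?C \<noteq> {}" by (auto intro!: exI[of _ "\<lambda>_. 0"])
      next
        fix p assume "p \<in> ?C"
        then obtain c where c: "\<forall>i. c i \<in> carrier R" "p = (\<Sum>i<m. c i * t i)" by blast
        then have "p \<in> carrier R" by auto
        then have "\<ominus>\<^bsub>R\<^esub> p = (\<Sum>i<m. - c i * t i)" using c(2) uminus_mpoly[of p]
          by (simp add: sum_negf)
        then show "\<ominus>\<^bsub>R\<^esub> p \<in> ?C" using c(1) by (auto intro!: exI[of _ "\<lambda>i. - c i"])
      next
        fix p q assume "p \<in> ?C" "q \<in> ?C"
        then obtain c d where c: "\<forall>i. c i \<in> carrier R" "p = (\<Sum>i<m. c i * t i)"
          "\<forall>i. d i \<in> carrier R" "q = (\<Sum>i<m. d i * t i)" by blast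
        then have "p + q = (\<Sum>i<m. (c i + d i) * t i)" by (simp add: sum.distrib distrib_right)
        then show "p \<oplus>\<^bsub>R\<^esub> q \<in> ?C" using c(1,3) by (auto intro!: exI[of _ "\<lambda>i. c i + d i"])
      qed
    next
      fix p x assume "p \<in> ?C" and x: "x \<in> carrier R"
      then obtain c where c: "\<forall>i. c i \<in> carrier R" "p = (\<Sum>i<m. c i * t i)" by blast
      then have "x * p = (\<Sum>i<m. (x * c i) * t i)" by (simp add: sum_distrib_left mult.assoc)
      then have "x * p \<in> ?C" using c(1) x by (auto intro!: exI[of _ "\<lambda>i. x * c i"])
      then show "x \<otimes>\<^bsub>R\<^esub> p \<in> ?C" "p \<otimes>\<^bsub>R\<^esub> x \<in> ?C" by (simp_all only: mpoly_ring_simps mult.commute[of p x])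
    qed
    moreover have "t ` {..<m} \<subseteq> ?C"
    proof
      fix p assume "p \<in> t ` {..<m}"
      then obtain j where j: "j < m" "p = t j" by auto
      have "(\<Sum>i<m. (if i = j then 1 else 0) * t i) = (\<Sum>i<m. if i = j then t i else 0)" by (rule sum.cong) auto
      then have "t j = (\<Sum>i<m. (if i = j then 1 else 0) * t i)" using j by simp
      then show "p \<in> ?C" using j by (auto intro!: exI[of _ "\<lambda>i. if i = j then 1 else 0"])
    qed
    ultimately have "I \<subseteq> ?C" unfolding I_eq by (rule R.genideal_minimal)
    then show ?thesis using that by blast
  qed
  have "p \<in> ideal_prod R (P N) I" using assms by simp
  then show ?thesis
  proof (induction p rule: ideal_prod.induct)
    case (prod i j)
    then obtain c where c: "\<forall>i. c i \<in> carrier R" "j = (\<Sum>i<m. c i * t i)" using Irep by blast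
    have "i \<otimes>\<^bsub>R\<^esub> j = (\<Sum>i'<m. (c i' * i) * t i')" by (simp add: c(2) sum_distrib_left mult_ac)
    then show ?case using c(1) prod(1) P_mult by (intro exI[of _ "\<lambda>i'. c i' * i"]) auto
  next
    case (sum s1 s2)
    then obtain c d where c: "\<forall>i. c i \<in> P N" "s1 = (\<Sum>i<m. c i * t i)"
          "\<forall>i. d i \<in> P N" "s2 = (\<Sum>i<m. d i * t i)" by blast
    then have "s1 \<oplus>\<^bsub>R\<^esub> s2 = (\<Sum>i<m. (c i + d i) * t i)" by (simp add: sum.distrib distrib_right)
    then show ?case using c(1,3) P_add by (intro exI[of _ "\<lambda>i. c i + d i"]) auto
  qed
qed

declare ideal_pow.simps(2) [simp del]

subsection \<open>Monomials in t\<close>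

definition deg :: "(nat \<Rightarrow>\<^sub>0 nat) \<Rightarrow> nat" where "deg u = (\<Sum>i<m. Poly_Mapping.lookup u i)"
definition "MI = multi_indices m"
text \<open>Modulo I^N only the finitely many multi-indices in \<open>B N\<close> contribute to a
  series in t, so infinite sums are replaced by finite ones at each level. The set
  \<open>D N\<close> is what is added from one level to the next.\<close>

definition "B N = {u \<in> MI. deg u < N}"
definition "D N = {u \<in> MI. deg u = N}"
abbreviation "ep i \<equiv> Poly_Mapping.single i (Suc 0)"

lemma deg_add: "deg (u + v) = deg u + deg v"
  by (simp add: deg_def lookup_add sum.distrib)

lemma deg_ep: "i < m \<Longrightarrow> deg (ep i) = 1"
  by (simp add: deg_def lookup_single when_def)

lemma MI_add: "u \<in> MI \<Longrightarrow> v \<in> MI \<Longrightarrow> u + v \<in> MI"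
  using keys_add[of u v] by (auto simp: MI_def multi_indices_def)

lemma MI_ep: "i < m \<Longrightarrow> ep i \<in> MI" by (auto simp: MI_def multi_indices_def)

lemma MI_minus: "u \<in> MI \<Longrightarrow> u - v \<in> MI"
proof -
  have "Poly_Mapping.keys (u - v) \<subseteq> Poly_Mapping.keys u"
    by (auto simp: in_keys_iff lookup_minus)
  then show "u \<in> MI \<Longrightarrow> u - v \<in> MI" by (auto simp: MI_def multi_indices_def)
qed

lemma minus_ep: "Poly_Mapping.lookup u i \<noteq> 0 \<Longrightarrow> u - ep i + ep i = u"
  by (rule poly_mapping_eqI) (auto simp: lookup_add lookup_minus lookup_single when_def)

lemma deg_minus_ep: "i < m \<Longrightarrow> Poly_Mapping.lookup u i \<noteq> 0 \<Longrightarrow> Suc (deg (u - ep i)) = deg u"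
  using deg_add[of "u - ep i" "ep i"] minus_ep[of u i] deg_ep[of i] by simp

lemma B_finite: "finite (B N)"
proof -
  let ?f = "\<lambda>u::nat \<Rightarrow>\<^sub>0 nat. restrict (Poly_Mapping.lookup u) {..<m}"
  have "inj_on ?f (B N)"
  proof (rule inj_onI)
    fix u v assume uv: "u \<in> B N" "v \<in> B N" "?f u = ?f v"
    show "u = v"
    proof (rule poly_mapping_eqI)
      fix i
      show "Poly_Mapping.lookup u i = Poly_Mapping.lookup v i"
      proof (cases "i < m")
        case True
        then show ?thesis using fun_cong[OF uv(3), of i] by simp
      next
        case False
        then have "i \<notin> Poly_Mapping.keys u" "i \<notin> Poly_Mapping.keys v"
          using uv(1,2) by (auto simp: B_def MI_def multi_indices_def)
        then show ?thesis by (simp add: in_keys_iff)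
      qed
    qed
  qed
  moreover have "?f ` B N \<subseteq> {..<m} \<rightarrow>\<^sub>E {..<N}"
  proof (rule image_subsetI)
    fix u assume u: "u \<in> B N"
    have "Poly_Mapping.lookup u i < N" if "i < m" for i
    proof -
      have "Poly_Mapping.lookup u i \<le> deg u" unfolding deg_def
        using that by (intro member_le_sum) auto
      then show ?thesis using u by (simp add: B_def)
    qed
    then show "?f u \<in> {..<m} \<rightarrow>\<^sub>E {..<N}" by auto
  qed
  ultimately show ?thesis
    by (meson finite_PiE finite_imageD finite_lessThan finite_subset)
qed

lemma B_Suc: "B (Suc N) = B N \<union> D N" and B_D: "B N \<inter> D N = {}"
  by (auto simp: B_def D_def)

lemma D_finite: "finite (D N)"
  using B_finite[of "Suc N"] by (simp add: B_Suc)

lemma B_mono: "N \<le> N' \<Longrightarrow> B N \<subseteq> B N'" by (auto simp: B_def)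

lemma tp_mem [simp, intro]: "tp u \<in> carrier R"
  unfolding t_pow_def t_def[symmetric] by (intro mpoly_prod mpoly_power t_mem)

lemma tp_0: "tp 0 = 1" by (simp add: t_pow_def)

lemma tp_add: "tp (u + v) = tp u * tp v"
  by (simp add: t_pow_def lookup_add power_add prod.distrib)

lemma tp_ep: "i < m \<Longrightarrow> tp (ep i) = t i"
proof -
  assume i: "i < m"
  have "tp (ep i) = (\<Prod>j<m. if j = i then t j else 1)"
    unfolding t_pow_def t_def[symmetric] by (intro prod.cong) (auto simp: lookup_single when_def)
  also have "\<dots> = t i" using i by (simp add: prod.delta)
  finally show ?thesis .
qed

lemma tp_ep_add: "i < m \<Longrightarrow> tp (u + ep i) = t i * tp u"
  unfolding tp_add by (simp only: tp_ep mult.commute)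

lemma MI_deg_0: "u \<in> MI \<Longrightarrow> deg u = 0 \<Longrightarrow> u = 0"
proof -
  assume u: "u \<in> MI" "deg u = 0"
  have "Poly_Mapping.keys u = {}"
  proof (rule equals0I)
    fix i assume i: "i \<in> Poly_Mapping.keys u"
    then have "i < m" using u by (auto simp: MI_def multi_indices_def)
    then have "Poly_Mapping.lookup u i = 0" using u(2) by (simp add: deg_def)
    then show False using i by (simp add: in_keys_iff)
  qed
  then show "u = 0" by (simp add: poly_mapping_eqI in_keys_iff)
qed

lemma MI_Suc: "u \<in> MI \<Longrightarrow> deg u = Suc N \<Longrightarrow> \<exists>i<m. Poly_Mapping.lookup u i \<noteq> 0"
  unfolding deg_def by (metis lessThan_iff nat.distinct(1) sum.neutral)

lemma tp_P: "u \<in> MI \<Longrightarrow> tp u \<in> P (deg u)"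
proof (induction "deg u" arbitrary: u)
  case 0
  then have "u = 0" using MI_deg_0 by simp
  then show ?case using 0 by (simp add: tp_0)
next
  case (Suc N)
  then obtain i where i: "i < m" "Poly_Mapping.lookup u i \<noteq> 0" using MI_Suc[of u N] by auto
  have d: "N = deg (u - ep i)" using deg_minus_ep[OF i] Suc(2) by simp
  have "tp u = tp (u - ep i) * t i" using tp_ep_add[OF i(1), of "u - ep i"] minus_ep[OF i(2)] by (simp add: mult.commute)
  also have "\<dots> \<in> P (Suc N)" using Suc(1)[OF d MI_minus[OF Suc(3)]] t_I[OF i(1)] d by (intro P_Suc_mult) simp_all
  finally show ?case using Suc(2) by simp
qed

lemma tp_P_le: "u \<in> MI \<Longrightarrow> N \<le> deg u \<Longrightarrow> tp u \<in> P N"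
  by (rule P_le[OF _ tp_P])

text \<open>Splitting off one factor t_i at a time writes an element of I^N as a form of degree N in
  t. Closing the set of such forms under addition collects terms with the same monomial.\<close>

lemma P_rep: "p \<in> P N \<Longrightarrow> \<exists>c. (\<forall>u. c u \<in> carrier R) \<and> p = (\<Sum>u\<in>D N. c u * tp u)"
proof (induction N arbitrary: p)
  case 0
  have "D 0 = {0}" using MI_deg_0 by (auto simp: D_def deg_def MI_def multi_indices_def)
  then show ?case using 0 by (intro exI[of _ "\<lambda>_. p"]) (simp add: tp_0)
next
  case (Suc N)
  let ?E = "\<lambda>p. \<exists>c. (\<forall>u. c u \<in> carrier R) \<and> p = (\<Sum>u\<in>D (Suc N). c u * tp u)"
  have E0: "?E 0" by (intro exI[of _ "\<lambda>_. 0"]) simp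
  have Eadd: "?E (p + q)" if pq: "?E p" "?E q" for p q
  proof -
    obtain c where "(\<forall>u. c u \<in> carrier R) \<and> p = (\<Sum>u\<in>D (Suc N). c u * tp u)"
      using pq(1) by (elim exE)
    moreover obtain d where "(\<forall>u. d u \<in> carrier R) \<and> q = (\<Sum>u\<in>D (Suc N). d u * tp u)"
      using pq(2) by (elim exE)
    ultimately
    show ?thesis by (intro exI[of _ "\<lambda>u. c u + d u"]) (simp add: sum.distrib distrib_right mpoly_add)
  qed
  have Esum: "?E (sum g F)" if "\<And>i. i \<in> F \<Longrightarrow> ?E (g i)" for g :: "'i \<Rightarrow> 'k pol" and F
    using that
  proof (induction F rule: infinite_finite_induct)
    case (insert x F)
    then show ?case using Eadd[of "g x" "sum g F"] by simp
  qed (use E0 in auto)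
  have Eel: "?E (c * tp v)" if "c \<in> carrier R" "v \<in> D (Suc N)" for c v
  proof -
    have "(\<Sum>u\<in>D (Suc N). (if u = v then c else 0) * tp u) = (\<Sum>u\<in>D (Suc N). if u = v then c * tp u else 0)"
      by (rule sum.cong) auto
    then have "c * tp v = (\<Sum>u\<in>D (Suc N). (if u = v then c else 0) * tp u)"
      using that(2) D_finite by simp
    then show ?thesis using that(1) by (intro exI[of _ "\<lambda>u. if u = v then c else 0"]) simp
  qed
  obtain c where c0: "(\<forall>i. c i \<in> P N) \<and> p = (\<Sum>i<m. c i * t i)" using P_Suc_rep[OF Suc.prems] by (elim exE)
  note c = conjunct1[OF c0] conjunct2[OF c0]
  have "?E (c i * t i)" if i: "i < m" for i
  proof -
    have "c i \<in> P N" using c(1) by blast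
    from Suc.IH[OF this] obtain d where d0: "(\<forall>u. d u \<in> carrier R) \<and> c i = (\<Sum>u\<in>D N. d u * tp u)" by (elim exE)
    note d = conjunct1[OF d0] conjunct2[OF d0]
    have "c i * t i = (\<Sum>u\<in>D N. d u * tp (u + ep i))"
      unfolding d(2) sum_distrib_right tp_ep_add[OF i] by (simp add: mult_ac)
    moreover have "?E (\<Sum>u\<in>D N. d u * tp (u + ep i))"
    proof (rule Esum)
      fix u assume "u \<in> D N"
      then have "u + ep i \<in> D (Suc N)" using i by (simp add: D_def MI_add MI_ep deg_add deg_ep)
      then show "?E (d u * tp (u + ep i))" using d(1) by (intro Eel) auto
    qed
    ultimately show ?thesis by simp
  qed
  then have "?E (\<Sum>i<m. c i * t i)" by (intro Esum) simp
  then show ?case using c(2) by simp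
qed

text \<open>Quasi-regularity rewritten with ordinary sums and the monomials
  \<open>tp\<close>.\<close>

lemma qreg:
  assumes c: "\<And>u. u \<in> D d \<Longrightarrow> c u \<in> carrier R" and s: "(\<Sum>u\<in>D d. c u * tp u) \<in> P (Suc d)" and u: "u \<in> D d"
  shows "c u \<in> I"
proof -
  have DD: "{u \<in> multi_indices m. (\<Sum>i<m. Poly_Mapping.lookup u i) = d} = D d"
    by (auto simp: D_def MI_def deg_def)
  have II: "Idl\<^bsub>R\<^esub> ((\<lambda>i. pd (Yv i) V) ` {..<m}) = I" by (simp add: jac_ideal_def)
  have pr: "(\<Otimes>\<^bsub>R\<^esub>i\<in>{..<m}. pd (Yv i) V [^]\<^bsub>R\<^esub> Poly_Mapping.lookup u i) = tp u" for u
    using V_mem by (subst finprod_mpoly) (auto simp: t_pow_def)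
  have "(\<Oplus>\<^bsub>R\<^esub>u\<in>D d. c u \<otimes>\<^bsub>R\<^esub> (\<Otimes>\<^bsub>R\<^esub>i\<in>{..<m}. pd (Yv i) V [^]\<^bsub>R\<^esub> Poly_Mapping.lookup u i)) = (\<Sum>u\<in>D d. c u * tp u)"
    unfolding pr using c by (subst finsum_mpoly) auto
  then show ?thesis using qr[unfolded quasi_regular_def Let_def II, rule_format, of c d u] c s u
    unfolding DD by (simp add: Pi_iff)
qed

subsection \<open>Elements of the completion\<close>

definition cos :: "nat \<Rightarrow> 'k pol \<Rightarrow> 'k pol set" where "cos N a = P N +>\<^bsub>R\<^esub> a"

lemma cos_eq: "a \<in> carrier R \<Longrightarrow> b \<in> carrier R \<Longrightarrow> cos N a = cos N b \<longleftrightarrow> a - b \<in> P N"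
  using R.quotient_eq_iff_same_a_r_cos[OF P_ideal, of a b N] by (simp add: cos_def)

lemma cos_def2: "cos N a = (\<lambda>p. p + a) ` P N"
  by (auto simp: cos_def a_r_coset_def r_coset_def)

lemma cos_self: "a \<in> cos N a" unfolding cos_def2 by (rule image_eqI[of _ _ 0]) auto

text \<open>In the inverse limit, compatibility of consecutive levels was encoded as inclusion of
  cosets; on representatives it is a congruence modulo the lower power of the ideal.\<close>

lemma cos_subset: "a \<in> carrier R \<Longrightarrow> b \<in> carrier R \<Longrightarrow> cos (Suc N) b \<subseteq> cos N a \<longleftrightarrow> b - a \<in> P N"
proof
  assume "cos (Suc N) b \<subseteq> cos N a"
  then have "b \<in> cos N a" using cos_self by blast
  then show "b - a \<in> P N" by (auto simp: cos_def2)
next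
  assume ba: "b - a \<in> P N"
  show "cos (Suc N) b \<subseteq> cos N a"
  proof
    fix x assume "x \<in> cos (Suc N) b"
    then obtain p where p: "p \<in> P (Suc N)" "x = p + b" unfolding cos_def2 by (elim imageE)
    then have "x = (p + (b - a)) + a" by simp
    then show "x \<in> cos N a" unfolding cos_def2 using P_add[OF P_Suc_subset[OF p(1)] ba] by (rule image_eqI)
  qed
qed

lemma quot_carrier: "carrier (R Quot P N) = cos N ` carrier R"
  by (auto simp: FactRing_def A_RCOSETS_def' cos_def)

lemma quot_ops:
  assumes "a \<in> carrier R" "b \<in> carrier R"
  shows "cos N a \<oplus>\<^bsub>R Quot P N\<^esub> cos N b = cos N (a + b)"
    and "(P N +>\<^bsub>R\<^esub> a) \<otimes>\<^bsub>R Quot P N\<^esub> cos N b = cos N (a * b)"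
proof -
  interpret ideal "P N" R by (rule P_ideal)
  show "cos N a \<oplus>\<^bsub>R Quot P N\<^esub> cos N b = cos N (a + b)"
    using a_rcos_sum[of a b] assms by (simp add: FactRing_def cos_def)
  show "(P N +>\<^bsub>R\<^esub> a) \<otimes>\<^bsub>R Quot P N\<^esub> cos N b = cos N (a * b)"
    using rcoset_mult_add[of a b] assms by (simp add: FactRing_def cos_def)
qed

lemma quot_zero: "\<zero>\<^bsub>R Quot P N\<^esub> = cos N 0"
proof -
  have "cos N 0 = P N" by (auto simp: cos_def2)
  then show ?thesis by (simp add: FactRing_def)
qed

text \<open>Elements of the completion are handled through sequences of polynomials that represent
  their levels. Equations in the inverse limit then become congruences modulo I^N, one for each
  N.\<close>

definition coherent :: "(nat \<Rightarrow> 'k pol) \<Rightarrow> bool" where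
  "coherent a \<longleftrightarrow> (\<forall>N. a N \<in> carrier R) \<and> (\<forall>N. a (Suc N) - a N \<in> P N)"

definition ofseq :: "(nat \<Rightarrow> 'k pol) \<Rightarrow> nat \<Rightarrow> 'k pol set" where "ofseq a = (\<lambda>N. cos N (a N))"

lemma coherentD: "coherent a \<Longrightarrow> a N \<in> carrier R" "coherent a \<Longrightarrow> a (Suc N) - a N \<in> P N"
  by (auto simp: coherent_def)

lemma coherent_le:
  assumes a: "coherent a" and "N \<le> N'" shows "a N' - a N \<in> P N"
  using assms(2)
proof (induction N' rule: dec_induct)
  case (step N')
  show ?case by (rule P_trans[OF P_le[OF step(1) coherentD(2)[OF a]] step.IH])
qed simp

lemma ofseq_eq: "coherent a \<Longrightarrow> coherent b \<Longrightarrow> ofseq a = ofseq b \<longleftrightarrow> (\<forall>N. a N - b N \<in> P N)"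
  by (simp add: ofseq_def fun_eq_iff cos_eq coherentD(1))

lemma K_carrier: "carrier K = ofseq ` {a. coherent a}"
proof (intro equalityI subsetI)
  fix h assume "h \<in> carrier K"
  then have h: "\<And>N. h N \<in> cos N ` carrier R" "\<And>N. h (Suc N) \<subseteq> h N"
    by (simp_all add: ky_hat_def completion_def quot_carrier)
  then have "\<forall>N. \<exists>a. a \<in> carrier R \<and> h N = cos N a" by blast
  then obtain a where a: "\<And>N. a N \<in> carrier R" "\<And>N. h N = cos N (a N)" by metis
  then have "coherent a" unfolding coherent_def using h(2) cos_subset by simp
  moreover have "h = ofseq a" using a(2) by (simp add: ofseq_def fun_eq_iff)
  ultimately show "h \<in> ofseq ` {a. coherent a}" by blast
next
  fix h assume "h \<in> ofseq ` {a. coherent a}"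
  then obtain a where a: "coherent a" "h = ofseq a" by blast
  then show "h \<in> carrier K"
    using cos_subset coherentD[OF a(1)] by (auto simp: ky_hat_def completion_def quot_carrier ofseq_def)
qed

lemma ofseq_closed [intro]: "coherent a \<Longrightarrow> ofseq a \<in> carrier K"
  by (simp add: K_carrier)

lemma K_cases: assumes "h \<in> carrier K" obtains a where "coherent a" "h = ofseq a"
  using assms by (auto simp: K_carrier)

lemma coherent_add: "coherent a \<Longrightarrow> coherent b \<Longrightarrow> coherent (\<lambda>N. a N + b N)"
  unfolding coherent_def using P_add[of "a (Suc N) - a N" N "b (Suc N) - b N" for N] by (simp add: algebra_simps)

lemma coherent_mult: "p \<in> carrier R \<Longrightarrow> coherent a \<Longrightarrow> coherent (\<lambda>N. p * a N)"
  unfolding coherent_def using P_mult[of p "a (Suc N) - a N" N for N] by (simp add: right_diff_distrib)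

lemma coherent_const: "p \<in> carrier R \<Longrightarrow> coherent (\<lambda>N. p)" by (simp add: coherent_def)

lemma coherent_sum: "(\<And>i. i \<in> F \<Longrightarrow> coherent (g i)) \<Longrightarrow> coherent (\<lambda>N. \<Sum>i\<in>F. g i N)"
  by (induction F rule: infinite_finite_induct) (simp_all add: coherent_add coherent_const)

lemma K_add: "coherent a \<Longrightarrow> coherent b \<Longrightarrow> ofseq a \<oplus>\<^bsub>K\<^esub> ofseq b = ofseq (\<lambda>N. a N + b N)"
  by (simp add: ky_hat_def completion_def ofseq_def quot_ops coherentD)

lemma K_smult: "p \<in> carrier R \<Longrightarrow> coherent a \<Longrightarrow> p \<odot>\<^bsub>K\<^esub> ofseq a = ofseq (\<lambda>N. p * a N)"
  by (simp add: ky_hat_def completion_def ofseq_def quot_ops coherentD)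

lemma K_zero: "\<zero>\<^bsub>K\<^esub> = ofseq (\<lambda>N. 0)"
  by (simp add: ky_hat_def completion_def ofseq_def quot_zero)

lemma K_module: "module R K"
proof (rule moduleI)
  show "abelian_group K"
  proof (rule abelian_groupI)
    fix x y z assume "x \<in> carrier K" "y \<in> carrier K" "z \<in> carrier K"
    then obtain a b c where abc: "coherent a" "coherent b" "coherent c" "x = ofseq a" "y = ofseq b" "z = ofseq c" by (meson K_cases)
    show "x \<oplus>\<^bsub>K\<^esub> y \<in> carrier K" "x \<oplus>\<^bsub>K\<^esub> y \<oplus>\<^bsub>K\<^esub> z = x \<oplus>\<^bsub>K\<^esub> (y \<oplus>\<^bsub>K\<^esub> z)" "x \<oplus>\<^bsub>K\<^esub> y = y \<oplus>\<^bsub>K\<^esub> x"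
      using abc by (auto simp: K_add coherent_add add_ac)
  next
    show "\<zero>\<^bsub>K\<^esub> \<in> carrier K" by (auto simp: K_zero coherent_const)
    fix x assume "x \<in> carrier K"
    then obtain a where a: "coherent a" "x = ofseq a" by (rule K_cases)
    show "\<zero>\<^bsub>K\<^esub> \<oplus>\<^bsub>K\<^esub> x = x" using a by (simp add: K_zero K_add coherent_const)
    have c: "coherent (\<lambda>N. -1 * a N)" by (rule coherent_mult) (use a in auto)
    show "\<exists>y\<in>carrier K. y \<oplus>\<^bsub>K\<^esub> x = \<zero>\<^bsub>K\<^esub>"
      using a c K_add[OF c a(1)] by (intro bexI[of _ "ofseq (\<lambda>N. -1 * a N)"]) (auto simp: K_zero)
  qed
next
  fix p q x y assume pq: "p \<in> carrier R" "q \<in> carrier R" and "x \<in> carrier K" "y \<in> carrier K"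
  then obtain a b where ab: "coherent a" "coherent b" "x = ofseq a" "y = ofseq b" by (meson K_cases)
  show "p \<odot>\<^bsub>K\<^esub> (x \<oplus>\<^bsub>K\<^esub> y) = p \<odot>\<^bsub>K\<^esub> x \<oplus>\<^bsub>K\<^esub> p \<odot>\<^bsub>K\<^esub> y"
    using ab pq by (simp add: K_add K_smult coherent_add coherent_mult distrib_left)
next
  fix p q x assume pq: "p \<in> carrier R" "q \<in> carrier R" and "x \<in> carrier K"
  then obtain a where ab: "coherent a" "x = ofseq a" by (meson K_cases)
  show "(p \<oplus>\<^bsub>R\<^esub> q) \<odot>\<^bsub>K\<^esub> x = p \<odot>\<^bsub>K\<^esub> x \<oplus>\<^bsub>K\<^esub> q \<odot>\<^bsub>K\<^esub> x" "(p \<otimes>\<^bsub>R\<^esub> q) \<odot>\<^bsub>K\<^esub> x = p \<odot>\<^bsub>K\<^esub> (q \<odot>\<^bsub>K\<^esub> x)"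
    using ab pq by (simp_all add: K_add K_smult coherent_mult distrib_right mult.assoc)
qed (auto elim!: K_cases simp: K_smult coherent_mult intro!: ofseq_closed)

sublocale K: module R K by (rule K_module)

lemma K_finsum: "finite F \<Longrightarrow> (\<And>i. i \<in> F \<Longrightarrow> coherent (g i)) \<Longrightarrow> (\<Oplus>\<^bsub>K\<^esub>i\<in>F. ofseq (g i)) = ofseq (\<lambda>N. \<Sum>i\<in>F. g i N)"
proof (induction F rule: finite_induct)
  case empty
  then show ?case by (simp add: K_zero)
next
  case (insert i F)
  then have "(\<Oplus>\<^bsub>K\<^esub>i\<in>insert i F. ofseq (g i)) = ofseq (g i) \<oplus>\<^bsub>K\<^esub> (\<Oplus>\<^bsub>K\<^esub>i\<in>F. ofseq (g i))"
    by (intro K.finsum_insert) auto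
  then show ?case using insert by (simp add: K_add coherent_sum)
qed

subsection \<open>The Jacobi ring\<close>

definition cj :: "'k pol \<Rightarrow> 'k pol set" where "cj a = cos 1 a"

lemma ofseq_1: "ofseq a (Suc 0) = cj (a (Suc 0))" by (simp add: ofseq_def cj_def)

lemma cj_eq: "a \<in> carrier R \<Longrightarrow> b \<in> carrier R \<Longrightarrow> cj a = cj b \<longleftrightarrow> a - b \<in> I"
  unfolding cj_def I_P by (rule cos_eq)

lemma J_carrier: "carrier J = cj ` carrier R"
  using quot_carrier[of 1] unfolding P_1 cj_def by (simp add: jac_ring_def quot_alg_def ring.defs module.defs)

lemma J_ops:
  assumes "a \<in> carrier R" "b \<in> carrier R"
  shows "cj a \<oplus>\<^bsub>J\<^esub> cj b = cj (a + b)" "a \<odot>\<^bsub>J\<^esub> cj b = cj (a * b)"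
  using quot_ops[OF assms, of 1] unfolding P_1 cj_def by (simp_all add: jac_ring_def quot_alg_def ring.defs module.defs)

lemma J_zero: "\<zero>\<^bsub>J\<^esub> = cj 0"
  using quot_zero[of 1] unfolding P_1 cj_def by (simp_all add: jac_ring_def quot_alg_def ring.defs module.defs)

lemma J_cases: assumes "r \<in> carrier J" obtains a where "a \<in> carrier R" "r = cj a"
  using assms by (auto simp: J_carrier)

lemma cj_closed [intro]: "a \<in> carrier R \<Longrightarrow> cj a \<in> carrier J" by (simp add: J_carrier)

lemma J_module: "module R J"
proof (rule moduleI)
  show "abelian_group J"
  proof (rule abelian_groupI)
    fix x y z assume "x \<in> carrier J" "y \<in> carrier J" "z \<in> carrier J"
    then obtain a b c where abc: "a \<in> carrier R" "b \<in> carrier R" "c \<in> carrier R" "x = cj a" "y = cj b" "z = cj c" by (meson J_cases)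
    show "x \<oplus>\<^bsub>J\<^esub> y \<in> carrier J" "x \<oplus>\<^bsub>J\<^esub> y \<oplus>\<^bsub>J\<^esub> z = x \<oplus>\<^bsub>J\<^esub> (y \<oplus>\<^bsub>J\<^esub> z)" "x \<oplus>\<^bsub>J\<^esub> y = y \<oplus>\<^bsub>J\<^esub> x"
      using abc by (auto simp: J_ops add_ac)
  next
    show "\<zero>\<^bsub>J\<^esub> \<in> carrier J" by (auto simp: J_zero)
    fix x assume "x \<in> carrier J"
    then obtain a where a: "a \<in> carrier R" "x = cj a" by (rule J_cases)
    show "\<zero>\<^bsub>J\<^esub> \<oplus>\<^bsub>J\<^esub> x = x" using a J_ops(1)[of 0 a] by (simp add: J_zero)
    show "\<exists>y\<in>carrier J. y \<oplus>\<^bsub>J\<^esub> x = \<zero>\<^bsub>J\<^esub>"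
      using a J_ops(1)[of "-a" a] by (intro bexI[of _ "cj (- a)"]) (auto simp: J_zero)
  qed
next
  fix p x y assume p: "p \<in> carrier R" and "x \<in> carrier J" "y \<in> carrier J"
  then obtain a b where ab: "a \<in> carrier R" "b \<in> carrier R" "x = cj a" "y = cj b" by (meson J_cases)
  show "p \<odot>\<^bsub>J\<^esub> (x \<oplus>\<^bsub>J\<^esub> y) = p \<odot>\<^bsub>J\<^esub> x \<oplus>\<^bsub>J\<^esub> p \<odot>\<^bsub>J\<^esub> y"
    using ab p by (simp add: J_ops distrib_left)
next
  fix p q x assume pq: "p \<in> carrier R" "q \<in> carrier R" and "x \<in> carrier J"
  then obtain a where ab: "a \<in> carrier R" "x = cj a" by (meson J_cases)
  show "(p \<oplus>\<^bsub>R\<^esub> q) \<odot>\<^bsub>J\<^esub> x = p \<odot>\<^bsub>J\<^esub> x \<oplus>\<^bsub>J\<^esub> q \<odot>\<^bsub>J\<^esub> x" "(p \<otimes>\<^bsub>R\<^esub> q) \<odot>\<^bsub>J\<^esub> x = p \<odot>\<^bsub>J\<^esub> (q \<odot>\<^bsub>J\<^esub> x)"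
    using ab pq by (simp_all add: J_ops distrib_right mult.assoc)
qed (auto elim!: J_cases simp: J_ops intro!: cj_closed)

sublocale J: module R J by (rule J_module)

lemma ev_linear: "is_linear R K J (\<lambda>h. h 1)"
proof (intro is_linearI addhomI)
  fix h assume "h \<in> carrier K"
  then obtain a where a: "coherent a" "h = ofseq a" by (rule K_cases)
  note a1 = coherentD(1)[OF a(1), of "Suc 0"]
  show "h 1 \<in> carrier J" using a cj_closed[OF a1] by (simp add: ofseq_1)
  show "(h \<oplus>\<^bsub>K\<^esub> h') 1 = h 1 \<oplus>\<^bsub>J\<^esub> h' 1" if h': "h' \<in> carrier K" for h'
  proof -
    obtain b where b: "coherent b" "h' = ofseq b" using h' by (rule K_cases)
    show ?thesis using J_ops(1)[OF a1 coherentD(1)[OF b(1), of "Suc 0"]] a b by (simp add: K_add ofseq_1)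
  qed
  show "(p \<odot>\<^bsub>K\<^esub> h) 1 = p \<odot>\<^bsub>J\<^esub> h 1" if "p \<in> carrier R" for p
    using that a J_ops(2)[OF that a1] by (simp add: K_smult ofseq_1)
qed

lemma ev_surj: assumes "r \<in> carrier J" shows "\<exists>h\<in>carrier K. h 1 = r"
proof -
  obtain a where a: "a \<in> carrier R" "r = cj a" using assms by (rule J_cases)
  show ?thesis using a by (intro bexI[of _ "ofseq (\<lambda>N. a)"] ofseq_closed coherent_const) (simp add: ofseq_1)
qed

text \<open>The element is the limit of a telescoping series whose N-th increment, for positive N,
  lies in I^N. Each increment is a combination of the t_i with coefficients in I^(N-1), so the
  coefficients of each t_i sum to an element of the completion.\<close>

lemma ev_kernel:
  assumes h: "h \<in> carrier K" "h 1 = \<zero>\<^bsub>J\<^esub>"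
  shows "\<exists>c. (\<forall>i<m. c i \<in> carrier K) \<and> h = (\<Oplus>\<^bsub>K\<^esub>i\<in>{..<m}. t i \<odot>\<^bsub>K\<^esub> c i)"
proof -
  obtain a where a: "coherent a" "h = ofseq a" using h(1) by (rule K_cases)
  have a1: "a 1 \<in> P 1"
    using h(2) a cj_eq[OF coherentD(1)[OF a(1), of "Suc 0"] mpoly_0] by (simp add: J_zero ofseq_1 I_P)
  \<comment> \<open>The initial term is \<open>a 1\<close> and not \<open>a 0\<close>, because only
    \<open>a 1\<close> is known to lie in I. The partial sum up to N is therefore
    \<open>a (Suc N)\<close>, and truncated subtraction covers the power of the ideal at N =
    0.\<close>
  let ?x = "\<lambda>N. if N = 0 then a 1 else a (Suc N) - a N"
  have "?x N \<in> P (Suc (N - 1))" for N using a1 coherentD(2)[OF a(1), of N] by (cases N) auto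
  note xr = P_Suc_rep[OF this]
  have "\<exists>c. \<forall>N. (\<forall>i. c N i \<in> P (N - 1)) \<and> ?x N = (\<Sum>i<m. c N i * t i)"
    by (intro choice allI xr)
  then obtain c where c0: "\<forall>N. (\<forall>i. c N i \<in> P (N - 1)) \<and> ?x N = (\<Sum>i<m. c N i * t i)" by (elim exE)
  note c = conjunct1[OF spec[OF c0], THEN spec] conjunct2[OF spec[OF c0]]
  let ?h = "\<lambda>i N. \<Sum>M\<le>N. c M i"
  have coherent: "coherent (?h i)" for i
    unfolding coherent_def
  proof (intro conjI allI)
    fix N
    show "?h i N \<in> carrier R" by (intro mpoly_sum P_carrier[OF c(1)])
    show "?h i (Suc N) - ?h i N \<in> P N" using c(1)[of "Suc N" i] by simp
  qed
  have sum: "(\<Sum>i<m. t i * ?h i N) = a (Suc N)" for N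
  proof (induction N)
    case 0
    then show ?case using c(2)[of 0] by (simp add: mult.commute)
  next
    case (Suc N)
    have "(\<Sum>i<m. t i * ?h i (Suc N)) = (\<Sum>i<m. t i * ?h i N) + (\<Sum>i<m. c (Suc N) i * t i)"
      by (simp add: algebra_simps sum.distrib)
    then show ?case unfolding Suc c(2)[of "Suc N", symmetric] by simp
  qed
  have "(\<Oplus>\<^bsub>K\<^esub>i\<in>{..<m}. t i \<odot>\<^bsub>K\<^esub> ofseq (?h i)) = (\<Oplus>\<^bsub>K\<^esub>i\<in>{..<m}. ofseq (\<lambda>N. t i * ?h i N))"
    by (rule K.finsum_cong'[OF refl]) (simp_all add: K_smult coherent coherent_mult ofseq_closed)
  also have "\<dots> = ofseq (\<lambda>N. \<Sum>i<m. t i * ?h i N)"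
    by (rule K_finsum) (simp_all add: coherent coherent_mult)
  also have "\<dots> = ofseq (\<lambda>N. a (Suc N))" unfolding sum ..
  \<comment> \<open>Advancing the index by one changes level N only by an element of I^N, hence not
    at all.\<close>
  also have "\<dots> = ofseq a"
  proof (subst ofseq_eq)
    show "coherent (\<lambda>N. a (Suc N))" unfolding coherent_def using coherentD[OF a(1)] P_Suc_subset by simp
  qed (use a(1) coherentD(2)[OF a(1)] in simp_all)
  finally show ?thesis using a(2) by (intro exI[of _ "\<lambda>i. ofseq (?h i)"] conjI allI impI ofseq_closed coherent) simp
qed

lemma t_kill: "i < m \<Longrightarrow> r \<in> carrier J \<Longrightarrow> t i \<odot>\<^bsub>J\<^esub> r = \<zero>\<^bsub>J\<^esub>"
proof (erule J_cases)
  fix a assume i: "i < m" and a: "a \<in> carrier R" "r = cj a"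
  have "t i * a - 0 \<in> I" using P_mult[OF a(1), of "t i" 1] t_I[OF i] unfolding I_P by (simp add: mult.commute)
  then have "cj (t i * a) = cj 0" using a by (subst cj_eq) auto
  then show "t i \<odot>\<^bsub>J\<^esub> r = \<zero>\<^bsub>J\<^esub>" using J_ops(2)[of "t i" a] a by (simp add: J_zero)
qed

text \<open>If all terms outside a finite set \<open>C N\<close> vanish modulo I^N, convergence over
  the directed family of finite sets is a single congruence per level. The sets are a parameter
  because the differentiated series needs one degree more than the series.\<close>

lemma adic_sums_ofseq:
  assumes g: "\<And>u. u \<in> MI \<Longrightarrow> coherent (g u)" and a: "coherent a"
    and C: "\<And>N. finite (C N)" "\<And>N. C N \<subseteq> MI" "\<And>N u. u \<in> MI \<Longrightarrow> u \<notin> C N \<Longrightarrow> g u N \<in> P N"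
  shows "adic_sums R I (multi_indices m) (\<lambda>u. ofseq (g u)) (ofseq a) \<longleftrightarrow> (\<forall>N. a N - (\<Sum>u\<in>C N. g u N) \<in> P N)"
proof -
  have gc: "g u N \<in> carrier R" if "u \<in> MI" for u N using coherentD(1)[OF g[OF that]] .
  have fs: "(\<Oplus>\<^bsub>completion R I\<^esub>u\<in>F. ofseq (g u)) N = cos N (\<Sum>u\<in>F. g u N)" if "finite F" "F \<subseteq> MI" for F N
  proof -
    have "(\<Oplus>\<^bsub>completion R I\<^esub>u\<in>F. ofseq (g u)) = ofseq (\<lambda>N. \<Sum>u\<in>F. g u N)"
      unfolding ky_hat_def[symmetric] by (rule K_finsum[OF that(1) g[OF subsetD[OF that(2)]]])
    then show ?thesis by (simp add: ofseq_def)
  qed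
  have big: "(\<Sum>u\<in>F. g u N) - (\<Sum>u\<in>C N. g u N) \<in> P N" if F: "finite F" "C N \<subseteq> F" "F \<subseteq> MI" for F N
  proof -
    have "(\<Sum>u\<in>F. g u N) - (\<Sum>u\<in>C N. g u N) = (\<Sum>u\<in>F - C N. g u N)" using sum_diff[OF F(1,2), of "\<lambda>u. g u N"] by simp
    also have "\<dots> \<in> P N" using C(3) F by (intro P_sum) auto
    finally show ?thesis .
  qed
  have cs: "(\<Sum>u\<in>F. g u N) \<in> carrier R" if "F \<subseteq> MI" for F N using gc that by (intro mpoly_sum) auto
  show ?thesis
  proof
    assume "adic_sums R I (multi_indices m) (\<lambda>u. ofseq (g u)) (ofseq a)"
    then have *: "\<exists>F0. finite F0 \<and> F0 \<subseteq> MI \<and> (\<forall>F. finite F \<and> F0 \<subseteq> F \<and> F \<subseteq> MI \<longrightarrow> (\<Oplus>\<^bsub>completion R I\<^esub>u\<in>F. ofseq (g u)) N = ofseq a N)" for N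
      by (simp add: adic_sums_def MI_def)
    show "\<forall>N. a N - (\<Sum>u\<in>C N. g u N) \<in> P N"
    proof
      fix N
      from *[of N] obtain F0 where F0': "finite F0 \<and> F0 \<subseteq> MI \<and> (\<forall>F. finite F \<and> F0 \<subseteq> F \<and> F \<subseteq> MI \<longrightarrow> (\<Oplus>\<^bsub>completion R I\<^esub>u\<in>F. ofseq (g u)) N = ofseq a N)"
        by (elim exE)
      note F0 = conjunct1[OF F0'] conjunct1[OF conjunct2[OF F0']] conjunct2[OF conjunct2[OF F0'], rule_format, OF conjI, OF _ conjI]
      let ?F = "F0 \<union> C N"
      have F: "finite ?F" "C N \<subseteq> ?F" "?F \<subseteq> MI" using F0 C(1,2) by auto
      have "cos N (\<Sum>u\<in>?F. g u N) = ofseq a N" by (rule trans[OF fs[OF F(1,3), symmetric] F0(3)[OF F(1) Un_upper1 F(3)]])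
      then have "cos N (\<Sum>u\<in>?F. g u N) = cos N (a N)" by (simp only: ofseq_def)
      then have "(\<Sum>u\<in>?F. g u N) - a N \<in> P N" using cos_eq[OF cs[OF F(3)] coherentD(1)[OF a]] by (simp only:)
      then have "a N - (\<Sum>u\<in>?F. g u N) \<in> P N" by (rule P_swap)
      then show "a N - (\<Sum>u\<in>C N. g u N) \<in> P N" using big[OF F] by (rule P_trans)
    qed
  next
    assume *: "\<forall>N. a N - (\<Sum>u\<in>C N. g u N) \<in> P N"
    show "adic_sums R I (multi_indices m) (\<lambda>u. ofseq (g u)) (ofseq a)"
      unfolding adic_sums_def MI_def[symmetric]
    proof (intro conjI allI)
      show "ofseq a \<in> carrier (completion R I)" using ofseq_closed[OF a] by (simp add: ky_hat_def)
      fix N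
      show "\<exists>F0. finite F0 \<and> F0 \<subseteq> MI \<and> (\<forall>F. finite F \<and> F0 \<subseteq> F \<and> F \<subseteq> MI \<longrightarrow> (\<Oplus>\<^bsub>completion R I\<^esub>u\<in>F. ofseq (g u)) N = ofseq a N)"
      proof (intro exI[of _ "C N"] conjI allI impI C)
        fix F assume F: "finite F \<and> C N \<subseteq> F \<and> F \<subseteq> MI"
        have "(\<Sum>u\<in>F. g u N) - a N \<in> P N"
          by (rule P_trans[OF big P_swap[OF *[rule_format]]]) (use F in simp_all)
        then have "cos N (\<Sum>u\<in>F. g u N) = ofseq a N"
          using F cs[of F N] coherentD(1)[OF a] by (simp add: ofseq_def cos_eq)
        then show "(\<Oplus>\<^bsub>completion R I\<^esub>u\<in>F. ofseq (g u)) N = ofseq a N"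
          using fs[of F N] F by (simp only: simp_thms)
      qed
    qed
  qed
qed

end

section \<open>Expansion of elements of the completion in powers of t\<close>

locale pot_section = pot m V for m and V :: "('k::comm_ring_1) pol" +
  fixes \<sigma> :: "'k pol set \<Rightarrow> nat \<Rightarrow> 'k pol set"
  assumes sec: "linear_section m V \<sigma>"
begin

lemma \<sigma>_linear: "is_linear (mpoly_ring {}) J K \<sigma>" and \<sigma>_1: "r \<in> carrier J \<Longrightarrow> \<sigma> r 1 = r"
  using sec by (simp_all add: linear_section_def)

text \<open>A chosen sequence that represents \<sigma> at r. Because of the choice, additivity and
  k-linearity of \<sigma> hold for these sequences only modulo I^N.\<close>

definition sg :: "'k pol set \<Rightarrow> nat \<Rightarrow> 'k pol" where "sg r = (SOME a. coherent a \<and> \<sigma> r = ofseq a)"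

lemma sg: assumes "r \<in> carrier J" shows "coherent (sg r)" "\<sigma> r = ofseq (sg r)"
proof -
  obtain a where "coherent a" "\<sigma> r = ofseq a" using is_linear_closed[OF \<sigma>_linear assms] by (rule K_cases)
  then have "\<exists>a. coherent a \<and> \<sigma> r = ofseq a" by (intro exI conjI)
  then have "coherent (sg r) \<and> \<sigma> r = ofseq (sg r)" unfolding sg_def by (rule someI_ex)
  then show "coherent (sg r)" "\<sigma> r = ofseq (sg r)" by simp_all
qed

lemma sg_mem: "r \<in> carrier J \<Longrightarrow> sg r N \<in> carrier R"
  by (rule coherentD(1)[OF sg(1)])

lemma sg_add:
  assumes "r \<in> carrier J" "r' \<in> carrier J" shows "sg (r \<oplus>\<^bsub>J\<^esub> r') N - (sg r N + sg r' N) \<in> P N"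
proof -
  have "ofseq (sg (r \<oplus>\<^bsub>J\<^esub> r')) = ofseq (\<lambda>N. sg r N + sg r' N)"
    using addhom_add[OF is_linear_addhom[OF \<sigma>_linear] assms] sg assms by (simp add: K_add)
  then show ?thesis using ofseq_eq[OF sg(1)[OF J.a_closed[OF assms]] coherent_add[OF sg(1)[OF assms(1)] sg(1)[OF assms(2)]]] by simp
qed

lemma sg_smult:
  assumes "r \<in> carrier J" shows "sg (cpoly c \<odot>\<^bsub>J\<^esub> r) N - cpoly c * sg r N \<in> P N"
proof -
  have "ofseq (sg (cpoly c \<odot>\<^bsub>J\<^esub> r)) = ofseq (\<lambda>N. cpoly c * sg r N)"
    using is_linear_smult[OF \<sigma>_linear cpoly_mem assms, of c] sg assms J.smult_closed[OF cpoly_mem assms, of c] by (simp add: K_smult)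
  then show ?thesis using ofseq_eq[OF sg(1)[OF J.smult_closed[OF cpoly_mem assms]] coherent_mult[OF cpoly_mem sg(1)[OF assms]]] by simp
qed

lemma sg_zero: "sg \<zero>\<^bsub>J\<^esub> N \<in> P N"
  using sg_add[OF J.zero_closed J.zero_closed, of N] P_uminus by force

lemma sg_1: "r \<in> carrier J \<Longrightarrow> cj (sg r (Suc 0)) = r"
  using \<sigma>_1[of r] sg(2)[of r] by (simp add: ofseq_1)

lemma sg_diff:
  assumes "r \<in> carrier J" "r' \<in> carrier J" shows "sg (r \<ominus>\<^bsub>J\<^esub> r') N - (sg r N - sg r' N) \<in> P N"
proof -
  have "(r \<ominus>\<^bsub>J\<^esub> r') \<oplus>\<^bsub>J\<^esub> r' = r" using assms by (simp add: J.minus_eq J.a_assoc J.l_neg)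
  then have "sg r N - (sg (r \<ominus>\<^bsub>J\<^esub> r') N + sg r' N) \<in> P N"
    using sg_add[of "r \<ominus>\<^bsub>J\<^esub> r'" r' N] assms by simp
  then have "- (sg r N - (sg (r \<ominus>\<^bsub>J\<^esub> r') N + sg r' N)) \<in> P N" by (rule P_uminus)
  then show ?thesis by (simp add: algebra_simps)
qed

text \<open>At every positive level the sequence is congruent modulo I to its first level, and the
  latter represents \<open>r\<close> since \<sigma> is a section. Level 0 carries no
  information.\<close>

lemma sg_nonzero:
  assumes r: "r \<in> carrier J" and N: "0 < N" and I: "sg r N \<in> I" shows "r = \<zero>\<^bsub>J\<^esub>"
proof -
  have "sg r N - sg r 1 \<in> P 1" by (rule coherent_le[OF sg(1)[OF r]]) (use N in simp)
  from P_diff[OF I[unfolded I_P] this] have "sg r N - (sg r N - sg r 1) \<in> P 1" .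
  then have "sg r (Suc 0) - 0 \<in> I" unfolding I_P by simp
  then have "cj (sg r (Suc 0)) = cj 0" using cj_eq[OF sg_mem[OF r] mpoly_0] by simp
  then show ?thesis using sg_1[OF r] by (simp add: J_zero)
qed

definition "RJ = MI \<rightarrow> carrier J"

lemma RJ: "r \<in> RJ \<Longrightarrow> u \<in> MI \<Longrightarrow> r u \<in> carrier J" by (auto simp: RJ_def)

lemma B_MI: "u \<in> B N \<Longrightarrow> u \<in> MI" and D_MI: "u \<in> D N \<Longrightarrow> u \<in> MI" by (auto simp: B_def D_def)

lemma sum_cong_P:
  assumes "\<And>u. u \<in> F \<Longrightarrow> q u \<in> carrier R" "\<And>u. u \<in> F \<Longrightarrow> x u - y u \<in> P N"
  shows "(\<Sum>u\<in>F. q u * x u) - (\<Sum>u\<in>F. q u * y u) \<in> P N"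
proof -
  have "(\<Sum>u\<in>F. q u * x u) - (\<Sum>u\<in>F. q u * y u) = (\<Sum>u\<in>F. q u * (x u - y u))"
    by (simp add: sum_subtractf right_diff_distrib)
  also have "\<dots> \<in> P N" using assms by (intro P_sum P_mult)
  finally show ?thesis .
qed

lemma sum_P_mult: "(\<And>u. u \<in> F \<Longrightarrow> q u \<in> P N) \<Longrightarrow> (\<And>u. u \<in> F \<Longrightarrow> x u \<in> carrier R) \<Longrightarrow> (\<Sum>u\<in>F. q u * x u) \<in> P N"
  using P_mult by (intro P_sum) (simp add: mult.commute[of "q _"])

text \<open>Level N of the series with coefficients \<sigma>(r_u): the omitted terms have degree at
  least N in t and vanish there.\<close>

definition E :: "((nat \<Rightarrow>\<^sub>0 nat) \<Rightarrow> 'k pol set) \<Rightarrow> nat \<Rightarrow> 'k pol" where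
  "E r N = (\<Sum>u\<in>B N. tp u * sg (r u) N)"

text \<open>Induction on the degree d of \<open>u\<close>: the coefficients of lower degree vanish,
  terms of higher degree lie in I^(d+1), so the form of degree d lies there too. Quasi-regularity
  puts its coefficients in I, and a value of a section that lies in I comes from zero.\<close>

lemma E_unique:
  assumes r: "r \<in> RJ" and E: "E r N \<in> P N" and u: "u \<in> B N"
  shows "r u = \<zero>\<^bsub>J\<^esub>"
  using u
proof (induction "deg u" arbitrary: u rule: less_induct)
  case less
  let ?d = "deg u"
  have dN: "?d < N" and uM: "u \<in> MI" using less(2) by (simp_all add: B_def)
  have split: "E r N = (\<Sum>v\<in>D ?d. tp v * sg (r v) N) + (\<Sum>v\<in>B N - D ?d. tp v * sg (r v) N)"
    unfolding E_def using dN by (subst sum.subset_diff[of "D ?d" "B N"]) (auto simp: D_def B_def B_finite[unfolded B_def])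
  have "(\<Sum>v\<in>B N - D ?d. tp v * sg (r v) N) \<in> P (Suc ?d)"
  proof (rule P_sum)
    fix v assume v: "v \<in> B N - D ?d"
    then have vM: "v \<in> MI" "v \<in> B N" "deg v \<noteq> ?d" by (auto simp: B_def D_def)
    show "tp v * sg (r v) N \<in> P (Suc ?d)"
    proof (cases "deg v < ?d")
      case True
      then have "r v = \<zero>\<^bsub>J\<^esub>" using less(1) vM by blast
      then have "tp v * sg (r v) N \<in> P N" using P_mult[OF tp_mem sg_zero] by simp
      then show ?thesis by (rule P_le[rotated]) (use dN in simp)
    next
      case False
      then have "tp v \<in> P (Suc ?d)" using vM by (intro tp_P_le) auto
      then show ?thesis using P_mult[OF sg_mem[OF RJ[OF r vM(1)]]] by (simp add: mult.commute)
    qed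
  qed
  moreover have "E r N \<in> P (Suc ?d)" by (rule P_le[OF _ E]) (use dN in simp)
  ultimately have "(\<Sum>v\<in>D ?d. tp v * sg (r v) N) \<in> P (Suc ?d)" using P_diff[of "E r N" "Suc ?d"] unfolding split by force
  then have "(\<Sum>v\<in>D ?d. sg (r v) N * tp v) \<in> P (Suc ?d)" by (simp add: mult.commute)
  then have "sg (r u) N \<in> I"
    by (rule qreg[rotated]) (use uM sg_mem[OF RJ[OF r D_MI]] in \<open>auto simp: D_def\<close>)
  then show ?case by (rule sg_nonzero[OF RJ[OF r uM], rotated]) (use dN in simp)
qed

definition ex_at :: "(nat \<Rightarrow> 'k pol) \<Rightarrow> ((nat \<Rightarrow>\<^sub>0 nat) \<Rightarrow> 'k pol set) \<Rightarrow> nat \<Rightarrow> bool" where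
  "ex_at a r N \<longleftrightarrow> a N - E r N \<in> P N"

lemma ex_at_unique:
  assumes r: "r \<in> RJ" "r' \<in> RJ" and ex: "ex_at a r N" "ex_at a r' N" and u: "u \<in> B N"
  shows "r u = r' u"
proof -
  let ?r = "\<lambda>u. r u \<ominus>\<^bsub>J\<^esub> r' u"
  have rr: "?r \<in> RJ" using r by (auto simp: RJ_def)
  have "E ?r N - (\<Sum>u\<in>B N. tp u * (sg (r u) N - sg (r' u) N)) \<in> P N"
    unfolding E_def by (intro sum_cong_P tp_mem sg_diff RJ[OF r(1) B_MI] RJ[OF r(2) B_MI])
  moreover have "(\<Sum>u\<in>B N. tp u * (sg (r u) N - sg (r' u) N)) = E r N - E r' N"
    by (simp add: E_def sum_subtractf right_diff_distrib)
  moreover have "E r N - E r' N \<in> P N" using P_diff[OF ex(2)[unfolded ex_at_def] ex(1)[unfolded ex_at_def]] by simp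
  ultimately have "E ?r N \<in> P N" using P_add[of "E ?r N - (E r N - E r' N)" N "E r N - E r' N"] by simp
  then have 0: "?r u = \<zero>\<^bsub>J\<^esub>" by (rule E_unique[OF rr _ u])
  have c: "r u \<in> carrier J" "r' u \<in> carrier J" using RJ[OF r(1) B_MI[OF u]] RJ[OF r(2) B_MI[OF u]] .
  then have "r u = ?r u \<oplus>\<^bsub>J\<^esub> r' u" by (simp add: J.minus_eq J.a_assoc J.l_neg)
  then show ?thesis using c unfolding 0 by simp
qed

text \<open>Passing to a lower level drops the terms of degree at least N, which are zero modulo
  I^N, and replaces the representatives of the coefficients by congruent ones.\<close>

lemma ex_at_le:
  assumes a: "coherent a" and r: "r \<in> RJ" and ex: "ex_at a r N'" and le: "N \<le> N'"
  shows "ex_at a r N"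
proof -
  have eq: "E r N' = (\<Sum>u\<in>B N. tp u * sg (r u) N') + (\<Sum>u\<in>B N' - B N. tp u * sg (r u) N')"
    unfolding E_def using sum.subset_diff[OF B_mono[OF le] B_finite] by (simp add: add.commute)
  have s1: "(\<Sum>u\<in>B N' - B N. tp u * sg (r u) N') \<in> P N"
    by (rule sum_P_mult) (auto simp: B_def intro!: tp_P_le sg_mem RJ[OF r])
  have s2: "(\<Sum>u\<in>B N. tp u * sg (r u) N') - E r N \<in> P N"
    unfolding E_def by (intro sum_cong_P tp_mem coherent_le[OF _ le] sg RJ[OF r B_MI])
  have 1: "E r N' - E r N \<in> P N" unfolding eq using P_add[OF s2 s1] by (simp add: algebra_simps)
  have 2: "a N' - E r N' \<in> P N" by (rule P_le[OF le ex[unfolded ex_at_def]])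
  show ?thesis unfolding ex_at_def by (rule P_trans[OF P_swap[OF coherent_le[OF a le]] P_trans[OF 2 1]])
qed

text \<open>Successive approximation: an expansion valid modulo I^N leaves an error in I^N at the
  next level, and this error is a form of degree N in t whose coefficients provide the missing
  terms.\<close>

lemma ex_at_exists:
  assumes a: "coherent a" shows "\<exists>r\<in>RJ. ex_at a r N"
proof (induction N)
  case 0
  have "a 0 - E (\<lambda>_. \<zero>\<^bsub>J\<^esub>) 0 \<in> P 0" using coherentD(1)[OF a, of 0] by (simp add: E_def B_def)
  then show ?case by (intro bexI[of _ "\<lambda>_. \<zero>\<^bsub>J\<^esub>"]) (auto simp: ex_at_def RJ_def)
next
  case (Suc N)
  then obtain r where r: "r \<in> RJ" "ex_at a r N" by (elim bexE)
  let ?S = "\<Sum>u\<in>B N. tp u * sg (r u) (Suc N)"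
  have "?S - E r N \<in> P N" unfolding E_def by (intro sum_cong_P tp_mem coherentD(2) sg RJ[OF r(1) B_MI])
  then have "E r N - ?S \<in> P N" by (rule P_swap)
  then have "a (Suc N) - ?S \<in> P N" using P_trans[OF coherentD(2)[OF a] P_trans[OF r(2)[unfolded ex_at_def]]] by simp
  from P_rep[OF this] obtain c where c0: "(\<forall>u. c u \<in> carrier R) \<and> a (Suc N) - ?S = (\<Sum>u\<in>D N. c u * tp u)" by (elim exE)
  note c = conjunct1[OF c0, THEN spec] conjunct2[OF c0]
  \<comment> \<open>Only degree N is changed, so the sum over lower degrees stays as it was. The
    class of a coefficient modulo I is all that can be stored.\<close>
  let ?r = "\<lambda>u. if deg u = N then cj (c u) else r u"
  have rr: "?r \<in> RJ" using r(1) cj_closed[OF c(1)] by (simp add: RJ_def Pi_iff)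
  have "(\<Sum>u\<in>B N. tp u * sg (?r u) (Suc N)) = ?S" by (rule sum.cong) (auto simp: B_def)
  moreover have "(\<Sum>u\<in>D N. tp u * sg (?r u) (Suc N)) = (\<Sum>u\<in>D N. tp u * sg (cj (c u)) (Suc N))" by (rule sum.cong) (auto simp: D_def)
  ultimately have "E ?r (Suc N) = ?S + (\<Sum>u\<in>D N. tp u * sg (cj (c u)) (Suc N))"
    unfolding E_def B_Suc using B_finite D_finite B_D by (simp add: sum.union_disjoint)
  then have "a (Suc N) - E ?r (Suc N) = (\<Sum>u\<in>D N. tp u * (c u - sg (cj (c u)) (Suc N)))"
    using c(2) by (simp add: right_diff_distrib sum_subtractf mult.commute algebra_simps)
  also have "\<dots> \<in> P (Suc N)"
  proof (rule P_sum)
    fix u assume u: "u \<in> D N"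
    have cj: "cj (c u) \<in> carrier J" using c(1) by blast
    \<comment> \<open>Replacing \<open>c u\<close> by the section of its class changes it by an
      element of I, and the factor of degree N in t brings the difference into I^(N+1).\<close>
    have "sg (cj (c u)) (Suc 0) - c u \<in> I"
      using sg_1[OF cj] cj_eq[OF sg_mem[OF cj] c(1)] by simp
    then have "sg (cj (c u)) 1 - c u \<in> P 1" by (simp add: I_P)
    then have "sg (cj (c u)) (Suc N) - c u \<in> P 1"
      using P_trans[OF coherent_le[OF sg(1)[OF cj], of 1 "Suc N"]] by simp
    then have "c u - sg (cj (c u)) (Suc N) \<in> I" unfolding I_P by (rule P_swap)
    moreover have "tp u \<in> P N" using u by (intro tp_P_le) (auto simp: D_def)
    ultimately show "tp u * (c u - sg (cj (c u)) (Suc N)) \<in> P (Suc N)" by (intro P_Suc_mult)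
  qed
  finally show ?case using rr unfolding ex_at_def by (intro bexI)
qed

text \<open>The expansions for the various levels are chosen independently, but uniqueness makes
  them agree wherever both see a coefficient. So each coefficient is read off at the first level
  that sees it, one above its degree.\<close>

lemma expansion_exists:
  assumes a: "coherent a" shows "\<exists>r\<in>RJ. \<forall>N. ex_at a r N"
proof -
  have "\<exists>rr. \<forall>N. rr N \<in> RJ \<and> ex_at a (rr N) N"
    using ex_at_exists[OF a] by (intro choice allI) blast
  then obtain rr where rr: "\<And>N. rr N \<in> RJ" "\<And>N. ex_at a (rr N) N" by blast
  define r where "r = (\<lambda>u. rr (Suc (deg u)) u)"
  have r: "r \<in> RJ" unfolding RJ_def r_def using RJ[OF rr(1)] by simp
  have "r u = rr N u" if u: "u \<in> B N" for N u
  proof -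
    have le: "Suc (deg u) \<le> N" and uB: "u \<in> B (Suc (deg u))" using u by (auto simp: B_def)
    show ?thesis unfolding r_def by (rule ex_at_unique[OF rr(1) rr(1) rr(2) ex_at_le[OF a rr(1) rr(2) le] uB])
  qed
  then have "E r N = E (rr N) N" for N unfolding E_def by (intro sum.cong) auto
  then have "ex_at a r N" for N using rr(2)[of N] by (simp add: ex_at_def)
  then show ?thesis using r by blast
qed

lemma adic_sums_cong:
  assumes "\<And>u. u \<in> MI \<Longrightarrow> g u = g' u" "\<And>u. u \<in> MI \<Longrightarrow> g' u \<in> carrier K"
  shows "adic_sums R I (multi_indices m) g h \<longleftrightarrow> adic_sums R I (multi_indices m) g' h"
proof -
  have "(\<Oplus>\<^bsub>completion R I\<^esub>u\<in>F. g u) = (\<Oplus>\<^bsub>completion R I\<^esub>u\<in>F. g' u)" if "F \<subseteq> MI" for F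
    unfolding ky_hat_def[symmetric] using assms that by (intro K.finsum_cong') auto
  then show ?thesis unfolding adic_sums_def MI_def[symmetric] by (simp cong: conj_cong)
qed

lemma t_expansion_iff:
  assumes a: "coherent a"
  shows "t_expansion m V \<sigma> (ofseq a) r \<longleftrightarrow> r \<in> RJ \<and> (\<forall>N. ex_at a r N)"
proof (cases "r \<in> RJ")
  case True
  have c: "coherent (\<lambda>N. tp u * sg (r u) N)" if "u \<in> MI" for u
    by (intro coherent_mult tp_mem sg RJ[OF True that])
  have "adic_sums R I (multi_indices m) (\<lambda>u. tp u \<odot>\<^bsub>K\<^esub> \<sigma> (r u)) (ofseq a) \<longleftrightarrow>
    adic_sums R I (multi_indices m) (\<lambda>u. ofseq (\<lambda>N. tp u * sg (r u) N)) (ofseq a)"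
    using sg RJ[OF True] c by (intro adic_sums_cong) (auto simp: K_smult)
  also have "\<dots> \<longleftrightarrow> (\<forall>N. a N - (\<Sum>u\<in>B N. tp u * sg (r u) N) \<in> P N)"
  proof (rule adic_sums_ofseq[OF c a B_finite])
    show "B N \<subseteq> MI" for N by (auto simp: B_def)
    fix N u assume u: "u \<in> MI" "u \<notin> B N"
    then have "tp u \<in> P N" by (intro tp_P_le) (auto simp: B_def)
    then show "tp u * sg (r u) N \<in> P N" using P_mult[OF sg_mem[OF RJ[OF True u(1)]]] by (simp add: mult.commute)
  qed
  finally show ?thesis using True unfolding t_expansion_def ex_at_def E_def RJ_def MI_def by simp
next
  case False
  then show ?thesis by (simp add: t_expansion_def RJ_def MI_def)
qed

subsection \<open>The derivatives\<close>

definition derivtp :: "nat \<Rightarrow> (nat \<Rightarrow>\<^sub>0 nat) \<Rightarrow> 'k pol" where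
  "derivtp i u = of_nat (Poly_Mapping.lookup u i) * tp (u - ep i)"

text \<open>Differentiation lowers the degree in \<open>t\<close> by one, so level \<open>N\<close> of the derivative needs all terms of
  degree at most \<open>N\<close>, one more than level \<open>N\<close> of the series itself.\<close>

definition derivseq :: "nat \<Rightarrow> ((nat \<Rightarrow>\<^sub>0 nat) \<Rightarrow> 'k pol set) \<Rightarrow> nat \<Rightarrow> 'k pol" where
  "derivseq i r N = (\<Sum>u\<in>B (Suc N). derivtp i u * sg (r u) N)"

lemma derivtp_mem [simp, intro]: "derivtp i u \<in> carrier R"
  unfolding derivtp_def by (intro mpoly_mult mpoly_of_nat tp_mem)

lemma derivtp_P: "i < m \<Longrightarrow> u \<in> MI \<Longrightarrow> N < deg u \<Longrightarrow> derivtp i u \<in> P N"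
proof (cases "Poly_Mapping.lookup u i = 0")
  case False
  assume i: "i < m" and u: "u \<in> MI" "N < deg u"
  have "tp (u - ep i) \<in> P N" using deg_minus_ep[OF i False] u by (intro tp_P_le MI_minus) auto
  then show ?thesis unfolding derivtp_def by (intro P_mult mpoly_of_nat)
qed (simp add: derivtp_def)

lemma derivseq_Suc:
  assumes i: "i < m" and r: "r \<in> RJ"
  shows "(\<Sum>u\<in>B (Suc (Suc N)). derivtp i u * sg (r u) M) - (\<Sum>u\<in>B (Suc N). derivtp i u * sg (r u) M) \<in> P N"
proof -
  have "(\<Sum>u\<in>B (Suc (Suc N)). derivtp i u * sg (r u) M) - (\<Sum>u\<in>B (Suc N). derivtp i u * sg (r u) M) = (\<Sum>u\<in>D (Suc N). derivtp i u * sg (r u) M)"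
    unfolding B_Suc[of "Suc N"] using B_finite D_finite B_D by (simp add: sum.union_disjoint)
  also have "\<dots> \<in> P N"
    by (rule sum_P_mult) (auto simp: D_def intro!: derivtp_P i sg_mem RJ[OF r])
  finally show ?thesis .
qed

lemma derivseq_coherent:
  assumes i: "i < m" and r: "r \<in> RJ" shows "coherent (derivseq i r)"
  unfolding coherent_def
proof (intro conjI allI)
  fix N
  show "derivseq i r N \<in> carrier R" unfolding derivseq_def by (intro mpoly_sum mpoly_mult derivtp_mem sg_mem RJ[OF r B_MI])
  have "(\<Sum>u\<in>B (Suc N). derivtp i u * sg (r u) (Suc N)) - derivseq i r N \<in> P N"
    unfolding derivseq_def by (intro sum_cong_P derivtp_mem coherentD(2) sg RJ[OF r B_MI])
  then show "derivseq i r (Suc N) - derivseq i r N \<in> P N"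
    by (rule P_trans[rotated]) (unfold derivseq_def, rule derivseq_Suc[OF i r])
qed

text \<open>The definite description is legitimate: any other expansion of the same element has the
  same coefficients, and the limit of the differentiated series is unique in the completion.\<close>

lemma partial_t_eq:
  assumes i: "i < m" and a: "coherent a" and r: "r \<in> RJ" and ex: "\<And>N. ex_at a r N"
  shows "partial_t m V \<sigma> i (ofseq a) = ofseq (derivseq i r)"
proof -
  have adic: "adic_sums R I (multi_indices m)
          (\<lambda>u. (of_nat (Poly_Mapping.lookup u i) * t_pow m V (u - Poly_Mapping.single i 1)) \<odot>\<^bsub>K\<^esub> \<sigma> (r' u)) (ofseq b)
      \<longleftrightarrow> ofseq b = ofseq (derivseq i r')" if r': "r' \<in> RJ" and b: "coherent b" for r' b
  proof -
    have c: "coherent (\<lambda>N. derivtp i u * sg (r' u) N)" if "u \<in> MI" for u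
      by (intro coherent_mult derivtp_mem sg RJ[OF r' that])
    have "adic_sums R I (multi_indices m)
          (\<lambda>u. (of_nat (Poly_Mapping.lookup u i) * t_pow m V (u - Poly_Mapping.single i 1)) \<odot>\<^bsub>K\<^esub> \<sigma> (r' u)) (ofseq b) \<longleftrightarrow>
      adic_sums R I (multi_indices m) (\<lambda>u. ofseq (\<lambda>N. derivtp i u * sg (r' u) N)) (ofseq b)"
    proof (rule adic_sums_cong)
      fix u assume u: "u \<in> MI"
      show "(of_nat (Poly_Mapping.lookup u i) * t_pow m V (u - Poly_Mapping.single i 1)) \<odot>\<^bsub>K\<^esub> \<sigma> (r' u) = ofseq (\<lambda>N. derivtp i u * sg (r' u) N)"
        unfolding sg(2)[OF RJ[OF r' u]] One_nat_def derivtp_def[symmetric] by (rule K_smult[OF derivtp_mem sg(1)[OF RJ[OF r' u]]])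
    qed (intro ofseq_closed c)
    also have "\<dots> \<longleftrightarrow> (\<forall>N. b N - derivseq i r' N \<in> P N)" unfolding derivseq_def
    proof (rule adic_sums_ofseq[OF c b B_finite])
      show "B (Suc N) \<subseteq> MI" for N by (auto simp: B_def)
      fix N u assume u: "u \<in> MI" "u \<notin> B (Suc N)"
      then have "derivtp i u \<in> P N" by (intro derivtp_P i) (auto simp: B_def)
      then show "derivtp i u * sg (r' u) N \<in> P N" using P_mult[OF sg_mem[OF RJ[OF r' u(1)]]] by (simp add: mult.commute)
    qed
    also have "\<dots> \<longleftrightarrow> ofseq b = ofseq (derivseq i r')" by (rule ofseq_eq[OF b derivseq_coherent[OF i r'], symmetric])
    finally show ?thesis .
  qed
  show ?thesis unfolding partial_t_def
  proof (rule the_equality)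
    show "\<exists>r'. t_expansion m V \<sigma> (ofseq a) r' \<and> adic_sums R I (multi_indices m)
          (\<lambda>u. (of_nat (Poly_Mapping.lookup u i) * t_pow m V (u - Poly_Mapping.single i 1)) \<odot>\<^bsub>K\<^esub> \<sigma> (r' u)) (ofseq (derivseq i r))"
      using adic[OF r derivseq_coherent[OF i r]] t_expansion_iff[OF a, of r] r ex by (intro exI[of _ r] conjI) simp_all
  next
    fix g assume "\<exists>r. t_expansion m V \<sigma> (ofseq a) r \<and> adic_sums R I (multi_indices m)
          (\<lambda>u. (of_nat (Poly_Mapping.lookup u i) * t_pow m V (u - Poly_Mapping.single i 1)) \<odot>\<^bsub>K\<^esub> \<sigma> (r u)) g"
    then obtain r' where r0: "t_expansion m V \<sigma> (ofseq a) r' \<and> adic_sums R I (multi_indices m)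
          (\<lambda>u. (of_nat (Poly_Mapping.lookup u i) * t_pow m V (u - Poly_Mapping.single i 1)) \<odot>\<^bsub>K\<^esub> \<sigma> (r' u)) g" by (elim exE)
    have r': "r' \<in> RJ" "\<And>N. ex_at a r' N" using t_expansion_iff[OF a, of r'] r0 by simp_all
    have "g \<in> carrier K" using conjunct2[OF r0] by (simp add: adic_sums_def ky_hat_def)
    then obtain b where b: "coherent b" "g = ofseq b" by (rule K_cases)
    have "g = ofseq (derivseq i r')" using adic[OF r'(1) b(1)] r0 b(2) by simp
    moreover have "r' u = r u" if "u \<in> B N" for u N by (rule ex_at_unique[OF r'(1) r r'(2) ex that])
    then have "derivseq i r' = derivseq i r" unfolding derivseq_def by (intro ext sum.cong) auto
    ultimately show "g = ofseq (derivseq i r)" by simp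
  qed
qed

lemma partial_t_closed: "i < m \<Longrightarrow> h \<in> carrier K \<Longrightarrow> partial_t m V \<sigma> i h \<in> carrier K"
proof (erule K_cases)
  fix a assume i: "i < m" and a: "coherent a" "h = ofseq a"
  obtain r where r: "r \<in> RJ" "\<forall>N. ex_at a r N" using expansion_exists[OF a(1)] by (elim bexE)
  show ?thesis unfolding a(2) partial_t_eq[OF i a(1) r(1) r(2)[rule_format]] by (intro ofseq_closed derivseq_coherent i r)
qed

lemma partial_t_hom: 
  assumes i: "i < m" shows "partial_t m V \<sigma> i \<in> addhom K K"
proof (rule addhomI)
  show "partial_t m V \<sigma> i h \<in> carrier K" if "h \<in> carrier K" for h by (rule partial_t_closed[OF i that])
  fix h h' assume hh: "h \<in> carrier K" "h' \<in> carrier K"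
  obtain a where a: "coherent a" "h = ofseq a" using hh(1) by (rule K_cases)
  obtain b where b: "coherent b" "h' = ofseq b" using hh(2) by (rule K_cases)
  obtain r where r: "r \<in> RJ" "\<forall>N. ex_at a r N" using expansion_exists[OF a(1)] by (elim bexE)
  obtain r' where r': "r' \<in> RJ" "\<forall>N. ex_at b r' N" using expansion_exists[OF b(1)] by (elim bexE)
  let ?r = "\<lambda>u. r u \<oplus>\<^bsub>J\<^esub> r' u" and ?a = "\<lambda>N. a N + b N"
  have rr: "?r \<in> RJ" using RJ[OF r(1)] RJ[OF r'(1)] unfolding RJ_def by simp
  \<comment> \<open>The weights \<open>q\<close> are left open so that the same congruence applies
    to the powers of t in the expansion and to their derivatives.\<close>
  have sum: "(\<Sum>u\<in>F. q u * sg (?r u) N) - ((\<Sum>u\<in>F. q u * sg (r u) N) + (\<Sum>u\<in>F. q u * sg (r' u) N)) \<in> P N"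
    if "F \<subseteq> MI" "\<And>u. q u \<in> carrier R" for F q N
  proof -
    have "(\<Sum>u\<in>F. q u * sg (?r u) N) - (\<Sum>u\<in>F. q u * (sg (r u) N + sg (r' u) N)) \<in> P N"
      using that by (intro sum_cong_P sg_add RJ[OF r(1)] RJ[OF r'(1)]) auto
    then show ?thesis by (simp add: distrib_left sum.distrib)
  qed
  have ex: "ex_at ?a ?r N" for N
  proof -
    have s: "E ?r N - (E r N + E r' N) \<in> P N" unfolding E_def by (rule sum) (auto simp: B_def)
    have "(a N - E r N) + (b N - E r' N) \<in> P N" using r(2) r'(2) unfolding ex_at_def by blast
    then have "?a N - (E r N + E r' N) \<in> P N" by (simp add: algebra_simps)
    then show ?thesis unfolding ex_at_def by (rule P_trans[OF _ P_swap[OF s]])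
  qed
  have "ofseq (derivseq i ?r) = ofseq (\<lambda>N. derivseq i r N + derivseq i r' N)"
  proof (subst ofseq_eq[OF derivseq_coherent[OF i rr] coherent_add[OF derivseq_coherent[OF i r(1)] derivseq_coherent[OF i r'(1)]]], intro allI)
    fix N
    show "derivseq i ?r N - (derivseq i r N + derivseq i r' N) \<in> P N" unfolding derivseq_def by (rule sum) (auto simp: B_def)
  qed
  then show "partial_t m V \<sigma> i (h \<oplus>\<^bsub>K\<^esub> h') = partial_t m V \<sigma> i h \<oplus>\<^bsub>K\<^esub> partial_t m V \<sigma> i h'"
    unfolding a(2) b(2) K_add[OF a(1) b(1)] partial_t_eq[OF i coherent_add[OF a(1) b(1)] rr ex]
      partial_t_eq[OF i a(1) r(1) r(2)[rule_format]] partial_t_eq[OF i b(1) r'(1) r'(2)[rule_format]]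
      K_add[OF derivseq_coherent[OF i r(1)] derivseq_coherent[OF i r'(1)]] .
qed

lemma partial_t_const: 
  assumes i: "i < m" and h: "h \<in> carrier K"
  shows "partial_t m V \<sigma> i (cpoly c \<odot>\<^bsub>K\<^esub> h) = cpoly c \<odot>\<^bsub>K\<^esub> partial_t m V \<sigma> i h"
proof -
  obtain a where a: "coherent a" "h = ofseq a" using h by (rule K_cases)
  obtain r where r: "r \<in> RJ" "\<forall>N. ex_at a r N" using expansion_exists[OF a(1)] by (elim bexE)
  let ?r = "\<lambda>u. cpoly c \<odot>\<^bsub>J\<^esub> r u" and ?a = "\<lambda>N. cpoly c * a N"
  have rr: "?r \<in> RJ" using RJ[OF r(1)] unfolding RJ_def by simp
  have sum: "(\<Sum>u\<in>F. q u * sg (?r u) N) - cpoly c * (\<Sum>u\<in>F. q u * sg (r u) N) \<in> P N"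
    if "F \<subseteq> MI" "\<And>u. q u \<in> carrier R" for F q N
  proof -
    have "(\<Sum>u\<in>F. q u * sg (?r u) N) - (\<Sum>u\<in>F. q u * (cpoly c * sg (r u) N)) \<in> P N"
      using that by (intro sum_cong_P sg_smult RJ[OF r(1)]) auto
    then show ?thesis by (simp add: sum_distrib_left mult.left_commute)
  qed
  have ex: "ex_at ?a ?r N" for N
  proof -
    have s: "E ?r N - cpoly c * E r N \<in> P N" unfolding E_def by (rule sum) (auto simp: B_def)
    have "cpoly c * (a N - E r N) \<in> P N" using r(2) unfolding ex_at_def by (intro P_mult) auto
    then have "?a N - cpoly c * E r N \<in> P N" by (simp add: right_diff_distrib)
    then show ?thesis unfolding ex_at_def by (rule P_trans[OF _ P_swap[OF s]])
  qed
  have "ofseq (derivseq i ?r) = ofseq (\<lambda>N. cpoly c * derivseq i r N)"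
  proof (subst ofseq_eq[OF derivseq_coherent[OF i rr] coherent_mult[OF cpoly_mem derivseq_coherent[OF i r(1)]]], intro allI)
    fix N
    show "derivseq i ?r N - cpoly c * derivseq i r N \<in> P N" unfolding derivseq_def by (rule sum) (auto simp: B_def)
  qed
  then show ?thesis
    unfolding a(2) K_smult[OF cpoly_mem a(1)] partial_t_eq[OF i coherent_mult[OF cpoly_mem a(1)] rr ex]
      partial_t_eq[OF i a(1) r(1) r(2)[rule_format]] K_smult[OF cpoly_mem derivseq_coherent[OF i r(1)]] .
qed

text \<open>The Leibniz rule for a monomial times t_j. The cases are due to truncated subtraction:
  if t_i does not occur in the monomial, its derivative vanishes through the integer coefficient
  alone.\<close>

lemma derivtp_shift:
  assumes "i < m" "j < m"
  shows "derivtp i (v + ep j) = t j * derivtp i v + (if i = j then tp v else 0)"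
proof (cases "Poly_Mapping.lookup v i = 0")
  case True
  then show ?thesis by (auto simp: derivtp_def lookup_add lookup_single when_def)
next
  case False
  have "tp v = t i * tp (v - ep i)" using tp_ep_add[OF assms(1), of "v - ep i"] minus_ep[OF False] by simp
  moreover have "v + ep j - ep i = v - ep i + ep j"
    using False by (intro poly_mapping_eqI) (auto simp: lookup_add lookup_minus lookup_single when_def)
  ultimately show ?thesis
    using tp_ep_add[OF assms(2), of "v - ep i"]
    by (cases "i = j") (auto simp: derivtp_def lookup_add lookup_single algebra_simps)
qed

text \<open>Multiplication by t_j only shifts exponents and leaves the values of \<sigma> as
  coefficients untouched. The rule thus reduces to monomials in t, although multiplication by a
  general element of k[y] would alter the coefficients.\<close>

lemma partial_t_leibniz:
  assumes i: "i < m" and j: "j < m" and h: "h \<in> carrier K"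
  shows "partial_t m V \<sigma> i (t j \<odot>\<^bsub>K\<^esub> h) = t j \<odot>\<^bsub>K\<^esub> partial_t m V \<sigma> i h \<oplus>\<^bsub>K\<^esub> (if i = j then h else \<zero>\<^bsub>K\<^esub>)"
proof -
  obtain a where a: "coherent a" "h = ofseq a" using h by (rule K_cases)
  obtain r where r: "r \<in> RJ" "\<forall>N. ex_at a r N" using expansion_exists[OF a(1)] by (elim bexE)
  \<comment> \<open>The expansion of t_j h, with zero coefficients where t_j does not occur; the
    test guards against truncated subtraction of exponents.\<close>
  let ?r = "\<lambda>u. if Poly_Mapping.lookup u j = 0 then \<zero>\<^bsub>J\<^esub> else r (u - ep j)" and ?a = "\<lambda>N. t j * a N"
  have rr: "?r \<in> RJ" using RJ[OF r(1) MI_minus] unfolding RJ_def by simp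
  have shift: "(\<Sum>u\<in>B (Suc M). q u * sg (?r u) N) - (\<Sum>v\<in>B M. q (v + ep j) * sg (r v) N) \<in> P N"
    if q: "\<And>u. q u \<in> carrier R" for q M N
  proof -
    let ?B = "{u \<in> B (Suc M). Poly_Mapping.lookup u j \<noteq> 0}"
    have img: "(\<lambda>v. v + ep j) ` B M = ?B"
    proof (intro equalityI subsetI)
      fix u assume "u \<in> (\<lambda>v. v + ep j) ` B M"
      then show "u \<in> ?B" using j by (auto simp: B_def MI_add MI_ep deg_add deg_ep lookup_add)
    next
      fix u assume u: "u \<in> ?B"
      then have "u - ep j \<in> B M" using deg_minus_ep[OF j, of u] by (auto simp: B_def MI_minus)
      moreover have "u = (u - ep j) + ep j" using minus_ep[of u j] u by simp
      ultimately show "u \<in> (\<lambda>v. v + ep j) ` B M" by (rule image_eqI[rotated])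
    qed
    have "(\<Sum>u\<in>B (Suc M). q u * sg (?r u) N) = (\<Sum>u\<in>?B. q u * sg (?r u) N) + (\<Sum>u\<in>B (Suc M) - ?B. q u * sg (?r u) N)"
      using sum.subset_diff[of ?B "B (Suc M)" "\<lambda>u. q u * sg (?r u) N"] B_finite by (simp add: add.commute)
    moreover have "(\<Sum>u\<in>B (Suc M) - ?B. q u * sg (?r u) N) \<in> P N"
      by (rule P_sum) (auto intro!: P_mult q sg_zero)
    moreover have "(\<Sum>u\<in>?B. q u * sg (?r u) N) = (\<Sum>v\<in>B M. q (v + ep j) * sg (r v) N)"
      unfolding img[symmetric] by (subst sum.reindex) (auto simp: inj_on_def lookup_add intro!: sum.cong)
    ultimately show ?thesis by simp
  qed
  have E_Suc: "(\<Sum>u\<in>B (Suc N). tp u * sg (r' u) N) - E r' N \<in> P N" if r': "r' \<in> RJ" for r' N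
  proof -
    have "(\<Sum>u\<in>B (Suc N). tp u * sg (r' u) N) - E r' N = (\<Sum>u\<in>D N. tp u * sg (r' u) N)"
      unfolding B_Suc E_def using B_finite D_finite B_D by (simp add: sum.union_disjoint)
    also have "\<dots> \<in> P N" by (rule sum_P_mult) (auto simp: D_def intro!: tp_P_le sg_mem RJ[OF r'])
    finally show ?thesis .
  qed
  have ex: "ex_at ?a ?r N" for N
  proof -
    have "(\<Sum>v\<in>B N. tp (v + ep j) * sg (r v) N) = t j * E r N"
      by (simp add: tp_ep_add[OF j] E_def sum_distrib_left mult.assoc)
    moreover have "(\<Sum>u\<in>B (Suc N). tp u * sg (?r u) N) - (\<Sum>v\<in>B N. tp (v + ep j) * sg (r v) N) \<in> P N"
      by (rule shift) (rule tp_mem)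
    ultimately have 1: "E ?r N - t j * E r N \<in> P N" using P_trans[OF P_swap[OF E_Suc[OF rr, of N]]] by (simp only:)
    have "t j * (a N - E r N) \<in> P N" using r(2) unfolding ex_at_def by (intro P_mult t_mem) auto
    then have "?a N - t j * E r N \<in> P N" by (simp add: right_diff_distrib)
    then show ?thesis unfolding ex_at_def by (rule P_trans[OF _ P_swap[OF 1]])
  qed
  let ?g = "\<lambda>N. t j * derivseq i r N + (if i = j then a N else 0)"
  have gc: "coherent ?g" 
    using coherent_add[OF coherent_mult[OF t_mem[of j] derivseq_coherent[OF i r(1)]] a(1)] coherent_mult[OF t_mem[of j] derivseq_coherent[OF i r(1)]]
    by (cases "i = j") simp_all
  have "ofseq (derivseq i ?r) = ofseq ?g"
  proof (subst ofseq_eq[OF derivseq_coherent[OF i rr] gc], intro allI)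
    fix N
    \<comment> \<open>At level N the derivative sums over degrees up to N, while the shift matches
      degrees up to N + 1 with degrees up to N. The extra degree is added first; it is zero modulo
      I^N.\<close>
    have 1: "derivseq i ?r N - (\<Sum>u\<in>B (Suc (Suc N)). derivtp i u * sg (?r u) N) \<in> P N"
      unfolding derivseq_def by (rule P_swap[OF derivseq_Suc[OF i rr]])
    have 2: "(\<Sum>u\<in>B (Suc (Suc N)). derivtp i u * sg (?r u) N) - (\<Sum>v\<in>B (Suc N). derivtp i (v + ep j) * sg (r v) N) \<in> P N"
      by (rule shift[OF derivtp_mem])
    have 3: "(\<Sum>v\<in>B (Suc N). derivtp i (v + ep j) * sg (r v) N) = t j * derivseq i r N + (if i = j then \<Sum>v\<in>B (Suc N). tp v * sg (r v) N else 0)"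
      unfolding derivtp_shift[OF i j] derivseq_def by (simp add: distrib_right sum.distrib sum_distrib_left mult.assoc)
    have "(\<Sum>v\<in>B (Suc N). tp v * sg (r v) N) - a N \<in> P N"
      by (rule P_trans[OF E_Suc[OF r(1)] P_swap[OF r(2)[rule_format, unfolded ex_at_def]]])
    then have "(\<Sum>v\<in>B (Suc N). derivtp i (v + ep j) * sg (r v) N) - ?g N \<in> P N" unfolding 3 by simp
    then show "derivseq i ?r N - ?g N \<in> P N" by (rule P_trans[OF P_trans[OF 1 2]])
  qed
  moreover have "t j \<odot>\<^bsub>K\<^esub> ofseq (derivseq i r) \<oplus>\<^bsub>K\<^esub> (if i = j then ofseq a else \<zero>\<^bsub>K\<^esub>) = ofseq ?g"
    using K_add[OF coherent_mult[OF t_mem[of j] derivseq_coherent[OF i r(1)]] a(1)]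
      K_add[OF coherent_mult[OF t_mem[of j] derivseq_coherent[OF i r(1)]] coherent_const[OF mpoly_0]]
      K_smult[OF t_mem[of j] derivseq_coherent[OF i r(1)]]
    by (cases "i = j") (simp_all add: K_zero)
  ultimately show ?thesis
    unfolding a(2) K_smult[OF t_mem a(1)] partial_t_eq[OF i coherent_mult[OF t_mem a(1)] rr ex]
      partial_t_eq[OF i a(1) r(1) r(2)[rule_format]] by simp
qed

end

section \<open>Homotopies\<close>

lemma (in abelian_group) sum_of_sums:
  assumes "a \<in> carrier G" "b \<in> carrier G" "c \<in> carrier G" "d \<in> carrier G"
  shows "(a \<oplus> b) \<oplus> (c \<oplus> d) = (a \<oplus> c) \<oplus> (b \<oplus> d)"
  using assms by algebra

lemma (in abelian_group) add_commutator:
  assumes "a \<in> carrier G" "b \<in> carrier G" "c \<in> carrier G" "d \<in> carrier G"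
  shows "(a \<oplus> b) \<ominus> (c \<oplus> d) = (a \<ominus> c) \<oplus> (b \<ominus> d)"
  using assms by algebra

lemma (in abelian_group) anticommutator_smult_split:
  assumes "a \<in> carrier G" "b \<in> carrier G" "c \<in> carrier G" "p \<in> carrier G"
  shows "(a \<oplus> c) \<ominus> p = (a \<ominus> b) \<oplus> ((b \<oplus> c) \<ominus> p)"
  using assms by algebra

lemma is_linear_cong:
  assumes F: "is_linear R M N F" and eq: "\<And>v. v \<in> carrier M \<Longrightarrow> G v = F v" and M: "module R M"
  shows "is_linear R M N G"
proof (intro is_linearI addhomI)
  interpret M: module R M by fact
  note h = is_linear_addhom[OF F]
  fix v assume v: "v \<in> carrier M"
  show "G v \<in> carrier N" unfolding eq[OF v] by (rule is_linear_closed[OF F v])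
  show "G (v \<oplus>\<^bsub>M\<^esub> w) = G v \<oplus>\<^bsub>N\<^esub> G w" if w: "w \<in> carrier M" for w
    unfolding eq[OF v] eq[OF w] eq[OF M.M.a_closed[OF v w]] by (rule addhom_add[OF h v w])
  show "G (p \<odot>\<^bsub>M\<^esub> v) = p \<odot>\<^bsub>N\<^esub> G v" if p: "p \<in> carrier R" for p
    unfolding eq[OF v] eq[OF M.smult_closed[OF p v]] by (rule is_linear_smult[OF F p v])
qed

context cut_basis
begin

text \<open>The sign (-1)^p as a constant polynomial: signs become scalars, which multiply by adding
  parities and pass through linear maps.\<close>

definition sg :: "bit \<Rightarrow> 'k pol" where "sg p = (if p = 0 then 1 else - 1)"

lemma sg_mem [simp, intro]: "sg p \<in> carrier (mpoly_ring Z)" by (simp add: sg_def)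
lemma sg_mult: "sg p * sg q = sg (p + q)" using bit_cases[of p] bit_cases[of q] by (auto simp: sg_def)
lemma smult_minus1: "v \<in> carrier M \<Longrightarrow> (- 1) \<odot>\<^bsub>M\<^esub> v = \<ominus>\<^bsub>M\<^esub> v"
  using smult_add[of 1 "- 1" v] smult_0[of v] smult_1[of v] smult_closed[of "- 1" v]
  by (intro M.minus_equality[symmetric]) (simp_all add: M.a_comm)

lemma psgn_sg: "v \<in> carrier M \<Longrightarrow> psgn M p v = sg p \<odot>\<^bsub>M\<^esub> v"
  by (simp add: psgn_def sg_def smult_minus1 smult_1)

lemma M_Rxz: "module Rxz M" by (rule module_mpoly_mono[OF M_module]) auto

lemma smult_hom: "g \<in> carrier R \<Longrightarrow> is_linear Rxz M M (\<lambda>v. g \<odot>\<^bsub>M\<^esub> v)"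
  by (rule is_linear_mpoly_mono[OF is_linear_smult_map[OF M_module cring_mpoly]]) auto

definition parity_op :: "bit \<Rightarrow> ((('y \<times> 's \<times> 'x) \<Rightarrow>\<^sub>0 int) set \<Rightarrow> (('y \<times> 's \<times> 'x) \<Rightarrow>\<^sub>0 int) set) \<Rightarrow> bool" where
  "parity_op p F \<longleftrightarrow> is_linear Rxz M M F \<and> (\<forall>v\<in>carrier M. eps (F v) = sg p \<odot>\<^bsub>M\<^esub> F (eps v))"

definition closed_op :: "bit \<Rightarrow> ((('y \<times> 's \<times> 'x) \<Rightarrow>\<^sub>0 int) set \<Rightarrow> (('y \<times> 's \<times> 'x) \<Rightarrow>\<^sub>0 int) set) \<Rightarrow> bool" where
  "closed_op p F \<longleftrightarrow> parity_op p F \<and> (\<forall>v\<in>carrier M. d (F v) = sg p \<odot>\<^bsub>M\<^esub> F (d v))"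

text \<open>The homotopy has parity p + 1, so its graded commutator with d carries the sign (-1)^p
  in the second term.\<close>

definition nullhtp :: "bit \<Rightarrow> ((('y \<times> 's \<times> 'x) \<Rightarrow>\<^sub>0 int) set \<Rightarrow> (('y \<times> 's \<times> 'x) \<Rightarrow>\<^sub>0 int) set) \<Rightarrow> bool" where
  "nullhtp p F \<longleftrightarrow> (\<exists>h. parity_op (p + 1) h \<and> (\<forall>v\<in>carrier M. F v = d (h v) \<oplus>\<^bsub>M\<^esub> sg p \<odot>\<^bsub>M\<^esub> h (d v)))"

lemma parity_opI: "is_linear Rxz M M F \<Longrightarrow> (\<And>v. v \<in> carrier M \<Longrightarrow> eps (F v) = sg p \<odot>\<^bsub>M\<^esub> F (eps v)) \<Longrightarrow> parity_op p F"
  by (simp add: parity_op_def)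

lemma parity_op_linear: "parity_op p F \<Longrightarrow> is_linear Rxz M M F" by (simp add: parity_op_def)

lemmas parity_op_hom = is_linear_addhom[OF parity_op_linear] and parity_op_closed = is_linear_closed[OF parity_op_linear]
  and parity_op_smult_out = is_linear_smult[OF parity_op_linear]

lemma parity_op_eps: "parity_op p F \<Longrightarrow> v \<in> carrier M \<Longrightarrow> eps (F v) = sg p \<odot>\<^bsub>M\<^esub> F (eps v)" by (simp add: parity_op_def)

lemma parity_op_has_parity: "parity_op p F \<Longrightarrow> has_parity M p F"
  by (rule has_parityI[OF parity_op_hom]) (simp_all add: psgn_sg parity_op_eps parity_op_closed eps_closed)

lemma smult_plus: "g \<in> carrier R \<Longrightarrow> v \<in> carrier M \<Longrightarrow> w \<in> carrier M \<Longrightarrow> g \<odot>\<^bsub>M\<^esub> (v \<oplus>\<^bsub>M\<^esub> w) = g \<odot>\<^bsub>M\<^esub> v \<oplus>\<^bsub>M\<^esub> g \<odot>\<^bsub>M\<^esub> w"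
  by (rule addhom_add[OF smult_addhom])

lemma smult_swap: "g \<in> carrier R \<Longrightarrow> g' \<in> carrier R \<Longrightarrow> v \<in> carrier M \<Longrightarrow> g \<odot>\<^bsub>M\<^esub> (g' \<odot>\<^bsub>M\<^esub> v) = g' \<odot>\<^bsub>M\<^esub> (g \<odot>\<^bsub>M\<^esub> v)"
  by (simp add: smult_assoc[symmetric] mult.commute)

lemma parity_op_add: assumes F: "parity_op p F" and G: "parity_op p G" shows "parity_op p (\<lambda>v. F v \<oplus>\<^bsub>M\<^esub> G v)"
proof (rule parity_opI)
  show "is_linear Rxz M M (\<lambda>v. F v \<oplus>\<^bsub>M\<^esub> G v)" by (rule is_linear_plus[OF parity_op_linear[OF F] parity_op_linear[OF G] M_Rxz])
  fix v assume v: "v \<in> carrier M"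
  note ev = eps_closed[OF v]
  show "eps (F v \<oplus>\<^bsub>M\<^esub> G v) = sg p \<odot>\<^bsub>M\<^esub> (F (eps v) \<oplus>\<^bsub>M\<^esub> G (eps v))"
    unfolding addhom_add[OF eps_hom parity_op_closed[OF F v] parity_op_closed[OF G v]] parity_op_eps[OF F v] parity_op_eps[OF G v]
    by (rule smult_plus[OF sg_mem parity_op_closed[OF F ev] parity_op_closed[OF G ev], symmetric])
qed

lemma parity_op_smult: assumes F: "parity_op p F" and g: "g \<in> carrier R" shows "parity_op p (\<lambda>v. g \<odot>\<^bsub>M\<^esub> F v)"
proof (rule parity_opI)
  show "is_linear Rxz M M (\<lambda>v. g \<odot>\<^bsub>M\<^esub> F v)" by (rule is_linear_comp[OF parity_op_linear[OF F] smult_hom[OF g]])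
  fix v assume v: "v \<in> carrier M"
  show "eps (g \<odot>\<^bsub>M\<^esub> F v) = sg p \<odot>\<^bsub>M\<^esub> (g \<odot>\<^bsub>M\<^esub> F (eps v))"
    unfolding is_linear_smult[OF eps_linear g parity_op_closed[OF F v]] parity_op_eps[OF F v]
    by (rule smult_swap[OF g sg_mem parity_op_closed[OF F eps_closed[OF v]]])
qed

lemma parity_op_comp: assumes F: "parity_op p F" and G: "parity_op q G" shows "parity_op (p + q) (\<lambda>v. G (F v))"
proof (rule parity_opI)
  show "is_linear Rxz M M (\<lambda>v. G (F v))" by (rule is_linear_comp[OF parity_op_linear[OF F] parity_op_linear[OF G]])
  fix v assume v: "v \<in> carrier M"
  note ev = parity_op_closed[OF F eps_closed[OF v]]
  show "eps (G (F v)) = sg (p + q) \<odot>\<^bsub>M\<^esub> G (F (eps v))"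
    unfolding parity_op_eps[OF G parity_op_closed[OF F v]] parity_op_eps[OF F v] parity_op_smult_out[OF G sg_mem ev]
      smult_assoc[OF sg_mem sg_mem parity_op_closed[OF G ev], symmetric] sg_mult by (simp only: add.commute[of q p])
qed

lemma parity_op_id: "parity_op 0 (\<lambda>v. v)"
  by (rule parity_opI[OF is_linear_id]) (simp add: sg_def smult_1 eps_closed)

lemma parity_op_zero: "parity_op p (\<lambda>v. \<zero>\<^bsub>M\<^esub>)"
proof (rule parity_opI)
  show "is_linear Rxz M M (\<lambda>v. \<zero>\<^bsub>M\<^esub>)" by (rule is_linear_zero[OF M_Rxz])
  show "eps \<zero>\<^bsub>M\<^esub> = sg p \<odot>\<^bsub>M\<^esub> \<zero>\<^bsub>M\<^esub>"
    by (simp add: addhom_zero[OF eps_hom M_ab M_ab] addhom_zero[OF smult_addhom[OF sg_mem] M_ab M_ab])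
qed

lemma parity_op_d: "parity_op 1 d"
proof (rule parity_opI)
  show "is_linear Rxz M M d" by (rule is_linear_mpoly_mono[OF d_linear]) auto
  show "eps (d v) = sg 1 \<odot>\<^bsub>M\<^esub> d (eps v)" if v: "v \<in> carrier M" for v
    unfolding d_eps[OF v] by (rule psgn_sg[OF d_closed[OF eps_closed[OF v]]])
qed

lemma closed_opI: "parity_op p F \<Longrightarrow> (\<And>v. v \<in> carrier M \<Longrightarrow> d (F v) = sg p \<odot>\<^bsub>M\<^esub> F (d v)) \<Longrightarrow> closed_op p F"
  by (simp add: closed_op_def)

lemma closed_op_parity_op: "closed_op p F \<Longrightarrow> parity_op p F" by (simp add: closed_op_def)

lemma closed_op_d: "closed_op p F \<Longrightarrow> v \<in> carrier M \<Longrightarrow> d (F v) = sg p \<odot>\<^bsub>M\<^esub> F (d v)" by (simp add: closed_op_def)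

lemma closed_op_add: assumes F: "closed_op p F" and G: "closed_op p G" shows "closed_op p (\<lambda>v. F v \<oplus>\<^bsub>M\<^esub> G v)"
proof (rule closed_opI[OF parity_op_add[OF closed_op_parity_op[OF F] closed_op_parity_op[OF G]]])
  fix v assume v: "v \<in> carrier M"
  note c = parity_op_closed[OF closed_op_parity_op[OF F]] parity_op_closed[OF closed_op_parity_op[OF G]]
  show "d (F v \<oplus>\<^bsub>M\<^esub> G v) = sg p \<odot>\<^bsub>M\<^esub> (F (d v) \<oplus>\<^bsub>M\<^esub> G (d v))"
    unfolding addhom_add[OF d_hom c(1)[OF v] c(2)[OF v]] closed_op_d[OF F v] closed_op_d[OF G v]
    by (rule smult_plus[OF sg_mem c(1)[OF d_closed[OF v]] c(2)[OF d_closed[OF v]], symmetric])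
qed

lemma closed_op_smult: assumes F: "closed_op p F" and g: "g \<in> carrier R" shows "closed_op p (\<lambda>v. g \<odot>\<^bsub>M\<^esub> F v)"
proof (rule closed_opI[OF parity_op_smult[OF closed_op_parity_op[OF F] g]])
  fix v assume v: "v \<in> carrier M"
  note c = parity_op_closed[OF closed_op_parity_op[OF F]]
  show "d (g \<odot>\<^bsub>M\<^esub> F v) = sg p \<odot>\<^bsub>M\<^esub> (g \<odot>\<^bsub>M\<^esub> F (d v))"
    unfolding is_linear_smult[OF d_linear g c[OF v]] closed_op_d[OF F v]
    by (rule smult_swap[OF g sg_mem c[OF d_closed[OF v]]])
qed

lemma closed_op_comp: assumes F: "closed_op p F" and G: "closed_op q G" shows "closed_op (p + q) (\<lambda>v. G (F v))"
proof (rule closed_opI[OF parity_op_comp[OF closed_op_parity_op[OF F] closed_op_parity_op[OF G]]])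
  fix v assume v: "v \<in> carrier M"
  note F' = closed_op_parity_op[OF F] note G' = closed_op_parity_op[OF G]
  note ev = parity_op_closed[OF F' d_closed[OF v]]
  show "d (G (F v)) = sg (p + q) \<odot>\<^bsub>M\<^esub> G (F (d v))"
    unfolding closed_op_d[OF G parity_op_closed[OF F' v]] closed_op_d[OF F v] parity_op_smult_out[OF G' sg_mem ev]
      smult_assoc[OF sg_mem sg_mem parity_op_closed[OF G' ev], symmetric] sg_mult by (simp only: add.commute[of q p])
qed

lemma closed_op_id: "closed_op 0 (\<lambda>v. v)"
  by (rule closed_opI[OF parity_op_id]) (simp add: sg_def smult_1 d_closed)

lemma closed_op_zero: "closed_op p (\<lambda>v. \<zero>\<^bsub>M\<^esub>)"
  by (rule closed_opI[OF parity_op_zero])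
    (simp add: addhom_zero[OF d_hom M_ab M_ab] addhom_zero[OF smult_addhom[OF sg_mem] M_ab M_ab])

lemma closed_op_closed_operator: assumes F: "closed_op p F" shows "closed_operator Rxz M p F"
  unfolding closed_operator_def
proof (intro conjI ballI parity_op_linear[OF closed_op_parity_op[OF F]] parity_op_has_parity[OF closed_op_parity_op[OF F]])
  fix v assume v: "v \<in> carrier M"
  note c = parity_op_closed[OF closed_op_parity_op[OF F] d_closed[OF v]]
  show "gcomm M 1 p d F v = \<zero>\<^bsub>M\<^esub>"
    using bit_cases[of p] unfolding gcomm_def closed_op_d[OF F v]
    by (auto simp: sg_def smult_1 smult_minus1 c M.r_neg M.l_neg a_minus_def)
qed

lemma nullhtpI: "parity_op (p + 1) h \<Longrightarrow> (\<And>v. v \<in> carrier M \<Longrightarrow> F v = d (h v) \<oplus>\<^bsub>M\<^esub> sg p \<odot>\<^bsub>M\<^esub> h (d v)) \<Longrightarrow> nullhtp p F"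
  by (auto simp: nullhtp_def)

lemma nullhtpE: assumes "nullhtp p F"
  obtains h where "parity_op (p + 1) h" "\<forall>v\<in>carrier M. F v = d (h v) \<oplus>\<^bsub>M\<^esub> sg p \<odot>\<^bsub>M\<^esub> h (d v)"
  using assms by (auto simp: nullhtp_def)

lemma nullhtp_cong: "nullhtp p F \<Longrightarrow> (\<And>v. v \<in> carrier M \<Longrightarrow> G v = F v) \<Longrightarrow> nullhtp p G"
  by (auto simp: nullhtp_def)

lemma nullhtp_zero: "nullhtp p (\<lambda>v. \<zero>\<^bsub>M\<^esub>)"
  by (rule nullhtpI[OF parity_op_zero])
    (simp add: addhom_zero[OF d_hom M_ab M_ab] addhom_zero[OF smult_addhom[OF sg_mem] M_ab M_ab])

lemma nullhtp_add: assumes "nullhtp p F" "nullhtp p G" shows "nullhtp p (\<lambda>v. F v \<oplus>\<^bsub>M\<^esub> G v)"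
proof -
  obtain h where h: "parity_op (p + 1) h" "\<forall>v\<in>carrier M. F v = d (h v) \<oplus>\<^bsub>M\<^esub> sg p \<odot>\<^bsub>M\<^esub> h (d v)" by (rule nullhtpE[OF assms(1)])
  obtain k where k: "parity_op (p + 1) k" "\<forall>v\<in>carrier M. G v = d (k v) \<oplus>\<^bsub>M\<^esub> sg p \<odot>\<^bsub>M\<^esub> k (d v)" by (rule nullhtpE[OF assms(2)])
  note c = parity_op_closed[OF h(1)] parity_op_closed[OF k(1)]
  show ?thesis
  proof (rule nullhtpI[OF parity_op_add[OF h(1) k(1)]])
    fix v assume v: "v \<in> carrier M"
    note dv = d_closed[OF v]
    show "F v \<oplus>\<^bsub>M\<^esub> G v = d (h v \<oplus>\<^bsub>M\<^esub> k v) \<oplus>\<^bsub>M\<^esub> sg p \<odot>\<^bsub>M\<^esub> (h (d v) \<oplus>\<^bsub>M\<^esub> k (d v))"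
      unfolding bspec[OF h(2) v] bspec[OF k(2) v] addhom_add[OF d_hom c(1)[OF v] c(2)[OF v]] smult_plus[OF sg_mem c(1)[OF dv] c(2)[OF dv]]
      by (intro M.sum_of_sums d_closed smult_closed sg_mem c v)
  qed
qed

lemma nullhtp_smult: assumes "nullhtp p F" and g: "g \<in> carrier R" shows "nullhtp p (\<lambda>v. g \<odot>\<^bsub>M\<^esub> F v)"
proof -
  obtain h where h: "parity_op (p + 1) h" "\<forall>v\<in>carrier M. F v = d (h v) \<oplus>\<^bsub>M\<^esub> sg p \<odot>\<^bsub>M\<^esub> h (d v)" by (rule nullhtpE[OF assms(1)])
  note c = parity_op_closed[OF h(1)]
  show ?thesis
  proof (rule nullhtpI[OF parity_op_smult[OF h(1) g]])
    fix v assume v: "v \<in> carrier M"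
    note dv = d_closed[OF v]
    show "g \<odot>\<^bsub>M\<^esub> F v = d (g \<odot>\<^bsub>M\<^esub> h v) \<oplus>\<^bsub>M\<^esub> sg p \<odot>\<^bsub>M\<^esub> (g \<odot>\<^bsub>M\<^esub> h (d v))"
      unfolding bspec[OF h(2) v] smult_plus[OF g d_closed[OF c[OF v]] smult_closed[OF sg_mem c[OF dv]]]
        is_linear_smult[OF d_linear g c[OF v]] smult_swap[OF sg_mem g c[OF dv]] ..
  qed
qed

text \<open>Composing the homotopy with \<open>C\<close> gives a homotopy for the composite, because
  \<open>C\<close> commutes with d up to the sign of its parity.\<close>

lemma nullhtp_comp: assumes "nullhtp p F" and C: "closed_op q C" shows "nullhtp (p + q) (\<lambda>v. F (C v))"
proof -
  obtain h where h: "parity_op (p + 1) h" "\<forall>v\<in>carrier M. F v = d (h v) \<oplus>\<^bsub>M\<^esub> sg p \<odot>\<^bsub>M\<^esub> h (d v)" by (rule nullhtpE[OF assms(1)])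
  note C' = closed_op_parity_op[OF C] note c = parity_op_closed[OF h(1)] parity_op_closed[OF C']
  have "q + (p + 1) = (p + q) + 1" by (simp only: ac_simps)
  then have "parity_op ((p + q) + 1) (\<lambda>v. h (C v))" using parity_op_comp[OF C' h(1)] by (simp only:)
  then show ?thesis
  proof (rule nullhtpI)
    fix v assume v: "v \<in> carrier M"
    note Cd = c(2)[OF d_closed[OF v]]
    show "F (C v) = d (h (C v)) \<oplus>\<^bsub>M\<^esub> sg (p + q) \<odot>\<^bsub>M\<^esub> h (C (d v))"
      unfolding bspec[OF h(2) c(2)[OF v]] closed_op_d[OF C v] parity_op_smult_out[OF h(1) sg_mem Cd]
        smult_assoc[OF sg_mem sg_mem c(1)[OF Cd], symmetric] sg_mult ..
  qed
qed

subsection \<open>Anticommutators up to homotopy\<close>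

text \<open>Up to homotopy, \<open>htp_scalar F p\<close> says that \<open>F\<close> is multiplication by \<open>p\<close>, and \<open>htp_linear F\<close> that the odd
  closed operator \<open>F\<close> is \<open>k[y]\<close>-linear.  Atiyah classes are not \<open>k[y]\<close>-linear on the nose.\<close>

definition htp_scalar :: "((('y \<times> 's \<times> 'x) \<Rightarrow>\<^sub>0 int) set \<Rightarrow> (('y \<times> 's \<times> 'x) \<Rightarrow>\<^sub>0 int) set) \<Rightarrow> 'k pol \<Rightarrow> bool" where
  "htp_scalar F p \<longleftrightarrow> nullhtp 0 (\<lambda>v. F v \<ominus>\<^bsub>M\<^esub> p \<odot>\<^bsub>M\<^esub> v)"

definition htp_linear :: "((('y \<times> 's \<times> 'x) \<Rightarrow>\<^sub>0 int) set \<Rightarrow> (('y \<times> 's \<times> 'x) \<Rightarrow>\<^sub>0 int) set) \<Rightarrow> bool" where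
  "htp_linear F \<longleftrightarrow> closed_op 1 F \<and> (\<forall>g\<in>carrier Ry. nullhtp 1 (\<lambda>v. F (g \<odot>\<^bsub>M\<^esub> v) \<ominus>\<^bsub>M\<^esub> g \<odot>\<^bsub>M\<^esub> F v))"

abbreviation "ac F G v \<equiv> F (G v) \<oplus>\<^bsub>M\<^esub> G (F v)"

lemma htp_linearI: "closed_op 1 F \<Longrightarrow> (\<And>g. g \<in> carrier Ry \<Longrightarrow> nullhtp 1 (\<lambda>v. F (g \<odot>\<^bsub>M\<^esub> v) \<ominus>\<^bsub>M\<^esub> g \<odot>\<^bsub>M\<^esub> F v)) \<Longrightarrow> htp_linear F"
  by (simp add: htp_linear_def)

lemma htp_linear_closed_op: "htp_linear F \<Longrightarrow> closed_op 1 F" by (simp add: htp_linear_def)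

lemmas htp_linear_parity_op = closed_op_parity_op[OF htp_linear_closed_op] and htp_linear_closed = parity_op_closed[OF closed_op_parity_op[OF htp_linear_closed_op]] and htp_linear_hom = parity_op_hom[OF closed_op_parity_op[OF htp_linear_closed_op]]

lemma htp_linear_nullhtp: "htp_linear F \<Longrightarrow> g \<in> carrier Ry \<Longrightarrow> nullhtp 1 (\<lambda>v. F (g \<odot>\<^bsub>M\<^esub> v) \<ominus>\<^bsub>M\<^esub> g \<odot>\<^bsub>M\<^esub> F v)"
  by (simp add: htp_linear_def)

lemma htp_linear_cong: assumes F: "htp_linear F" and eq: "\<And>v. v \<in> carrier M \<Longrightarrow> G v = F v" shows "htp_linear G"
proof (rule htp_linearI[OF closed_opI[OF parity_opI]])
  show "is_linear Rxz M M G" by (rule is_linear_cong[OF parity_op_linear[OF htp_linear_parity_op[OF F]] eq M_Rxz])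
  fix v assume v: "v \<in> carrier M"
  show "eps (G v) = sg 1 \<odot>\<^bsub>M\<^esub> G (eps v)" unfolding eq[OF v] eq[OF eps_closed[OF v]] by (rule parity_op_eps[OF htp_linear_parity_op[OF F] v])
  show "d (G v) = sg 1 \<odot>\<^bsub>M\<^esub> G (d v)" unfolding eq[OF v] eq[OF d_closed[OF v]] by (rule closed_op_d[OF htp_linear_closed_op[OF F] v])
next
  fix g assume g: "g \<in> carrier Ry"
  show "nullhtp 1 (\<lambda>v. G (g \<odot>\<^bsub>M\<^esub> v) \<ominus>\<^bsub>M\<^esub> g \<odot>\<^bsub>M\<^esub> G v)"
    by (rule nullhtp_cong[OF htp_linear_nullhtp[OF F g]]) (simp only: eq smult_closed[OF Ry_R[OF g]])
qed

lemma htp_linear_zero: "htp_linear (\<lambda>v. \<zero>\<^bsub>M\<^esub>)"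
proof (rule htp_linearI[OF closed_op_zero])
  show "nullhtp 1 (\<lambda>v. \<zero>\<^bsub>M\<^esub> \<ominus>\<^bsub>M\<^esub> g \<odot>\<^bsub>M\<^esub> \<zero>\<^bsub>M\<^esub>)" if "g \<in> carrier Ry" for g
    by (rule nullhtp_cong[OF nullhtp_zero]) (simp add: addhom_zero[OF smult_addhom[OF Ry_R[OF that]] M_ab M_ab] a_minus_def M_neg_zero)
qed

lemma htp_linear_add: assumes F: "htp_linear F" and G: "htp_linear G" shows "htp_linear (\<lambda>v. F v \<oplus>\<^bsub>M\<^esub> G v)"
proof (rule htp_linearI[OF closed_op_add[OF htp_linear_closed_op[OF F] htp_linear_closed_op[OF G]]])
  fix g assume g: "g \<in> carrier Ry"
  show "nullhtp 1 (\<lambda>v. (F (g \<odot>\<^bsub>M\<^esub> v) \<oplus>\<^bsub>M\<^esub> G (g \<odot>\<^bsub>M\<^esub> v)) \<ominus>\<^bsub>M\<^esub> g \<odot>\<^bsub>M\<^esub> (F v \<oplus>\<^bsub>M\<^esub> G v))"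
  proof (rule nullhtp_cong[OF nullhtp_add[OF htp_linear_nullhtp[OF F g] htp_linear_nullhtp[OF G g]]])
    fix v assume v: "v \<in> carrier M"
    show "(F (g \<odot>\<^bsub>M\<^esub> v) \<oplus>\<^bsub>M\<^esub> G (g \<odot>\<^bsub>M\<^esub> v)) \<ominus>\<^bsub>M\<^esub> g \<odot>\<^bsub>M\<^esub> (F v \<oplus>\<^bsub>M\<^esub> G v)
      = (F (g \<odot>\<^bsub>M\<^esub> v) \<ominus>\<^bsub>M\<^esub> g \<odot>\<^bsub>M\<^esub> F v) \<oplus>\<^bsub>M\<^esub> (G (g \<odot>\<^bsub>M\<^esub> v) \<ominus>\<^bsub>M\<^esub> g \<odot>\<^bsub>M\<^esub> G v)"
      unfolding smult_plus[OF Ry_R[OF g] htp_linear_closed[OF F v] htp_linear_closed[OF G v]]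
      by (intro M.add_commutator smult_closed Ry_R g htp_linear_closed[OF F] htp_linear_closed[OF G] v)
  qed
qed

lemma smult_minus: "g \<in> carrier R \<Longrightarrow> v \<in> carrier M \<Longrightarrow> w \<in> carrier M \<Longrightarrow> g \<odot>\<^bsub>M\<^esub> (v \<ominus>\<^bsub>M\<^esub> w) = g \<odot>\<^bsub>M\<^esub> v \<ominus>\<^bsub>M\<^esub> g \<odot>\<^bsub>M\<^esub> w"
  by (rule addhom_minus[OF smult_addhom M_ab M_ab])

lemma htp_linear_smult: assumes F: "htp_linear F" and c: "c \<in> carrier Ry" shows "htp_linear (\<lambda>v. c \<odot>\<^bsub>M\<^esub> F v)"
proof (rule htp_linearI[OF closed_op_smult[OF htp_linear_closed_op[OF F] Ry_R[OF c]]])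
  fix g assume g: "g \<in> carrier Ry"
  show "nullhtp 1 (\<lambda>v. c \<odot>\<^bsub>M\<^esub> F (g \<odot>\<^bsub>M\<^esub> v) \<ominus>\<^bsub>M\<^esub> g \<odot>\<^bsub>M\<^esub> (c \<odot>\<^bsub>M\<^esub> F v))"
  proof (rule nullhtp_cong[OF nullhtp_smult[OF htp_linear_nullhtp[OF F g] Ry_R[OF c]]])
    fix v assume v: "v \<in> carrier M"
    note Fv = htp_linear_closed[OF F v]
    show "c \<odot>\<^bsub>M\<^esub> F (g \<odot>\<^bsub>M\<^esub> v) \<ominus>\<^bsub>M\<^esub> g \<odot>\<^bsub>M\<^esub> (c \<odot>\<^bsub>M\<^esub> F v) = c \<odot>\<^bsub>M\<^esub> (F (g \<odot>\<^bsub>M\<^esub> v) \<ominus>\<^bsub>M\<^esub> g \<odot>\<^bsub>M\<^esub> F v)"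
      unfolding smult_minus[OF Ry_R[OF c] htp_linear_closed[OF F smult_closed[OF Ry_R[OF g] v]] smult_closed[OF Ry_R[OF g] Fv]]
        smult_swap[OF Ry_R[OF g] Ry_R[OF c] Fv] ..
  qed
qed

lemma htp_scalar_cong: "htp_scalar F p \<Longrightarrow> (\<And>v. v \<in> carrier M \<Longrightarrow> G v = F v) \<Longrightarrow> htp_scalar G p"
  unfolding htp_scalar_def by (erule nullhtp_cong) simp

lemma htp_scalar_add:
  assumes F: "htp_scalar F p" "\<And>v. v \<in> carrier M \<Longrightarrow> F v \<in> carrier M" and G: "htp_scalar G q" "\<And>v. v \<in> carrier M \<Longrightarrow> G v \<in> carrier M"
    and p: "p \<in> carrier R" and q: "q \<in> carrier R"
  shows "htp_scalar (\<lambda>v. F v \<oplus>\<^bsub>M\<^esub> G v) (p + q)"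
  unfolding htp_scalar_def
proof (rule nullhtp_cong[OF nullhtp_add[OF F(1)[unfolded htp_scalar_def] G(1)[unfolded htp_scalar_def]]])
  fix v assume v: "v \<in> carrier M"
  show "(F v \<oplus>\<^bsub>M\<^esub> G v) \<ominus>\<^bsub>M\<^esub> (p + q) \<odot>\<^bsub>M\<^esub> v = (F v \<ominus>\<^bsub>M\<^esub> p \<odot>\<^bsub>M\<^esub> v) \<oplus>\<^bsub>M\<^esub> (G v \<ominus>\<^bsub>M\<^esub> q \<odot>\<^bsub>M\<^esub> v)"
    unfolding smult_add[OF p q v] by (intro M.add_commutator F(2) G(2) smult_closed p q v)
qed

lemma htp_scalar_smult:
  assumes F: "htp_scalar F p" "\<And>v. v \<in> carrier M \<Longrightarrow> F v \<in> carrier M" and p: "p \<in> carrier R" and g: "g \<in> carrier R"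
  shows "htp_scalar (\<lambda>v. g \<odot>\<^bsub>M\<^esub> F v) (g * p)"
  unfolding htp_scalar_def
proof (rule nullhtp_cong[OF nullhtp_smult[OF F(1)[unfolded htp_scalar_def] g]])
  fix v assume v: "v \<in> carrier M"
  show "g \<odot>\<^bsub>M\<^esub> F v \<ominus>\<^bsub>M\<^esub> (g * p) \<odot>\<^bsub>M\<^esub> v = g \<odot>\<^bsub>M\<^esub> (F v \<ominus>\<^bsub>M\<^esub> p \<odot>\<^bsub>M\<^esub> v)"
    unfolding smult_minus[OF g F(2)[OF v] smult_closed[OF p v]] smult_assoc[OF g p v] ..
qed

lemma htp_scalar_ac_sym: assumes F: "htp_linear F" and G: "htp_linear G" and s: "htp_scalar (ac F G) p" shows "htp_scalar (ac G F) p"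
proof (rule htp_scalar_cong[OF s])
  fix v assume v: "v \<in> carrier M"
  show "ac G F v = ac F G v"
    by (rule M.a_comm[OF htp_linear_closed[OF G htp_linear_closed[OF F v]] htp_linear_closed[OF F htp_linear_closed[OF G v]]])
qed

lemma ac_closed: "htp_linear F \<Longrightarrow> htp_linear G \<Longrightarrow> v \<in> carrier M \<Longrightarrow> ac F G v \<in> carrier M"
  by (simp add: htp_linear_closed)

lemma htp_scalar_ac_add:
  assumes C: "htp_linear C" and F: "htp_linear F" "htp_scalar (ac C F) p" and G: "htp_linear G" "htp_scalar (ac C G) q" and p: "p \<in> carrier R" and q: "q \<in> carrier R"
  shows "htp_scalar (ac C (\<lambda>v. F v \<oplus>\<^bsub>M\<^esub> G v)) (p + q)"
proof (rule htp_scalar_cong[OF htp_scalar_add[OF F(2) ac_closed[OF C F(1)] G(2) ac_closed[OF C G(1)] p q]])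
  fix v assume v: "v \<in> carrier M"
  note c = htp_linear_closed[OF C] htp_linear_closed[OF F(1)] htp_linear_closed[OF G(1)]
  show "C (F v \<oplus>\<^bsub>M\<^esub> G v) \<oplus>\<^bsub>M\<^esub> (F (C v) \<oplus>\<^bsub>M\<^esub> G (C v)) = (C (F v) \<oplus>\<^bsub>M\<^esub> F (C v)) \<oplus>\<^bsub>M\<^esub> (C (G v) \<oplus>\<^bsub>M\<^esub> G (C v))"
    unfolding addhom_add[OF htp_linear_hom[OF C] c(2)[OF v] c(3)[OF v]]
    by (intro M.sum_of_sums c v)
qed

text \<open>Since \<open>C\<close> commutes with \<open>g\<close> only up to homotopy, the
  difference of C g F and g C F is null-homotopic rather than zero. It is added to \<open>g\<close>
  times the anticommutator of \<open>C\<close> and \<open>F\<close>.\<close>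

lemma htp_scalar_ac_smult:
  assumes C: "htp_linear C" and F: "htp_linear F" "htp_scalar (ac C F) p" and p: "p \<in> carrier R" and g: "g \<in> carrier Ry"
  shows "htp_scalar (ac C (\<lambda>v. g \<odot>\<^bsub>M\<^esub> F v)) (g * p)"
proof -
  note gR = Ry_R[OF g]
  have "nullhtp (1 + 1) (\<lambda>v. C (g \<odot>\<^bsub>M\<^esub> F v) \<ominus>\<^bsub>M\<^esub> g \<odot>\<^bsub>M\<^esub> C (F v))" by (rule nullhtp_comp[OF htp_linear_nullhtp[OF C g] htp_linear_closed_op[OF F(1)]])
  then have 1: "nullhtp 0 (\<lambda>v. C (g \<odot>\<^bsub>M\<^esub> F v) \<ominus>\<^bsub>M\<^esub> g \<odot>\<^bsub>M\<^esub> C (F v))" by simp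
  note 2 = htp_scalar_smult[OF F(2) ac_closed[OF C F(1)] p gR, unfolded htp_scalar_def]
  note c = htp_linear_closed[OF C] htp_linear_closed[OF F(1)]
  show ?thesis unfolding htp_scalar_def
  proof (rule nullhtp_cong[OF nullhtp_add[OF 1 2]])
    fix v assume v: "v \<in> carrier M"
    show "C (g \<odot>\<^bsub>M\<^esub> F v) \<oplus>\<^bsub>M\<^esub> g \<odot>\<^bsub>M\<^esub> F (C v) \<ominus>\<^bsub>M\<^esub> (g * p) \<odot>\<^bsub>M\<^esub> v =
      (C (g \<odot>\<^bsub>M\<^esub> F v) \<ominus>\<^bsub>M\<^esub> g \<odot>\<^bsub>M\<^esub> C (F v)) \<oplus>\<^bsub>M\<^esub> (g \<odot>\<^bsub>M\<^esub> (C (F v) \<oplus>\<^bsub>M\<^esub> F (C v)) \<ominus>\<^bsub>M\<^esub> (g * p) \<odot>\<^bsub>M\<^esub> v)"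
      unfolding smult_plus[OF gR c(1)[OF c(2)[OF v]] c(2)[OF c(1)[OF v]]]
      by (intro M.anticommutator_smult_split c smult_closed gR p v mpoly_mult)
  qed
qed

lemma htp_scalar_ac_zero: "htp_linear C \<Longrightarrow> htp_scalar (ac C (\<lambda>v. \<zero>\<^bsub>M\<^esub>)) 0"
  unfolding htp_scalar_def
proof (rule nullhtp_cong[OF nullhtp_zero])
  fix v assume C: "htp_linear C" and v: "v \<in> carrier M"
  show "C \<zero>\<^bsub>M\<^esub> \<oplus>\<^bsub>M\<^esub> \<zero>\<^bsub>M\<^esub> \<ominus>\<^bsub>M\<^esub> 0 \<odot>\<^bsub>M\<^esub> v = \<zero>\<^bsub>M\<^esub>"
    unfolding addhom_zero[OF htp_linear_hom[OF C] M_ab M_ab] smult_0[OF v] by (simp add: a_minus_def M_neg_zero)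
qed

text \<open>The two claims are proved together, because adding a summand to the anticommutator needs
  that the remaining sum is again k[y]-linear up to homotopy.\<close>

lemma htp_linear_finsum:
  assumes "finite I" "\<And>i. i \<in> I \<Longrightarrow> htp_linear (F i)" "\<And>i. i \<in> I \<Longrightarrow> c i \<in> carrier Ry"
  shows "htp_linear (\<lambda>v. \<Oplus>\<^bsub>M\<^esub>i\<in>I. c i \<odot>\<^bsub>M\<^esub> F i v) \<and>
    (\<forall>C s. htp_linear C \<longrightarrow> (\<forall>i\<in>I. s i \<in> carrier R \<and> htp_scalar (ac C (F i)) (s i)) \<longrightarrow> htp_scalar (ac C (\<lambda>v. \<Oplus>\<^bsub>M\<^esub>i\<in>I. c i \<odot>\<^bsub>M\<^esub> F i v)) (\<Sum>i\<in>I. c i * s i))"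
  using assms
proof (induction I rule: finite_induct)
  case empty
  show ?case using htp_linear_zero htp_scalar_ac_zero by simp
next
  case (insert i I)
  let ?S = "\<lambda>I v. \<Oplus>\<^bsub>M\<^esub>i\<in>I. c i \<odot>\<^bsub>M\<^esub> F i v"
  note Fi = insert(4)[OF insertI1] and ci = insert(5)[OF insertI1]
  note IH = insert(3)[OF insert(4,5)[OF insertI2]]
  have gI: "htp_linear (?S I)" by (rule conjunct1[OF IH])
  note gi = htp_linear_smult[OF Fi ci]
  have eq: "?S (insert i I) v = c i \<odot>\<^bsub>M\<^esub> F i v \<oplus>\<^bsub>M\<^esub> ?S I v" if v: "v \<in> carrier M" for v
  proof (rule M.finsum_insert[OF insert(1,2)])
    show "(\<lambda>i. c i \<odot>\<^bsub>M\<^esub> F i v) \<in> I \<rightarrow> carrier M"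
      using htp_linear_closed[OF insert(4)[OF insertI2] v] Ry_R[OF insert(5)[OF insertI2]] smult_closed by auto
    show "c i \<odot>\<^bsub>M\<^esub> F i v \<in> carrier M" by (rule smult_closed[OF Ry_R[OF ci] htp_linear_closed[OF Fi v]])
  qed
  have gS: "htp_linear (?S (insert i I))"
  proof -
    have "htp_linear (\<lambda>v. c i \<odot>\<^bsub>M\<^esub> F i v \<oplus>\<^bsub>M\<^esub> ?S I v)" by (rule htp_linear_add[OF gi gI])
    then show ?thesis by (rule htp_linear_cong) (rule eq)
  qed
  show ?case
  proof (intro conjI allI impI gS)
    fix C s assume C: "htp_linear C" and s: "\<forall>i\<in>insert i I. s i \<in> carrier R \<and> htp_scalar (ac C (F i)) (s i)"
    then have si: "s i \<in> carrier R" "htp_scalar (ac C (F i)) (s i)" and sI: "\<forall>i\<in>I. s i \<in> carrier R \<and> htp_scalar (ac C (F i)) (s i)" by simp_all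
    have sS: "(\<Sum>i\<in>I. c i * s i) \<in> carrier R" using sI Ry_R[OF insert(5)[OF insertI2]] by (intro mpoly_sum mpoly_mult) auto
    have "htp_scalar (ac C (?S I)) (\<Sum>i\<in>I. c i * s i)" by (rule conjunct2[OF IH, rule_format, OF _ _ C bspec[OF sI]])
    then have "htp_scalar (ac C (\<lambda>v. c i \<odot>\<^bsub>M\<^esub> F i v \<oplus>\<^bsub>M\<^esub> ?S I v)) (c i * s i + (\<Sum>i\<in>I. c i * s i))"
      by (intro htp_scalar_ac_add[OF C gi htp_scalar_ac_smult[OF C Fi si(2,1) ci] gI] sS mpoly_mult Ry_R[OF ci] si(1))
    then have "htp_scalar (ac C (?S (insert i I))) (c i * s i + (\<Sum>i\<in>I. c i * s i))"
      by (rule htp_scalar_cong) (simp only: eq htp_linear_closed[OF C])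
    then show "htp_scalar (ac C (?S (insert i I))) (\<Sum>i\<in>insert i I. c i * s i)" using insert(1,2) by simp
  qed
qed

lemma htp_scalar_homotopic:
  assumes F: "closed_op 0 F" and s: "htp_scalar F p" and G: "closed_op 0 G" "\<And>v. v \<in> carrier M \<Longrightarrow> G v = p \<odot>\<^bsub>M\<^esub> v"
  shows "homotopic Rxz M 0 F G"
proof -
  obtain h where h: "parity_op (0 + 1) h" "\<forall>v\<in>carrier M. F v \<ominus>\<^bsub>M\<^esub> p \<odot>\<^bsub>M\<^esub> v = d (h v) \<oplus>\<^bsub>M\<^esub> sg 0 \<odot>\<^bsub>M\<^esub> h (d v)"
    by (rule nullhtpE[OF s[unfolded htp_scalar_def]])
  show ?thesis unfolding homotopic_def
  proof (intro conjI exI ballI)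
    fix v assume v: "v \<in> carrier M"
    have "F v \<ominus>\<^bsub>M\<^esub> p \<odot>\<^bsub>M\<^esub> v = d (h v) \<oplus>\<^bsub>M\<^esub> h (d v)"
      using bspec[OF h(2) v] smult_1[OF parity_op_closed[OF h(1) d_closed[OF v]]] by (simp add: sg_def)
    then show "F v \<ominus>\<^bsub>M\<^esub> G v = gcomm M 1 (0 + 1) d h v" unfolding G(2)[OF v] by (simp add: gcomm_def)
  qed (rule closed_op_closed_operator[OF F] closed_op_closed_operator[OF G(1)] parity_op_linear[OF h(1)] parity_op_has_parity[OF h(1)])+
qed

lemma ac_homotopic:
  assumes F: "htp_linear F" and G: "htp_linear G" and s: "htp_scalar (ac F G) p" and H: "closed_op 0 H" "\<And>v. v \<in> carrier M \<Longrightarrow> H v = p \<odot>\<^bsub>M\<^esub> v"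
  shows "homotopic Rxz M 0 (gcomm M 1 1 F G) H"
proof -
  have eq: "gcomm M 1 1 F G = ac F G" by (simp add: gcomm_def fun_eq_iff)
  have "closed_op (1 + 1) (ac F G)" by (rule closed_op_add[OF closed_op_comp[OF htp_linear_closed_op[OF G] htp_linear_closed_op[OF F]] closed_op_comp[OF htp_linear_closed_op[OF F] htp_linear_closed_op[OF G]]])
  then show ?thesis unfolding eq by (intro htp_scalar_homotopic[OF _ s H]) simp
qed

end

section \<open>The Clifford relations\<close>

context cut_basis
begin

lemma htp_linear_commuting:
  assumes F: "closed_op 1 F" and c: "\<And>g v. g \<in> carrier Ry \<Longrightarrow> v \<in> carrier M \<Longrightarrow> F (g \<odot>\<^bsub>M\<^esub> v) = g \<odot>\<^bsub>M\<^esub> F v"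
  shows "htp_linear F"
proof (rule htp_linearI[OF F])
  fix g assume g: "g \<in> carrier Ry"
  show "nullhtp 1 (\<lambda>v. F (g \<odot>\<^bsub>M\<^esub> v) \<ominus>\<^bsub>M\<^esub> g \<odot>\<^bsub>M\<^esub> F v)"
  proof (rule nullhtp_cong[OF nullhtp_zero])
    fix v assume v: "v \<in> carrier M"
    show "F (g \<odot>\<^bsub>M\<^esub> v) \<ominus>\<^bsub>M\<^esub> g \<odot>\<^bsub>M\<^esub> F v = \<zero>\<^bsub>M\<^esub>"
      unfolding c[OF g v] using smult_closed[OF Ry_R[OF g] parity_op_closed[OF closed_op_parity_op[OF F] v]] by (simp add: a_minus_def M.r_neg)
  qed
qed

lemma hf_hf: "cpoly hf + cpoly hf = 1"
  unfolding cpoly_simps(3)[symmetric] hf cpoly_simps(2) ..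

text \<open>The Clifford relations follow formally from the homotopy relations assumed here.
  \<open>At\<close> stands for the Atiyah classes, \<open>L\<close> for the derivatives of the right
  differential and \<open>Hs\<close> for the Hessian of V.\<close>

context
  fixes At L :: "nat \<Rightarrow> (('y \<times> 's \<times> 'x) \<Rightarrow>\<^sub>0 int) set \<Rightarrow> (('y \<times> 's \<times> 'x) \<Rightarrow>\<^sub>0 int) set" and Hs :: "nat \<Rightarrow> nat \<Rightarrow> 'k pol"
  assumes At: "\<And>i. i < m \<Longrightarrow> htp_linear (At i)" and L: "\<And>i. i < m \<Longrightarrow> htp_linear (L i)"
    and AA: "\<And>i j. i < m \<Longrightarrow> j < m \<Longrightarrow> htp_scalar (ac (At i) (At j)) 0"
    and AL: "\<And>i j. i < m \<Longrightarrow> j < m \<Longrightarrow> htp_scalar (ac (At i) (L j)) (if i = j then - 1 else 0)"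
    and LL: "\<And>i j. i < m \<Longrightarrow> j < m \<Longrightarrow> htp_scalar (ac (L i) (L j)) (Hs i j)"
    and Hs: "\<And>i j. i < m \<Longrightarrow> j < m \<Longrightarrow> Hs i j \<in> carrier Ry" and Hs_sym: "\<And>i j. Hs i j = Hs j i"
begin

definition cf :: "nat \<Rightarrow> nat \<Rightarrow> 'k pol" where "cf i q = - cpoly hf * Hs i q"

definition hess where "hess i v = (\<Oplus>\<^bsub>M\<^esub>q\<in>{..<m}. cf i q \<odot>\<^bsub>M\<^esub> At q v)"

text \<open>The operators \<gamma>^\<dagger>, with the signs and the half written as scalars so that
  the rules for sums and multiples up to homotopy apply directly.\<close>

definition dagger where "dagger i v = (- 1) \<odot>\<^bsub>M\<^esub> L i v \<oplus>\<^bsub>M\<^esub> hess i v"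

lemma cf_mem: "i < m \<Longrightarrow> q < m \<Longrightarrow> cf i q \<in> carrier Ry"
  unfolding cf_def by (intro mpoly_mult mpoly_uminus cpoly_mem Hs)

lemma m1: "- 1 \<in> carrier Ry" by (intro mpoly_uminus mpoly_1)

lemma hess_htp_linear: "i < m \<Longrightarrow> htp_linear (hess i)"
  unfolding hess_def[abs_def] by (rule conjunct1[OF htp_linear_finsum]) (simp_all add: At cf_mem)

lemma htp_scalar_hess:
  assumes i: "i < m" and C: "htp_linear C" and s: "\<And>q. q < m \<Longrightarrow> s q \<in> carrier R \<and> htp_scalar (ac C (At q)) (s q)"
  shows "htp_scalar (ac C (hess i)) (\<Sum>q<m. cf i q * s q)"
  unfolding hess_def[abs_def]
  by (rule conjunct2[OF htp_linear_finsum, rule_format, OF _ _ _ C]) (simp_all add: At cf_mem i s)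

lemma dagger_htp_linear: "i < m \<Longrightarrow> htp_linear (dagger i)"
  unfolding dagger_def[abs_def] by (intro htp_linear_add htp_linear_smult L m1 hess_htp_linear)

lemma htp_scalar_dagger:
  assumes i: "i < m" and C: "htp_linear C" and p: "htp_scalar (ac C (L i)) p" "p \<in> carrier R" and q: "htp_scalar (ac C (hess i)) q" "q \<in> carrier R"
  shows "htp_scalar (ac C (dagger i)) (- p + q)"
proof -
  have "htp_scalar (ac C (dagger i)) ((- 1) * p + q)" unfolding dagger_def[abs_def]
    by (rule htp_scalar_ac_add[OF C htp_linear_smult[OF L[OF i] m1] htp_scalar_ac_smult[OF C L[OF i] p m1] hess_htp_linear[OF i] q(1) mpoly_mult[OF Ry_R[OF m1] p(2)] q(2)])
  then show ?thesis by simp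
qed

lemma At_hess: "i < m \<Longrightarrow> j < m \<Longrightarrow> htp_scalar (ac (At i) (hess j)) 0"
  using htp_scalar_hess[of j "At i" "\<lambda>_. 0"] At AA by simp

text \<open>The whole of \<delta>_ij comes from the summand - L_j, whose sign turns -\<delta>_ij
  around; the Hessian summand consists of Atiyah classes and contributes nothing.\<close>

lemma At_dagger: assumes "i < m" "j < m" shows "htp_scalar (ac (At i) (dagger j)) (if i = j then 1 else 0)"
proof -
  have "htp_scalar (ac (At i) (dagger j)) (- (if i = j then - 1 else 0) + 0)"
    by (rule htp_scalar_dagger[OF assms(2) At[OF assms(1)] AL[OF assms] _ At_hess[OF assms]]) auto
  then show ?thesis by (cases "i = j") simp_all
qed

text \<open>Only the summand q = i survives, where -(1/2) H_ji meets the value -1 of the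
  anticommutator.\<close>

lemma L_hess: assumes i: "i < m" and j: "j < m" shows "htp_scalar (ac (L i) (hess j)) (cpoly hf * Hs i j)"
proof -
  have "htp_scalar (ac (L i) (hess j)) (\<Sum>q<m. cf j q * (if q = i then - 1 else 0))"
  proof (rule htp_scalar_hess[OF j L[OF i]], rule conjI)
    fix q assume q: "q < m"
    show "htp_scalar (ac (L i) (At q)) (if q = i then - 1 else 0)" by (rule htp_scalar_ac_sym[OF At[OF q] L[OF i] AL[OF q i]])
  qed auto
  also have "(\<Sum>q<m. cf j q * (if q = i then - 1 else 0)) = (\<Sum>q<m. if q = i then - cf j q else 0)"
    by (rule sum.cong) auto
  also have "\<dots> = - cf j i" using i by simp
  also have "\<dots> = cpoly hf * Hs i j" by (simp add: cf_def Hs_sym[of i j])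
  finally show ?thesis .
qed

lemma hess_hess: assumes i: "i < m" and j: "j < m" shows "htp_scalar (ac (hess i) (hess j)) 0"
  using htp_scalar_hess[of j "hess i" "\<lambda>_. 0"] htp_scalar_ac_sym[OF At hess_htp_linear At_hess] i j hess_htp_linear by simp

text \<open>The summands contribute H_ij from the two derivatives, -(1/2) H_ij from each mixed pair,
  by symmetry of the Hessian, and nothing from the two Hessian terms.\<close>

lemma dagger_dagger: assumes i: "i < m" and j: "j < m" shows "htp_scalar (ac (dagger i) (dagger j)) 0"
proof -
  note R = Ry_R[OF Hs[OF i j]] and hR = mpoly_mult[OF cpoly_mem Ry_R[OF Hs[OF i j]]]
  have "htp_scalar (ac (L j) (dagger i)) (- Hs j i + cpoly hf * Hs j i)"
    by (rule htp_scalar_dagger[OF i L[OF j] LL[OF j i] _ L_hess[OF j i]]) (use R hR in \<open>simp_all add: Hs_sym[of j i]\<close>)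
  then have 1: "htp_scalar (ac (dagger i) (L j)) (- Hs j i + cpoly hf * Hs j i)" by (rule htp_scalar_ac_sym[OF L[OF j] dagger_htp_linear[OF i]])
  have "htp_scalar (ac (hess j) (dagger i)) (- (cpoly hf * Hs i j) + 0)"
    by (rule htp_scalar_dagger[OF i hess_htp_linear[OF j] htp_scalar_ac_sym[OF L[OF i] hess_htp_linear[OF j] L_hess[OF i j]] hR hess_hess[OF j i]]) simp
  then have 2: "htp_scalar (ac (dagger i) (hess j)) (- (cpoly hf * Hs i j) + 0)" by (rule htp_scalar_ac_sym[OF hess_htp_linear[OF j] dagger_htp_linear[OF i]])
  have "htp_scalar (ac (dagger i) (dagger j)) (- (- Hs j i + cpoly hf * Hs j i) + (- (cpoly hf * Hs i j) + 0))"
    by (rule htp_scalar_dagger[OF j dagger_htp_linear[OF i] 1 _ 2]) (use R hR in \<open>auto simp: Hs_sym[of j i]\<close>)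
  moreover have "- (- Hs j i + cpoly hf * Hs j i) + (- (cpoly hf * Hs i j) + 0) = Hs i j - (cpoly hf + cpoly hf) * Hs i j"
    by (simp add: Hs_sym[of j i] algebra_simps)
  ultimately show ?thesis by (simp add: hf_hf)
qed

lemma dagger_eq:
  assumes i: "i < m" and v: "v \<in> carrier M"
  shows "dagger i v = \<ominus>\<^bsub>M\<^esub> L i v \<ominus>\<^bsub>M\<^esub> cpoly hf \<odot>\<^bsub>M\<^esub> (\<Oplus>\<^bsub>M\<^esub>q\<in>{..<m}. Hs i q \<odot>\<^bsub>M\<^esub> At q v)"
proof -
  have T: "Hs i q \<odot>\<^bsub>M\<^esub> At q v \<in> carrier M" if "q < m" for q
    by (rule smult_closed[OF Ry_R[OF Hs[OF i that]] htp_linear_closed[OF At[OF that] v]])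
  have h: "- cpoly hf \<in> carrier R" by (intro mpoly_uminus cpoly_mem)
  let ?s = "\<Oplus>\<^bsub>M\<^esub>q\<in>{..<m}. Hs i q \<odot>\<^bsub>M\<^esub> At q v"
  have s: "?s \<in> carrier M" using T by (intro M.finsum_closed) auto
  have "hess i v = (\<Oplus>\<^bsub>M\<^esub>q\<in>{..<m}. (- cpoly hf) \<odot>\<^bsub>M\<^esub> (Hs i q \<odot>\<^bsub>M\<^esub> At q v))"
    unfolding hess_def
  proof (rule M.finsum_cong')
    fix q assume "q \<in> {..<m}"
    then have q: "q < m" by simp
    show "cf i q \<odot>\<^bsub>M\<^esub> At q v = (- cpoly hf) \<odot>\<^bsub>M\<^esub> (Hs i q \<odot>\<^bsub>M\<^esub> At q v)"
      unfolding cf_def by (rule smult_assoc[OF h Ry_R[OF Hs[OF i q]] htp_linear_closed[OF At[OF q] v]])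
  qed (use smult_closed[OF h T] in auto)
  also have "\<dots> = (- cpoly hf) \<odot>\<^bsub>M\<^esub> ?s"
    using T by (intro addhom_finsum[OF smult_addhom[OF h] M_ab M_ab, symmetric]) auto
  also have "\<dots> = (- 1 * cpoly hf) \<odot>\<^bsub>M\<^esub> ?s" by simp
  also have "\<dots> = (- 1) \<odot>\<^bsub>M\<^esub> (cpoly hf \<odot>\<^bsub>M\<^esub> ?s)" by (rule smult_assoc[OF Ry_R[OF m1] cpoly_mem s])
  also have "\<dots> = \<ominus>\<^bsub>M\<^esub> (cpoly hf \<odot>\<^bsub>M\<^esub> ?s)" by (rule smult_minus1[OF smult_closed[OF cpoly_mem s]])
  finally show ?thesis unfolding dagger_def smult_minus1[OF htp_linear_closed[OF L[OF i] v]] by (simp add: a_minus_def)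
qed

end

end

section \<open>Atiyah classes\<close>

locale cut_potential =
  cut_pair n m l YY XX "JV m V" "ky_hat m V" U V W hf A e B f "\<lambda>h. h (Suc 0)" "\<lambda>i. pd (Yv i) V" +
  PS: pot_section m V \<sigma>
  for n m l and YY :: "(('k::comm_ring_1) pol, 'y) mf" and XX :: "('k pol, 'x) mf" and U V W hf
    and A :: "'a set" and e and B :: "'b set" and f and \<sigma>
begin

lemma pt_hom: "i < m \<Longrightarrow> partial_t m V \<sigma> i \<in> addhom (ky_hat m V) (ky_hat m V)"
  by (rule PS.partial_t_hom)
lemma pt_const: "i < m \<Longrightarrow> s \<in> carrier (ky_hat m V) \<Longrightarrow>
    partial_t m V \<sigma> i (cpoly c \<odot>\<^bsub>ky_hat m V\<^esub> s) = cpoly c \<odot>\<^bsub>ky_hat m V\<^esub> partial_t m V \<sigma> i s"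
  by (rule PS.partial_t_const)
lemma pt_leibniz: "i < m \<Longrightarrow> j < m \<Longrightarrow> s \<in> carrier (ky_hat m V) \<Longrightarrow>
    partial_t m V \<sigma> i (pd (Yv j) V \<odot>\<^bsub>ky_hat m V\<^esub> s) =
    pd (Yv j) V \<odot>\<^bsub>ky_hat m V\<^esub> partial_t m V \<sigma> i s \<oplus>\<^bsub>ky_hat m V\<^esub> (if i = j then s else \<zero>\<^bsub>ky_hat m V\<^esub>)"
  using PS.partial_t_leibniz unfolding PS.t_def by simp

lemma pt: "connection (partial_t m V \<sigma>)"
  unfolding connection_def using pt_hom pt_const pt_leibniz by simp

abbreviation "nabla0 i \<equiv> H.middleext (partial_t m V \<sigma> i)"
abbreviation "At0 i \<equiv> commutator H.d (nabla0 i)"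
abbreviation "At1 i \<equiv> descend (At0 i)"

lemma At0_tlin: "i < m \<Longrightarrow> tlin (At0 i)" by (rule ath_tlin[OF pt])

text \<open>A k[x,z]-linear operator is determined by its values on basis tensors, so the
  description of \<open>nabla\<close> names the coefficientwise extension, restricted to the
  carrier.\<close>

lemma nabla_eq:
  assumes i: "i < m" shows "nabla n m l V \<sigma> YY A e XX B f i = restrict (nabla0 i) (carrier H.M)"
  unfolding nabla_def Let_def mf_cut_hat_def
proof (rule the_equality)
  show "restrict (nabla0 i) (carrier H.M) \<in> extensional (carrier H.M) \<and>
    is_linear J.Rxz H.M H.M (restrict (nabla0 i) (carrier H.M)) \<and>
    (\<forall>a\<in>A. \<forall>h\<in>carrier (ky_hat m V). \<forall>b\<in>B. restrict (nabla0 i) (carrier H.M) (H.\<tau> (e a) h (f b)) = H.\<tau> (e a) (partial_t m V \<sigma> i h) (f b))"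
  proof (intro conjI ballI)
    show "is_linear J.Rxz H.M H.M (restrict (nabla0 i) (carrier H.M))"
      proof (rule is_linear_cong[OF nab_linear[OF pt i] _ H_Rxz])
      fix v assume "v \<in> carrier H.M"
      then show "restrict (nabla0 i) (carrier H.M) v = nabla0 i v" by (rule restrict_apply')
    qed
    fix a h b assume c: "a \<in> A" "h \<in> carrier (ky_hat m V)" "b \<in> B"
    show "restrict (nabla0 i) (carrier H.M) (H.\<tau> (e a) h (f b)) = H.\<tau> (e a) (partial_t m V \<sigma> i h) (f b)"
      using H.middleext_pure[OF pt_hom[OF i] pt_const[OF i] c] H.\<tau>M[OF J.ec[OF c(1)] c(2) J.fc[OF c(3)]] by simp
  qed simp
next
  fix D assume D: "D \<in> extensional (carrier H.M) \<and> is_linear J.Rxz H.M H.M D \<and>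
    (\<forall>a\<in>A. \<forall>h\<in>carrier (ky_hat m V). \<forall>b\<in>B. D (H.\<tau> (e a) h (f b)) = H.\<tau> (e a) (partial_t m V \<sigma> i h) (f b))"
  show "D = restrict (nabla0 i) (carrier H.M)"
  proof (rule extensionalityI[OF conjunct1[OF D] restrict_extensional])
    fix v assume v: "v \<in> carrier H.M"
    show "D v = restrict (nabla0 i) (carrier H.M) v"
      using H.middleext_unique[OF pt_hom[OF i] pt_const[OF i], of D v] D v by simp
  qed
qed

lemma mod_t_eq: "mod_t m V YY XX = reduce"
  by (simp add: mod_t_def reduce_def Let_def)

lemma gcomm_nabla:
  assumes i: "i < m" and v: "v \<in> carrier H.M"
  shows "gcomm H.M 1 0 H.d (nabla n m l V \<sigma> YY A e XX B f i) v = At0 i v"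
  unfolding gcomm_def nabla_eq[OF i] using v H.d_closed[OF v] by (simp add: commutator_def)

text \<open>Reduction is surjective, so at most one operator is compatible with it; one exists
  because the commutator of d with the connection commutes with the t_j.\<close>

lemma atiyah_eq: assumes i: "i < m" shows "atiyah n m l V \<sigma> YY A e XX B f i = At1 i"
  unfolding atiyah_def Let_def mf_cut_hat_def mf_cut_def mod_t_eq
proof (rule the_equality)
  show "At1 i \<in> extensional (carrier J.M) \<and>
    (\<forall>v\<in>carrier H.M. At1 i (reduce v) = reduce (gcomm H.M 1 0 H.d (nabla n m l V \<sigma> YY A e XX B f i) v))"
    using descend_reduce[OF At0_tlin[OF i]] by (simp add: gcomm_nabla[OF i]) (simp add: descend_def)
next
  fix g assume g: "g \<in> extensional (carrier J.M) \<and>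
    (\<forall>v\<in>carrier H.M. g (reduce v) = reduce (gcomm H.M 1 0 H.d (nabla n m l V \<sigma> YY A e XX B f i) v))"
  show "g = At1 i"
    by (rule descend_unique[OF At0_tlin[OF i]]) (use g in \<open>simp_all add: gcomm_nabla[OF i]\<close>)
qed

lemma descend_parity_op:
  assumes F: "tlin F" and p: "\<And>v. v \<in> carrier H.M \<Longrightarrow> H.eps (F v) = psgn H.M p (F (H.eps v))"
  shows "J.parity_op p (descend F)"
proof (rule J.parity_opI[OF descend_linear[OF F]])
  fix v assume v: "v \<in> carrier J.M"
  show "J.eps (descend F v) = J.sg p \<odot>\<^bsub>J.M\<^esub> descend F (J.eps v)"
    using descend_eps[OF F p v] J.psgn_sg[OF is_linear_closed[OF descend_linear[OF F] J.eps_closed[OF v]]] by (rule trans)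
qed

lemma J_neg:
  assumes "x \<in> carrier J.M" "y \<in> carrier J.M" "x \<oplus>\<^bsub>J.M\<^esub> y = \<zero>\<^bsub>J.M\<^esub>" shows "x = J.sg 1 \<odot>\<^bsub>J.M\<^esub> y"
  using J.M.minus_equality[of x y] assms by (simp add: J.sg_def J.smult_minus1)

lemma At1_closed_op: assumes i: "i < m" shows "J.closed_op 1 (At1 i)"
proof (rule J.closed_opI[OF descend_parity_op[OF At0_tlin[OF i], OF ath_eps[OF pt i]]])
  fix v assume v: "v \<in> carrier J.M"
  note l = is_linear_closed[OF descend_linear[OF At0_tlin[OF i]]]
  show "J.d (At1 i v) = J.sg 1 \<odot>\<^bsub>J.M\<^esub> At1 i (J.d v)"
    using descend_anticommutator[OF At0_tlin[OF i], OF d_ath[OF pt i] mpoly_0 v] J.smult_0[OF v]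
    by (intro J_neg J.d_closed l v) simp
qed

lemma smult_tlin: "g \<in> carrier J.Ry \<Longrightarrow> tlin (\<lambda>v. g \<odot>\<^bsub>H.M\<^esub> v)"
  by (rule R_tlin[OF is_linear_smult_map[OF H.M_module cring_mpoly J.Ry_R]])

lemma descend_smult:
  assumes g: "g \<in> carrier J.Ry" and v: "v \<in> carrier J.M" shows "descend (\<lambda>v. g \<odot>\<^bsub>H.M\<^esub> v) v = g \<odot>\<^bsub>J.M\<^esub> v"
proof -
  obtain u where u: "u \<in> carrier H.M" "reduce u = v" using reduce_surj[OF v] by (elim bexE)
  show ?thesis unfolding u(2)[symmetric] descend_reduce[OF smult_tlin[OF g] u(1)] by (rule reduce_smult[OF J.Ry_R[OF g] u(1)])
qed

text \<open>The homotopy is the commutator of the connection with multiplication by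
  \<open>g\<close>. It need not vanish, because differentiation in t acts on k[y], but it commutes
  with the t_j and therefore descends.\<close>

lemma At1_htp_linear: assumes i: "i < m" shows "J.htp_linear (At1 i)"
proof (rule J.htp_linearI[OF At1_closed_op[OF i]])
  fix g assume g: "g \<in> carrier J.Ry"
  let ?Q = "\<lambda>v. g \<odot>\<^bsub>H.M\<^esub> v"
  note gR = J.Ry_R[OF g]
  have Qd: "H.d (?Q v) = ?Q (H.d v)" if "v \<in> carrier H.M" for v by (rule is_linear_smult[OF H.d_linear gR that])
  have Qe: "H.eps (?Q v) = psgn H.M 0 (?Q (H.eps v))" if "v \<in> carrier H.M" for v
    using is_linear_smult[OF H.eps_linear gR that] by (simp add: psgn_def)
  let ?h = "descend (commutator (nabla0 i) ?Q)"
  have h: "J.parity_op 0 ?h" by (rule descend_parity_op[OF nb_tlin[OF pt i smult_tlin[OF g]], OF nb_parity[OF pt i smult_tlin[OF g], OF Qe]])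
  show "J.nullhtp 1 (\<lambda>v. At1 i (g \<odot>\<^bsub>J.M\<^esub> v) \<ominus>\<^bsub>J.M\<^esub> g \<odot>\<^bsub>J.M\<^esub> At1 i v)"
  proof (rule J.nullhtpI[of _ ?h])
    show "J.parity_op (1 + 1) ?h" using h by simp
    fix v assume v: "v \<in> carrier J.M"
    note At = J.parity_op_closed[OF J.closed_op_parity_op[OF At1_closed_op[OF i]]]
    have "J.d (?h v) \<ominus>\<^bsub>J.M\<^esub> ?h (J.d v) = At1 i (descend ?Q v) \<ominus>\<^bsub>J.M\<^esub> descend ?Q (At1 i v)"
      by (rule descend_homotopy_even[OF pt i smult_tlin[OF g], OF Qd v])
    then have "At1 i (g \<odot>\<^bsub>J.M\<^esub> v) \<ominus>\<^bsub>J.M\<^esub> g \<odot>\<^bsub>J.M\<^esub> At1 i v = J.d (?h v) \<ominus>\<^bsub>J.M\<^esub> ?h (J.d v)"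
      unfolding descend_smult[OF g v] descend_smult[OF g At[OF v]] by (rule sym)
    then show "At1 i (g \<odot>\<^bsub>J.M\<^esub> v) \<ominus>\<^bsub>J.M\<^esub> g \<odot>\<^bsub>J.M\<^esub> At1 i v = J.d (?h v) \<oplus>\<^bsub>J.M\<^esub> J.sg 1 \<odot>\<^bsub>J.M\<^esub> ?h (J.d v)"
      using J.parity_op_closed[OF h J.d_closed[OF v]] by (simp add: J.sg_def J.smult_minus1 a_minus_def)
  qed
qed

text \<open>Common source of the relations for At_i with At_j and with the derivatives of the
  differential: the homotopy [\<nabla>_i, Q] shows that the anticommutator of At_i and Q is
  -[\<nabla>_i, p] up to homotopy, where p is [d, Q] before reduction.\<close>

lemma descend_htp_scalar:
  assumes i: "i < m" and Q: "tlin Q" and Qe: "\<And>v. v \<in> carrier H.M \<Longrightarrow> H.eps (Q v) = psgn H.M 1 (Q (H.eps v))"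
    and p: "p \<in> carrier J.R"
    and Qp: "\<And>v. v \<in> carrier H.M \<Longrightarrow> H.d (Q v) \<oplus>\<^bsub>H.M\<^esub> Q (H.d v) = p \<odot>\<^bsub>H.M\<^esub> v"
    and pi: "\<And>v. v \<in> carrier H.M \<Longrightarrow> nabla0 i (p \<odot>\<^bsub>H.M\<^esub> v) = p \<odot>\<^bsub>H.M\<^esub> nabla0 i v \<oplus>\<^bsub>H.M\<^esub> (if b then v else \<zero>\<^bsub>H.M\<^esub>)"
  shows "J.htp_scalar (J.ac (At1 i) (descend Q)) (if b then - 1 else 0)"
  unfolding J.htp_scalar_def
proof (rule J.nullhtpI[of _ "descend (commutator (nabla0 i) Q)"])
  have h: "J.parity_op 1 (descend (commutator (nabla0 i) Q))" by (rule descend_parity_op[OF nb_tlin[OF pt i Q], OF nb_parity[OF pt i Q, OF Qe]])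
  then show "J.parity_op (0 + 1) (descend (commutator (nabla0 i) Q))" by simp
  fix v assume v: "v \<in> carrier J.M"
  have c: "J.ac (At1 i) (descend Q) v \<in> carrier J.M"
    using is_linear_closed[OF descend_linear[OF At0_tlin[OF i]]] is_linear_closed[OF descend_linear[OF Q]] v by simp
  have "J.d (descend (commutator (nabla0 i) Q) v) \<oplus>\<^bsub>J.M\<^esub> descend (commutator (nabla0 i) Q) (J.d v)
     = J.ac (At1 i) (descend Q) v \<oplus>\<^bsub>J.M\<^esub> (if b then v else \<zero>\<^bsub>J.M\<^esub>)"
    by (rule descend_homotopy_odd[where p = p, OF pt i Q p Qp pi v])
  then have "J.d (descend (commutator (nabla0 i) Q) v) \<oplus>\<^bsub>J.M\<^esub> J.sg 0 \<odot>\<^bsub>J.M\<^esub> descend (commutator (nabla0 i) Q) (J.d v)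
     = J.ac (At1 i) (descend Q) v \<oplus>\<^bsub>J.M\<^esub> (if b then v else \<zero>\<^bsub>J.M\<^esub>)"
    using J.smult_1[OF J.parity_op_closed[OF h J.d_closed[OF v]]] by (simp add: J.sg_def)
  also have "\<dots> = J.ac (At1 i) (descend Q) v \<ominus>\<^bsub>J.M\<^esub> (if b then - 1 else 0) \<odot>\<^bsub>J.M\<^esub> v"
    using c v by (cases b) (simp_all add: a_minus_def J.smult_minus1 J.smult_0 J.M_neg_zero)
  finally show "J.ac (At1 i) (descend Q) v \<ominus>\<^bsub>J.M\<^esub> (if b then - 1 else 0) \<odot>\<^bsub>J.M\<^esub> v
     = J.d (descend (commutator (nabla0 i) Q) v) \<oplus>\<^bsub>J.M\<^esub> J.sg 0 \<odot>\<^bsub>J.M\<^esub> descend (commutator (nabla0 i) Q) (J.d v)" by (rule sym)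
qed

text \<open>Here \<open>Q\<close> is the commutator of d with the connection before reduction, which
  anticommutes with d already there, so p = 0 and no constant is left.\<close>

lemma At1_At1: assumes i: "i < m" and j: "j < m" shows "J.htp_scalar (J.ac (At1 i) (At1 j)) 0"
proof -
  have "J.htp_scalar (J.ac (At1 i) (At1 j)) (if False then - 1 else 0)"
  proof (rule descend_htp_scalar[OF i At0_tlin[OF j], OF ath_eps[OF pt j] mpoly_0 d_ath[OF pt j]])
    fix v assume v: "v \<in> carrier H.M"
    note nv = nab_closed[OF pt i v]
    show "nabla0 i (0 \<odot>\<^bsub>H.M\<^esub> v) = 0 \<odot>\<^bsub>H.M\<^esub> nabla0 i v \<oplus>\<^bsub>H.M\<^esub> (if False then v else \<zero>\<^bsub>H.M\<^esub>)"
      unfolding H.smult_0[OF v] H.smult_0[OF nv] addhom_zero[OF nab_hom[OF pt i] H.M_ab H.M_ab] by simp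
  qed
  then show ?thesis by simp
qed

subsection \<open>Derivatives of the differential\<close>

abbreviation "dd i \<equiv> entrywise_pd (Yv i) J.Rxy XX B f (dmap XX)"
abbreviation "dd2 i j \<equiv> entrywise_pd (Yv i) J.Rxy XX B f (dd j)"

lemma VW: "V - W \<in> carrier J.Rxy"
  by (rule mpoly_diff[OF J.UVW(3,4)])

lemma pd_VW: "pd (Yv i) (V - W) = pd (Yv i) V"
  using pd_const[OF J.W, of "Yv i"] by (simp add: image_iff)

lemma dd_linear: "is_linear J.Rxy XX XX (dd i)"
  by (rule entrywise_pd_linear[OF J.gX J.fb J.dX])

lemma dd_odd: "J.oddX (dd i)" and dd2_odd: "J.oddX (dd2 i j)"
proof -
  have 1: "parity_inv XX (dd i x) = \<ominus>\<^bsub>XX\<^esub> dd i (parity_inv XX x)" if "x \<in> carrier XX" for i x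
    by (rule entrywise_pd_odd[OF J.gX J.fb J.dX J.PXdX that])
  show "J.oddX (dd i)" unfolding J.oddX_def by (intro conjI ballI dd_linear 1)
  show "J.oddX (dd2 i j)" unfolding J.oddX_def
    by (intro conjI ballI entrywise_pd_linear[OF J.gX J.fb dd_linear] entrywise_pd_odd[OF J.gX J.fb dd_linear 1])
qed

text \<open>Of the two polynomials in V - W only V involves y, so the derivative of the square of
  the differential is that of V.\<close>

lemma d_dd: assumes "x \<in> carrier XX" shows "dmap XX (dd i x) \<oplus>\<^bsub>XX\<^esub> dd i (dmap XX x) = pd (Yv i) V \<odot>\<^bsub>XX\<^esub> x"
  using entrywise_pd_square[OF J.gX J.fb J.dX VW J.dXdX assms, of "Yv i"] by (simp only: pd_VW)

lemma V_Rxy: "pd (Yv i) V \<in> carrier J.Rxy"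
  by (intro pd_mem J.UVW)

lemma dd_dd:
  assumes "x \<in> carrier XX"
  shows "(dmap XX (dd2 i j x) \<oplus>\<^bsub>XX\<^esub> dd2 i j (dmap XX x)) \<oplus>\<^bsub>XX\<^esub> (dd i (dd j x) \<oplus>\<^bsub>XX\<^esub> dd j (dd i x)) = pd (Yv i) (pd (Yv j) V) \<odot>\<^bsub>XX\<^esub> x"
  by (rule entrywise_pd_anticommutator[OF J.gX J.fb J.dX dd_linear V_Rxy d_dd assms])

lemma partial_dX_eq: "partial_dX n m V YY XX B f i = J.lam (dd i)"
  by (simp add: partial_dX_def J.tmap_def Let_def)

lemma lam_parity_op: assumes h: "J.oddX h" shows "J.parity_op 1 (J.lam h)"
proof (rule J.parity_opI)
  show "is_linear J.Rxz J.M J.M (J.lam h)" by (rule is_linear_mpoly_mono[OF J.lam_linear[OF h]]) auto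
  fix v assume v: "v \<in> carrier J.M"
  show "J.eps (J.lam h v) = J.sg 1 \<odot>\<^bsub>J.M\<^esub> J.lam h (J.eps v)"
    unfolding J.lam_eps[OF h v] by (rule J.psgn_sg[OF J.lam_closed[OF h J.eps_closed[OF v]]])
qed

text \<open>The operator becomes closed only after reduction: its anticommutator with d is
  multiplication by t_i, which acts as zero over the Jacobi ring.\<close>

lemma lam_htp_linear: assumes i: "i < m" shows "J.htp_linear (J.lam (dd i))"
proof (rule J.htp_linear_commuting[OF J.closed_opI[OF lam_parity_op[OF dd_odd]]])
  fix v assume v: "v \<in> carrier J.M"
  note c = J.lam_closed[OF dd_odd]
  show "J.d (J.lam (dd i) v) = J.sg 1 \<odot>\<^bsub>J.M\<^esub> J.lam (dd i) (J.d v)"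
    using J.d_lam[OF dd_odd V_Rxy d_dd v, of i] J_t_zero[OF i v] by (intro J_neg J.d_closed c v) simp
  show "J.lam (dd i) (g \<odot>\<^bsub>J.M\<^esub> v) = g \<odot>\<^bsub>J.M\<^esub> J.lam (dd i) v" if "g \<in> carrier J.Ry" for g
    by (rule is_linear_smult[OF J.lam_linear[OF dd_odd] J.Ry_R[OF that] v])
qed

lemma descend_lam:
  assumes h: "J.oddX h" and v: "v \<in> carrier J.M" shows "descend (H.lam h) v = J.lam h v"
proof -
  have hH: "H.oddX h" using h by (simp add: J.oddX_def H.oddX_def)
  obtain u where u: "u \<in> carrier H.M" "reduce u = v" using reduce_surj[OF v] by (elim bexE)
  show ?thesis unfolding u(2)[symmetric] descend_reduce[OF R_tlin[OF H.lam_linear[OF hH]] u(1)]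
    by (rule reduce_tmap[OF J.PYl J.hl[OF h] u(1)])
qed

text \<open>Before reduction the anticommutator of d with the derivative is t_j. Although t_j
  vanishes in the Jacobi ring, its commutator with the connection does not, and this is where
  \<delta>_ij comes from.\<close>

lemma At1_lam: assumes i: "i < m" and j: "j < m" shows "J.htp_scalar (J.ac (At1 i) (J.lam (dd j))) (if i = j then - 1 else 0)"
proof -
  have hH: "H.oddX (dd j)" using dd_odd[of j] by (simp add: J.oddX_def H.oddX_def)
  have "J.htp_scalar (J.ac (At1 i) (descend (H.lam (dd j)))) (if i = j then - 1 else 0)"
  proof (rule descend_htp_scalar[where p = "pd (Yv j) V", OF i R_tlin[OF H.lam_linear[OF hH]]])
    fix v assume v: "v \<in> carrier H.M"
    show "H.eps (H.lam (dd j) v) = psgn H.M 1 (H.lam (dd j) (H.eps v))" by (rule H.lam_eps[OF hH v])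
    show "H.d (H.lam (dd j) v) \<oplus>\<^bsub>H.M\<^esub> H.lam (dd j) (H.d v) = pd (Yv j) V \<odot>\<^bsub>H.M\<^esub> v"
      by (rule H.d_lam[OF hH V_Rxy d_dd v])
    show "nabla0 i (pd (Yv j) V \<odot>\<^bsub>H.M\<^esub> v) = pd (Yv j) V \<odot>\<^bsub>H.M\<^esub> nabla0 i v \<oplus>\<^bsub>H.M\<^esub> (if i = j then v else \<zero>\<^bsub>H.M\<^esub>)"
      by (rule nab_t[OF pt i j v])
  qed (rule J.Rxy_R[OF V_Rxy])
  then show ?thesis
  proof (rule J.htp_scalar_cong)
    fix v assume v: "v \<in> carrier J.M"
    show "J.ac (At1 i) (J.lam (dd j)) v = J.ac (At1 i) (descend (H.lam (dd j))) v"
      unfolding descend_lam[OF dd_odd v] descend_lam[OF dd_odd J.htp_linear_closed[OF At1_htp_linear[OF i] v]] ..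
  qed
qed

lemma lam_lam_htp_scalar: "J.htp_scalar (J.ac (J.lam (dd i)) (J.lam (dd j))) (pd (Yv i) (pd (Yv j) V))"
proof -
  let ?p = "pd (Yv i) (pd (Yv j) V)"
  have p: "?p \<in> carrier J.Rxy" by (intro pd_mem V_Rxy)
  have o: "J.parity_op 1 (J.lam (dd2 i j))" by (rule lam_parity_op[OF dd2_odd])
  note c = J.parity_op_closed[OF o]
  have "J.nullhtp 0 (\<lambda>v. J.d (J.lam (dd2 i j) v) \<oplus>\<^bsub>J.M\<^esub> J.lam (dd2 i j) (J.d v))"
  proof (rule J.nullhtpI[of _ "J.lam (dd2 i j)"])
    show "J.parity_op (0 + 1) (J.lam (dd2 i j))" using o by simp
    show "J.d (J.lam (dd2 i j) v) \<oplus>\<^bsub>J.M\<^esub> J.lam (dd2 i j) (J.d v) =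
      J.d (J.lam (dd2 i j) v) \<oplus>\<^bsub>J.M\<^esub> J.sg 0 \<odot>\<^bsub>J.M\<^esub> J.lam (dd2 i j) (J.d v)" if "v \<in> carrier J.M" for v
      using J.smult_1[OF c[OF J.d_closed[OF that]]] by (simp add: J.sg_def)
  qed
  \<comment> \<open>The second derivative enters with the opposite sign, since its anticommutator
    with d is moved to the other side of the twice differentiated equation.\<close>
  from J.nullhtp_smult[OF this, of "- 1"]
  have *: "J.nullhtp 0 (\<lambda>v. (- 1) \<odot>\<^bsub>J.M\<^esub> (J.d (J.lam (dd2 i j) v) \<oplus>\<^bsub>J.M\<^esub> J.lam (dd2 i j) (J.d v)))" by simp
  show ?thesis unfolding J.htp_scalar_def
  proof (rule J.nullhtp_cong[OF *])
    fix v assume v: "v \<in> carrier J.M"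
    let ?x = "J.d (J.lam (dd2 i j) v) \<oplus>\<^bsub>J.M\<^esub> J.lam (dd2 i j) (J.d v)" and ?y = "J.ac (J.lam (dd i)) (J.lam (dd j)) v"
    have x: "?x \<in> carrier J.M" by (intro J.M.a_closed J.d_closed c v)
    have y: "?y \<in> carrier J.M" by (intro J.M.a_closed J.lam_closed[OF dd_odd] v)
    have "?x \<oplus>\<^bsub>J.M\<^esub> ?y = ?p \<odot>\<^bsub>J.M\<^esub> v" by (rule J.lam_lam[OF dd_odd dd_odd dd2_odd p dd_dd v])
    moreover have "a \<ominus>\<^bsub>J.M\<^esub> (b \<oplus>\<^bsub>J.M\<^esub> a) = \<ominus>\<^bsub>J.M\<^esub> b" if "a \<in> carrier J.M" "b \<in> carrier J.M" for a b
      using that by algebra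
    ultimately show "?y \<ominus>\<^bsub>J.M\<^esub> ?p \<odot>\<^bsub>J.M\<^esub> v = (- 1) \<odot>\<^bsub>J.M\<^esub> ?x"
      using x y J.smult_minus1[OF x] by metis
  qed
qed

subsection \<open>The representation\<close>

abbreviation "hs i q \<equiv> pd (Yv q) (pd (Yv i) V)"
abbreviation "dg i \<equiv> J.dagger At1 (\<lambda>i. J.lam (dd i)) hs i"

lemma lam_lam_htp_scalar': "J.htp_scalar (J.ac (J.lam (dd i)) (J.lam (dd j))) (hs i j)"
  using lam_lam_htp_scalar[of i j] by (simp only: pd_commute)

lemma hs_mem: "hs i q \<in> carrier J.Ry"
  by (intro pd_mem J.V)

text \<open>The hypotheses of the formal Clifford computation, in the order in which it takes
  them.\<close>

lemmas clifford = At1_htp_linear lam_htp_linear At1_At1 At1_lam lam_lam_htp_scalar' hs_mem pd_commute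

lemma gamma_dag_eq:
  assumes i: "i < m" and v: "v \<in> carrier J.M" and hf: "\<phi> (1 / 2) = hf"
  shows "gamma_dag \<phi> n m l V \<sigma> YY A e XX B f i v = dg i v"
proof -
  have "(\<Oplus>\<^bsub>J.M\<^esub>q\<in>{..<m}. hs i q \<odot>\<^bsub>J.M\<^esub> atiyah n m l V \<sigma> YY A e XX B f q v) = (\<Oplus>\<^bsub>J.M\<^esub>q\<in>{..<m}. hs i q \<odot>\<^bsub>J.M\<^esub> At1 q v)"
    using J.smult_closed[OF J.Ry_R[OF hs_mem] J.htp_linear_closed[OF At1_htp_linear v]]
    by (intro J.M.finsum_cong') (auto simp: atiyah_eq)
  then show ?thesis
    unfolding gamma_dag_def Let_def mf_cut_def hf partial_dX_eq
    by (simp only: J.dagger_eq[OF clifford i v])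
qed

end

section \<open>Finite rank and the representation on the cut\<close>

context cut_basis
begin

lemma M_finite_rank:
  assumes jb: "finite_basis (mpoly_ring {}) S J g" shows "finite_rank_mf Rxz (U - W) M"
  unfolding finite_rank_mf_def
proof (intro conjI ballI exI)
  show "U - W \<in> carrier Rxz"
    by (rule mpoly_diff[OF mpoly_mono[OF _ U] mpoly_mono[OF _ W]]) auto
  show "graded_module Rxz M" by (rule M_graded) auto
  let ?I = "A \<times> B \<times> J" and ?g = "\<lambda>(a, b, j). \<tau> (e a) (g j) (f b)"
  have S0: "module (mpoly_ring {}) S" by (rule module_mpoly_mono[OF Sm]) simp
  show "homogeneous_basis Rxz M (?g ` ?I) (\<lambda>b. b)" unfolding homogeneous_basis_def
  proof (intro conjI ballI)
    show "finite_basis Rxz M (?g ` ?I) (\<lambda>b. b)" by (rule finite_basis_image[OF M_Rxz M_finite_basis[OF jb]])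
    fix v assume "v \<in> ?g ` ?I"
    then obtain a b j where v: "a \<in> A" "b \<in> B" "j \<in> J" "v = \<tau> (e a) (g j) (f b)" by auto
    have "\<forall>a\<in>A. \<exists>q. e a \<in> homog YY q" "\<forall>b\<in>B. \<exists>r. f b \<in> homog XX r"
      using eb fb by (simp_all add: homogeneous_basis_def)
    from bspec[OF this(1) v(1)] bspec[OF this(2) v(2)]
    obtain q r where "e a \<in> homog YY q" "f b \<in> homog XX r" by (elim exE)
    then have "v \<in> homog M (q + r)" unfolding v(4) by (rule homog_pure[OF _ fb_closed[OF S0 jb v(3)]])
    then show "\<exists>p. v \<in> homog M p" by (rule exI)
  qed
  show "is_linear Rxz M M d" by (rule parity_op_linear[OF parity_op_d])
  show "has_parity M 1 d" by (rule d_parity)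
  show "d (d v) = (U - W) \<odot>\<^bsub>M\<^esub> v" if "v \<in> carrier M" for v by (rule d_d[OF that])
qed

end

context cut_potential
begin

context
  fixes \<phi> :: "rat \<Rightarrow> 'k"
  assumes hf_half: "\<phi> (1 / 2) = hf"
begin

abbreviation "gd \<equiv> gamma_dag \<phi> n m l V \<sigma> YY A e XX B f"

lemma gd_eq: "i < m \<Longrightarrow> v \<in> carrier J.M \<Longrightarrow> gd i v = dg i v"
  by (rule gamma_dag_eq[where \<phi> = \<phi>, OF _ _ hf_half])

lemma dg_htp_linear: "i < m \<Longrightarrow> J.htp_linear (dg i)"
  by (rule J.dagger_htp_linear[OF clifford])

lemma gd_htp_linear: "i < m \<Longrightarrow> J.htp_linear (gd i)"
  by (rule J.htp_linear_cong[OF dg_htp_linear gd_eq])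

lemma At1_gd: assumes i: "i < m" and j: "j < m" shows "J.htp_scalar (J.ac (At1 i) (gd j)) (if i = j then 1 else 0)"
proof (rule J.htp_scalar_cong[OF J.At_dagger[OF clifford i j]])
  fix v assume v: "v \<in> carrier J.M"
  show "J.ac (At1 i) (gd j) v = J.ac (At1 i) (dg j) v"
    unfolding gd_eq[OF j v] gd_eq[OF j J.htp_linear_closed[OF At1_htp_linear[OF i] v]] ..
qed

lemma gd_gd: assumes i: "i < m" and j: "j < m" shows "J.htp_scalar (J.ac (gd i) (gd j)) 0"
proof (rule J.htp_scalar_cong[OF J.dagger_dagger[OF clifford i j]])
  fix v assume v: "v \<in> carrier J.M"
  show "J.ac (gd i) (gd j) v = J.ac (dg i) (dg j) v"
    unfolding gd_eq[OF j v] gd_eq[OF i v] gd_eq[OF i J.htp_linear_closed[OF dg_htp_linear[OF j] v]]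
      gd_eq[OF j J.htp_linear_closed[OF dg_htp_linear[OF i] v]] ..
qed

lemma clifford_representation:
  "let R = mpoly_ring (xvars n \<union> zvars l) :: 'k pol ring;
       YX = mf_cut m V YY XX;
       \<gamma> = atiyah n m l V \<sigma> YY A e XX B f
   in finite_rank_mf R (U - W) YX \<and>
      (\<forall>i<m. closed_operator R YX 1 (\<gamma> i) \<and> closed_operator R YX 1 (gd i)) \<and>
      (\<forall>i<m. \<forall>j<m.
         homotopic R YX 0 (gcomm YX 1 1 (\<gamma> i) (\<gamma> j)) (\<lambda>v. \<zero>\<^bsub>YX\<^esub>) \<and>
         homotopic R YX 0 (gcomm YX 1 1 (gd i) (gd j)) (\<lambda>v. \<zero>\<^bsub>YX\<^esub>) \<and>
         homotopic R YX 0 (gcomm YX 1 1 (\<gamma> i) (gd j)) (\<lambda>v. if i = j then v else \<zero>\<^bsub>YX\<^esub>))"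
  unfolding Let_def mf_cut_def
proof (intro conjI allI impI)
  obtain I where "finite_basis (mpoly_ring {} :: 'k pol ring) (JV m V) I (\<lambda>b. b)" using PS.J_basis by (elim exE)
  then show "finite_rank_mf J.Rxz (U - W) J.M" by (rule J.M_finite_rank)
next
  fix i assume i: "i < m"
  show "closed_operator J.Rxz J.M 1 (atiyah n m l V \<sigma> YY A e XX B f i)"
    unfolding atiyah_eq[OF i] by (rule J.closed_op_closed_operator[OF At1_closed_op[OF i]])
  show "closed_operator J.Rxz J.M 1 (gd i)" by (rule J.closed_op_closed_operator[OF J.htp_linear_closed_op[OF gd_htp_linear[OF i]]])
  fix j assume j: "j < m"
  \<comment> \<open>The target zero is written as multiplication by the scalar 0, the form in which
    an anticommutator is compared with a scalar.\<close>
  have z: "\<zero>\<^bsub>J.M\<^esub> = 0 \<odot>\<^bsub>J.M\<^esub> v" if "v \<in> carrier J.M" for v using J.smult_0[OF that] by (rule sym)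
  show "homotopic J.Rxz J.M 0 (gcomm J.M 1 1 (atiyah n m l V \<sigma> YY A e XX B f i) (atiyah n m l V \<sigma> YY A e XX B f j)) (\<lambda>v. \<zero>\<^bsub>J.M\<^esub>)"
    unfolding atiyah_eq[OF i] atiyah_eq[OF j]
    by (rule J.ac_homotopic[OF At1_htp_linear[OF i] At1_htp_linear[OF j] At1_At1[OF i j] J.closed_op_zero z])
  show "homotopic J.Rxz J.M 0 (gcomm J.M 1 1 (gd i) (gd j)) (\<lambda>v. \<zero>\<^bsub>J.M\<^esub>)"
    by (rule J.ac_homotopic[OF gd_htp_linear[OF i] gd_htp_linear[OF j] gd_gd[OF i j] J.closed_op_zero z])
  show "homotopic J.Rxz J.M 0 (gcomm J.M 1 1 (atiyah n m l V \<sigma> YY A e XX B f i) (gd j)) (\<lambda>v. if i = j then v else \<zero>\<^bsub>J.M\<^esub>)"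
    unfolding atiyah_eq[OF i]
  proof (rule J.ac_homotopic[OF At1_htp_linear[OF i] gd_htp_linear[OF j] At1_gd[OF i j]])
    show "J.closed_op 0 (\<lambda>v. if i = j then v else \<zero>\<^bsub>J.M\<^esub>)" using J.closed_op_id J.closed_op_zero by (cases "i = j") simp_all
    show "(if i = j then v else \<zero>\<^bsub>J.M\<^esub>) = (if i = j then 1 else 0) \<odot>\<^bsub>J.M\<^esub> v" if "v \<in> carrier J.M" for v
      using J.smult_1[OF that] J.smult_0[OF that] by simp
  qed
qed

end

end

text \<open>Stated for any middle factor, since it provides the setting both over the Jacobi ring
  and over the completion.\<close>

lemma cut_basis_of_mf:
  fixes YY :: "(('k::comm_ring_1) pol, 'y) mf" and XX :: "('k pol, 'x) mf" and S :: "('k pol, 's) module"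
  assumes X: "finite_rank_mf (mpoly_ring (xvars n \<union> yvars m)) (V - W) XX"
    and Y: "finite_rank_mf (mpoly_ring (yvars m \<union> zvars l)) (U - V) YY"
    and e: "homogeneous_basis (mpoly_ring (yvars m \<union> zvars l)) YY A e"
    and f: "homogeneous_basis (mpoly_ring (xvars n \<union> yvars m)) XX B f"
    and S: "module (mpoly_ring (yvars m)) S"
    and UVW: "U \<in> carrier (mpoly_ring (zvars l))" "V \<in> carrier (mpoly_ring (yvars m))" "W \<in> carrier (mpoly_ring (xvars n))"
    and hf: "hf + hf = 1"
  shows "cut_basis n m l YY XX S U V W hf A e B f"
proof -
  note x = X[unfolded finite_rank_mf_def] and y = Y[unfolded finite_rank_mf_def]
  have "cut_mod n m l YY XX S"
    using x y S by (intro cut_mod.intro gm_module) simp_all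
  moreover have "cut_axioms n m l YY XX U V W hf"
    using x y UVW hf by (intro cut_axioms.intro) simp_all
  ultimately show ?thesis using e f by (intro cut_basis.intro cut.intro cut_basis_axioms.intro)
qed

theorem theorem3p11:
  fixes \<phi> :: "rat \<Rightarrow> 'k::comm_ring_1"
    and n m l :: nat
    and W V U :: "'k pol"
    and XX :: "('k pol, 'x) mf" and YY :: "('k pol, 'y) mf"
    and A :: "'a set" and e :: "'a \<Rightarrow> 'y"
    and B :: "'b set" and f :: "'b \<Rightarrow> 'x"
    and \<sigma> :: "'k pol set \<Rightarrow> nat \<Rightarrow> 'k pol set"
  assumes "noetherian_ring (ring_of_type_algebra :: 'k ring)"
    and "\<phi> \<in> ring_hom (ring_of_type_algebra :: rat ring) (ring_of_type_algebra :: 'k ring)"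
    and "potential Xv n W" and "potential Yv m V" and "potential Zv l U"
    and "finite_rank_mf (mpoly_ring (xvars n \<union> yvars m)) (V - W) XX"
    and "finite_rank_mf (mpoly_ring (yvars m \<union> zvars l)) (U - V) YY"
    and "homogeneous_basis (mpoly_ring (yvars m \<union> zvars l)) YY A e"
    and "homogeneous_basis (mpoly_ring (xvars n \<union> yvars m)) XX B f"
    and "linear_section m V \<sigma>"
  shows "let R = mpoly_ring (xvars n \<union> zvars l) :: 'k pol ring;
             YX = mf_cut m V YY XX;
             \<gamma> = atiyah n m l V \<sigma> YY A e XX B f;
             \<gamma>d = gamma_dag \<phi> n m l V \<sigma> YY A e XX B f
         in finite_rank_mf R (U - W) YX \<and>
            (\<forall>i<m. closed_operator R YX 1 (\<gamma> i) \<and> closed_operator R YX 1 (\<gamma>d i)) \<and>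
            (\<forall>i<m. \<forall>j<m.
               homotopic R YX 0 (gcomm YX 1 1 (\<gamma> i) (\<gamma> j)) (\<lambda>v. \<zero>\<^bsub>YX\<^esub>) \<and>
               homotopic R YX 0 (gcomm YX 1 1 (\<gamma>d i) (\<gamma>d j)) (\<lambda>v. \<zero>\<^bsub>YX\<^esub>) \<and>
               homotopic R YX 0 (gcomm YX 1 1 (\<gamma> i) (\<gamma>d j)) (\<lambda>v. if i = j then v else \<zero>\<^bsub>YX\<^esub>))"
proof -
  have pots: "W \<in> carrier (mpoly_ring (xvars n))" "V \<in> carrier (mpoly_ring (yvars m))" "U \<in> carrier (mpoly_ring (zvars l))"
    using assms(3-5) by (simp_all add: potential_def Let_def)
  \<comment> \<open>The image of 1/2 under the structure map is the half in k that the grading and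
    the correction term rely on.\<close>
  have "\<phi> (1 / 2) + \<phi> (1 / 2) = \<phi> (1 / 2 + 1 / 2)"
    using ring_hom_add[OF assms(2), of "1 / 2" "1 / 2"] by (simp add: ring_of_type_algebra_def)
  also have "\<dots> = 1" using ring_hom_one[OF assms(2)] by (simp add: ring_of_type_algebra_def)
  finally have hf: "\<phi> (1 / 2) + \<phi> (1 / 2) = 1" .
  interpret PS: pot_section m V \<sigma>
    by (intro pot_section.intro pot.intro pot_section_axioms.intro assms(4,10))
  note cb = cut_basis_of_mf[OF assms(6-9) _ pots(3,2,1) hf]
  interpret cut_potential n m l YY XX U V W "\<phi> (1 / 2)" A e B f \<sigma>
  proof (intro cut_potential.intro cut_pair.intro cut_pair_axioms.intro)
    show "cut_basis n m l YY XX (JV m V) U V W (\<phi> (1 / 2)) A e B f" by (rule cb[OF PS.J_module])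
    show "cut_basis n m l YY XX (ky_hat m V) U V W (\<phi> (1 / 2)) A e B f" by (rule cb[OF PS.K_module])
    show "pot_section m V \<sigma>" by (rule PS.pot_section_axioms)
    show "is_linear (mpoly_ring (yvars m)) (ky_hat m V) (JV m V) (\<lambda>h. h (Suc 0))"
      using PS.ev_linear by simp
    show "\<exists>h\<in>carrier (ky_hat m V). h (Suc 0) = s" if "s \<in> carrier (JV m V)" for s
      using PS.ev_surj[OF that] by simp
    show "pd (Yv j) V \<in> carrier (mpoly_ring (yvars m))" for j
      using PS.t_mem[of j] by (simp add: PS.t_def)
    show "\<exists>c. (\<forall>j<m. c j \<in> carrier (ky_hat m V)) \<and> h = (\<Oplus>\<^bsub>ky_hat m V\<^esub>j\<in>{..<m}. pd (Yv j) V \<odot>\<^bsub>ky_hat m V\<^esub> c j)"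
      if "h \<in> carrier (ky_hat m V)" "h (Suc 0) = \<zero>\<^bsub>JV m V\<^esub>" for h
      using PS.ev_kernel[of h] that by (simp add: PS.t_def)
    show "pd (Yv j) V \<odot>\<^bsub>JV m V\<^esub> s = \<zero>\<^bsub>JV m V\<^esub>" if "j < m" "s \<in> carrier (JV m V)" for j s
      using PS.t_kill[OF that] by (simp add: PS.t_def)
  qed
  show ?thesis using clifford_representation[of \<phi>, OF refl] unfolding Let_def .
qed

end
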